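(* Let $H$ be a real Hilbert space and let $A$ be a nonnegative self-adjoint linear operator on $H$ with dense domain $D(A)$. Let $0\leq p\leq 1$ and $\gamma\geq 1$, and let $(u_0,u_1)\in D(A)\times D(A^{1/2})$ with $A^{1/2}u_0\neq 0$. Then there exists $\varepsilon_0>0$ such that for every $\varepsilon\in(0,\varepsilon_0)$ the problem $$\varepsilon u_\varepsilon''(t)+(1+t)^{-p}u_\varepsilon'(t)+|A^{1/2}u_\varepsilon(t)|^{2\gamma}Au_\varepsilon(t)=0,\qquad u_\varepsilon(0)=u_0,\quad u_\varepsilon'(0)=u_1$$ has a unique global solution $$u_\varepsilon\in C^2([0,+\infty[;H)\cap C^1([0,+\infty[;D(A^{1/2}))\cap C^0([0,+\infty[;D(A)).$$ Moreover there exist positive constants $C_1$ and $C_2$, independent of $\varepsilon$, such that $$|u_\varepsilon(t)|^2\leq C_2\qquad\forall t\geq 0;$$ $$\frac{C_1}{(1+t)^{(p+1)/\gamma}}\leq |A^{1/2}u_\varepsilon(t)|^2\leq\frac{C_2}{(1+t)^{(p+1)/(\gamma+1)}}\qquad\forall t\geq 0;$$ $$|A^{1/2}u_\varepsilon(t)|^{2(\gamma-1)}|Au_\varepsilon(t)|^2\leq\frac{C_2}{(1+t)^{p+1}}\qquad\forall t\geq 0;$$ $$|u_\varepsilon'(t)|^2\leq\frac{C_2\,|A^{1/2}u_\varepsilon(t)|^{2(\gamma+1)}}{(1+t)^{1-p}}\qquad\forall t\geq 0;$$ $$\int_0^{+\infty}|u_\varepsilon'(t)|^2(1+t)\,dt\leq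 C_2.$$
   Context: $|x|$ and $\langle x,y\rangle$ denote the norm and scalar product of $H$. $A$ nonnegative means $\langle Ax,x\rangle\geq 0$ for all $x\in D(A)$; for $\alpha\geq 0$, $A^\alpha$ denotes the power of $A$, with domain $D(A^\alpha)$. *)

theory Defs
  imports "HOL-Analysis.Analysis"
begin

text \<open>An unbounded operator is a partial function; its domain \<open>D(A)\<close> is \<^term>\<open>dom A\<close>, and
  equality of operators includes equality of domains.\<close>

type_synonym 'a partial_op = "'a \<Rightarrow> 'a option"

abbreviation op_apply :: "'a partial_op \<Rightarrow> 'a \<Rightarrow> 'a"  (infixr "\<cdot>" 90)
  where "A \<cdot> x \<equiv> the (A x)"

definition linear_op :: "'a::real_vector partial_op \<Rightarrow> bool" where
  "linear_op A \<longleftrightarrow> subspace (dom A) \<and>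
     (\<forall>x\<in>dom A. \<forall>y\<in>dom A. A \<cdot> (x + y) = A \<cdot> x + A \<cdot> y) \<and>
     (\<forall>c. \<forall>x\<in>dom A. A \<cdot> (c *\<^sub>R x) = c *\<^sub>R (A \<cdot> x))"

text \<open>The vector \<open>z\<close> below is unique as soon as \<^term>\<open>dom A\<close> is dense.\<close>

definition adjoint_op :: "'a::real_inner partial_op \<Rightarrow> 'a partial_op" where
  "adjoint_op A = (\<lambda>y.
     if \<exists>z. \<forall>x\<in>dom A. inner (A \<cdot> x) y = inner x z
     then Some (THE z. \<forall>x\<in>dom A. inner (A \<cdot> x) y = inner x z)
     else None)"

definition self_adjoint_op :: "'a::real_inner partial_op \<Rightarrow> bool" where
  "self_adjoint_op A \<longleftrightarrow> linear_op A \<and> closure (dom A) = UNIV \<and> adjoint_op A = A"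

definition nonneg_op :: "'a::real_inner partial_op \<Rightarrow> bool" where
  "nonneg_op A \<longleftrightarrow> (\<forall>x\<in>dom A. 0 \<le> inner (A \<cdot> x) x)"

text \<open>\<open>A\<^sup>1\<^sup>/\<^sup>2\<close> for a nonnegative self-adjoint operator on a Hilbert space: the nonnegative
  self-adjoint operator whose square is \<open>A\<close>. It exists and is unique, so the choice operator
  involves no actual choice. Composition of partial functions gives \<open>B\<^sup>2\<close> its natural domain
  \<open>{x \<in> D(B). B x \<in> D(B)}\<close>.\<close>

definition sqrt_op :: "'a::real_inner partial_op \<Rightarrow> 'a partial_op" where
  "sqrt_op A = (SOME B. self_adjoint_op B \<and> nonneg_op B \<and> B \<circ>\<^sub>m B = A)"

text \<open>The derivative at \<open>t = 0\<close> is one-sided, and values for \<open>t < 0\<close> are irrelevant.\<close>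

definition time_deriv :: "(real \<Rightarrow> 'b::real_normed_vector) \<Rightarrow> real \<Rightarrow> 'b" where
  "time_deriv u t = vector_derivative u (at t within {0..})"

primrec C_class :: "nat \<Rightarrow> (real \<Rightarrow> 'b::real_normed_vector) \<Rightarrow> bool" where
  "C_class 0 u \<longleftrightarrow> continuous_on {0..} u"
| "C_class (Suc k) u \<longleftrightarrow> u differentiable_on {0..} \<and> C_class k (time_deriv u)"

text \<open>\<open>C\<^sup>k([0,\<infinity>); D(B))\<close>, where \<open>D(B)\<close> carries the graph norm. The norm of the product type is
  \<open>sqrt (|x|\<^sup>2 + |B x|\<^sup>2)\<close>, so \<open>x \<mapsto> (x, B x)\<close> is an isometry of \<open>D(B)\<close> onto the graph of \<open>B\<close>.
  The definition is only used for closed \<open>B\<close> (self-adjoint operators are closed): then the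
  graph is a closed subspace, and derivatives taken in the product space remain in it.\<close>

definition C_class_dom :: "nat \<Rightarrow> 'a::real_normed_vector partial_op \<Rightarrow> (real \<Rightarrow> 'a) \<Rightarrow> bool" where
  "C_class_dom k B u \<longleftrightarrow> (\<forall>t\<ge>0. u t \<in> dom B) \<and> C_class k (\<lambda>t. (u t, B \<cdot> u t))"

definition kirchhoff_solution ::
  "'a::real_inner partial_op \<Rightarrow> real \<Rightarrow> real \<Rightarrow> 'a \<Rightarrow> 'a \<Rightarrow> real \<Rightarrow> (real \<Rightarrow> 'a) \<Rightarrow> bool" where
  "kirchhoff_solution A p \<gamma> u0 u1 \<epsilon> u \<longleftrightarrow>
     C_class 2 u \<and> C_class_dom 1 (sqrt_op A) u \<and> C_class_dom 0 A u \<and>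
     (\<forall>t\<ge>0. \<epsilon> *\<^sub>R time_deriv (time_deriv u) t + (1 + t) powr (- p) *\<^sub>R time_deriv u t
              + norm (sqrt_op A \<cdot> u t) powr (2 * \<gamma>) *\<^sub>R (A \<cdot> u t) = 0) \<and>
     u 0 = u0 \<and> time_deriv u 0 = u1"

end

theory Submission
  imports Defs
begin

text \<open>The spectral theorem is replaced by square roots of bounded operators, computed from the binomial
  series: they give \<open>A\<^sup>1\<^sup>/\<^sup>2\<close> and projections \<open>E n\<close> that commute with \<open>A\<close>, have ranges on which
  \<open>A\<close> is bounded, and converge strongly to the identity. With \<open>A\<close> replaced by \<open>A E n\<close> and the data by
  their projections the equation is an ordinary differential equation. Its solutions satisfy all
  estimates with constants independent of \<open>n\<close> and \<open>\<epsilon>\<close>, because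
  \<^item> a combination of the Hamiltonian, weighted with \<open>(1 + t)\<^sup>p\<^sup>+\<^sup>1\<close>, and of
    \<open>\<langle>u, u'\<rangle>\<close> decreases up to an integrable factor; this bounds \<open>|u|\<close>, gives the upper
    decay of \<open>|A\<^sup>1\<^sup>/\<^sup>2u|\<close> and the weighted integral of \<open>|u'|\<^sup>2\<close>;
  \<^item> as long as \<open>\<epsilon>|c'|/c\<close> is small against \<open>(1 + t)\<^sup>-\<^sup>p\<close>, where \<open>c = |A\<^sup>1\<^sup>/\<^sup>2u|\<^sup>2\<^sup>\<gamma>\<close>, the quotient
    \<open>P = \<epsilon>(|A\<^sup>1\<^sup>/\<^sup>2u'|\<^sup>2|A\<^sup>1\<^sup>/\<^sup>2u|\<^sup>2 - \<langle>Au, u'\<rangle>\<^sup>2) / (c|A\<^sup>1\<^sup>/\<^sup>2u|\<^sup>4) + |Au|\<^sup>2/|A\<^sup>1\<^sup>/\<^sup>2u|\<^sup>2\<close> decreases,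
    \<open>W = c P\<close> satisfies a Riccati inequality and so decays like \<open>(1 + t)\<^sup>-\<^sup>p\<^sup>-\<^sup>1\<close>, and the first
    order equation for \<open>u'\<close> bounds \<open>|u'|\<close>; these bounds in turn give \<open>|c'|/c \<le> C/(1 + t)\<close>, which
    closes the argument for small \<open>\<epsilon>\<close>, since \<open>p \<le> 1\<close>.
  The approximations converge in the first order energy norm by the estimate that also yields
  uniqueness, and in the second order norm because the tails \<open>(1 - E k) u\<close> are uniformly small.\<close>

section \<open>Hilbert space\<close>

text \<open>The obstacle is degeneracy: energy estimates for a wave equation with coefficient c(t)
  need a positive lower bound of c and a bound of c', and neither is given in advance. Both are
  governed by one scalar, the logarithmic derivative z of |A^(1/2)u|, because c'/c = 2 \<gamma> z.
  It satisfies \<epsilon> z' = 2 \<epsilon> nu - W - (1+t)^(-p) z - \<epsilon> z^2, where nu is the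
  squared angular speed of A^(1/2)u. For small \<epsilon> it is thus close to -(1+t)^p W, as in the
  parabolic limit, and W' \<le> 2 \<gamma> z W turns into the Riccati inequality W' \<le> -2
  \<gamma> (1+t)^p W^2 up to small terms. The bound of (1+t)|z| can be improved only if its constant
  is independent of \<epsilon>; hence all constants are explicit functions of the data, and
  \<epsilon> is chosen last. The derivative of |A^(1/2)u'|^2 involves A^(1/2)u'', which the stated
  regularity does not provide. So the second order estimates are proved for approximations and reach
  other solutions through uniqueness; the first order ones hold for every solution directly.\<close>

lemma closed_subspace_projection:
  fixes M :: "'a::{real_inner,complete_space} set"
  assumes "closed M" "subspace M"
  obtains m where "m \<in> M" "\<And>v. v \<in> M \<Longrightarrow> inner (x - m) v = 0"
proof -
  define D where "D = (\<lambda>m. (norm (x - m))\<^sup>2) ` M"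
  have ne: "D \<noteq> {}" using subspace_0[OF assms(2)] by (auto simp: D_def)
  have bb: "bdd_below D" by (auto simp: D_def intro!: bdd_belowI[of _ 0])
  have ge: "Inf D \<le> (norm (x - m))\<^sup>2" if "m \<in> M" for m
    using cInf_lower[OF _ bb] that by (auto simp: D_def)
  have "\<exists>m\<in>M. (norm (x - m))\<^sup>2 < Inf D + 1 / real (Suc n)" for n
    using cInf_lessD[OF ne, of "Inf D + 1 / real (Suc n)"] by (auto simp: D_def)
  then obtain f where fM: "\<And>n. f n \<in> M"
    and f: "\<And>n. (norm (x - f n))\<^sup>2 < Inf D + 1 / real (Suc n)" by metis
  \<comment> \<open>Parallelogram law: the midpoint of two almost minimizing points lies in
    \<open>M\<close>, so it is not closer to \<open>x\<close> than the infimum, which forces the two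
    points together.\<close>
  have par: "(norm (f i - f j))\<^sup>2 \<le> 2 / real (Suc i) + 2 / real (Suc j)" for i j
  proof -
    have "(1/2) *\<^sub>R (f i + f j) \<in> M" using fM assms(2) by (simp add: subspace_add subspace_scale)
    from ge[OF this] have "4 * Inf D \<le> (norm ((x - f i) + (x - f j)))\<^sup>2"
    proof -
      assume a: "Inf D \<le> (norm (x - (1/2) *\<^sub>R (f i + f j)))\<^sup>2"
      have "(x - f i) + (x - f j) = 2 *\<^sub>R (x - (1/2) *\<^sub>R (f i + f j))"
        by (simp add: algebra_simps scaleR_2)
      then have "norm ((x - f i) + (x - f j)) = 2 * norm (x - (1/2) *\<^sub>R (f i + f j))"
        by (metis abs_numeral norm_scaleR)
      then show ?thesis using a by (simp add: power_mult_distrib)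
    qed
    moreover have "(norm (f i - f j))\<^sup>2 + (norm ((x - f i) + (x - f j)))\<^sup>2
        = 2 * (norm (x - f i))\<^sup>2 + 2 * (norm (x - f j))\<^sup>2"
      by (simp add: power2_norm_eq_inner inner_diff inner_add inner_commute algebra_simps)
    ultimately show ?thesis using f[of i] f[of j] by auto
  qed
  have "Cauchy f"
  proof (rule metric_CauchyI)
    fix e :: real assume "0 < e"
    obtain N where N: "4 / e\<^sup>2 < real N" using reals_Archimedean2 by blast
    show "\<exists>N. \<forall>m\<ge>N. \<forall>n\<ge>N. dist (f m) (f n) < e"
    proof (intro exI allI impI)
      fix m n assume mn: "N \<le> m" "N \<le> n"
      have "0 < 4 / e\<^sup>2" using \<open>0 < e\<close> by simp
      then have N0: "0 < real N" using N by linarith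
      have "2 / real (Suc m) \<le> 2 / real N" "2 / real (Suc n) \<le> 2 / real N"
        using mn N0 by (auto intro!: divide_left_mono)
      moreover have "4 / real N < e\<^sup>2" using N N0 \<open>0 < e\<close> by (simp add: field_simps)
      ultimately have "(norm (f m - f n))\<^sup>2 < e\<^sup>2" using par[of m n] by auto
      then show "dist (f m) (f n) < e" using \<open>0 < e\<close> by (simp add: dist_norm power_less_imp_less_base)
    qed
  qed
  then obtain m where m: "f \<longlonglongrightarrow> m" using Cauchy_convergent_iff convergent_def by blast
  have mM: "m \<in> M" using closed_sequentially[OF assms(1) fM m] .
  have "(\<lambda>n. (norm (x - f n))\<^sup>2) \<longlonglongrightarrow> (norm (x - m))\<^sup>2" by (intro tendsto_intros m)
  moreover have "(\<lambda>n. Inf D + 1 / real (Suc n)) \<longlonglongrightarrow> Inf D + 0"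
    by (intro tendsto_intros LIMSEQ_Suc lim_1_over_n)
  ultimately have "(norm (x - m))\<^sup>2 \<le> Inf D + 0"
    by (rule LIMSEQ_le) (use f less_imp_le in blast)
  then have min: "(norm (x - m))\<^sup>2 \<le> Inf D" by simp
  have "inner (x - m) v = 0" if "v \<in> M" for v
  proof (cases "v = 0")
    case False
    \<comment> \<open>The minimizer of the quadratic t -> |x - m - t v|^2; it lowers the squared
      distance by <x - m, v>^2 / <v, v>.\<close>
    define t where "t = inner (x - m) v / inner v v"
    have vv: "inner v v > 0" using False by simp
    have "m + t *\<^sub>R v \<in> M" using mM that assms(2) by (simp add: subspace_add subspace_scale)
    then have "(norm (x - m))\<^sup>2 \<le> (norm (x - (m + t *\<^sub>R v)))\<^sup>2"
      using ge min by (meson order_trans)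
    also have "\<dots> = (norm (x - m))\<^sup>2 - 2 * t * inner (x - m) v + t\<^sup>2 * inner v v"
      unfolding power2_norm_eq_inner
      by (simp add: inner_diff inner_add inner_commute algebra_simps power2_eq_square)
    also have "\<dots> = (norm (x - m))\<^sup>2 - (inner (x - m) v)\<^sup>2 / inner v v"
      using vv by (simp add: t_def power2_eq_square field_simps)
    finally have "(inner (x - m) v)\<^sup>2 / inner v v \<le> 0" by simp
    then show ?thesis using vv by (simp add: divide_le_0_iff)
  qed simp
  with mM that show ?thesis by blast
qed

text \<open>The kernel of a nonzero functional is a closed hyperplane, and a suitable multiple of
  its normal \<open>w\<close> represents the functional.\<close>

lemma riesz_representation:
  fixes f :: "'a::{real_inner,complete_space} \<Rightarrow> real"
  assumes "bounded_linear f"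
  obtains z where "\<And>x. f x = inner x z"
proof (cases "\<forall>x. f x = 0")
  case True
  then show ?thesis using that[of 0] by simp
next
  case False
  then obtain x0 where x0: "f x0 \<noteq> 0" by blast
  interpret f: bounded_linear f by fact
  have cl: "closed {x. f x = 0}" 
    by (intro closed_Collect_eq f.continuous_on continuous_on_id continuous_on_const)
  have sub: "subspace {x. f x = 0}" by (auto simp: subspace_def f.add f.scaleR f.zero)
  obtain m where m: "f m = 0" "\<And>v. f v = 0 \<Longrightarrow> inner (x0 - m) v = 0"
    using closed_subspace_projection[OF cl sub, of x0] by auto
  define w where "w = x0 - m"
  have fw: "f w \<noteq> 0" using x0 m by (simp add: w_def f.diff)
  then have w0: "inner w w \<noteq> 0" using f.zero by auto
  have "f x = inner x ((f w / inner w w) *\<^sub>R w)" for x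
  proof -
    have "inner w (x - (f x / f w) *\<^sub>R w) = 0" unfolding w_def
      by (rule m(2)) (use fw in \<open>simp add: f.diff f.scaleR w_def\<close>)
    then have "inner w x = f x / f w * inner w w" by (simp add: inner_diff)
    then show ?thesis using fw w0 by (simp add: inner_commute)
  qed
  then show ?thesis using that by blast
qed

text \<open>The form may be degenerate. If <T y, y> > 0, the polynomial \<open>q\<close> at s = <T
  y, y>, r = <T x, y> is the claim multiplied by <T y, y>. If <T y, y> = 0, \<open>q\<close> is
  affine in r and can stay nonnegative only when its slope <T x, y> vanishes.\<close>

lemma form_cauchy_schwarz:
  fixes T :: "'a::real_inner \<Rightarrow> 'a"
  assumes "linear T" and sym: "\<And>x y. inner (T x) y = inner x (T y)"
    and nn: "\<And>x. 0 \<le> inner (T x) x"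
  shows "(inner (T x) y)\<^sup>2 \<le> inner (T x) x * inner (T y) y"
proof -
  interpret T: linear T by fact
  let ?a = "inner (T x) x" and ?b = "inner (T x) y" and ?c = "inner (T y) y"
  have q: "0 \<le> s\<^sup>2 * ?a - 2 * s * r * ?b + r\<^sup>2 * ?c" for s r
  proof -
    have "0 \<le> inner (T (s *\<^sub>R x - r *\<^sub>R y)) (s *\<^sub>R x - r *\<^sub>R y)" by (rule nn)
    also have "\<dots> = s\<^sup>2 * ?a - s * r * ?b - r * s * inner (T y) x + r\<^sup>2 * ?c"
      by (simp add: T.diff T.scaleR inner_diff power2_eq_square algebra_simps)
    also have "inner (T y) x = ?b" using sym[of y x] by (simp add: inner_commute)
    finally show ?thesis by (simp add: algebra_simps)
  qed
  show ?thesis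
  proof (cases "?c = 0")
    case False
    then have c: "0 < ?c" using nn[of y] by simp
    have "0 \<le> ?c\<^sup>2 * ?a - 2 * ?c * ?b * ?b + ?b\<^sup>2 * ?c" by (rule q)
    also have "\<dots> = ?c * (?a * ?c - ?b\<^sup>2)" by (simp add: power2_eq_square algebra_simps)
    finally show ?thesis using c by (simp add: zero_le_mult_iff)
  next
    case True
    have "?b = 0"
    proof (rule ccontr)
      assume b: "?b \<noteq> 0"
      have "0 \<le> ?a - 2 * ((?a + 1) / (2 * ?b)) * ?b" using q[of 1 "(?a + 1) / (2 * ?b)"] True by simp
      also have "\<dots> = -1" using b by (simp add: field_simps)
      finally show False by simp
    qed
    then show ?thesis using True by simp
  qed
qed

text \<open>Absolute convergence for the sort used throughout, complete and normed but without the
  class \<open>banach\<close>; hence the conclusion is obtained from \<open>Cauchy\<close>.\<close>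

lemma partial_sums_convergent:
  fixes f :: "nat \<Rightarrow> 'a::{real_normed_vector,complete_space}"
  assumes "summable (\<lambda>k. norm (f k))"
  shows "convergent (\<lambda>n. \<Sum>k<n. f k)"
proof -
  have "Cauchy (\<lambda>n. \<Sum>k<n. f k)"
  proof (rule metric_CauchyI)
    fix e :: real assume "0 < e"
    have "Cauchy (\<lambda>n. \<Sum>k<n. norm (f k))"
      using assms by (simp add: summable_iff_convergent convergent_Cauchy)
    then obtain N where N: "\<And>m n. m \<ge> N \<Longrightarrow> n \<ge> N \<Longrightarrow>
        dist (\<Sum>k<m. norm (f k)) (\<Sum>k<n. norm (f k)) < e"
      using \<open>0 < e\<close> by (meson metric_CauchyD)
    have *: "dist (\<Sum>k<m. f k) (\<Sum>k<n. f k) < e" if "N \<le> m" "m \<le> n" for m n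
    proof -
      have s: "(\<Sum>k<n. h k) - (\<Sum>k<m. h k) = (\<Sum>k=m..<n. h k)" for h :: "nat \<Rightarrow> 'b::real_normed_vector"
        using sum_diff_nat_ivl[of 0 m n h] that by (simp add: atLeast0LessThan)
      have "norm (\<Sum>k=m..<n. f k) \<le> (\<Sum>k=m..<n. norm (f k))" by (rule norm_sum)
      also have "\<dots> < e" using N[of n m] that s[of "\<lambda>k. norm (f k)"] by (simp add: dist_norm)
      finally show ?thesis using s[of f] by (metis dist_norm dist_commute)
    qed
    show "\<exists>N. \<forall>m\<ge>N. \<forall>n\<ge>N. dist (\<Sum>k<m. f k) (\<Sum>k<n. f k) < e"
    proof (intro exI allI impI)
      fix m n assume "N \<le> m" "N \<le> n"
      then show "dist (\<Sum>k<m. f k) (\<Sum>k<n. f k) < e"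
        using *[of m n] *[of n m] by (cases "m \<le> n") (auto simp: dist_commute)
    qed
  qed
  then show ?thesis by (simp add: Cauchy_convergent_iff)
qed

subsection \<open>Square roots of bounded operators\<close>

text \<open>The Taylor coefficients of \<open>sqrt (1 - x)\<close>. All but the first are negative and the partial
  sums stay nonnegative, so the series converges in norm for \<open>x\<close> replaced by any contraction.\<close>

definition sqrt_coeff :: "nat \<Rightarrow> real" where
  "sqrt_coeff k = pochhammer (-1/2) k / fact k"

lemma sqrt_coeff_gbinomial: "sqrt_coeff k = (1/2 gchoose k) * (-1) ^ k"
  by (simp add: sqrt_coeff_def gbinomial_pochhammer)

lemma sqrt_coeff_0: "sqrt_coeff 0 = 1"
  by (simp add: sqrt_coeff_def)

lemma sqrt_coeff_Suc_nonpos: "sqrt_coeff (Suc k) \<le> 0"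
proof -
  have "pochhammer (-1/2 :: real) (Suc k) = (-1/2) * pochhammer (1/2) k"
    by (simp add: pochhammer_rec)
  moreover have "0 < pochhammer (1/2 :: real) k" by (rule pochhammer_pos) simp
  ultimately show ?thesis by (simp add: sqrt_coeff_def divide_le_0_iff)
qed

text \<open>Summing coefficients divides the generating function by 1 - x, so the partial sums are
  coefficients of (1 - x)^(-1/2), which are positive.\<close>

lemma sqrt_coeff_sum_nonneg: "0 \<le> (\<Sum>k<n. sqrt_coeff k)"
proof (cases n)
  case (Suc m)
  have "(\<Sum>k\<le>m. sqrt_coeff k) = (-1) ^ m * ((1/2 - 1) gchoose m)"
    unfolding sqrt_coeff_gbinomial by (rule gbinomial_sum_lower_neg)
  also have "\<dots> = pochhammer (1/2) m / fact m"
    by (simp add: gbinomial_pochhammer)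
  also have "\<dots> \<ge> 0" using pochhammer_pos[of "1/2::real" m] by simp
  finally show ?thesis using Suc by (simp add: lessThan_Suc_atMost)
qed simp

text \<open>Only the first coefficient, 1, is positive, so the sum of the absolute values is 2 minus
  the signed sum.\<close>

lemma sqrt_coeff_abs_sum_le: "(\<Sum>k<n. \<bar>sqrt_coeff k\<bar>) \<le> 2"
proof (cases n)
  case (Suc m)
  have "(\<Sum>k<Suc m. \<bar>sqrt_coeff k\<bar>) = 1 + (\<Sum>k<m. - sqrt_coeff (Suc k))"
    unfolding sum.lessThan_Suc_shift using sqrt_coeff_Suc_nonpos by (simp add: sqrt_coeff_0 abs_of_nonpos)
  also have "\<dots> = 2 - (\<Sum>k<Suc m. sqrt_coeff k)"
    unfolding sum.lessThan_Suc_shift by (simp add: sqrt_coeff_0 sum_negf)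
  finally show ?thesis using Suc sqrt_coeff_sum_nonneg[of "Suc m"] by simp
qed simp

lemma sqrt_coeff_summable: "summable (\<lambda>k. \<bar>sqrt_coeff k\<bar>)"
  by (rule bounded_imp_summable[of _ 2])
    (use sqrt_coeff_abs_sum_le[of "Suc _"] in \<open>auto simp: lessThan_Suc_atMost\<close>)

text \<open>The square of the series is 1 - x: Vandermonde's identity with 1/2 + 1/2 = 1.\<close>

lemma sqrt_coeff_square:
  "(\<Sum>i\<le>k. sqrt_coeff i * sqrt_coeff (k - i)) = (if k = 0 then 1 else if k = 1 then -1 else 0)"
proof -
  have "(\<Sum>i\<le>k. sqrt_coeff i * sqrt_coeff (k - i))
      = (\<Sum>i\<le>k. ((1/2 gchoose i) * (1/2 gchoose (k - i))) * (-1) ^ k)"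
  proof (rule sum.cong[OF refl])
    fix i assume "i \<in> {..k}"
    then have "(-1::real) ^ i * (-1) ^ (k - i) = (-1) ^ k" by (simp flip: power_add)
    then show "sqrt_coeff i * sqrt_coeff (k - i) = ((1/2 gchoose i) * (1/2 gchoose (k - i))) * (-1) ^ k"
      unfolding sqrt_coeff_gbinomial by (simp flip: \<open>(-1) ^ i * (-1) ^ (k - i) = (-1) ^ k\<close>)
  qed
  also have "\<dots> = (\<Sum>i=0..k. (1/2 gchoose i) * (1/2 gchoose (k - i))) * (-1) ^ k"
    by (simp add: sum_distrib_right atMost_atLeast0)
  also have "\<dots> = (1 gchoose k) * (-1) ^ k"
    by (simp add: gbinomial_Vandermonde)
  also have "(1::real) gchoose k = of_nat (1 choose k)"
    using binomial_gbinomial[of 1 k, where 'a = real] by simp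
  finally show ?thesis by (cases k rule: nat.exhaust) (auto simp: binomial_eq_0)
qed

text \<open>The operator inequality T^2 \<le> T for 0 \<le> T \<le> 1, from the Cauchy-Schwarz
  inequality of the form with y = T x. It makes 1 - T a contraction.\<close>

lemma symmetric_contraction_form_le:
  fixes T :: "'a::real_inner \<Rightarrow> 'a"
  assumes "linear T" and sym: "\<And>x y. inner (T x) y = inner x (T y)"
    and nn: "\<And>x. 0 \<le> inner (T x) x" and contr: "\<And>x. norm (T x) \<le> norm x"
  shows "(norm (T x))\<^sup>2 \<le> inner (T x) x"
proof (cases "T x = 0")
  case False
  have "((norm (T x))\<^sup>2)\<^sup>2 = (inner (T x) (T x))\<^sup>2" by (simp add: power2_norm_eq_inner)
  also have "\<dots> \<le> inner (T x) x * inner (T (T x)) (T x)"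
    by (rule form_cauchy_schwarz[OF assms(1-3)])
  also have "inner (T (T x)) (T x) \<le> norm (T (T x)) * norm (T x)" by (rule norm_cauchy_schwarz)
  also have "\<dots> \<le> (norm (T x))\<^sup>2"
    using contr[of "T x"] by (simp add: power2_eq_square mult_right_mono)
  finally have "((norm (T x))\<^sup>2)\<^sup>2 \<le> inner (T x) x * (norm (T x))\<^sup>2"
    using nn[of x] by (simp add: mult_left_mono)
  then show ?thesis using False by (simp add: power2_eq_square)
qed simp

text \<open>A substitute for "S commutes with everything T commutes with" that also covers unbounded
  operators: take for \<open>G\<close> the graph of the operator. It holds for strong limits of
  polynomials in T.\<close>

definition inherits_invariant_graphs ::
  "('a::real_normed_vector \<Rightarrow> 'a) \<Rightarrow> ('a \<Rightarrow> 'a) \<Rightarrow> bool" where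
  "inherits_invariant_graphs T S \<longleftrightarrow> (\<forall>G. closed G \<and> subspace G \<and>
     (\<forall>x y. (x, y) \<in> G \<longrightarrow> (T x, T y) \<in> G) \<longrightarrow> (\<forall>x y. (x, y) \<in> G \<longrightarrow> (S x, S y) \<in> G))"

lemma inherits_invariant_graphsD:
  assumes "inherits_invariant_graphs T S" "closed G" "subspace G"
    "\<And>x y. (x, y) \<in> G \<Longrightarrow> (T x, T y) \<in> G" "(x, y) \<in> G"
  shows "(S x, S y) \<in> G"
  using assms unfolding inherits_invariant_graphs_def by blast

text \<open>With X = 1 - T, a contraction because T^2 \<le> T, the root is the binomial series of (1
  - X)^(1/2). Its partial sums \<open>P n\<close> are polynomials in T, so symmetry, sign and
  invariant graphs pass to the limit \<open>S\<close>.\<close>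

lemma bounded_sqrt:
  fixes T :: "'a::{real_inner,complete_space} \<Rightarrow> 'a"
  assumes lin: "linear T" and sym: "\<And>x y. inner (T x) y = inner x (T y)"
    and nn: "\<And>x. 0 \<le> inner (T x) x" and contr: "\<And>x. norm (T x) \<le> norm x"
  obtains S where "linear S" "\<And>x y. inner (S x) y = inner x (S y)" "\<And>x. 0 \<le> inner (S x) x"
    "\<And>x. norm (S x) \<le> norm x" "\<And>x. S (S x) = T x"
    "inherits_invariant_graphs T S"
proof -
  interpret T: linear T by fact
  define X where "X x = x - T x" for x
  have linX: "linear X" by (rule linearI) (auto simp: X_def T.add T.scaleR algebra_simps)
  have normX: "norm (X x) \<le> norm x" for x
  proof -
    have "(norm (X x))\<^sup>2 = (norm x)\<^sup>2 - 2 * inner (T x) x + (norm (T x))\<^sup>2"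
      unfolding X_def power2_norm_eq_inner by (simp add: inner_diff inner_commute)
    also have "\<dots> \<le> (norm x)\<^sup>2"
      using symmetric_contraction_form_le[OF assms, of x] nn[of x] by linarith
    finally show ?thesis by simp
  qed
  have linXk: "linear (X ^^ k)" for k
  proof (induction k)
    case 0
    show ?case by (rule linearI) auto
  next
    case (Suc k)
    have "linear (X \<circ> X ^^ k)" by (rule linear_compose[OF Suc linX])
    then show ?case by (simp only: funpow.simps(2))
  qed
  have normXk: "norm ((X ^^ k) x) \<le> norm x" for k x
  proof (induction k)
    case (Suc k)
    then show ?case using normX[of "(X ^^ k) x"] by simp
  qed simp
  have symX: "inner (X x) y = inner x (X y)" for x y
    by (simp add: X_def inner_diff sym)
  have symXk: "inner ((X ^^ k) x) y = inner x ((X ^^ k) y)" for k x y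
  proof (induction k arbitrary: x y)
    case (Suc k)
    have "inner ((X ^^ Suc k) x) y = inner ((X ^^ k) x) (X y)" by (simp add: symX)
    also have "\<dots> = inner x ((X ^^ k) (X y))" by (rule Suc)
    finally show ?case by (simp add: funpow_swap1)
  qed simp
  let ?a = sqrt_coeff
  define P where "P n x = (\<Sum>k<n. ?a k *\<^sub>R (X ^^ k) x)" for n x
  have linP: "linear (P n)" for n
    unfolding P_def by (intro linear_compose_sum ballI linear_compose_scale_right linXk)
  have normP: "norm (P n x) \<le> 2 * norm x" for n x
  proof -
    have "norm (P n x) \<le> (\<Sum>k<n. \<bar>?a k\<bar> * norm x)"
      unfolding P_def by (rule sum_norm_le) (simp add: mult_left_mono normXk)
    also have "\<dots> \<le> 2 * norm x"
      using sqrt_coeff_abs_sum_le[of n] by (simp add: mult_right_mono flip: sum_distrib_right)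
    finally show ?thesis .
  qed
  have "convergent (\<lambda>n. P n x)" for x
    unfolding P_def
  proof (rule partial_sums_convergent, rule summable_comparison_test')
    show "summable (\<lambda>k. \<bar>?a k\<bar> * norm x)" by (intro summable_mult2 sqrt_coeff_summable)
  qed (simp add: mult_left_mono normXk)
  then obtain S where S: "\<And>x. (\<lambda>n. P n x) \<longlonglongrightarrow> S x"
    unfolding convergent_def by metis
  have linS: "linear S"
  proof (rule linearI)
    fix x y r
    have "(\<lambda>n. P n (x + y)) \<longlonglongrightarrow> S x + S y"
      unfolding linear_add[OF linP] by (intro tendsto_intros S)
    then show "S (x + y) = S x + S y" using S LIMSEQ_unique by blast
    have "(\<lambda>n. P n (r *\<^sub>R x)) \<longlonglongrightarrow> r *\<^sub>R S x"
      unfolding linear_scale[OF linP] by (intro tendsto_intros S)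
    then show "S (r *\<^sub>R x) = r *\<^sub>R S x" using S LIMSEQ_unique by blast
  qed
  have symP: "inner (P n x) y = inner x (P n y)" for n x y
    unfolding P_def inner_sum_left inner_sum_right by (simp add: symXk)
  have symS: "inner (S x) y = inner x (S y)" for x y
  proof -
    have "(\<lambda>n. inner (P n x) y) \<longlonglongrightarrow> inner (S x) y" by (intro tendsto_intros S)
    moreover have "(\<lambda>n. inner (P n x) y) \<longlonglongrightarrow> inner x (S y)"
      unfolding symP by (intro tendsto_intros S)
    ultimately show ?thesis by (rule LIMSEQ_unique)
  qed
  \<comment> \<open>For k \<ge> 1 the coefficient is nonpositive and <X^k x, x> \<le> |x|^2, so <P n
    x, x> is at least |x|^2 times the partial sum of the coefficients.\<close>
  have nnP: "0 \<le> inner (P n x) x" for n x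
  proof -
    have "0 \<le> (\<Sum>k<n. ?a k) * (norm x)\<^sup>2" using sqrt_coeff_sum_nonneg[of n] by simp
    also have "\<dots> = (\<Sum>k<n. ?a k * (norm x)\<^sup>2)" by (simp add: sum_distrib_right)
    also have "\<dots> \<le> (\<Sum>k<n. ?a k * inner ((X ^^ k) x) x)"
    proof (rule sum_mono)
      fix k
      show "?a k * (norm x)\<^sup>2 \<le> ?a k * inner ((X ^^ k) x) x"
      proof (cases k)
        case 0
        then show ?thesis by (simp add: power2_norm_eq_inner)
      next
        case (Suc m)
        have "inner ((X ^^ k) x) x \<le> norm ((X ^^ k) x) * norm x" by (rule norm_cauchy_schwarz)
        also have "\<dots> \<le> (norm x)\<^sup>2" by (simp add: power2_eq_square mult_right_mono normXk)
        finally show ?thesis using sqrt_coeff_Suc_nonpos[of m] Suc by (simp add: mult_left_mono_neg)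
      qed
    qed
    also have "\<dots> = inner (P n x) x" by (simp add: P_def inner_sum_left)
    finally show ?thesis .
  qed
  have nnS: "0 \<le> inner (S x) x" for x
  proof (rule LIMSEQ_le_const)
    show "(\<lambda>n. inner (P n x) x) \<longlonglongrightarrow> inner (S x) x" by (intro tendsto_intros S)
  qed (use nnP in blast)
  have SS: "S (S x) = T x" for x
  proof -
    \<comment> \<open>The operators \<open>P n\<close> are bounded by 2 uniformly in n, so strong
      convergence is compatible with squaring.\<close>
    have "(\<lambda>n. P n (P n x) - S (S x)) \<longlonglongrightarrow> 0"
    proof (rule Lim_null_comparison)
      show "\<forall>\<^sub>F n in sequentially. norm (P n (P n x) - S (S x)) \<le> 2 * norm (P n x - S x) + norm (P n (S x) - S (S x))"
      proof (rule always_eventually, rule allI)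
        fix n
        have eq: "P n (P n x) - S (S x) = P n (P n x - S x) + (P n (S x) - S (S x))"
          by (simp add: linear_diff[OF linP])
        show "norm (P n (P n x) - S (S x)) \<le> 2 * norm (P n x - S x) + norm (P n (S x) - S (S x))"
          using eq norm_triangle_ineq[of "P n (P n x - S x)" "P n (S x) - S (S x)"] normP[of n "P n x - S x"]
          by (smt (verit))
      qed
      have "(\<lambda>n. 2 * norm (P n x - S x) + norm (P n (S x) - S (S x))) \<longlonglongrightarrow>
          2 * norm (S x - S x) + norm (S (S x) - S (S x))" by (intro tendsto_intros S)
      then show "(\<lambda>n. 2 * norm (P n x - S x) + norm (P n (S x) - S (S x))) \<longlonglongrightarrow> 0" by simp
    qed
    then have 1: "(\<lambda>n. P n (P n x)) \<longlonglongrightarrow> S (S x)" by (simp add: LIM_zero_iff)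
    \<comment> \<open>The square of a partial sum runs over index pairs in a square. The triangle i
      + j < n inside it already sums to T x, and the rest is dominated by the same rest for the
      absolute values, which tends to 0 by the scalar Cauchy product.\<close>
    let ?b = "\<lambda>k. \<bar>?a k\<bar>"
    let ?tri = "\<lambda>n. {(i, j). i + j < n} :: (nat \<times> nat) set"
    have tri_sub: "?tri n \<subseteq> {..<n} \<times> {..<n}" for n by auto
    have fin: "finite (?tri n)" for n using tri_sub by (rule finite_subset) simp
    have tri: "(\<Sum>(i,j)\<in>?tri n. (?a i * ?a j) *\<^sub>R (X ^^ (i + j)) x) = T x" if "2 \<le> n" for n
    proof -
      from le_Suc_ex[OF that] obtain m where m: "n = Suc (Suc m)" by auto
      have "(\<Sum>(i,j)\<in>?tri n. (?a i * ?a j) *\<^sub>R (X ^^ (i + j)) x)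
          = (\<Sum>k<n. (\<Sum>i\<le>k. ?a i * ?a (k - i)) *\<^sub>R (X ^^ k) x)"
        unfolding sum.triangle_reindex scaleR_sum_left
        by (intro sum.cong refl) (metis (no_types) atMost_iff le_add_diff_inverse)
      also have "\<dots> = (\<Sum>k<n. (if k = 0 then 1 else if k = 1 then -1 else 0) *\<^sub>R (X ^^ k) x)"
        unfolding sqrt_coeff_square ..
      also have "\<dots> = x - X x" unfolding m sum.lessThan_Suc_shift by simp
      finally show ?thesis by (simp add: X_def)
    qed
    have sq: "P n (P n x) = (\<Sum>(i,j)\<in>{..<n} \<times> {..<n}. (?a i * ?a j) *\<^sub>R (X ^^ (i + j)) x)" for n
    proof -
      have "P n (P n x) = (\<Sum>i<n. ?a i *\<^sub>R (X ^^ i) (\<Sum>j<n. ?a j *\<^sub>R (X ^^ j) x))" by (simp add: P_def)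
      also have "\<dots> = (\<Sum>i<n. \<Sum>j<n. (?a i * ?a j) *\<^sub>R (X ^^ (i + j)) x)"
        unfolding linear_sum[OF linXk] linear_scale[OF linXk] scaleR_sum_right by (simp add: funpow_add)
      finally show ?thesis by (simp add: sum.cartesian_product)
    qed
    have "(\<lambda>n. P n (P n x) - T x) \<longlonglongrightarrow> 0"
    proof (rule Lim_null_comparison)
      let ?e = "\<lambda>n. ((\<Sum>k<n. ?b k) * (\<Sum>k<n. ?b k) - (\<Sum>k<n. \<Sum>i\<le>k. ?b i * ?b (k - i))) * norm x"
      show "\<forall>\<^sub>F n in sequentially. norm (P n (P n x) - T x) \<le> ?e n"
        using eventually_ge_at_top[of 2]
      proof eventually_elim
        case (elim n)
        let ?f = "\<lambda>(i,j). (?a i * ?a j) *\<^sub>R (X ^^ (i + j)) x"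
        have "P n (P n x) - T x = sum ?f ({..<n} \<times> {..<n} - ?tri n)"
          unfolding sq tri[OF elim, symmetric] by (rule sum_diff[symmetric]) (use tri_sub in auto)
        also have "norm \<dots> \<le> (\<Sum>(i,j)\<in>{..<n} \<times> {..<n} - ?tri n. ?b i * ?b j * norm x)"
          by (rule sum_norm_le) (auto simp: abs_mult intro!: mult_left_mono normXk)
        also have "\<dots> = (\<Sum>(i,j)\<in>{..<n} \<times> {..<n}. ?b i * ?b j * norm x) - (\<Sum>(i,j)\<in>?tri n. ?b i * ?b j * norm x)"
          by (rule sum_diff) (use tri_sub in auto)
        also have "(\<Sum>(i,j)\<in>?tri n. ?b i * ?b j * norm x) = (\<Sum>k<n. \<Sum>i\<le>k. ?b i * ?b (k - i)) * norm x"
          unfolding sum.triangle_reindex by (simp add: sum_distrib_right)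
        also have "(\<Sum>(i,j)\<in>{..<n} \<times> {..<n}. ?b i * ?b j * norm x) = (\<Sum>k<n. ?b k) * (\<Sum>k<n. ?b k) * norm x"
          unfolding sum_product sum.cartesian_product[symmetric] by (simp add: sum_distrib_right)
        finally show ?case by (simp add: left_diff_distrib)
      qed
      have s: "(\<lambda>n. \<Sum>k<n. ?b k) \<longlonglongrightarrow> suminf ?b" using sqrt_coeff_summable summable_LIMSEQ by blast
      have "(\<lambda>n. \<Sum>k<n. \<Sum>i\<le>k. ?b i * ?b (k - i)) \<longlonglongrightarrow> suminf ?b * suminf ?b"
        using Cauchy_product_sums[of ?b ?b] sqrt_coeff_summable by (simp add: sums_def)
      then have "?e \<longlonglongrightarrow> (suminf ?b * suminf ?b - suminf ?b * suminf ?b) * norm x"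
        by (intro tendsto_intros s)
      then show "?e \<longlonglongrightarrow> 0" by simp
    qed
    then have 2: "(\<lambda>n. P n (P n x)) \<longlonglongrightarrow> T x" by (simp add: LIM_zero_iff)
    from 1 2 show ?thesis by (rule LIMSEQ_unique)
  qed
  have normS: "norm (S x) \<le> norm x" for x
  proof -
    have "(norm (S x))\<^sup>2 = inner (T x) x"
      using symS[of "S x" x] by (simp add: power2_norm_eq_inner SS)
    also have "\<dots> \<le> norm (T x) * norm x" by (rule norm_cauchy_schwarz)
    also have "\<dots> \<le> (norm x)\<^sup>2" by (simp add: power2_eq_square mult_right_mono contr)
    finally show ?thesis by simp
  qed
  have inv: "(S x, S y) \<in> G"
    if G: "closed G" "subspace G" "\<And>x y. (x, y) \<in> G \<Longrightarrow> (T x, T y) \<in> G" "(x, y) \<in> G" for G x y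
  proof (rule closed_sequentially[OF G(1)])
    have "((X ^^ k) x, (X ^^ k) y) \<in> G" for k
    proof (induction k)
      case (Suc k)
      have "((X ^^ k) x, (X ^^ k) y) - (T ((X ^^ k) x), T ((X ^^ k) y)) \<in> G"
        using Suc G by (intro subspace_diff) auto
      then show ?case using X_def[of "(X ^^ k) x"] X_def[of "(X ^^ k) y"] by simp
    qed (simp add: G)
    then have "(\<Sum>k<n. ?a k *\<^sub>R ((X ^^ k) x, (X ^^ k) y)) \<in> G" for n
      by (intro subspace_sum subspace_scale G)
    moreover have "(\<Sum>k<n. ?a k *\<^sub>R ((X ^^ k) x, (X ^^ k) y)) = (P n x, P n y)" for n
      by (simp add: P_def prod_eq_iff fst_sum snd_sum)
    ultimately show "(P n x, P n y) \<in> G" for n by simp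
    show "(\<lambda>n. (P n x, P n y)) \<longlonglongrightarrow> (S x, S y)" by (intro tendsto_intros S)
  qed
  show ?thesis
  proof (rule that[of S])
    show "linear S" by (fact linS)
    show "inner (S x) y = inner x (S y)" for x y by (fact symS)
    show "0 \<le> inner (S x) x" for x by (fact nnS)
    show "norm (S x) \<le> norm x" for x by (fact normS)
    show "S (S x) = T x" for x by (fact SS)
    show "inherits_invariant_graphs T S"
      unfolding inherits_invariant_graphs_def using inv by blast
  qed
qed

section \<open>Unbounded self-adjoint operators\<close>

lemma subspace_closure:
  fixes M :: "'a::real_normed_vector set"
  assumes "subspace M"
  shows "subspace (closure M)"
proof (rule subspaceI)
  show "0 \<in> closure M" using subspace_0[OF assms] closure_subset by blast
next
  fix x y assume "x \<in> closure M" "y \<in> closure M"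
  then obtain f g where "\<And>n. f n \<in> M" "f \<longlonglongrightarrow> x" "\<And>n. g n \<in> M" "g \<longlonglongrightarrow> y"
    unfolding closure_sequential by blast
  then have "\<And>n. f n + g n \<in> M" "(\<lambda>n. f n + g n) \<longlonglongrightarrow> x + y"
    by (auto intro: subspace_add[OF assms] tendsto_add)
  then show "x + y \<in> closure M" unfolding closure_sequential by (intro exI[of _ "\<lambda>n. f n + g n"]) auto
next
  fix x c assume "x \<in> closure M"
  then obtain f where "\<And>n. f n \<in> M" "f \<longlonglongrightarrow> x"
    unfolding closure_sequential by blast
  then have "\<And>n. c *\<^sub>R f n \<in> M" "(\<lambda>n. c *\<^sub>R f n) \<longlonglongrightarrow> c *\<^sub>R x"
    by (auto intro: subspace_scale[OF assms] tendsto_scaleR)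
  then show "c *\<^sub>R x \<in> closure M" unfolding closure_sequential by (intro exI[of _ "\<lambda>n. c *\<^sub>R f n"]) auto
qed

lemma dense_subspaceI:
  fixes M :: "'a::{real_inner,complete_space} set"
  assumes "subspace M" and "\<And>x. (\<And>v. v \<in> M \<Longrightarrow> inner x v = 0) \<Longrightarrow> x = 0"
  shows "closure M = UNIV"
proof (intro set_eqI iffI UNIV_I)
  fix x
  obtain m where m: "m \<in> closure M" "\<And>v. v \<in> closure M \<Longrightarrow> inner (x - m) v = 0"
    using closed_subspace_projection[OF closed_closure subspace_closure[OF assms(1)]] by metis
  then have "x - m = 0" using assms(2) closure_subset by blast
  then show "x \<in> closure M" using m by simp
qed

lemma dense_inner_eqD:
  fixes D :: "'a::real_inner set"
  assumes "closure D = UNIV" and "\<And>x. x \<in> D \<Longrightarrow> inner x y = inner x z"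
  shows "y = z"
proof -
  have "closed {x. inner x y = inner x z}"
    by (intro closed_Collect_eq continuous_intros)
  then have "closure D \<subseteq> {x. inner x y = inner x z}"
    using assms(2) by (intro closure_minimal) auto
  then have "inner (y - z) y = inner (y - z) z" using assms(1) by blast
  then have "inner (y - z) (y - z) = 0" by (simp add: inner_diff)
  then show ?thesis by simp
qed

lemma op_apply_Some: "x \<in> dom A \<Longrightarrow> A x = Some (A \<cdot> x)"
  by auto

lemma linear_opD:
  assumes "linear_op A"
  shows "subspace (dom A)"
    "\<And>x y. x \<in> dom A \<Longrightarrow> y \<in> dom A \<Longrightarrow> A \<cdot> (x + y) = A \<cdot> x + A \<cdot> y"
    "\<And>c x. x \<in> dom A \<Longrightarrow> A \<cdot> (c *\<^sub>R x) = c *\<^sub>R (A \<cdot> x)"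
    "\<And>x y. x \<in> dom A \<Longrightarrow> y \<in> dom A \<Longrightarrow> A \<cdot> (x - y) = A \<cdot> x - A \<cdot> y"
proof -
  show 1: "subspace (dom A)"
    and 2: "\<And>x y. x \<in> dom A \<Longrightarrow> y \<in> dom A \<Longrightarrow> A \<cdot> (x + y) = A \<cdot> x + A \<cdot> y"
    and 3: "\<And>c x. x \<in> dom A \<Longrightarrow> A \<cdot> (c *\<^sub>R x) = c *\<^sub>R (A \<cdot> x)"
    using assms by (auto simp: linear_op_def)
  fix x y assume xy: "x \<in> dom A" "y \<in> dom A"
  have "A \<cdot> (x + (-1) *\<^sub>R y) = A \<cdot> x + A \<cdot> ((-1) *\<^sub>R y)"
    by (rule 2[OF xy(1) subspace_scale[OF 1 xy(2)]])
  then show "A \<cdot> (x - y) = A \<cdot> x - A \<cdot> y" using 3[OF xy(2), of "-1"] by simp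
qed

lemma self_adjoint_sym:
  assumes "self_adjoint_op A" "x \<in> dom A" "y \<in> dom A"
  shows "inner (A \<cdot> x) y = inner x (A \<cdot> y)"
proof -
  have Ay: "adjoint_op A y = Some (A \<cdot> y)" using assms by (metis op_apply_Some self_adjoint_op_def)
  then have ex: "\<exists>z. \<forall>x\<in>dom A. inner (A \<cdot> x) y = inner x z"
    and the: "(THE z. \<forall>x\<in>dom A. inner (A \<cdot> x) y = inner x z) = A \<cdot> y"
    by (auto simp: adjoint_op_def split: if_splits)
  from ex obtain z where z: "\<forall>x\<in>dom A. inner (A \<cdot> x) y = inner x z" by blast
  have "(THE z. \<forall>x\<in>dom A. inner (A \<cdot> x) y = inner x z) = z"
  proof (rule the_equality, rule z)
    fix z' assume "\<forall>x\<in>dom A. inner (A \<cdot> x) y = inner x z'"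
    then show "z' = z" using z assms(1) by (intro dense_inner_eqD[of "dom A"]) (auto simp: self_adjoint_op_def)
  qed
  then show ?thesis using z the assms(2) by auto
qed

text \<open>The half of self-adjointness beyond symmetry: it puts a vector into the domain by
  testing against the domain only.\<close>

lemma self_adjoint_maximal:
  assumes "self_adjoint_op A" "\<And>x. x \<in> dom A \<Longrightarrow> inner (A \<cdot> x) y = inner x z"
  shows "A y = Some z"
proof -
  have "(THE z. \<forall>x\<in>dom A. inner (A \<cdot> x) y = inner x z) = z"
  proof (rule the_equality)
    fix z' assume "\<forall>x\<in>dom A. inner (A \<cdot> x) y = inner x z'"
    then show "z' = z" using assms by (intro dense_inner_eqD[of "dom A"]) (auto simp: self_adjoint_op_def)
  qed (use assms in auto)
  then have "adjoint_op A y = Some z" using assms(2) by (auto simp: adjoint_op_def)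
  then show ?thesis using assms(1) by (metis self_adjoint_op_def)
qed

lemma self_adjointI:
  assumes "linear_op B" "closure (dom B) = UNIV"
    and sym: "\<And>x y. x \<in> dom B \<Longrightarrow> y \<in> dom B \<Longrightarrow> inner (B \<cdot> x) y = inner x (B \<cdot> y)"
    and max: "\<And>y z. (\<And>x. x \<in> dom B \<Longrightarrow> inner (B \<cdot> x) y = inner x z) \<Longrightarrow> B y = Some z"
  shows "self_adjoint_op B"
proof -
  have "adjoint_op B y = B y" for y
  proof (cases "\<exists>z. \<forall>x\<in>dom B. inner (B \<cdot> x) y = inner x z")
    case True
    then obtain z where z: "\<forall>x\<in>dom B. inner (B \<cdot> x) y = inner x z" by blast
    have "(THE z. \<forall>x\<in>dom B. inner (B \<cdot> x) y = inner x z) = z"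
    proof (rule the_equality, rule z)
      fix z' assume "\<forall>x\<in>dom B. inner (B \<cdot> x) y = inner x z'"
      then show "z' = z" using z assms(2) by (intro dense_inner_eqD[of "dom B"]) auto
    qed
    then have "adjoint_op B y = Some z" using True by (simp only: adjoint_op_def if_True)
    moreover have "B y = Some z" by (rule max) (use z in blast)
    ultimately show ?thesis by simp
  next
    case False
    have "y \<notin> dom B" using sym False by blast
    then have "B y = None" by (simp add: domIff)
    then show ?thesis using False by (simp only: adjoint_op_def if_False)
  qed
  then have "adjoint_op B = B" by blast
  then show ?thesis using assms by (simp add: self_adjoint_op_def)
qed

definition op_graph :: "'a partial_op \<Rightarrow> ('a \<times> 'a) set" where
  "op_graph A = {(x, y). A x = Some y}"

text \<open>As an intersection of kernels of continuous linear conditions the graph is visibly a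
  closed subspace.\<close>

lemma op_graph_eq:
  assumes "self_adjoint_op A"
  shows "op_graph A = (\<Inter>x\<in>dom A. {q. inner (A \<cdot> x) (fst q) = inner x (snd q)})"
proof (intro set_eqI iffI)
  fix q assume "q \<in> op_graph A"
  then have q: "fst q \<in> dom A" "A \<cdot> fst q = snd q" by (auto simp: op_graph_def)
  then show "q \<in> (\<Inter>x\<in>dom A. {q. inner (A \<cdot> x) (fst q) = inner x (snd q)})"
    using self_adjoint_sym[OF assms _ q(1)] q(2) by (intro INT_I CollectI) simp
next
  fix q assume "q \<in> (\<Inter>x\<in>dom A. {q. inner (A \<cdot> x) (fst q) = inner x (snd q)})"
  then have "A (fst q) = Some (snd q)" by (intro self_adjoint_maximal[OF assms]) blast
  then show "q \<in> op_graph A" by (auto simp: op_graph_def)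
qed

lemma closed_op_graph: "self_adjoint_op A \<Longrightarrow> closed (op_graph A)"
  unfolding op_graph_eq by (intro closed_INT ballI closed_Collect_eq continuous_intros)

lemma subspace_op_graph: "self_adjoint_op A \<Longrightarrow> subspace (op_graph A)"
  unfolding op_graph_eq by (auto simp: subspace_def inner_add_right)

text \<open>The closed range argument: the bound carries the Cauchy property from images back to
  preimages. Stated for relations so that it serves both 1 + A, whose domain is not the whole space,
  and \<open>J\<close> restricted to a subspace.\<close>

lemma closed_image_of_closed_relation:
  fixes G :: "('a::{real_normed_vector,complete_space} \<times> 'b::real_normed_vector) set"
  assumes "closed G" "subspace G" "\<And>x y. (x, y) \<in> G \<Longrightarrow> norm x \<le> C * norm y"
  shows "closed (snd ` G)"
proof (unfold closed_sequential_limits, intro allI impI, elim conjE)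
  fix f l assume f: "\<forall>n. f n \<in> snd ` G" and l: "f \<longlonglongrightarrow> l"
  then have "\<forall>n. \<exists>x. (x, f n) \<in> G" by force
  then obtain g where g: "\<And>n. (g n, f n) \<in> G" by metis
  have C: "norm (g m - g n) \<le> (\<bar>C\<bar> + 1) * norm (f m - f n)" for m n
  proof -
    have "(g m, f m) - (g n, f n) \<in> G" using g assms(2) by (intro subspace_diff)
    then have "norm (g m - g n) \<le> C * norm (f m - f n)" using assms(3) by simp
    also have "\<dots> \<le> (\<bar>C\<bar> + 1) * norm (f m - f n)" by (rule mult_right_mono) auto
    finally show ?thesis .
  qed
  have "Cauchy g"
  proof (rule metric_CauchyI)
    fix e :: real assume "0 < e"
    then have "0 < e / (\<bar>C\<bar> + 1)" by (simp add: add_nonneg_pos)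
    then obtain M where M: "\<And>m n. m \<ge> M \<Longrightarrow> n \<ge> M \<Longrightarrow> dist (f m) (f n) < e / (\<bar>C\<bar> + 1)"
      using LIMSEQ_imp_Cauchy[OF l] by (meson metric_CauchyD)
    show "\<exists>M. \<forall>m\<ge>M. \<forall>n\<ge>M. dist (g m) (g n) < e"
    proof (intro exI allI impI)
      fix m n assume mn: "M \<le> m" "M \<le> n"
      have "norm (g m - g n) \<le> (\<bar>C\<bar> + 1) * norm (f m - f n)" by (rule C)
      also have "\<dots> < (\<bar>C\<bar> + 1) * (e / (\<bar>C\<bar> + 1))"
        using M[OF mn] by (intro mult_strict_left_mono) (auto simp: dist_norm add_nonneg_pos)
      finally show "dist (g m) (g n) < e" by (simp add: dist_norm)
    qed
  qed
  then obtain x where "g \<longlonglongrightarrow> x" using Cauchy_convergent_iff convergent_def by blast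
  then have "(\<lambda>n. (g n, f n)) \<longlonglongrightarrow> (x, l)" using l by (intro tendsto_Pair)
  then have "(x, l) \<in> G" by (rule closed_sequentially[OF assms(1), rotated]) (rule g)
  then show "l \<in> snd ` G" by force
qed

text \<open>J is the inverse of 1 + A. The range of 1 + A is closed since |x| \<le> |x + A x|. It is
  dense because a vector r orthogonal to it satisfies A r = -r by maximality, against nonnegativity
  unless r = 0.\<close>

lemma resolvent:
  fixes A :: "'a::{real_inner,complete_space} partial_op"
  assumes "self_adjoint_op A" "nonneg_op A"
  obtains J where "linear J" "\<And>x y. inner (J x) y = inner x (J y)" "\<And>x. 0 \<le> inner (J x) x"
    "\<And>x. norm (J x) \<le> norm x" "\<And>x. J x \<in> dom A" "\<And>x. A \<cdot> J x = x - J x"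
    "\<And>x. x \<in> dom A \<Longrightarrow> J (x + A \<cdot> x) = x"
proof -
  have lo: "linear_op A" using assms by (auto simp: self_adjoint_op_def)
  note lin = linear_opD[OF lo]
  have nn: "0 \<le> inner (A \<cdot> x) x" if "x \<in> dom A" for x using assms that by (auto simp: nonneg_op_def)
  define G where "G = {(x, y). (x, y - x) \<in> op_graph A}"
  have Geq: "(x, y) \<in> G \<longleftrightarrow> x \<in> dom A \<and> y = x + A \<cdot> x" for x y
  proof
    assume "(x, y) \<in> G"
    then have "A x = Some (y - x)" by (simp add: G_def op_graph_def)
    then show "x \<in> dom A \<and> y = x + A \<cdot> x" by (simp add: domI)
  qed (auto simp: G_def op_graph_def)
  have clG: "closed G"
  proof -
    have "G = (\<lambda>q. (fst q, snd q - fst q)) -` op_graph A" by (auto simp: G_def)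
    then show ?thesis
      by (simp only:) (intro continuous_closed_vimage closed_op_graph assms continuous_intros)
  qed
  have subG: "subspace G"
  proof (rule subspaceI)
    show "0 \<in> G" using subspace_0[OF lin(1)] lin(3)[of 0 0] by (simp add: zero_prod_def Geq)
    show "u + v \<in> G" if "u \<in> G" "v \<in> G" for u v
      using that subspace_add[OF lin(1)] lin(2) by (cases u; cases v) (simp add: Geq algebra_simps)
    show "c *\<^sub>R u \<in> G" if "u \<in> G" for u c
      using that subspace_scale[OF lin(1)] lin(3) by (cases u) (simp add: Geq algebra_simps)
  qed
  have bd: "norm x \<le> norm (x + A \<cdot> x)" and form: "(norm x)\<^sup>2 \<le> inner x (x + A \<cdot> x)" if "x \<in> dom A" for x
  proof -
    show f: "(norm x)\<^sup>2 \<le> inner x (x + A \<cdot> x)"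
      using nn[OF that] by (simp add: inner_add power2_norm_eq_inner inner_commute)
    also have "\<dots> \<le> norm x * norm (x + A \<cdot> x)" by (rule norm_cauchy_schwarz)
    finally have "norm x * norm x \<le> norm x * norm (x + A \<cdot> x)" by (simp add: power2_eq_square)
    then show "norm x \<le> norm (x + A \<cdot> x)" by (cases "x = 0") auto
  qed
  have "closed (snd ` G)"
    by (rule closed_image_of_closed_relation[OF clG subG, of 1]) (auto simp: Geq bd)
  have dense: "snd ` G = UNIV"
  proof -
    have "closure (snd ` G) = UNIV"
    proof (rule dense_subspaceI)
      show "subspace (snd ` G)" by (intro linear_subspace_image linear_snd subG)
      fix r assume r: "\<And>v. v \<in> snd ` G \<Longrightarrow> inner r v = 0"
      have "inner r (x + A \<cdot> x) = 0" if "x \<in> dom A" for x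
        by (rule r) (use that Geq in force)
      then have Ar: "A r = Some (- r)"
        by (intro self_adjoint_maximal[OF assms(1)]) (simp add: inner_add inner_commute add_eq_0_iff)
      then have "0 \<le> inner (- r) r" using nn[of r] by auto
      then have "inner r r \<le> 0" by simp
      then show "r = 0" by (metis inner_ge_zero inner_eq_zero_iff order_antisym)
    qed
    then show ?thesis using \<open>closed (snd ` G)\<close> by (simp add: closure_closed)
  qed
  then have "\<forall>y. \<exists>x. (x, y) \<in> G" 
  proof (intro allI)
    fix y
    have "y \<in> snd ` G" using dense by simp
    then show "\<exists>x. (x, y) \<in> G" by force
  qed
  then obtain J where "\<And>y. (J y, y) \<in> G" by metis
  then have J: "J y \<in> dom A" "J y + A \<cdot> J y = y" for y using Geq[of "J y" y] by simp_all
  have uniq: "J y = x" if "x \<in> dom A" "y = x + A \<cdot> x" for x y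
  proof -
    have "J y - x \<in> dom A" using J that lin(1) by (simp add: subspace_diff)
    then have "norm (J y - x) \<le> norm (J y - x + A \<cdot> (J y - x))" by (rule bd)
    also have "J y - x + A \<cdot> (J y - x) = (J y + A \<cdot> J y) - (x + A \<cdot> x)"
      using J(1) that(1) by (simp add: lin)
    also have "\<dots> = 0" using J that by simp
    finally show ?thesis by simp
  qed
  have linJ: "linear J"
  proof (rule linearI)
    fix x y r
    show "J (x + y) = J x + J y"
    proof (rule uniq)
      show "J x + J y \<in> dom A" using J(1) lin(1) by (simp add: subspace_add)
      have "x + y = (J x + A \<cdot> J x) + (J y + A \<cdot> J y)" by (simp only: J(2))
      also have "\<dots> = J x + J y + A \<cdot> (J x + J y)" unfolding lin(2)[OF J(1) J(1)] by simp
      finally show "x + y = J x + J y + A \<cdot> (J x + J y)" .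
    qed
    show "J (r *\<^sub>R x) = r *\<^sub>R J x"
    proof (rule uniq)
      show "r *\<^sub>R J x \<in> dom A" using J(1) lin(1) by (simp add: subspace_scale)
      have "r *\<^sub>R x = r *\<^sub>R (J x + A \<cdot> J x)" by (simp only: J(2))
      also have "\<dots> = r *\<^sub>R J x + A \<cdot> (r *\<^sub>R J x)" unfolding lin(3)[OF J(1)] by (simp only: scaleR_add_right)
      finally show "r *\<^sub>R x = r *\<^sub>R J x + A \<cdot> (r *\<^sub>R J x)" .
    qed
  qed
  have AJ: "A \<cdot> J x = x - J x" for x using J(2)[of x] by (metis add_diff_cancel_left')
  have symJ: "inner (J x) y = inner x (J y)" for x y
  proof -
    have "inner (A \<cdot> J x) (J y) = inner (J x) (A \<cdot> J y)" using self_adjoint_sym[OF assms(1)] J by blast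
    then show ?thesis unfolding AJ by (simp add: inner_diff)
  qed
  have nnJ: "0 \<le> inner (J x) x" for x
    using form[OF J(1)[of x]] J(2)[of x] by (metis order_trans zero_le_power2)
  have nJ: "norm (J x) \<le> norm x" for x using bd[OF J(1)[of x]] J(2)[of x] by simp
  show ?thesis
  proof (rule that[of J])
    show "linear J" by (fact linJ)
    show "inner (J x) y = inner x (J y)" for x y by (fact symJ)
    show "0 \<le> inner (J x) x" for x by (fact nnJ)
    show "norm (J x) \<le> norm x" for x by (fact nJ)
    show "J x \<in> dom A" for x by (fact J(1))
    show "A \<cdot> J x = x - J x" for x by (fact AJ)
    show "J (x + A \<cdot> x) = x" if "x \<in> dom A" for x using that by (rule uniq) simp
  qed
qed

lemma contraction_bounded_linear:
  "linear T \<Longrightarrow> (\<And>x. norm (T x) \<le> norm x) \<Longrightarrow> bounded_linear T"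
  by (rule bounded_linear.intro) (auto simp: bounded_linear_axioms_def intro!: exI[of _ 1])

lemma closed_bounded_graph:
  assumes "bounded_linear T"
  shows "closed {(x, y). y = T x}"
proof -
  have "closed {q. snd q = T (fst q)}"
    by (intro closed_Collect_eq bounded_linear.continuous_on[OF assms] continuous_intros)
  moreover have "{q. snd q = T (fst q)} = {(x, y). y = T x}" by auto
  ultimately show ?thesis by simp
qed

lemma subspace_linear_graph:
  assumes "linear T"
  shows "subspace {(x, y). y = T x}"
proof (rule subspaceI)
  show "0 \<in> {(x, y). y = T x}" by (simp add: zero_prod_def linear_0[OF assms])
qed (auto simp: linear_add[OF assms] linear_scale[OF assms])

text \<open>With \<open>J = (1 + A)\<^sup>-\<^sup>1\<close>, \<open>C = J\<^sup>1\<^sup>/\<^sup>2\<close> and \<open>S = (1 - J)\<^sup>1\<^sup>/\<^sup>2\<close>, the square root is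
  \<open>S C\<^sup>-\<^sup>1\<close>; everything follows from \<open>C\<^sup>2 + S\<^sup>2 = 1\<close> and \<open>C S = S C\<close>.\<close>

lemma sqrt_op_exists:
  fixes A :: "'a::{real_inner,complete_space} partial_op"
  assumes "self_adjoint_op A" "nonneg_op A"
  shows "\<exists>B. self_adjoint_op B \<and> nonneg_op B \<and> B \<circ>\<^sub>m B = A"
proof -
  obtain J where J: "linear J" "\<And>x y. inner (J x) y = inner x (J y)" "\<And>x. 0 \<le> inner (J x) x"
    "\<And>x. norm (J x) \<le> norm x" "\<And>x. J x \<in> dom A" "\<And>x. A \<cdot> J x = x - J x"
    "\<And>x. x \<in> dom A \<Longrightarrow> J (x + A \<cdot> x) = x"
    by (rule resolvent[OF assms], rule that)
  obtain C where C: "linear C" "\<And>x y. inner (C x) y = inner x (C y)" "\<And>x. 0 \<le> inner (C x) x"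
    "\<And>x. norm (C x) \<le> norm x" "\<And>x. C (C x) = J x" "inherits_invariant_graphs J C"
    by (rule bounded_sqrt[OF J(1-4)], rule that)
  have Jle: "(norm (J x))\<^sup>2 \<le> inner (J x) x" for x by (rule symmetric_contraction_form_le[OF J(1-4)])
  define X where "X x = x - J x" for x
  have X: "linear X" "\<And>x y. inner (X x) y = inner x (X y)" "\<And>x. 0 \<le> inner (X x) x"
    "\<And>x. norm (X x) \<le> norm x"
  proof -
    show "linear X" by (rule linearI) (auto simp: X_def linear_add[OF J(1)] linear_scale[OF J(1)] algebra_simps)
    show "inner (X x) y = inner x (X y)" for x y by (simp add: X_def inner_diff J(2))
    show "0 \<le> inner (X x) x" for x
    proof -
      have "inner (J x) x \<le> norm (J x) * norm x" by (rule norm_cauchy_schwarz)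
      also have "\<dots> \<le> inner x x"
        using mult_right_mono[OF J(4)[of x] norm_ge_zero[of x]] by (simp add: norm_eq_sqrt_inner)
      finally show ?thesis by (simp add: X_def inner_diff)
    qed
    show "norm (X x) \<le> norm x" for x
    proof -
      have "(norm (X x))\<^sup>2 = (norm x)\<^sup>2 - 2 * inner (J x) x + (norm (J x))\<^sup>2"
        unfolding X_def power2_norm_eq_inner by (simp add: inner_diff inner_commute)
      also have "\<dots> \<le> (norm x)\<^sup>2" using Jle[of x] J(3)[of x] by linarith
      finally show ?thesis by simp
    qed
  qed
  obtain S where S: "linear S" "\<And>x y. inner (S x) y = inner x (S y)" "\<And>x. 0 \<le> inner (S x) x"
    "\<And>x. norm (S x) \<le> norm x" "\<And>x. S (S x) = X x"
    and Sinv: "inherits_invariant_graphs X S"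
    by (rule bounded_sqrt[OF X(1-4)], rule that)
  have clC: "closed {(x, y). y = C x}" "subspace {(x, y). y = C x}"
    by (intro closed_bounded_graph contraction_bounded_linear C subspace_linear_graph)+
  have CX: "X (C x) = C (X x)" for x
    by (simp add: X_def linear_diff[OF C(1)] flip: C(5))
  \<comment> \<open>The graph of \<open>C\<close> is a closed subspace invariant under
    \<open>X\<close>, hence under its root \<open>S\<close>: this is commutation.\<close>
  have CS: "C (S x) = S (C x)" for x
    using inherits_invariant_graphsD[OF Sinv clC, of x "C x"] CX by auto
  \<comment> \<open>A product of commuting nonnegative operators is nonnegative: with R^2 = S one
    has <S x, C x> = <C R x, R x>.\<close>
  obtain R where "linear R" and R: "\<And>x y. inner (R x) y = inner x (R y)"
    and "\<And>x. 0 \<le> inner (R x) x" "\<And>x. norm (R x) \<le> norm x" and RR: "\<And>x. R (R x) = S x"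
    and Rinv: "inherits_invariant_graphs S R"
    by (rule bounded_sqrt[OF S(1-4)], rule that)
  have CR: "C (R x) = R (C x)" for x
    using inherits_invariant_graphsD[OF Rinv clC, of x "C x"] CS by auto
  have pos: "0 \<le> inner (S x) (C x)" for x
    using C(3)[of "R x"] R[of "R x" "C x"] RR[of x] CR[of x] by (simp add: inner_commute)
  have one: "C (C x) + S (S x) = x" for x by (simp add: C S X_def)
  have injC: "x = 0" if "C x = 0" for x
  proof -
    have "J x = 0" using that C(5)[of x] linear_0[OF C(1)] by simp
    then show ?thesis using J(6)[of x] linear_opD(3)[of A 0 0] J(5)[of x] assms(1)
      by (simp add: self_adjoint_op_def)
  qed
  then have inj: "inj C" using C(1) by (simp add: linear_injective_0)
  define B where "B y = (if y \<in> range C then Some (S (inv C y)) else None)" for y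
  have domB: "dom B = range C" by (auto simp: B_def dom_def split: if_splits)
  have BC: "B (C v) = Some (S v)" for v by (simp add: B_def inv_f_f[OF inj])
  have BCa: "B \<cdot> (C v) = S v" for v by (simp add: BC)
  have sub: "subspace (range C)" by (intro linear_subspace_image C subspace_UNIV)
  have linB: "linear_op B"
  proof (unfold linear_op_def domB, intro conjI ballI allI sub)
    fix x y c assume "x \<in> range C"
    then obtain v where v: "x = C v" by blast
    show "B \<cdot> (c *\<^sub>R x) = c *\<^sub>R (B \<cdot> x)"
      unfolding v linear_scale[OF C(1), symmetric] BCa by (rule linear_scale[OF S(1)])
    assume "y \<in> range C"
    then obtain w where w: "y = C w" by blast
    show "B \<cdot> (x + y) = B \<cdot> x + B \<cdot> y"
      unfolding v w linear_add[OF C(1), symmetric] BCa by (rule linear_add[OF S(1)])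
  qed
  have denseB: "closure (dom B) = UNIV" unfolding domB
  proof (rule dense_subspaceI[OF sub])
    fix x assume x: "\<And>v. v \<in> range C \<Longrightarrow> inner x v = 0"
    then have "inner x (C (C x)) = 0" by blast
    then have "inner (C x) (C x) = 0" using C(2) by metis
    then show "x = 0" using injC by simp
  qed
  have saB: "self_adjoint_op B"
  proof (rule self_adjointI[OF linB denseB])
    show "inner (B \<cdot> x) y = inner x (B \<cdot> y)" if xy: "x \<in> dom B" "y \<in> dom B" for x y
    proof -
      obtain v where v: "x = C v" using xy(1) unfolding domB by (rule imageE)
      obtain w where w: "y = C w" using xy(2) unfolding domB by (rule imageE)
      have "inner (S v) (C w) = inner v (C (S w))" by (simp only: S(2) CS)
      then show ?thesis unfolding v w BCa by (simp only: C(2))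
    qed
    fix y z assume yz: "\<And>x. x \<in> dom B \<Longrightarrow> inner (B \<cdot> x) y = inner x z"
    have "inner v (S y) = inner v (C z)" for v
      using yz[of "C v"] unfolding domB BCa by (auto simp: C(2) S(2))
    then have Sy: "S y = C z" by (metis inner_diff_right inner_eq_zero_iff right_minus_eq)
    \<comment> \<open>From S y = C z and C^2 + S^2 = 1: the vector v = C y + S z satisfies C v = y
      and S v = z, so y is in the domain and B y = z.\<close>
    have y: "y = C (C y + S z)" using one[of y] CS[of z] Sy by (simp add: linear_add[OF C(1)])
    have "S (C y + S z) = z" using one[of z] CS[of y] Sy by (simp add: linear_add[OF S(1)])
    then show "B y = Some z" using BC[of "C y + S z"] y by metis
  qed
  have nnB: "nonneg_op B" unfolding nonneg_op_def domB by (auto simp: BC pos)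
  have "(B \<circ>\<^sub>m B) x = A x" for x
  proof (cases "x \<in> dom A")
    case True
    define q where "q = x + A \<cdot> x"
    \<comment> \<open>Here J q = x. Applying S C^(-1) twice to C C q gives S S q = q - J q = A
      x.\<close>
    have x: "x = C (C q)" using J(7)[OF True] C(5) by (simp add: q_def)
    have "(B \<circ>\<^sub>m B) x = B (S (C q))" unfolding map_comp_def x BC by simp
    also have "\<dots> = B (C (S q))" by (simp add: CS)
    also have "\<dots> = Some (q - x)" unfolding BC S(5) X_def using x C(5) by simp
    also have "q - x = A \<cdot> x" by (simp add: q_def)
    finally show ?thesis using op_apply_Some[OF True] by simp
  next
    case False
    have "(B \<circ>\<^sub>m B) x = None"
    proof (rule ccontr)
      assume "(B \<circ>\<^sub>m B) x \<noteq> None"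
      then obtain u w where u: "B x = Some u" "B u = Some w" by (auto simp: map_comp_def split: option.splits)
      then have "x \<in> range C" "u \<in> range C" using domI[of B] domB by auto
      then obtain v where v: "x = C v" by (auto elim: imageE)
      obtain v' where v': "u = C v'" using \<open>u \<in> range C\<close> by (auto elim: imageE)
      \<comment> \<open>Conversely, B x in the domain of \<open>B\<close> makes v = C^2 v + S^2 v
        lie in the range of \<open>C\<close>, so x = C v lies in the range of C^2 = J, which is
        contained in the domain of \<open>A\<close>.\<close>
      have "S v = C v'" using u(1) BC[of v] v v' by simp
      then have "v = C (C v) + S (C v')" using one[of v] by simp
      then have "v = C (C v + S v')" by (simp add: CS linear_add[OF C(1)])
      then have "x = J (C v + S v')" using v C(5) by metis
      then show False using J(5) False by blast
    qed
    then show ?thesis using False by (simp add: domIff)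
  qed
  then have "B \<circ>\<^sub>m B = A" by (rule ext)
  then show ?thesis using saB nnB by blast
qed

lemma sqrt_op_self_adjoint:
  fixes A :: "'a::{real_inner,complete_space} partial_op"
  assumes "self_adjoint_op A" "nonneg_op A"
  shows "self_adjoint_op (sqrt_op A)" "nonneg_op (sqrt_op A)" "sqrt_op A \<circ>\<^sub>m sqrt_op A = A"
  using someI_ex[OF sqrt_op_exists[OF assms]] by (simp_all add: sqrt_op_def)

lemma dom_map_compD:
  assumes "B \<circ>\<^sub>m B = A" "x \<in> dom A"
  shows "x \<in> dom B" "B \<cdot> x \<in> dom B" "B \<cdot> (B \<cdot> x) = A \<cdot> x"
  using assms by (auto simp: map_comp_def split: option.splits)

text \<open>The last clause, uniqueness of the orthogonal decomposition, is the means of proving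
  that \<open>E\<close> commutes with a symmetric operator that maps \<open>M\<close> into
  itself.\<close>

lemma orthogonal_projection:
  fixes M :: "'a::{real_inner,complete_space} set"
  assumes "closed M" "subspace M"
  obtains E where "linear E" "\<And>x. E x \<in> M" "\<And>x. x \<in> M \<Longrightarrow> E x = x"
    "\<And>x v. v \<in> M \<Longrightarrow> inner (x - E x) v = 0" "\<And>x. norm (E x) \<le> norm x"
    "\<And>x m. m \<in> M \<Longrightarrow> \<forall>v\<in>M. inner (x - m) v = 0 \<Longrightarrow> E x = m"
proof -
  have "\<forall>x. \<exists>m. m \<in> M \<and> (\<forall>v\<in>M. inner (x - m) v = 0)"
    using closed_subspace_projection[OF assms] by metis
  then obtain E where E: "\<And>x. E x \<in> M" "\<And>x v. v \<in> M \<Longrightarrow> inner (x - E x) v = 0" by metis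
  have uniq: "E x = m" if "m \<in> M" and m: "\<And>v. v \<in> M \<Longrightarrow> inner (x - m) v = 0" for x m
  proof -
    have d: "E x - m \<in> M" using E(1) that(1) assms(2) by (simp add: subspace_diff)
    have "inner (E x - m) (E x - m) = inner (x - m) (E x - m) - inner (x - E x) (E x - m)"
      by (simp add: inner_diff_left)
    also have "\<dots> = 0" using m[OF d] E(2)[OF d] by simp
    finally show ?thesis by simp
  qed
  show ?thesis
  proof (rule that[of E])
    show "linear E"
    proof (rule linearI)
      fix x y r
      have *: "(x + y) - (E x + E y) = (x - E x) + (y - E y)" by simp
      show "E (x + y) = E x + E y"
      proof (rule uniq)
        show "E x + E y \<in> M" using E(1) assms(2) by (simp add: subspace_add)
        show "inner (x + y - (E x + E y)) v = 0" if "v \<in> M" for v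
          unfolding * inner_add_left using E(2)[OF that] by simp
      qed
      show "E (r *\<^sub>R x) = r *\<^sub>R E x"
      proof (rule uniq)
        show "r *\<^sub>R E x \<in> M" using E(1) assms(2) by (simp add: subspace_scale)
        show "inner (r *\<^sub>R x - r *\<^sub>R E x) v = 0" if "v \<in> M" for v
          using E(2)[OF that, of x] by (simp flip: scaleR_diff_right)
      qed
    qed
    show "E x \<in> M" for x by (rule E(1))
    show "inner (x - E x) v = 0" if "v \<in> M" for x v using that by (rule E(2))
    show "E x = x" if "x \<in> M" for x by (rule uniq[OF that]) simp
    show "norm (E x) \<le> norm x" for x
    proof -
      have "inner (E x) (E x) = inner x (E x)" using E(2)[OF E(1), of x x] by (simp add: inner_diff_left)
      also have "\<dots> \<le> norm x * norm (E x)" by (rule norm_cauchy_schwarz)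
      finally have "norm (E x) * norm (E x) \<le> norm x * norm (E x)"
        by (simp add: norm_eq_sqrt_inner)
      then show ?thesis by (cases "E x = 0") auto
    qed
    show "E x = m" if "m \<in> M" "\<forall>v\<in>M. inner (x - m) v = 0" for x m
      using that by (intro uniq) blast+
  qed
qed

text \<open>The range of \<open>E\<close> is the kernel of \<open>|T| - T\<close> for \<open>T = (J - \<mu>)/2\<close> and
  \<open>J = (1 + A)\<^sup>-\<^sup>1\<close>: there \<open>J \<ge> \<mu>\<close>, hence \<open>A\<close> is bounded, and \<open>J \<le> \<mu>\<close> on its complement.
  This replaces a spectral projection of \<open>A\<close>.\<close>

lemma spectral_cutoff:
  fixes A B :: "'a::{real_inner,complete_space} partial_op"
  assumes A: "self_adjoint_op A" "nonneg_op A" and B: "self_adjoint_op B" "B \<circ>\<^sub>m B = A"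
    and \<mu>: "0 < \<mu>" "\<mu> \<le> 1"
  obtains E where "linear E" "\<And>x. norm (E x) \<le> norm x" "\<And>x y. inner (E x) y = inner x (E y)"
    "\<And>x. E (E x) = E x" "\<And>x. E x \<in> dom A"
    "\<And>x. x \<in> dom A \<Longrightarrow> E (A \<cdot> x) = A \<cdot> E x" "\<And>x. x \<in> dom B \<Longrightarrow> E (B \<cdot> x) = B \<cdot> E x"
    "\<And>x. norm (A \<cdot> E x) \<le> (1 / \<mu> + 1) * norm x"
    "\<And>x. x \<in> dom A \<Longrightarrow> norm (x - E x) \<le> sqrt \<mu> * norm (x + A \<cdot> x)"
proof -
  have loA: "linear_op A" and loB: "linear_op B" using A B by (auto simp: self_adjoint_op_def)
  note linA = linear_opD[OF loA] and linB = linear_opD[OF loB]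
  obtain J where J: "linear J" "\<And>x y. inner (J x) y = inner x (J y)" "\<And>x. 0 \<le> inner (J x) x"
    "\<And>x. norm (J x) \<le> norm x" "\<And>x. J x \<in> dom A" "\<And>x. A \<cdot> J x = x - J x"
    "\<And>x. x \<in> dom A \<Longrightarrow> J (x + A \<cdot> x) = x"
    by (rule resolvent[OF A], rule that)
  \<comment> \<open>The factor 1/2 makes T a contraction, as the construction of the root of T^2
    demands.\<close>
  define T where "T x = (1/2) *\<^sub>R (J x - \<mu> *\<^sub>R x)" for x
  have linT: "linear T"
    by (rule linearI) (simp_all add: T_def linear_add[OF J(1)] linear_scale[OF J(1)] algebra_simps)
  have symT: "inner (T x) y = inner x (T y)" for x y
    by (simp add: T_def inner_diff J(2))
  have normT: "norm (T x) \<le> norm x" for x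
  proof -
    have "norm (J x - \<mu> *\<^sub>R x) \<le> norm (J x) + norm (\<mu> *\<^sub>R x)" by (rule norm_triangle_ineq4)
    also have "\<dots> \<le> norm x + 1 * norm x"
      using J(4)[of x] \<mu> mult_right_mono[of \<mu> 1 "norm x"] by simp
    finally show ?thesis by (simp add: T_def)
  qed
  define T2 where "T2 x = T (T x)" for x
  have T2: "linear T2" "\<And>x y. inner (T2 x) y = inner x (T2 y)" "\<And>x. 0 \<le> inner (T2 x) x"
    "\<And>x. norm (T2 x) \<le> norm x"
  proof -
    show "linear T2" using linear_compose[OF linT linT] by (simp add: T2_def[abs_def] o_def)
    show "inner (T2 x) y = inner x (T2 y)" for x y by (simp add: T2_def symT)
    show "0 \<le> inner (T2 x) x" for x by (simp add: T2_def symT[of "T x"])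
    show "norm (T2 x) \<le> norm x" for x unfolding T2_def using normT[of "T x"] normT[of x] by linarith
  qed
  \<comment> \<open>K is |T|, so the subspace \<open>M\<close> below, where K = T, is one on which T
    is nonnegative.\<close>
  obtain K where K: "linear K" "\<And>x y. inner (K x) y = inner x (K y)" "\<And>x. 0 \<le> inner (K x) x"
    "\<And>x. norm (K x) \<le> norm x" "\<And>x. K (K x) = T2 x" "inherits_invariant_graphs T2 K"
    by (rule bounded_sqrt[OF T2], rule that)
  have inv: "(T x, T y) \<in> G \<and> (K x, K y) \<in> G"
    if G: "closed G" "subspace G" "\<And>x y. (x, y) \<in> G \<Longrightarrow> (J x, J y) \<in> G" "(x, y) \<in> G" for G x y
  proof -
    have GT: "(T x, T y) \<in> G" if "(x, y) \<in> G" for x y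
    proof -
      have "(1/2) *\<^sub>R ((J x, J y) - \<mu> *\<^sub>R (x, y)) \<in> G"
        by (intro subspace_scale subspace_diff G(2,3) that)
      then show ?thesis by (simp add: T_def)
    qed
    have "(K x, K y) \<in> G"
      by (rule inherits_invariant_graphsD[OF K(6) G(1,2) _ G(4)]) (simp add: T2_def GT)
    then show ?thesis using GT G(4) by blast
  qed
  have blJ: "bounded_linear J" and blK: "bounded_linear K" and blT: "bounded_linear T"
    by (intro contraction_bounded_linear J K linT normT)+
  have JTK: "J (K x) = K (J x)" "J (T x) = T (J x)" for x
    using inv[OF closed_bounded_graph[OF blJ] subspace_linear_graph[OF J(1)], of x "J x"] by auto
  have KT: "T (K x) = K (T x)" for x
    by (simp add: T_def linear_scale[OF K(1)] linear_diff[OF K(1)] JTK)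
  define M where "M = {x. K x = T x}"
  have clM: "closed M" unfolding M_def
    by (intro closed_Collect_eq bounded_linear.continuous_on[OF blK] bounded_linear.continuous_on[OF blT] continuous_on_id)
  have subM: "subspace M" unfolding M_def
  proof (rule subspaceI)
    show "0 \<in> {x. K x = T x}" by (simp add: linear_0[OF K(1)] linear_0[OF linT])
  qed (auto simp: linear_add[OF K(1)] linear_add[OF linT] linear_scale[OF K(1)] linear_scale[OF linT])
  have JM: "J x \<in> M" if "x \<in> M" for x
    using that JTK[of x] unfolding M_def mem_Collect_eq by metis
  have lowM: "\<mu> * (norm x)\<^sup>2 \<le> inner (J x) x" if "x \<in> M" for x
  proof -
    have "0 \<le> inner (T x) x" using that K(3)[of x] unfolding M_def mem_Collect_eq by metis
    then show ?thesis by (simp add: T_def inner_diff_left power2_norm_eq_inner)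
  qed
  have lowM': "norm x \<le> (1 / \<mu>) * norm (J x)" if "x \<in> M" for x
  proof (cases "x = 0")
    case False
    have "\<mu> * (norm x)\<^sup>2 \<le> norm (J x) * norm x" using lowM[OF that] norm_cauchy_schwarz[of "J x" x] by linarith
    then have "\<mu> * norm x \<le> norm (J x)" using False by (simp add: power2_eq_square)
    then show ?thesis using \<mu> by (simp add: field_simps)
  qed (use \<mu> in simp)
  define GM where "GM = {(x, y). x \<in> M \<and> y = J x}"
  have clGM: "closed GM"
  proof -
    have "GM = {(x, y). y = J x} \<inter> fst -` M" by (auto simp: GM_def)
    then show ?thesis
      by (simp only:) (intro closed_Int closed_bounded_graph blJ closed_vimage_fst clM)
  qed
  have subGM: "subspace GM"
  proof (rule subspaceI)
    show "0 \<in> GM" by (simp add: GM_def zero_prod_def linear_0[OF J(1)] subspace_0[OF subM])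
  qed (auto simp: GM_def linear_add[OF J(1)] linear_scale[OF J(1)] subspace_add[OF subM] subspace_scale[OF subM])
  have clJM: "closed (J ` M)"
  proof -
    have "closed (snd ` GM)"
      by (rule closed_image_of_closed_relation[OF clGM subGM, of "1 / \<mu>"]) (auto simp: GM_def dest: lowM')
    moreover have "snd ` GM = J ` M" by (force simp: GM_def)
    ultimately show ?thesis by simp
  qed
  \<comment> \<open>J maps \<open>M\<close> onto \<open>M\<close>: the image is closed because J is
    bounded below there, and a vector m of \<open>M\<close> orthogonal to J m vanishes since <J m,
    m> \<ge> \<mu> |m|^2. This places \<open>M\<close> in the range of J, which lies in the domain
    of \<open>A\<close>.\<close>
  have surj: "\<exists>q\<in>M. x = J q" if x: "x \<in> M" for x
  proof -
    have "subspace (J ` M)" by (intro linear_subspace_image J subM)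
    then obtain m where m: "m \<in> J ` M" "\<And>v. v \<in> J ` M \<Longrightarrow> inner (x - m) v = 0"
      using closed_subspace_projection[OF clJM] by metis
    have "m \<in> M" using m(1) JM by blast
    then have r: "x - m \<in> M" using x subM by (simp add: subspace_diff)
    then have "inner (x - m) (J (x - m)) = 0" using m(2) by blast
    then have "\<mu> * (norm (x - m))\<^sup>2 \<le> 0" using lowM[OF r] by (simp add: inner_commute)
    then have "x = m" using \<mu> by (simp add: mult_le_0_iff)
    then show ?thesis using m(1) by blast
  qed
  obtain E where E: "linear E" "\<And>x. E x \<in> M" "\<And>x. x \<in> M \<Longrightarrow> E x = x"
    "\<And>x v. v \<in> M \<Longrightarrow> inner (x - E x) v = 0" "\<And>x. norm (E x) \<le> norm x"
    "\<And>x m. m \<in> M \<Longrightarrow> \<forall>v\<in>M. inner (x - m) v = 0 \<Longrightarrow> E x = m"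
    by (rule orthogonal_projection[OF clM subM], rule that)
  have symE: "inner (E x) y = inner x (E y)" for x y
  proof -
    have "inner (x - E x) (E y) = 0" "inner (y - E y) (E x) = 0" using E(4)[OF E(2)] by blast+
    then show ?thesis using inner_commute[of y "E x"] inner_commute[of "E y" "E x"]
      by (simp add: inner_diff_left)
  qed
  have MA: "x \<in> dom A" if "x \<in> M" for x
    using surj[OF that] J(5) by blast
  have JE: "E (J x) = J (E x)" for x
  proof (rule E(6))
    show "J (E x) \<in> M" by (intro JM E)
    show "\<forall>v\<in>M. inner (J x - J (E x)) v = 0"
    proof
      fix v assume v: "v \<in> M"
      have "inner (J x - J (E x)) v = inner (x - E x) (J v)" by (simp add: J(2) flip: linear_diff[OF J(1)])
      then show "inner (J x - J (E x)) v = 0" using E(4)[OF JM[OF v]] by simp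
    qed
  qed
  have AE: "E (A \<cdot> x) = A \<cdot> E x" if "x \<in> dom A" for x
  proof -
    define w where "w = x + A \<cdot> x"
    have x: "x = J w" using J(7)[OF that] by (simp add: w_def)
    have "A \<cdot> E x = A \<cdot> J (E w)" by (simp add: x JE)
    also have "\<dots> = E w - E x" by (simp add: J(6) x JE)
    also have "\<dots> = E (A \<cdot> x)" by (simp add: w_def linear_add[OF E(1)])
    finally show ?thesis by simp
  qed
  have AEb: "norm (A \<cdot> E x) \<le> (1 / \<mu> + 1) * norm x" for x
  proof -
    obtain q where q: "q \<in> M" "E x = J q" using surj[OF E(2)] by blast
    have "norm (A \<cdot> E x) \<le> norm q + norm (J q)" unfolding q(2) J(6) by (rule norm_triangle_ineq4)
    also have "\<dots> \<le> (1 / \<mu>) * norm (J q) + norm (J q)" using lowM'[OF q(1)] by simp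
    also have "\<dots> = (1 / \<mu> + 1) * norm (E x)" by (simp add: q algebra_simps)
    also have "\<dots> \<le> (1 / \<mu> + 1) * norm x" using E(5) \<mu> by (intro mult_left_mono) auto
    finally show ?thesis .
  qed
  have domAB: "x \<in> dom B" "B \<cdot> x \<in> dom B" "B \<cdot> (B \<cdot> x) = A \<cdot> x" if "x \<in> dom A" for x
    using dom_map_compD[OF B(2) that] by auto
  \<comment> \<open>J commutes with \<open>B\<close> in the sense of unbounded operators. For q = J
    x the vector A q = x - q is in the domain of \<open>B\<close>, so B q is in the domain of
    \<open>A\<close> with A B q = B A q, and J can be applied to B q + A B q = B x.\<close>
  have JB: "J x \<in> dom B \<and> B \<cdot> J x = J (B \<cdot> x)" if x: "x \<in> dom B" for x
  proof -
    let ?q = "J x"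
    have q: "?q \<in> dom A" "?q \<in> dom B" "B \<cdot> ?q \<in> dom B" "B \<cdot> (B \<cdot> ?q) = A \<cdot> ?q"
      using J(5) domAB by auto
    have xq: "x = ?q + A \<cdot> ?q" by (simp add: J(6))
    have Aq: "A \<cdot> ?q \<in> dom B" using subspace_diff[OF linB(1) x q(2)] by (simp add: J(6))
    then have BBq: "B \<cdot> (B \<cdot> ?q) \<in> dom B" using q by simp
    have "(B \<circ>\<^sub>m B) (B \<cdot> ?q) = B (B \<cdot> (B \<cdot> ?q))" using q(3) by (auto simp: map_comp_def)
    then have ABq: "A (B \<cdot> ?q) = B (A \<cdot> ?q)" using q(4) B(2) by simp
    then have "B \<cdot> ?q \<in> dom A" using Aq by (simp add: domIff)
    then have "J (B \<cdot> ?q + A \<cdot> (B \<cdot> ?q)) = B \<cdot> ?q" by (rule J(7))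
    also have "B \<cdot> ?q + A \<cdot> (B \<cdot> ?q) = B \<cdot> (?q + A \<cdot> ?q)" using ABq linB(2)[OF q(2) Aq] by simp
    finally show ?thesis using q(2) xq by simp
  qed
  have invB: "(x, y) \<in> op_graph B \<Longrightarrow> (T x, T y) \<in> op_graph B \<and> (K x, K y) \<in> op_graph B" for x y
  proof (rule inv[OF closed_op_graph[OF B(1)] subspace_op_graph[OF B(1)]])
    fix x y assume "(x, y) \<in> op_graph B"
    then have "x \<in> dom B" "y = B \<cdot> x" by (auto simp: op_graph_def)
    then show "(J x, J y) \<in> op_graph B" using JB[of x] by (auto simp: op_graph_def)
  qed
  have BM: "B \<cdot> m \<in> M" if m: "m \<in> M" for m
  proof -
    have "(m, B \<cdot> m) \<in> op_graph B" using domAB(1)[OF MA[OF m]] by (auto simp: op_graph_def)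
    then have "B (T m) = Some (T (B \<cdot> m))" "B (K m) = Some (K (B \<cdot> m))"
      using invB by (auto simp: op_graph_def)
    then show ?thesis using m by (simp add: M_def)
  qed
  have BE: "E (B \<cdot> x) = B \<cdot> E x" if x: "x \<in> dom B" for x
  proof (rule E(6))
    have ExB: "E x \<in> dom B" by (intro domAB MA E)
    show "B \<cdot> E x \<in> M" by (intro BM E)
    show "\<forall>v\<in>M. inner (B \<cdot> x - B \<cdot> E x) v = 0"
    proof
      fix v assume v: "v \<in> M"
      have "inner (B \<cdot> x - B \<cdot> E x) v = inner (B \<cdot> (x - E x)) v" by (simp add: linB(4)[OF x ExB])
      also have "\<dots> = inner (x - E x) (B \<cdot> v)"
        by (rule self_adjoint_sym[OF B(1) subspace_diff[OF linB(1) x ExB] domAB(1)[OF MA[OF v]]])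
      also have "\<dots> = 0" by (rule E(4)[OF BM[OF v]])
      finally show "inner (B \<cdot> x - B \<cdot> E x) v = 0" .
    qed
  qed
  have compl: "norm (x - E x) \<le> sqrt \<mu> * norm (x + A \<cdot> x)" if x: "x \<in> dom A" for x
  proof -
    define q where "q = x + A \<cdot> x"
    define r where "r = q - E q"
    have xJ: "x = J q" using J(7)[OF x] by (simp add: q_def)
    have xr: "x - E x = J r" by (simp add: r_def linear_diff[OF J(1)] JE xJ)
    \<comment> \<open>Since (K - T)(K + T) = K^2 - T^2 = 0, the range of K + T lies in
      \<open>M\<close>. As r is orthogonal to \<open>M\<close>, (K + T) r = 0, so <T r, r> = -<K r,
      r> \<le> 0, that is <J r, r> \<le> \<mu> |r|^2.\<close>
    have "inner (K r + T r) v = 0" for v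
    proof -
      have "K v + T v \<in> M"
        using KT[of v] K(5)[of v] KT by (simp add: M_def linear_add[OF K(1)] linear_add[OF linT] T2_def)
      then have "inner r (K v + T v) = 0" unfolding r_def by (rule E(4))
      then show ?thesis by (simp add: inner_add K(2) symT)
    qed
    then have "K r + T r = 0" using inner_eq_zero_iff by blast
    then have "inner (K r + T r) r = 0" by simp
    then have "inner (T r) r \<le> 0" using K(3)[of r] by (simp add: inner_add_left)
    then have Jr: "inner (J r) r \<le> \<mu> * (norm r)\<^sup>2"
      by (simp add: T_def inner_diff_left power2_norm_eq_inner)
    have "norm r \<le> norm q"
    proof -
      have "inner r (E q) = 0" using E(4)[OF E(2)] by (simp add: r_def)
      then have "(norm r)\<^sup>2 = inner r q" by (simp add: r_def power2_norm_eq_inner inner_diff_right)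
      also have "\<dots> \<le> norm r * norm q" by (rule norm_cauchy_schwarz)
      finally show ?thesis by (cases "r = 0") (auto simp: power2_eq_square)
    qed
    then have "(norm r)\<^sup>2 \<le> (norm q)\<^sup>2" by (simp add: power_mono)
    then have "\<mu> * (norm r)\<^sup>2 \<le> \<mu> * (norm q)\<^sup>2" using \<mu> by (simp add: mult_left_mono)
    then have "(norm (J r))\<^sup>2 \<le> \<mu> * (norm q)\<^sup>2"
      using symmetric_contraction_form_le[OF J(1-4), of r] Jr by linarith
    also have "\<dots> = (sqrt \<mu> * norm q)\<^sup>2" using \<mu> by (simp add: power_mult_distrib)
    finally have "norm (J r) \<le> sqrt \<mu> * norm q" by (rule power2_le_imp_le) (use \<mu> in simp)
    then show ?thesis by (simp add: xr q_def)
  qed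
  show ?thesis
  proof (rule that[of E])
    show "linear E" by (fact E(1))
    show "norm (E x) \<le> norm x" for x by (fact E(5))
    show "inner (E x) y = inner x (E y)" for x y by (fact symE)
    show "E (E x) = E x" for x by (intro E)
    show "E x \<in> dom A" for x by (intro MA E)
    show "E (A \<cdot> x) = A \<cdot> E x" if "x \<in> dom A" for x using that by (rule AE)
    show "E (B \<cdot> x) = B \<cdot> E x" if "x \<in> dom B" for x using that by (rule BE)
    show "norm (A \<cdot> E x) \<le> (1 / \<mu> + 1) * norm x" for x by (fact AEb)
    show "norm (x - E x) \<le> sqrt \<mu> * norm (x + A \<cdot> x)" if "x \<in> dom A" for x using that by (rule compl)
  qed
qed

text \<open>With \<mu> = 1/(n+1) the complements tend to 0 at rate \<mu>^(1/2) on the domain of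
  \<open>A\<close>; density and the uniform bound |E n x| \<le> |x| extend the convergence to every
  vector.\<close>

lemma spectral_cutoff_sequence:
  fixes A B :: "'a::{real_inner,complete_space} partial_op"
  assumes A: "self_adjoint_op A" "nonneg_op A" and B: "self_adjoint_op B" "B \<circ>\<^sub>m B = A"
  obtains E :: "nat \<Rightarrow> 'a \<Rightarrow> 'a" where "\<And>n. linear (E n)" "\<And>n x. norm (E n x) \<le> norm x"
    "\<And>n x y. inner (E n x) y = inner x (E n y)"
    "\<And>n x. E n (E n x) = E n x" "\<And>n x. E n x \<in> dom A"
    "\<And>n x. x \<in> dom A \<Longrightarrow> E n (A \<cdot> x) = A \<cdot> E n x" "\<And>n x. x \<in> dom B \<Longrightarrow> E n (B \<cdot> x) = B \<cdot> E n x"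
    "\<And>n. bounded_linear (\<lambda>x. A \<cdot> E n x)" "\<And>x. (\<lambda>n. E n x) \<longlonglongrightarrow> x"
proof -
  let ?\<mu> = "\<lambda>n. 1 / real (Suc n)"
  let ?P = "\<lambda>\<mu> E. linear E \<and> (\<forall>x. norm (E x) \<le> norm x) \<and> (\<forall>x y. inner (E x) y = inner x (E y)) \<and>
    (\<forall>x. E (E x) = E x) \<and> (\<forall>x. E x \<in> dom A) \<and> (\<forall>x\<in>dom A. E (A \<cdot> x) = A \<cdot> E x) \<and>
    (\<forall>x\<in>dom B. E (B \<cdot> x) = B \<cdot> E x) \<and> (\<forall>x. norm (A \<cdot> E x) \<le> (1 / \<mu> + 1) * norm x) \<and>
    (\<forall>x\<in>dom A. norm (x - E x) \<le> sqrt \<mu> * norm (x + A \<cdot> x))"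
  have "\<exists>E. ?P (?\<mu> n) E" for n
  proof -
    have \<mu>: "0 < ?\<mu> n" "?\<mu> n \<le> 1" by simp_all
    obtain E where E: "linear E" "\<And>x. norm (E x) \<le> norm x" "\<And>x y. inner (E x) y = inner x (E y)"
      "\<And>x. E (E x) = E x" "\<And>x. E x \<in> dom A"
      "\<And>x. x \<in> dom A \<Longrightarrow> E (A \<cdot> x) = A \<cdot> E x" "\<And>x. x \<in> dom B \<Longrightarrow> E (B \<cdot> x) = B \<cdot> E x"
      "\<And>x. norm (A \<cdot> E x) \<le> (1 / ?\<mu> n + 1) * norm x"
      "\<And>x. x \<in> dom A \<Longrightarrow> norm (x - E x) \<le> sqrt (?\<mu> n) * norm (x + A \<cdot> x)"
      by (rule spectral_cutoff[OF A B \<mu>], rule that)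
    show ?thesis
      by (intro exI[of _ E] conjI allI ballI) (fact E(1) E(2) E(3) E(4) E(5) E(8) | rule E(6) E(7) E(9), assumption)+
  qed
  then have "\<exists>E. \<forall>n. ?P (?\<mu> n) (E n)" by (intro choice allI)
  then obtain E where E0: "\<forall>n. ?P (?\<mu> n) (E n)" by (rule exE)
  then have E: "\<And>n. linear (E n)" "\<And>n x. norm (E n x) \<le> norm x" "\<And>n x y. inner (E n x) y = inner x (E n y)"
    "\<And>n x. E n (E n x) = E n x" "\<And>n x. E n x \<in> dom A" "\<And>n x. x \<in> dom A \<Longrightarrow> E n (A \<cdot> x) = A \<cdot> E n x"
    "\<And>n x. x \<in> dom B \<Longrightarrow> E n (B \<cdot> x) = B \<cdot> E n x"
    "\<And>n x. norm (A \<cdot> E n x) \<le> (1 / ?\<mu> n + 1) * norm x"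
    "\<And>n x. x \<in> dom A \<Longrightarrow> norm (x - E n x) \<le> sqrt (?\<mu> n) * norm (x + A \<cdot> x)"
    using E0 by simp_all
  have "linear_op A" and dA: "closure (dom A) = UNIV" using A by (auto simp: self_adjoint_op_def)
  note linA = linear_opD[OF this(1)]
  have bl: "bounded_linear (\<lambda>x. A \<cdot> E n x)" for n
  proof (rule bounded_linear_intro[where K = "1 / ?\<mu> n + 1"])
    show "A \<cdot> E n (x + y) = A \<cdot> E n x + A \<cdot> E n y" for x y
      by (simp add: linear_add[OF E(1)] linA(2)[OF E(5) E(5)])
    show "A \<cdot> E n (r *\<^sub>R x) = r *\<^sub>R (A \<cdot> E n x)" for r x
      by (simp add: linear_scale[OF E(1)] linA(3)[OF E(5)])
    show "norm (A \<cdot> E n x) \<le> norm x * (1 / ?\<mu> n + 1)" for x using E(8)[of n x] by (simp only: mult.commute)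
  qed
  have conv: "(\<lambda>n. E n x) \<longlonglongrightarrow> x" for x
  proof (rule LIMSEQ_I)
    fix e :: real assume "0 < e"
    have "x \<in> closure (dom A)" using dA by simp
    moreover have "0 < e / 3" using \<open>0 < e\<close> by simp
    ultimately have "\<exists>y\<in>dom A. dist y x < e / 3" unfolding closure_approachable by blast
    then obtain y where y: "y \<in> dom A" "dist y x < e / 3" by blast
    have "(\<lambda>n. sqrt (?\<mu> n) * norm (y + A \<cdot> y)) \<longlonglongrightarrow> sqrt 0 * norm (y + A \<cdot> y)"
      by (intro tendsto_intros LIMSEQ_Suc lim_1_over_n)
    then have "\<forall>\<^sub>F n in sequentially. sqrt (?\<mu> n) * norm (y + A \<cdot> y) < e / 3"
      by (rule order_tendstoD(2)) (use \<open>0 < e\<close> in simp)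
    then obtain N where N: "\<And>n. n \<ge> N \<Longrightarrow> sqrt (?\<mu> n) * norm (y + A \<cdot> y) < e / 3"
      unfolding eventually_sequentially by blast
    show "\<exists>N. \<forall>n\<ge>N. norm (E n x - x) < e"
    proof (intro exI allI impI)
      fix n assume "N \<le> n"
      have "E n x - x = E n (x - y) - (y - E n y) + (y - x)" by (simp add: linear_diff[OF E(1)])
      then have "norm (E n x - x) \<le> norm (E n (x - y)) + norm (y - E n y) + norm (y - x)"
        using norm_triangle_ineq[of "E n (x - y) - (y - E n y)" "y - x"]
          norm_triangle_ineq4[of "E n (x - y)" "y - E n y"] by simp
      also have "\<dots> < e / 3 + e / 3 + e / 3"
        using E(2)[of n "x - y"] E(9)[OF y(1), of n] N[OF \<open>N \<le> n\<close>] y(2)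
        by (simp add: dist_norm norm_minus_commute)
      finally show "norm (E n x - x) < e" by simp
    qed
  qed
  show ?thesis
  proof (rule that[of E])
    show "linear (E n)" for n by (fact E(1))
    show "norm (E n x) \<le> norm x" for n x by (fact E(2))
    show "inner (E n x) y = inner x (E n y)" for n x y by (fact E(3))
    show "E n (E n x) = E n x" for n x by (fact E(4))
    show "E n x \<in> dom A" for n x by (fact E(5))
    show "E n (A \<cdot> x) = A \<cdot> E n x" if "x \<in> dom A" for n x using that by (rule E(6))
    show "E n (B \<cdot> x) = B \<cdot> E n x" if "x \<in> dom B" for n x using that by (rule E(7))
    show "bounded_linear (\<lambda>x. A \<cdot> E n x)" for n by (fact bl)
    show "(\<lambda>n. E n x) \<longlonglongrightarrow> x" for x by (fact conv)
  qed
qed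

section \<open>Energy estimates\<close>

lemma nonincreasing_within:
  fixes f :: "real \<Rightarrow> real"
  assumes "a \<le> b" and "\<And>t. a \<le> t \<Longrightarrow> t \<le> b \<Longrightarrow> (f has_real_derivative f' t) (at t within {a..b})"
    and "\<And>t. a \<le> t \<Longrightarrow> t \<le> b \<Longrightarrow> f' t \<le> 0"
  shows "f b \<le> f a"
proof -
  have "\<exists>x\<in>{a..b}. f b - f a = f' x * (b - a)"
    by (rule mvt_very_simple[OF assms(1)]) (use assms(2) in \<open>auto simp: has_field_derivative_def\<close>)
  then obtain x where "x \<in> {a..b}" "f b - f a = f' x * (b - a)" by blast
  moreover have "f' x * (b - a) \<le> 0" using assms calculation by (intro mult_nonpos_nonneg) auto
  ultimately show ?thesis by simp
qed

text \<open>After the last time s with f \<le> K the function is nonincreasing, so f T \<le> f r for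
  r just after s; continuity at s then excludes f T > K. The sign of f' is demanded only above the
  barrier, which is all a differential inequality with absorption provides.\<close>

lemma barrier_upper:
  fixes f :: "real \<Rightarrow> real"
  assumes "0 \<le> T" and der: "\<And>t. 0 \<le> t \<Longrightarrow> t \<le> T \<Longrightarrow> (f has_real_derivative f' t) (at t within {0..T})"
    and "f 0 \<le> K" and neg: "\<And>t. 0 \<le> t \<Longrightarrow> t \<le> T \<Longrightarrow> K < f t \<Longrightarrow> f' t \<le> 0"
  shows "f T \<le> K"
proof (rule ccontr)
  assume "\<not> f T \<le> K"
  have cont: "continuous_on {0..T} f"
    using der by (auto intro!: DERIV_continuous_on)
  define Z where "Z = {0..T} \<inter> f -` {..K}"
  have "closed Z" unfolding Z_def by (rule continuous_closed_preimage[OF cont]) auto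
  moreover have "0 \<in> Z" using assms by (auto simp: Z_def)
  moreover have bdd: "bdd_above Z" by (auto simp: Z_def bdd_above_def)
  ultimately have "Sup Z \<in> Z" using closed_contains_Sup[of Z] by blast
  define s where "s = Sup Z"
  have s: "0 \<le> s" "s \<le> T" "f s \<le> K" using \<open>Sup Z \<in> Z\<close> by (auto simp: Z_def s_def)
  have above: "K < f t" if "s < t" "t \<le> T" for t
  proof (rule ccontr)
    assume "\<not> K < f t"
    then have "t \<in> Z" using that s by (auto simp: Z_def)
    then have "t \<le> s" unfolding s_def by (rule cSup_upper[OF _ bdd])
    then show False using that by simp
  qed
  have sT: "s < T" using s \<open>\<not> f T \<le> K\<close> by (cases "s = T") auto
  have dec: "f T \<le> f r" if "s < r" "r < T" for r
  proof (rule nonincreasing_within[of r T f f'])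
    show "r \<le> T" using that by simp
    show "(f has_real_derivative f' t) (at t within {r..T})" if "r \<le> t" "t \<le> T" for t
      by (rule DERIV_subset[OF der]) (use that s \<open>s < r\<close> in auto)
    show "f' t \<le> 0" if "r \<le> t" "t \<le> T" for t
      by (rule neg) (use that s \<open>s < r\<close> above in auto)
  qed
  have "0 < f T - f s" using s \<open>\<not> f T \<le> K\<close> by simp
  then have "\<exists>d>0. \<forall>x'\<in>{0..T}. dist x' s < d \<longrightarrow> dist (f x') (f s) < f T - f s"
    using cont s unfolding continuous_on_iff by simp
  then obtain d where d: "d > 0" "\<And>x'. x' \<in> {0..T} \<Longrightarrow> dist x' s < d \<Longrightarrow> dist (f x') (f s) < f T - f s"
    by blast
  define r where "r = min ((s + T) / 2) (s + d / 2)"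
  have r: "s < r" "r < T" "dist r s < d" using d(1) sT by (auto simp: r_def dist_real_def min_def field_simps)
  then have "dist (f r) (f s) < f T - f s" using s by (intro d) auto
  then show False using dec[OF r(1,2)] by (simp add: dist_real_def)
qed

text \<open>The bootstrap principle: at the first time with f \<ge> 0 continuity gives f = 0, while
  the improvement step gives f < 0 there. Several conditions are treated together by taking f as a
  maximum.\<close>

lemma continuity_method:
  fixes f :: "real \<Rightarrow> real"
  assumes cont: "continuous_on {0..} f" and "f 0 < 0"
    and step: "\<And>T. 0 \<le> T \<Longrightarrow> (\<And>t. 0 \<le> t \<Longrightarrow> t \<le> T \<Longrightarrow> f t \<le> 0) \<Longrightarrow> f T < 0"
    and "0 \<le> t"
  shows "f t < 0"
proof (rule ccontr)
  assume "\<not> f t < 0"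
  define Z where "Z = {0..} \<inter> f -` {0..}"
  have "closed Z" unfolding Z_def by (rule continuous_closed_preimage[OF cont]) auto
  moreover have "t \<in> Z" using \<open>\<not> f t < 0\<close> assms by (auto simp: Z_def)
  moreover have bdd: "bdd_below Z" by (auto simp: Z_def bdd_below_def)
  ultimately have "Inf Z \<in> Z" using closed_contains_Inf[of Z] by blast
  define s where "s = Inf Z"
  have s: "0 \<le> s" "0 \<le> f s" using \<open>Inf Z \<in> Z\<close> by (auto simp: Z_def s_def)
  have below: "f r < 0" if "0 \<le> r" "r < s" for r
  proof (rule ccontr)
    assume "\<not> f r < 0"
    then have "r \<in> Z" using that by (auto simp: Z_def)
    then have "s \<le> r" unfolding s_def by (rule cInf_lower[OF _ bdd])
    then show False using that by simp
  qed
  have "s \<noteq> 0" using s \<open>f 0 < 0\<close> by auto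
  have "f s \<le> 0"
  proof (rule ccontr)
    assume "\<not> f s \<le> 0"
    then have "\<exists>d>0. \<forall>x'\<in>{0..}. dist x' s < d \<longrightarrow> dist (f x') (f s) < f s"
      using cont s unfolding continuous_on_iff by (meson atLeast_iff not_le)
    then obtain d where d: "d > 0" "\<And>x'. 0 \<le> x' \<Longrightarrow> dist x' s < d \<Longrightarrow> dist (f x') (f s) < f s" by auto
    define r where "r = max 0 (s - d / 2)"
    have "0 \<le> r" "r < s" "dist r s < d" using d(1) s \<open>s \<noteq> 0\<close> by (auto simp: r_def dist_real_def)
    then have "dist (f r) (f s) < f s" "f r < 0" using d(2) below by auto
    then show False by (simp add: dist_real_def)
  qed
  then have "f s < 0" using below by (intro step s) (metis order_le_less)
  then show False using s by simp
qed

lemma powr_mvt: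
  fixes x y a :: real
  assumes "0 \<le> x" "x < y" "1 \<le> a"
  shows "\<exists>z>x. z < y \<and> y powr a - x powr a = (y - x) * (a * z powr (a - 1))"
proof (rule mvt[OF assms(2)])
  show "continuous_on {x..y} (\<lambda>x. x powr a)"
    using assms by (intro continuous_on_powr' continuous_intros) auto
  show "((\<lambda>x. x powr a) has_derivative (\<lambda>h. h * (a * z powr (a - 1)))) (at z)" if "x < z" "z < y" for z
  proof -
    have "((\<lambda>x. x powr a) has_derivative (*) (a * z powr (a - 1))) (at z)"
      using has_real_derivative_powr[of z a] that assms by (simp add: has_field_derivative_def)
    then show ?thesis by (simp only: mult.commute[of _ "a * z powr (a - 1)"])
  qed
qed (auto simp: mult.commute)

lemma powr_diff_le:
  fixes x y a K :: real
  assumes "1 \<le> a" "0 \<le> x" "x \<le> K" "0 \<le> y" "y \<le> K"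
  shows "\<bar>x powr a - y powr a\<bar> \<le> a * K powr (a - 1) * \<bar>x - y\<bar>"
proof -
  have *: "\<bar>x powr a - y powr a\<bar> \<le> a * K powr (a - 1) * \<bar>x - y\<bar>"
    if "0 \<le> x" "x < y" "y \<le> K" for x y
  proof -
    have "\<exists>z>x. z < y \<and> y powr a - x powr a = (y - x) * (a * z powr (a - 1))"
      using that assms(1) by (intro powr_mvt) auto
    then obtain z where z: "x < z" "z < y" "y powr a - x powr a = (y - x) * (a * z powr (a - 1))" by blast
    have "z powr (a - 1) \<le> K powr (a - 1)" using z that assms(1) by (intro powr_mono2) auto
    then have "a * z powr (a - 1) \<le> a * K powr (a - 1)" using assms(1) by (intro mult_left_mono) auto
    then have "(y - x) * (a * z powr (a - 1)) \<le> (y - x) * (a * K powr (a - 1))"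
      by (rule mult_left_mono) (use that(2) in simp)
    moreover have "0 \<le> (y - x) * (a * z powr (a - 1))" using that assms(1) by simp
    moreover have "\<bar>x powr a - y powr a\<bar> = \<bar>(y - x) * (a * z powr (a - 1))\<bar>" using z(3) by (simp add: abs_minus_commute)
    moreover have "\<bar>x - y\<bar> = y - x" using that by simp
    ultimately show ?thesis by (simp add: mult.commute)
  qed
  consider "x < y" | "y < x" | "x = y" by linarith
  then show ?thesis
  proof cases
    case 1 then show ?thesis using * assms by auto
  next
    case 2 then show ?thesis using *[of y x] assms by (simp add: abs_minus_commute)
  qed simp
qed

text \<open>At a zero of g the difference quotient is that of g times g^(a-1), and the second factor
  tends to 0. The weak energy identity needs this case, because it is used before |A^(1/2)u| is
  known to be positive.\<close>

lemma has_real_derivative_powr_nonneg: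
  fixes g :: "real \<Rightarrow> real"
  assumes a: "1 < a" and g: "(g has_real_derivative g') (at t within S)"
    and nn: "\<And>s. s \<in> S \<Longrightarrow> 0 \<le> g s" and t: "t \<in> S"
  shows "((\<lambda>s. g s powr a) has_real_derivative a * g t powr (a - 1) * g') (at t within S)"
proof (cases "g t = 0")
  case False
  then have "0 < g t" using nn[OF t] by simp
  then have "((\<lambda>r. r powr a) has_real_derivative a * g t powr (a - 1)) (at (g t))"
    by (rule has_real_derivative_powr)
  from DERIV_chain2[OF this g] show ?thesis .
next
  case True
  have "((\<lambda>s. (g s - g t) / (s - t)) \<longlongrightarrow> g') (at t within S)"
    using g by (simp add: has_field_derivative_iff)
  moreover have "((\<lambda>s. g s powr (a - 1)) \<longlongrightarrow> 0) (at t within S)"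
  proof -
    have gt: "(g \<longlongrightarrow> 0) (at t within S)"
      using DERIV_continuous[OF g] True by (simp add: continuous_within)
    have "((\<lambda>s. g s powr (a - 1)) \<longlongrightarrow> 0 powr (a - 1)) (at t within S)"
      by (rule tendsto_powr2[OF gt tendsto_const]) (use nn a in \<open>auto simp: eventually_at_filter\<close>)
    then show ?thesis by simp
  qed
  ultimately have "((\<lambda>s. (g s - g t) / (s - t) * g s powr (a - 1)) \<longlongrightarrow> g' * 0) (at t within S)"
    by (rule tendsto_mult)
  moreover have "\<forall>\<^sub>F s in at t within S. (g s - g t) / (s - t) * g s powr (a - 1) = (g s powr a - g t powr a) / (s - t)"
  proof -
    have "(g s - g t) / (s - t) * g s powr (a - 1) = (g s powr a - g t powr a) / (s - t)" if "s \<in> S" for s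
    proof -
      have "g s * g s powr (a - 1) = g s powr a" 
        using nn[OF that] by (cases "g s = 0") (simp_all add: powr_mult_base)
      then show ?thesis using True by simp
    qed
    then show ?thesis by (auto intro: eventually_at_filter[THEN iffD2, OF always_eventually])
  qed
  ultimately have "((\<lambda>s. (g s powr a - g t powr a) / (s - t)) \<longlongrightarrow> g' * 0) (at t within S)"
    by (rule Lim_transform_eventually)
  then show ?thesis using True a by (simp add: has_field_derivative_iff)
qed

lemma exp_half_le: "exp (1/2 :: real) \<le> 2"
proof -
  have "(exp (1/2 :: real))\<^sup>2 = exp 1" by (simp add: power2_eq_square flip: exp_add)
  also have "\<dots> \<le> 2\<^sup>2" using exp_le by simp
  finally show ?thesis by (rule power2_le_imp_le) simp
qed

lemma has_real_derivative_one_add_powr: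
  assumes "0 \<le> t"
  shows "((\<lambda>t. (1 + t) powr r) has_real_derivative r * (1 + t) powr (r - 1)) (at t within S)"
proof -
  have "((\<lambda>t. (1 + t) powr r) has_real_derivative r * (1 + t) powr (r - 1) * 1) (at t within S)"
    by (rule DERIV_chain2[OF has_real_derivative_powr]) (use assms in \<open>auto intro!: derivative_eq_intros\<close>)
  then show ?thesis by simp
qed

text \<open>The quantities below stand for \<open>y = |A\<^sup>1\<^sup>/\<^sup>2u|\<^sup>2\<close>, \<open>h = \<langle>Au, u'\<rangle>\<close>, \<open>q = |u'|\<^sup>2\<close>,
  \<open>m = \<langle>u, u'\<rangle>\<close> and \<open>s = |u|\<^sup>2\<close>.\<close>

locale weak_energy =
  fixes \<epsilon> p \<gamma> :: real and S :: "real set" and y h q m s :: "real \<Rightarrow> real"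
  assumes eps: "0 < \<epsilon>" "\<epsilon> \<le> 1/8" and p: "0 \<le> p" "p \<le> 1" and gam: "1 \<le> \<gamma>"
    and S0: "\<And>t. t \<in> S \<Longrightarrow> 0 \<le> t" and S_down: "\<And>t. t \<in> S \<Longrightarrow> {0..t} \<subseteq> S"
    and y': "\<And>t. t \<in> S \<Longrightarrow> (y has_real_derivative 2 * h t) (at t within S)"
    and q': "\<And>t. t \<in> S \<Longrightarrow> (q has_real_derivative
        - (2 / \<epsilon>) * ((1 + t) powr (-p) * q t + y t powr \<gamma> * h t)) (at t within S)"
    and m': "\<And>t. t \<in> S \<Longrightarrow> (m has_real_derivative
        q t - (1 / \<epsilon>) * ((1 + t) powr (-p) * m t + y t powr \<gamma> * y t)) (at t within S)"
    and s': "\<And>t. t \<in> S \<Longrightarrow> (s has_real_derivative 2 * m t) (at t within S)"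
    and nonneg: "\<And>t. t \<in> S \<Longrightarrow> 0 \<le> y t" "\<And>t. t \<in> S \<Longrightarrow> 0 \<le> q t" "\<And>t. t \<in> S \<Longrightarrow> 0 \<le> s t"
    and ms: "\<And>t. t \<in> S \<Longrightarrow> (m t)\<^sup>2 \<le> s t * q t"
begin

text \<open>The Hamiltonian has derivative -2 (1+t)^(-p) q; its weight contributes
  (p+1)/(\<gamma>+1) (1+t)^p y^(\<gamma>+1), which the term with \<open>m\<close> compensates. That
  term also produces -m and \<epsilon> p (1+t)^(p-1) m, cancelled by the derivatives of s/2 and of
  the last term. What remains is signed because p \<le> 1 \<le> \<gamma>, except for a multiple of
  (1+t)^(p-2) s.\<close>

definition F :: "real \<Rightarrow> real" where
  "F t = (1 + t) powr (p + 1) * (\<epsilon> * q t + y t powr (\<gamma> + 1) / (\<gamma> + 1)) + \<epsilon> * ((1 + t) powr p * m t)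
     + s t / 2 - \<epsilon> * p / 2 * ((1 + t) powr (p - 1) * s t)"

lemma powr_facts:
  assumes "0 \<le> t"
  shows "(1 + t) powr (p + 1) = (1 + t) * (1 + t) powr p"
    "(1 + t) powr p * (1 + t) powr (-p) = 1"
    "(1 + t) powr (p - 1) = (1 + t) powr p / (1 + t)"
    "1 \<le> (1 + t) powr p" "(1 + t) powr p \<le> 1 + t" "(1 + t) powr (p - 1) \<le> 1"
    "1 / (1 + t) \<le> (1 + t) powr (-p)"
proof -
  have t: "1 \<le> 1 + t" using assms by simp
  show "(1 + t) powr (p + 1) = (1 + t) * (1 + t) powr p"
    using assms by (simp add: powr_add)
  show "(1 + t) powr p * (1 + t) powr (-p) = 1"
    using assms by (simp flip: powr_add)
  show "(1 + t) powr (p - 1) = (1 + t) powr p / (1 + t)"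
    using assms by (simp add: powr_diff)
  show "1 \<le> (1 + t) powr p" using ge_one_powr_ge_zero[OF t p(1)] .
  show "(1 + t) powr p \<le> 1 + t" using powr_mono[OF p(2) t] assms by simp
  show "(1 + t) powr (p - 1) \<le> 1" using powr_mono[of "p - 1" 0 "1 + t"] t p by simp
  show "1 / (1 + t) \<le> (1 + t) powr (-p)" using powr_mono[of "-1" "-p" "1 + t"] t p by (simp add: powr_minus divide_inverse)
qed

lemma F_lower:
  assumes "t \<in> S"
  shows "s t / 4 + (1 + t) powr (p + 1) * (\<epsilon> * q t + y t powr (\<gamma> + 1) / (\<gamma> + 1)) / 2 \<le> F t"
proof -
  have t: "0 \<le> t" using S0 assms .
  note pf = powr_facts[OF t]
  let ?P = "(1 + t) powr p"
  have m: "\<bar>m t\<bar> \<le> sqrt (s t) * sqrt (q t)"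
    using real_sqrt_le_mono[OF ms[OF assms]] by (simp add: real_sqrt_mult)
  \<comment> \<open>Weights for which the mixed term costs s/16 and at most half of the weighted
    kinetic energy; the latter uses \<epsilon> \<le> 1/8 and (1+t)^p \<le> 1+t.\<close>
  have "0 \<le> (sqrt (s t) / 4 - 2 * \<epsilon> * ?P * sqrt (q t))\<^sup>2" by simp
  also have "\<dots> = s t / 16 - \<epsilon> * ?P * (sqrt (s t) * sqrt (q t)) + 4 * \<epsilon>\<^sup>2 * ?P\<^sup>2 * q t"
    using nonneg[OF assms] by (simp add: power2_diff power_mult_distrib power_divide)
  finally have "\<epsilon> * ?P * (sqrt (s t) * sqrt (q t)) \<le> s t / 16 + 4 * \<epsilon>\<^sup>2 * ?P\<^sup>2 * q t" by simp
  moreover have "\<epsilon> * ?P * \<bar>m t\<bar> \<le> \<epsilon> * ?P * (sqrt (s t) * sqrt (q t))"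
    using m eps by (intro mult_left_mono) auto
  ultimately have 1: "\<epsilon> * ?P * \<bar>m t\<bar> \<le> s t / 16 + 4 * \<epsilon>\<^sup>2 * ?P\<^sup>2 * q t" by linarith
  have "4 * \<epsilon>\<^sup>2 * ?P\<^sup>2 * q t \<le> \<epsilon> / 2 * ((1 + t) * ?P) * q t"
  proof (rule mult_right_mono[OF _ nonneg(2)[OF assms]])
    have "4 * \<epsilon>\<^sup>2 \<le> \<epsilon> / 2" using eps by (simp add: power2_eq_square)
    moreover have "?P\<^sup>2 \<le> (1 + t) * ?P" using pf(4,5) by (simp add: power2_eq_square)
    ultimately show "4 * \<epsilon>\<^sup>2 * ?P\<^sup>2 \<le> \<epsilon> / 2 * ((1 + t) * ?P)"
      using eps by (intro mult_mono) auto
  qed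
  with 1 have 2: "- (\<epsilon> * ?P * m t) \<le> s t / 16 + \<epsilon> / 2 * ((1 + t) * ?P) * q t"
  proof -
    have "- (\<epsilon> * ?P * m t) \<le> \<epsilon> * ?P * \<bar>m t\<bar>"
      using eps mult_left_mono[of "- m t" "\<bar>m t\<bar>" "\<epsilon> * ?P"] by simp
    then show ?thesis using 1 \<open>4 * \<epsilon>\<^sup>2 * ?P\<^sup>2 * q t \<le> \<epsilon> / 2 * ((1 + t) * ?P) * q t\<close> by linarith
  qed
  have 3: "\<epsilon> * p / 2 * ((1 + t) powr (p - 1) * s t) \<le> s t / 16"
  proof -
    have "\<epsilon> * p \<le> 1/8 * 1" using eps p by (intro mult_mono) auto
    then have "\<epsilon> * p / 2 * ((1 + t) powr (p - 1) * s t) \<le> 1/16 * (1 * s t)"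
      using pf(6) nonneg[OF assms] p eps by (intro mult_mono) auto
    then show ?thesis by simp
  qed
  define Z where "Z = (1 + t) * ?P * (y t powr (\<gamma> + 1) / (\<gamma> + 1))"
  define R where "R = \<epsilon> * ((1 + t) * ?P) * q t"
  have Z: "0 \<le> Z" using t gam by (simp add: Z_def)
  have eq: "(1 + t) * ?P * (\<epsilon> * q t + y t powr (\<gamma> + 1) / (\<gamma> + 1)) = R + Z"
    by (simp add: Z_def R_def algebra_simps)
  have "- (\<epsilon> * (?P * m t)) \<le> s t / 16 + R / 2" using 2 by (simp add: R_def mult.assoc mult.commute mult.left_commute)
  moreover have "s' / 4 + (R' + Z') / 2 \<le> R' + Z' + x + s' / 2 - w"
    if "- x \<le> s' / 16 + R' / 2" "w \<le> s' / 16" "0 \<le> Z'" "0 \<le> s'" for s' R' Z' x w :: real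
    using that by (simp add: field_simps)
  ultimately show ?thesis using 3 Z nonneg(3)[OF assms] unfolding F_def pf(1) eq by blast
qed

lemma F_deriv:
  assumes "t \<in> S"
  shows "(F has_real_derivative
     - (2 * (1 + t) - (p + 2) * \<epsilon> * (1 + t) powr p) * q t
     - (1 - (p + 1) / (\<gamma> + 1)) * (1 + t) powr p * y t powr (\<gamma> + 1)
     + \<epsilon> * p * (1 - p) / 2 * (1 + t) powr (p - 2) * s t) (at t within S)"
proof -
  have t: "0 \<le> t" using S0 assms .
  note pf = powr_facts[OF t]
  have yg: "((\<lambda>t. y t powr (\<gamma> + 1)) has_real_derivative (\<gamma> + 1) * y t powr \<gamma> * (2 * h t)) (at t within S)"
    using has_real_derivative_powr_nonneg[of "\<gamma> + 1" y "2 * h t" t S] y'[OF assms] nonneg(1) gam assms by simp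
  have yy: "y t powr (\<gamma> + 1) = y t powr \<gamma> * y t"
    using nonneg(1)[OF assms] by (cases "y t = 0") (auto simp: powr_add)
  note d = has_real_derivative_one_add_powr[OF t]
  have pm: "(p + 1) * (1 + t) powr (p + 1 - 1) = (p + 1) * (1 + t) powr p" "p - 1 - 1 = p - 2" by auto
  have D: "(F has_real_derivative
      (((p + 1) * (1 + t) powr (p + 1 - 1)) * (\<epsilon> * q t + y t powr (\<gamma> + 1) / (\<gamma> + 1))
        + (\<epsilon> * (- (2 / \<epsilon>) * ((1 + t) powr (-p) * q t + y t powr \<gamma> * h t))
          + (\<gamma> + 1) * y t powr \<gamma> * (2 * h t) / (\<gamma> + 1)) * (1 + t) powr (p + 1))
      + \<epsilon> * ((p * (1 + t) powr (p - 1)) * m t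
          + (q t - (1 / \<epsilon>) * ((1 + t) powr (-p) * m t + y t powr \<gamma> * y t)) * (1 + t) powr p)
      + 2 * m t / 2
      - \<epsilon> * p / 2 * (((p - 1) * (1 + t) powr (p - 1 - 1)) * s t + 2 * m t * (1 + t) powr (p - 1))) (at t within S)"
    unfolding F_def[abs_def]
    by (intro DERIV_add DERIV_diff DERIV_cmult DERIV_mult DERIV_cdivide d yg q' m' s' assms)
  define P where "P = (1 + t) powr p"
  define b where "b = (1 + t) powr (-p)"
  have Pb: "P * b = 1" using pf(2) by (simp add: P_def b_def)
  have P1: "(1 + t) powr (p + 1) = (1 + t) * P" "(1 + t) powr (p - 1) = P / (1 + t)" using pf by (auto simp: P_def)
  define c where "c = y t powr \<gamma>"
  have e1: "\<epsilon> * (- (2 / \<epsilon>) * (b * q t + c * h t)) = - 2 * (b * q t + c * h t)" using eps by simp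
  have e2: "\<epsilon> * ((p * (1 + t) powr (p - 1)) * m t + (q t - (1 / \<epsilon>) * (b * m t + c * y t)) * P)
     = \<epsilon> * p * (1 + t) powr (p - 1) * m t + \<epsilon> * P * q t - (P * b) * m t - P * c * y t"
    using eps by (simp add: field_simps)
  have e3: "(\<gamma> + 1) * c * (2 * h t) / (\<gamma> + 1) = 2 * c * h t" using gam by simp
  have PB: "P * (b * x) = x" for x using Pb by (simp flip: mult.assoc)
  show ?thesis
    using D unfolding pm yy c_def[symmetric] P_def[symmetric] b_def[symmetric] e1 e2 e3 P1(1) Pb
    by (simp add: algebra_simps add_divide_distrib diff_divide_distrib PB)
qed

text \<open>The integrating factor for the one bad term of F': the exponent has derivative -2
  \<epsilon> p (1-p) (1+t)^(p-2), and s/4 \<le> F turns this into a bound of that term. The exponent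
  is bounded, so H and F are comparable.\<close>

definition H :: "real \<Rightarrow> real" where
  "H t = exp (2 * \<epsilon> * p * (1 + t) powr (p - 1)) * F t"

lemma F_nonneg: "t \<in> S \<Longrightarrow> 0 \<le> F t"
proof -
  assume t: "t \<in> S"
  have "0 \<le> s t / 4 + (1 + t) powr (p + 1) * (\<epsilon> * q t + y t powr (\<gamma> + 1) / (\<gamma> + 1)) / 2"
    using nonneg[OF t] eps gam by simp
  then show ?thesis using F_lower[OF t] by linarith
qed

lemma H_deriv:
  assumes "t \<in> S"
  shows "\<exists>D. (H has_real_derivative D) (at t within S) \<and> D \<le> - ((1 + t) * q t)"
proof -
  have t: "0 \<le> t" using S0 assms .
  note pf = powr_facts[OF t]
  let ?e = "exp (2 * \<epsilon> * p * (1 + t) powr (p - 1))"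
  define F' where "F' = - (2 * (1 + t) - (p + 2) * \<epsilon> * (1 + t) powr p) * q t
     - (1 - (p + 1) / (\<gamma> + 1)) * (1 + t) powr p * y t powr (\<gamma> + 1)
     + \<epsilon> * p * (1 - p) / 2 * (1 + t) powr (p - 2) * s t"
  have F': "(F has_real_derivative F') (at t within S)" using F_deriv[OF assms] by (simp add: F'_def)
  have E': "((\<lambda>t. exp (2 * \<epsilon> * p * (1 + t) powr (p - 1))) has_real_derivative
      ?e * (2 * \<epsilon> * p * ((p - 1) * (1 + t) powr (p - 1 - 1)))) (at t within S)"
    by (rule DERIV_chain2[OF DERIV_exp DERIV_cmult[OF has_real_derivative_one_add_powr[OF t]]])
  have HD: "(H has_real_derivative ?e * (2 * \<epsilon> * p * ((p - 1) * (1 + t) powr (p - 1 - 1))) * F t + F' * ?e) (at t within S)"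
    unfolding H_def[abs_def] by (rule DERIV_mult[OF E' F'])
  have "s t / 4 \<le> F t"
  proof -
    have "0 \<le> (1 + t) powr (p + 1) * (\<epsilon> * q t + y t powr (\<gamma> + 1) / (\<gamma> + 1)) / 2"
      using nonneg[OF assms] eps gam by simp
    then show ?thesis using F_lower[OF assms] by linarith
  qed
  then have "(2 * \<epsilon> * p * (1 - p) * (1 + t) powr (p - 2)) * (s t / 4) \<le> (2 * \<epsilon> * p * (1 - p) * (1 + t) powr (p - 2)) * F t"
    using eps p by (intro mult_left_mono) auto
  then have sF: "\<epsilon> * p * (1 - p) / 2 * (1 + t) powr (p - 2) * s t \<le> 2 * \<epsilon> * p * (1 - p) * (1 + t) powr (p - 2) * F t"
    by (simp add: field_simps)
  have "(p + 1) / (\<gamma> + 1) \<le> 1" using p gam by simp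
  then have yn: "0 \<le> (1 - (p + 1) / (\<gamma> + 1)) * (1 + t) powr p * y t powr (\<gamma> + 1)" by simp
  define X where "X = (p + 2) * \<epsilon> * (1 + t) powr p"
  have "X \<le> 3 * (1/8) * (1 + t)"
    unfolding X_def using p eps pf t by (intro mult_mono) auto
  then have "1 + t \<le> 2 * (1 + t) - X" using t by simp
  then have "(1 + t) * q t \<le> (2 * (1 + t) - X) * q t"
    using nonneg[OF assms] by (intro mult_right_mono) auto
  then have le: "F' - 2 * \<epsilon> * p * (1 - p) * (1 + t) powr (p - 2) * F t \<le> - ((1 + t) * q t)"
    using sF yn unfolding F'_def X_def[symmetric] minus_mult_left[symmetric] by linarith
  have e1: "1 \<le> ?e" using eps p by simp
  have "?e * (2 * \<epsilon> * p * ((p - 1) * (1 + t) powr (p - 1 - 1))) * F t + F' * ?e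
     = ?e * (F' - 2 * \<epsilon> * p * (1 - p) * (1 + t) powr (p - 2) * F t)"
    by (simp add: algebra_simps)
  also have "\<dots> \<le> ?e * (- ((1 + t) * q t))" using le by (intro mult_left_mono) auto
  also have "\<dots> \<le> 1 * (- ((1 + t) * q t))"
    by (rule mult_right_mono_neg[OF e1]) (use nonneg[OF assms] t in simp)
  finally show ?thesis by (intro exI[of _ "?e * (2 * \<epsilon> * p * ((p - 1) * (1 + t) powr (p - 1 - 1))) * F t + F' * ?e"] conjI HD) simp
qed

lemma weak_decay:
  assumes T: "T \<in> S"
  shows "s T \<le> 8 * F 0" "(1 + T) powr (p + 1) * y T powr (\<gamma> + 1) \<le> 4 * (\<gamma> + 1) * F 0"
    "integral {0..T} (\<lambda>t. (1 + t) * q t) \<le> 2 * F 0"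
proof -
  have T0: "0 \<le> T" using S0 T .
  have sub: "t \<in> S" if "0 \<le> t" "t \<le> T" for t using S_down[OF T] that by auto
  obtain D where D: "\<And>t. t \<in> S \<Longrightarrow> (H has_real_derivative D t) (at t within S)"
    "\<And>t. t \<in> S \<Longrightarrow> D t \<le> - ((1 + t) * q t)"
    using H_deriv by metis
  have cont: "continuous_on {0..T} (\<lambda>t. (1 + t) * q t)"
  proof -
    have "continuous_on S q" using q' by (auto intro!: DERIV_continuous_on)
    then have "continuous_on {0..T} q" by (rule continuous_on_subset) (rule S_down[OF T])
    then show ?thesis by (intro continuous_intros)
  qed
  let ?I = "\<lambda>t. integral {0..t} (\<lambda>t. (1 + t) * q t)"
  \<comment> \<open>With the running integral inside the monotone quantity, one inequality yields
    the pointwise decay and the integral bound.\<close>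
  have "H T + ?I T \<le> H 0 + ?I 0"
  proof (rule nonincreasing_within[OF T0])
    fix t assume t: "0 \<le> t" "t \<le> T"
    have dH: "(H has_real_derivative D t) (at t within {0..T})"
      by (rule DERIV_subset[OF D(1)[OF sub[OF t]] S_down[OF T]])
    have dI: "(?I has_real_derivative (1 + t) * q t) (at t within {0..T})"
      by (rule integral_has_real_derivative[OF cont]) (use t in auto)
    show "((\<lambda>t. H t + ?I t) has_real_derivative D t + (1 + t) * q t) (at t within {0..T})"
      by (rule DERIV_add[OF dH dI])
    show "D t + (1 + t) * q t \<le> 0" using D(2)[OF sub[OF t]] by simp
  qed
  moreover have "0 \<le> ?I T"
    by (rule integral_nonneg) (use cont sub nonneg in \<open>auto intro!: integrable_continuous_interval\<close>)
  moreover have "H 0 \<le> 2 * F 0"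
  proof -
    have "2 * \<epsilon> * p \<le> 2 * (1/8) * 1" using eps p by (intro mult_mono) auto
    then have "exp (2 * \<epsilon> * p) \<le> exp (1/2)" by simp
    then have "exp (2 * \<epsilon> * p) \<le> 2" using exp_half_le by linarith
    then show ?thesis using F_nonneg[of 0] sub T0 by (simp add: H_def mult_right_mono)
  qed
  moreover have "F T \<le> H T"
  proof -
    have "1 \<le> exp (2 * \<epsilon> * p * (1 + T) powr (p - 1))" using eps p by simp
    then show ?thesis unfolding H_def using F_nonneg[OF T] mult_right_mono[of 1 _ "F T"] by fastforce
  qed
  ultimately have 1: "F T \<le> 2 * F 0" and 2: "?I T \<le> 2 * F 0" using F_nonneg[OF T] by auto
  have n: "0 \<le> \<epsilon> * q T" "0 \<le> y T powr (\<gamma> + 1) / (\<gamma> + 1)" using nonneg[OF T] eps gam by auto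
  let ?R = "(1 + T) powr (p + 1)"
  have R: "0 \<le> ?R * (\<epsilon> * q T)" "0 \<le> ?R * (y T powr (\<gamma> + 1) / (\<gamma> + 1))"
    by (intro mult_nonneg_nonneg n powr_ge_zero)+
  have gen: "s' \<le> 8 * f0 \<and> r2 \<le> 4 * f0"
    if "0 \<le> r1" "0 \<le> r2" "s' / 4 + (r1 + r2) / 2 \<le> f" "f \<le> 2 * f0" "0 \<le> s'" for r1 r2 s' f f0 :: real
    using that by (simp add: field_simps)
  note bounds = gen[OF R F_lower[OF T, unfolded distrib_left] 1 nonneg(3)[OF T]]
  then show "s T \<le> 8 * F 0" by blast
  have "?R * (y T powr (\<gamma> + 1) / (\<gamma> + 1)) \<le> 4 * F 0" using bounds by blast
  moreover have eq: "(?R * (y T powr (\<gamma> + 1) / (\<gamma> + 1))) * (\<gamma> + 1) = ?R * y T powr (\<gamma> + 1)"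
    using gam by simp
  ultimately have "(?R * (y T powr (\<gamma> + 1) / (\<gamma> + 1))) * (\<gamma> + 1) \<le> 4 * F 0 * (\<gamma> + 1)"
    by (intro mult_right_mono) (use gam in auto)
  then show "?R * y T powr (\<gamma> + 1) \<le> 4 * (\<gamma> + 1) * F 0"
    unfolding eq by (simp only: mult.commute[of "F 0"] mult.assoc)
  show "?I T \<le> 2 * F 0" by (fact 2)
qed

text \<open>The right-hand side is free of \<epsilon>; all constants of the first order estimates
  become uniform here.\<close>

lemma F_0_le:
  assumes "0 \<in> S"
  shows "F 0 \<le> 2 * q 0 + 2 * s 0 + y 0 powr (\<gamma> + 1)"
proof -
  note n = nonneg[OF assms]
  have "(m 0)\<^sup>2 \<le> (s 0 + q 0)\<^sup>2"
    unfolding power2_sum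
    using ms[OF assms] mult_nonneg_nonneg[OF n(3,2)] zero_le_power2[of "s 0"] zero_le_power2[of "q 0"] by linarith
  then have "m 0 \<le> s 0 + q 0" by (rule power2_le_imp_le) (use n in simp)
  then have "\<epsilon> * m 0 \<le> \<epsilon> * (s 0 + q 0)" by (rule mult_left_mono) (use eps in simp)
  also have "\<dots> \<le> 1 * (s 0 + q 0)" by (rule mult_right_mono) (use eps n in simp_all)
  finally have 1: "\<epsilon> * m 0 \<le> s 0 + q 0" by simp
  have 2: "\<epsilon> * q 0 \<le> 1 * q 0" by (rule mult_right_mono) (use eps n in simp_all)
  have "y 0 powr (\<gamma> + 1) / (\<gamma> + 1) \<le> y 0 powr (\<gamma> + 1) / 1"
    by (rule divide_left_mono) (use gam in simp_all)
  then have 3: "y 0 powr (\<gamma> + 1) / (\<gamma> + 1) \<le> y 0 powr (\<gamma> + 1)" by simp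
  have "0 \<le> \<epsilon> * p / 2 * s 0" using eps p n by simp
  moreover have "F 0 = \<epsilon> * q 0 + y 0 powr (\<gamma> + 1) / (\<gamma> + 1) + \<epsilon> * m 0 + s 0 / 2 - \<epsilon> * p / 2 * s 0"
    by (simp add: F_def)
  ultimately show ?thesis using 1 2 3 n by linarith
qed

end

section \<open>Constants of the second order estimates, computed from bounds of the data\<close>

definition W_bound :: "real \<Rightarrow> real \<Rightarrow> real \<Rightarrow> real \<Rightarrow> real \<Rightarrow> real" where
  "W_bound \<gamma> Ylo Yhi A0 D0 = 4 * (Yhi powr (\<gamma> - 1) * A0 + D0 / Ylo) + 6"

definition P_bound :: "real \<Rightarrow> real \<Rightarrow> real \<Rightarrow> real \<Rightarrow> real" where
  "P_bound \<gamma> Ylo A0 D0 = D0 / Ylo powr (\<gamma> + 1) + A0 / Ylo"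

text \<open>The shape "initial value plus four times a bound" for this constant and the next is
  dictated by the barrier in \<open>velocity_bound\<close>.\<close>

definition Q_bound :: "real \<Rightarrow> real \<Rightarrow> real \<Rightarrow> real \<Rightarrow> real \<Rightarrow> real \<Rightarrow> real" where
  "Q_bound \<gamma> Ylo Yhi A0 D0 Q0 = Q0 / Ylo powr (\<gamma> + 1) + 4 * W_bound \<gamma> Ylo Yhi A0 D0"

definition R_bound :: "real \<Rightarrow> real \<Rightarrow> real \<Rightarrow> real \<Rightarrow> real \<Rightarrow> real" where
  "R_bound \<gamma> Ylo A0 D0 Q0 = Q0 / Ylo powr (2 * \<gamma> + 1) + 4 * P_bound \<gamma> Ylo A0 D0"

text \<open>Strictly above \<open>W_bound\<close> and above \<open>W_bound\<close> +
  \<open>Q_bound\<close>, the values to which the two bootstrap bounds improve; strictness is what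
  closes the bootstrap.\<close>

definition z_bound :: "real \<Rightarrow> real \<Rightarrow> real \<Rightarrow> real \<Rightarrow> real \<Rightarrow> real \<Rightarrow> real" where
  "z_bound \<gamma> Ylo Yhi A0 D0 Q0 = 2 * W_bound \<gamma> Ylo Yhi A0 D0 + Q_bound \<gamma> Ylo Yhi A0 D0 Q0 + 1"

text \<open>In addition \<open>d = |A\<^sup>1\<^sup>/\<^sup>2u'|\<^sup>2\<close>, \<open>k = \<langle>Au, Au'\<rangle>\<close> and \<open>a = |Au|\<^sup>2\<close>.\<close>

locale strong_energy = weak_energy \<epsilon> p \<gamma> "{0..}" y h q m s
  for \<epsilon> p \<gamma> :: real and y h q m s :: "real \<Rightarrow> real" +
  fixes d k a :: "real \<Rightarrow> real" and Ylo Yhi A0 D0 Q0 M :: real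
  assumes h': "\<And>t. 0 \<le> t \<Longrightarrow> (h has_real_derivative
        d t - (1 / \<epsilon>) * ((1 + t) powr (-p) * h t + y t powr \<gamma> * a t)) (at t within {0..})"
    and d': "\<And>t. 0 \<le> t \<Longrightarrow> (d has_real_derivative
        - (2 / \<epsilon>) * ((1 + t) powr (-p) * d t + y t powr \<gamma> * k t)) (at t within {0..})"
    and a': "\<And>t. 0 \<le> t \<Longrightarrow> (a has_real_derivative 2 * k t) (at t within {0..})"
    and dn: "\<And>t. 0 \<le> t \<Longrightarrow> 0 \<le> d t" and an: "\<And>t. 0 \<le> t \<Longrightarrow> 0 \<le> a t"
    and hd: "\<And>t. 0 \<le> t \<Longrightarrow> (h t)\<^sup>2 \<le> y t * d t"
    and hq: "\<And>t. 0 \<le> t \<Longrightarrow> (h t)\<^sup>2 \<le> q t * a t"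
    and Ylo: "0 < Ylo" "Ylo \<le> y 0" and Yhi: "y 0 \<le> Yhi"
    and A0: "a 0 \<le> A0" and D0: "d 0 \<le> D0" and Q0: "q 0 \<le> Q0"
    and M_def: "M = z_bound \<gamma> Ylo Yhi A0 D0 Q0"
    and small: "\<epsilon> * (10 * \<gamma> * M + 10) \<le> 1"
begin

section \<open>Logarithmic derivative, angular speed and the second order quotients\<close>

definition z :: "real \<Rightarrow> real" where "z t = h t / y t"
text \<open>With x = A^(1/2)u this is the squared norm of the derivative of x/|x|, while
  \<open>z\<close> is |x|'/|x|; the identity d/y = nu + z^2 splits the velocity of x into angular
  and radial parts.\<close>

definition nu :: "real \<Rightarrow> real" where "nu t = (y t * d t - (h t)\<^sup>2) / (y t)\<^sup>2"
definition W :: "real \<Rightarrow> real" where "W t = \<epsilon> * nu t + y t powr \<gamma> * (a t / y t)"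
definition P :: "real \<Rightarrow> real" where "P t = \<epsilon> * (nu t * y t powr (-\<gamma>)) + a t / y t"

abbreviation "b t \<equiv> (1 + t) powr (-p)"
abbreviation "WB \<equiv> W_bound \<gamma> Ylo Yhi A0 D0"
abbreviation "PB \<equiv> P_bound \<gamma> Ylo A0 D0"
abbreviation "QB \<equiv> Q_bound \<gamma> Ylo Yhi A0 D0 Q0"
abbreviation "RB \<equiv> R_bound \<gamma> Ylo A0 D0 Q0"

lemma init_nonneg: "0 \<le> A0" "0 \<le> D0" "0 \<le> Q0" "0 < y 0"
  using A0 D0 Q0 an[of 0] dn[of 0] nonneg(2)[of 0] Ylo by auto

lemma bounds_nonneg: "6 \<le> WB" "0 \<le> PB" "0 \<le> QB" "0 \<le> RB" "13 \<le> M"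
proof -
  show W: "6 \<le> WB" using init_nonneg Ylo by (simp add: W_bound_def)
  show P: "0 \<le> PB" using init_nonneg Ylo by (simp add: P_bound_def)
  have "0 \<le> Q0 / Ylo powr (\<gamma> + 1)" using init_nonneg by simp
  then show Q: "0 \<le> QB" using W by (simp add: Q_bound_def)
  have "0 \<le> Q0 / Ylo powr (2 * \<gamma> + 1)" using init_nonneg by simp
  then show "0 \<le> RB" using P by (simp add: R_bound_def)
  show "13 \<le> M" using W Q by (simp add: M_def z_bound_def)
qed

text \<open>Since \<gamma> \<ge> 1 and M \<ge> 0, the quantity 10 \<gamma> M + 10 dominates each of
  the factors, so one smallness condition covers all uses.\<close>

lemma small_cases:
  "\<epsilon> * ((2 * \<gamma> + 4) * M) \<le> 1" "4 * \<gamma> * \<epsilon> * M \<le> 1" "2 * \<gamma> * \<epsilon> * M \<le> 1/2"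
  "\<epsilon> * (2 * (\<gamma> + 1) * M + 1) \<le> 1" "\<epsilon> * (2 * (2 * \<gamma> + 1) * M + 1) \<le> 1"
proof -
  have gM: "M \<le> \<gamma> * M" "0 \<le> \<gamma> * M" using gam bounds_nonneg(5) mult_right_mono[of 1 \<gamma> M] by auto
  have *: "\<epsilon> * x \<le> 1" if "x \<le> 10 * (\<gamma> * M) + 10" for x
  proof -
    have "\<epsilon> * x \<le> \<epsilon> * (10 * (\<gamma> * M) + 10)" using that eps by (intro mult_left_mono) auto
    then show ?thesis using small by (simp add: mult.assoc)
  qed
  show "\<epsilon> * ((2 * \<gamma> + 4) * M) \<le> 1" by (rule *) (use gM in \<open>simp add: algebra_simps\<close>)
  show "4 * \<gamma> * \<epsilon> * M \<le> 1" using *[of "4 * (\<gamma> * M)"] gM by (simp add: algebra_simps)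
  show "2 * \<gamma> * \<epsilon> * M \<le> 1/2" using *[of "4 * (\<gamma> * M)"] gM by (simp add: algebra_simps)
  show "\<epsilon> * (2 * (\<gamma> + 1) * M + 1) \<le> 1" by (rule *) (use gM in \<open>simp add: algebra_simps\<close>)
  show "\<epsilon> * (2 * (2 * \<gamma> + 1) * M + 1) \<le> 1" by (rule *) (use gM in \<open>simp add: algebra_simps\<close>)
qed

lemma nu_nonneg: "0 \<le> t \<Longrightarrow> 0 \<le> nu t"
  using hd by (simp add: nu_def)

lemma W_ge: "0 \<le> t \<Longrightarrow> 0 < y t \<Longrightarrow> y t powr (\<gamma> - 1) * a t \<le> W t"
  using nu_nonneg[of t] eps by (simp add: W_def powr_diff)

lemma y_deriv: "0 \<le> t \<Longrightarrow> (y has_real_derivative 2 * h t) (at t within {0..})"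
  using y' by simp

lemma q_deriv: "0 \<le> t \<Longrightarrow> (q has_real_derivative
        - (2 / \<epsilon>) * (b t * q t + y t powr \<gamma> * h t)) (at t within {0..})"
  using q' by simp

lemma y_powr_deriv:
  assumes "0 \<le> t" "0 < y t"
  shows "((\<lambda>t. y t powr r) has_real_derivative r * y t powr r * (2 * z t)) (at t within {0..})"
proof -
  have "((\<lambda>t. y t powr r) has_real_derivative r * y t powr (r - 1) * (2 * h t)) (at t within {0..})"
    by (rule DERIV_chain2[OF has_real_derivative_powr[OF assms(2)] y_deriv[OF assms(1)]])
  moreover have "r * y t powr (r - 1) * (2 * h t) = r * y t powr r * (2 * z t)"
    using assms by (simp add: z_def powr_diff)
  ultimately show ?thesis by simp
qed

lemma z_deriv:
  assumes t: "0 \<le> t" "0 < y t"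
  shows "(z has_real_derivative nu t - (z t)\<^sup>2 - (1 / \<epsilon>) * (b t * z t + y t powr \<gamma> * (a t / y t))) (at t within {0..})"
proof -
  have "(z has_real_derivative ((d t - (1 / \<epsilon>) * (b t * h t + y t powr \<gamma> * a t)) * y t - h t * (2 * h t)) / (y t * y t)) (at t within {0..})"
    unfolding z_def[abs_def] by (rule DERIV_divide[OF h'[OF t(1)] y_deriv[OF t(1)]]) (use t in simp)
  moreover have "((d t - (1 / \<epsilon>) * (b t * h t + c * a t)) * y t - h t * (2 * h t)) / (y t * y t)
     = nu t - (z t)\<^sup>2 - (1 / \<epsilon>) * (b t * z t + c * (a t / y t))" for c
    using t eps by (simp add: nu_def z_def field_simps power2_eq_square)
  ultimately show ?thesis by simp
qed

lemma nu_deriv: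
  assumes t: "0 \<le> t" "0 < y t"
  shows "(nu has_real_derivative
    - (2 / \<epsilon>) * (b t * nu t) - (2 / \<epsilon>) * (y t powr \<gamma> * ((y t * k t - h t * a t) / (y t)\<^sup>2)) - 4 * z t * nu t) (at t within {0..})"
proof -
  define c where "c = y t powr \<gamma>"
  define B where "B = b t"
  have hh: "((\<lambda>t. (h t)\<^sup>2) has_real_derivative 2 * h t * (d t - (1 / \<epsilon>) * (B * h t + c * a t))) (at t within {0..})"
    using DERIV_power[OF h'[OF t(1)], of 2] by (simp add: c_def B_def algebra_simps add_divide_distrib)
  have yy: "((\<lambda>t. (y t)\<^sup>2) has_real_derivative 2 * y t * (2 * h t)) (at t within {0..})"
    using DERIV_power[OF y_deriv[OF t(1)], of 2] by (simp add: mult.commute mult.left_commute)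
  have "(nu has_real_derivative
     ((2 * h t * d t + (- (2 / \<epsilon>) * (B * d t + c * k t)) * y t - 2 * h t * (d t - (1 / \<epsilon>) * (B * h t + c * a t))) * (y t)\<^sup>2
       - (y t * d t - (h t)\<^sup>2) * (2 * y t * (2 * h t))) / ((y t)\<^sup>2 * (y t)\<^sup>2)) (at t within {0..})"
    unfolding nu_def[abs_def] c_def B_def
    by (rule DERIV_divide[OF DERIV_diff[OF DERIV_mult[OF y_deriv[OF t(1)] d'[OF t(1)]] hh[unfolded c_def B_def]] yy]) (use t in simp)
  moreover have "((2 * h t * d t + (- (2 / \<epsilon>) * (B * d t + c * k t)) * y t - 2 * h t * (d t - (1 / \<epsilon>) * (B * h t + c * a t))) * (y t)\<^sup>2
       - (y t * d t - (h t)\<^sup>2) * (2 * y t * (2 * h t))) / ((y t)\<^sup>2 * (y t)\<^sup>2)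
     = - (2 / \<epsilon>) * (B * nu t) - (2 / \<epsilon>) * (c * ((y t * k t - h t * a t) / (y t)\<^sup>2)) - 4 * z t * nu t"
    using t eps by (simp add: nu_def z_def field_simps power2_eq_square)
  ultimately show ?thesis by (simp add: c_def B_def)
qed

lemma beta_deriv:
  assumes t: "0 \<le> t" "0 < y t"
  shows "((\<lambda>t. a t / y t) has_real_derivative 2 * ((y t * k t - h t * a t) / (y t)\<^sup>2)) (at t within {0..})"
proof -
  have "((\<lambda>t. a t / y t) has_real_derivative (2 * k t * y t - a t * (2 * h t)) / (y t * y t)) (at t within {0..})"
    by (rule DERIV_divide[OF a'[OF t(1)] y_deriv[OF t(1)]]) (use t in simp)
  moreover have "(2 * k t * y t - a t * (2 * h t)) / (y t * y t) = 2 * ((y t * k t - h t * a t) / (y t)\<^sup>2)"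
    using t by (simp add: field_simps power2_eq_square)
  ultimately show ?thesis by simp
qed

text \<open>This explains the combination: the terms with \<open>k\<close>, that is <Au, Au'>, which
  no estimate controls, cancel between \<epsilon> nu and y^\<gamma> a/y.\<close>

lemma W_deriv:
  assumes t: "0 \<le> t" "0 < y t"
  shows "(W has_real_derivative 2 * \<gamma> * z t * W t - nu t * (2 * b t + (2 * \<gamma> + 4) * \<epsilon> * z t)) (at t within {0..})"
proof -
  define X where "X = (y t * k t - h t * a t) / (y t)\<^sup>2"
  define c where "c = y t powr \<gamma>"
  define be where "be = a t / y t"
  have "(W has_real_derivative \<epsilon> * (- (2 / \<epsilon>) * (b t * nu t) - (2 / \<epsilon>) * (c * X) - 4 * z t * nu t)
     + (\<gamma> * c * (2 * z t) * be + 2 * X * c)) (at t within {0..})"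
    unfolding W_def[abs_def] c_def X_def be_def
    by (rule DERIV_add[OF DERIV_cmult[OF nu_deriv[OF t]] DERIV_mult[OF y_powr_deriv[OF t] beta_deriv[OF t]]])
  moreover have "\<epsilon> * (- (2 / \<epsilon>) * (b t * nu t) - (2 / \<epsilon>) * (c * X) - 4 * z t * nu t)
     + (\<gamma> * c * (2 * z t) * be + 2 * X * c) = 2 * \<gamma> * z t * W t - nu t * (2 * b t + (2 * \<gamma> + 4) * \<epsilon> * z t)"
    using eps unfolding W_def c_def[symmetric] be_def[symmetric] by (simp add: field_simps)
  ultimately show ?thesis by simp
qed

text \<open>Dividing W by y^\<gamma> also removes the term 2 \<gamma> z W. What is left has a sign
  as soon as the damping dominates \<epsilon> z.\<close>

lemma P_deriv:
  assumes t: "0 \<le> t" "0 < y t"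
  shows "(P has_real_derivative - (nu t * y t powr (-\<gamma>) * (2 * b t + (2 * \<gamma> + 4) * \<epsilon> * z t))) (at t within {0..})"
proof -
  define X where "X = (y t * k t - h t * a t) / (y t)\<^sup>2"
  define c where "c = y t powr \<gamma>"
  define g where "g = y t powr (-\<gamma>)"
  have cg: "c * (g * x) = x" for x using t by (simp add: c_def g_def powr_minus)
  have "(P has_real_derivative \<epsilon> * ((- (2 / \<epsilon>) * (b t * nu t) - (2 / \<epsilon>) * (c * X) - 4 * z t * nu t) * g
     + (-\<gamma> * g * (2 * z t)) * nu t) + 2 * X) (at t within {0..})"
    unfolding P_def[abs_def] c_def X_def g_def
    by (rule DERIV_add[OF DERIV_cmult[OF DERIV_mult[OF nu_deriv[OF t] y_powr_deriv[OF t]]] beta_deriv[OF t]])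
  moreover have "\<epsilon> * ((- (2 / \<epsilon>) * (b t * nu t) - (2 / \<epsilon>) * (c * X) - 4 * z t * nu t) * g
     + (-\<gamma> * g * (2 * z t)) * nu t) + 2 * X = - (nu t * g * (2 * b t + (2 * \<gamma> + 4) * \<epsilon> * z t))"
    using eps by (simp add: field_simps cg)
  ultimately show ?thesis by (simp add: g_def)
qed

end

section \<open>A priori estimates under the bootstrap hypothesis\<close>

context strong_energy
begin

text \<open>The bound of z keeps the damping in W' and P' positive; the bound of W is what absorbs
  the term with \<open>nu\<close> in the Riccati argument.\<close>

definition controlled :: "real \<Rightarrow> bool" where
  "controlled T \<longleftrightarrow> 0 \<le> T \<and> (\<forall>t. 0 \<le> t \<and> t \<le> T \<longrightarrow>
     0 < y t \<and> \<bar>z t\<bar> * (1 + t) \<le> M \<and> W t * (1 + t) powr (p + 1) \<le> M)"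

lemma controlledD:
  assumes "controlled T" "0 \<le> t" "t \<le> T"
  shows "0 < y t" "\<bar>z t\<bar> * (1 + t) \<le> M" "W t * (1 + t) powr (p + 1) \<le> M"
    "\<bar>z t\<bar> \<le> M / (1 + t)" "\<bar>z t\<bar> \<le> M * b t"
proof -
  show 1: "0 < y t" "\<bar>z t\<bar> * (1 + t) \<le> M" "W t * (1 + t) powr (p + 1) \<le> M"
    using assms by (auto simp: controlled_def)
  show 2: "\<bar>z t\<bar> \<le> M / (1 + t)" using 1(2) assms by (simp add: pos_le_divide_eq)
  have "M * (1 / (1 + t)) \<le> M * b t"
    by (rule mult_left_mono) (use powr_facts(7)[OF assms(2)] bounds_nonneg in auto)
  then show "\<bar>z t\<bar> \<le> M * b t" using 2 by simp
qed

lemma der_within: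
  assumes "(f has_real_derivative D) (at t within {0..})" "(T::real) \<ge> 0"
  shows "(f has_real_derivative D) (at t within {0..T})"
  by (rule DERIV_subset[OF assms(1)]) auto

text \<open>Here p \<le> 1 enters: 1/(1+t) \<le> (1+t)^(-p), so the bootstrap bound of z is a
  multiple of the damping coefficient and small \<epsilon> leaves half of the damping.\<close>

lemma damping_dominates:
  assumes "controlled T" "0 \<le> t" "t \<le> T"
  shows "b t \<le> 2 * b t + (2 * \<gamma> + 4) * \<epsilon> * z t"
proof -
  have "\<bar>(2 * \<gamma> + 4) * \<epsilon> * z t\<bar> = ((2 * \<gamma> + 4) * \<epsilon>) * \<bar>z t\<bar>"
    using gam eps by (simp add: abs_mult)
  also have "\<dots> \<le> ((2 * \<gamma> + 4) * \<epsilon>) * (M * b t)"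
    by (rule mult_left_mono[OF controlledD(5)[OF assms]]) (use gam eps in simp)
  also have "\<dots> = (\<epsilon> * ((2 * \<gamma> + 4) * M)) * b t" by simp
  also have "\<dots> \<le> 1 * b t" by (rule mult_right_mono[OF small_cases(1)]) simp
  finally show ?thesis by linarith
qed

lemma P_init: "P 0 \<le> PB"
proof -
  have y0: "0 < y 0" by (rule init_nonneg)
  have "nu 0 \<le> (y 0 * d 0) / (y 0)\<^sup>2" unfolding nu_def by (rule divide_right_mono) auto
  also have "\<dots> = d 0 / y 0" using y0 by (simp add: power2_eq_square)
  finally have nu0: "nu 0 \<le> d 0 / y 0" .
  have "\<epsilon> * (nu 0 * y 0 powr (-\<gamma>)) \<le> 1 * (nu 0 * y 0 powr (-\<gamma>))"
    by (rule mult_right_mono) (use eps nu_nonneg[of 0] in simp_all)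
  also have "\<dots> \<le> (d 0 / y 0) * y 0 powr (-\<gamma>)" using mult_right_mono[OF nu0, of "y 0 powr (-\<gamma>)"] by simp
  also have "\<dots> = d 0 / y 0 powr (\<gamma> + 1)" using y0 by (simp add: powr_minus powr_add divide_inverse)
  also have "\<dots> \<le> D0 / Ylo powr (\<gamma> + 1)"
    by (rule frac_le) (use D0 init_nonneg Ylo gam in \<open>auto intro!: powr_mono2\<close>)
  finally have 1: "\<epsilon> * (nu 0 * y 0 powr (-\<gamma>)) \<le> D0 / Ylo powr (\<gamma> + 1)" .
  have "a 0 / y 0 \<le> A0 / Ylo" by (rule frac_le) (use A0 init_nonneg Ylo in auto)
  then show ?thesis using 1 by (simp add: P_def P_bound_def)
qed

lemma W_init: "4 * W 0 + 6 \<le> WB"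
proof -
  have y0: "0 < y 0" by (rule init_nonneg)
  have "nu 0 \<le> (y 0 * d 0) / (y 0)\<^sup>2" unfolding nu_def by (rule divide_right_mono) auto
  also have "\<dots> = d 0 / y 0" using y0 by (simp add: power2_eq_square)
  also have "\<dots> \<le> D0 / Ylo" by (rule frac_le) (use D0 init_nonneg Ylo in auto)
  finally have nu0: "nu 0 \<le> D0 / Ylo" .
  have "\<epsilon> * nu 0 \<le> 1 * nu 0"
    by (rule mult_right_mono) (use eps nu_nonneg[of 0] in simp_all)
  moreover have "y 0 powr \<gamma> * (a 0 / y 0) = y 0 powr (\<gamma> - 1) * a 0" using y0 by (simp add: powr_diff)
  moreover have "y 0 powr (\<gamma> - 1) * a 0 \<le> Yhi powr (\<gamma> - 1) * A0"
    by (rule mult_mono) (use A0 an[of 0] y0 Yhi gam in \<open>auto intro!: powr_mono2\<close>)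
  ultimately show ?thesis using nu0 by (simp add: W_def W_bound_def)
qed

lemma P_decreasing:
  assumes "controlled T"
  shows "a T / y T \<le> PB"
proof -
  have T: "0 \<le> T" using assms by (simp add: controlled_def)
  have "P T \<le> P 0"
  proof (rule nonincreasing_within[OF T])
    fix t assume t: "0 \<le> t" "t \<le> T"
    show "(P has_real_derivative - (nu t * y t powr (-\<gamma>) * (2 * b t + (2 * \<gamma> + 4) * \<epsilon> * z t))) (at t within {0..T})"
      by (rule der_within[OF P_deriv T]) (use t controlledD[OF assms t] in auto)
    have "0 \<le> b t" by simp
    then have "0 \<le> 2 * b t + (2 * \<gamma> + 4) * \<epsilon> * z t" using damping_dominates[OF assms t] by linarith
    then show "- (nu t * y t powr (-\<gamma>) * (2 * b t + (2 * \<gamma> + 4) * \<epsilon> * z t)) \<le> 0"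
      using nu_nonneg[OF t(1)] by simp
  qed
  moreover have "a T / y T \<le> P T" using nu_nonneg[OF T] eps by (simp add: P_def)
  ultimately show ?thesis using P_init by linarith
qed

text \<open>W' contains 2 \<gamma> z W, and z is only approximately -(1+t)^p W. The factor exp r
  with r = 2 \<gamma> \<epsilon> (1+t)^p z replaces z exactly: by the equation for \<epsilon> z',
  the term -2 \<gamma> z W appears in r' W and cancels, leaving -2 \<gamma> (1+t)^p W^2 and terms
  that small \<epsilon> absorbs. As |r| \<le> 1/2, the factor costs at most 2 in each
  direction.\<close>

lemma W_decay:
  assumes "controlled T"
  shows "W T * (1 + T) powr (p + 1) \<le> WB"
proof -
  have T: "0 \<le> T" using assms by (simp add: controlled_def)
  define r where "r t = 2 * \<gamma> * \<epsilon> * ((1 + t) powr p * z t)" for t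
  define Y where "Y t = (1 + t) powr (p + 1) * (W t * exp (r t))" for t
  have W0: "0 \<le> W t" if "0 \<le> t" "t \<le> T" for t
    by (rule order_trans[OF mult_nonneg_nonneg[OF powr_ge_zero an[OF that(1)]]
          W_ge[OF that(1) controlledD(1)[OF assms that]]])
  have r: "\<bar>r t\<bar> \<le> 1/2" if t: "0 \<le> t" "t \<le> T" for t
  proof -
    have "\<bar>r t\<bar> = 2 * \<gamma> * \<epsilon> * ((1 + t) powr p * \<bar>z t\<bar>)" using gam eps by (simp add: r_def abs_mult)
    also have "\<dots> \<le> 2 * \<gamma> * \<epsilon> * ((1 + t) powr p * (M * b t))"
      by (intro mult_left_mono controlledD[OF assms t]) (use gam eps in auto)
    also have "\<dots> = 2 * \<gamma> * \<epsilon> * M * ((1 + t) powr p * b t)" by simp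
    also have "\<dots> \<le> 1/2" using small_cases(3) powr_facts(2)[OF t(1)] by simp
    finally show ?thesis .
  qed
  have e2: "exp (r t) \<le> 2" "1/2 \<le> exp (r t)" if t: "0 \<le> t" "t \<le> T" for t
  proof -
    have "r t \<le> 1/2" "- r t \<le> 1/2" using r[OF t] by auto
    then have 1: "exp (r t) \<le> 2" "exp (- r t) \<le> 2"
      by (auto intro: order_trans[OF iffD2[OF exp_le_cancel_iff] exp_half_le])
    then show "exp (r t) \<le> 2" by simp
    have "1 = exp (r t) * exp (- r t)" by (simp flip: exp_add)
    also have "\<dots> \<le> exp (r t) * 2" using 1(2) by simp
    finally show "1/2 \<le> exp (r t)" by simp
  qed
  \<comment> \<open>The value 3 is the level at which the quadratic term beats the weight, and 2 W 0
    bounds the initial value of \<open>Y\<close>. Undoing exp r doubles this once more, whence 4 W 0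
    + 6 in \<open>W_bound\<close>.\<close>
  define K where "K = max 3 (2 * W 0)"
  have "\<exists>D. (Y has_real_derivative D) (at t within {0..T}) \<and> (K < Y t \<longrightarrow> D \<le> 0)" if t: "0 \<le> t" "t \<le> T" for t
  proof -
    note c = controlledD[OF assms t]
    define B where "B = (1 + t) powr p"
    define w where "w = W t"
    define n where "n = nu t"
    define zz where "zz = z t"
    define G where "G = 2 * b t + (2 * \<gamma> + 4) * \<epsilon> * z t"
    define z' where "z' = nu t - (z t)\<^sup>2 - (1 / \<epsilon>) * (b t * z t + y t powr \<gamma> * (a t / y t))"
    define W' where "W' = 2 * \<gamma> * z t * W t - nu t * G"
    note pf = powr_facts[OF t(1)]
    have zd: "(z has_real_derivative z') (at t within {0..T})"
      unfolding z'_def by (rule der_within[OF z_deriv[OF t(1) c(1)] T])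
    have Wd: "(W has_real_derivative W') (at t within {0..T})"
      unfolding W'_def G_def by (rule der_within[OF W_deriv[OF t(1) c(1)] T])
    note pd = has_real_derivative_one_add_powr[OF t(1)]
    have rd: "(r has_real_derivative 2 * \<gamma> * \<epsilon> * (p * (1 + t) powr (p - 1) * z t + z' * (1 + t) powr p)) (at t within {0..T})"
      unfolding r_def[abs_def] by (rule DERIV_cmult[OF DERIV_mult[OF pd zd]])
    define D where "D = (p + 1) * (1 + t) powr (p + 1 - 1) * (W t * exp (r t)) +
       (W' * exp (r t) + exp (r t) * (2 * \<gamma> * \<epsilon> * (p * (1 + t) powr (p - 1) * z t + z' * (1 + t) powr p)) * W t) * (1 + t) powr (p + 1)"
    have Yd: "(Y has_real_derivative D) (at t within {0..T})"
      unfolding Y_def[abs_def] D_def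
      by (rule DERIV_mult[OF pd DERIV_mult[OF Wd DERIV_chain2[OF DERIV_exp rd]]])
    have ez: "\<epsilon> * z' = 2 * \<epsilon> * n - w - b t * zz - \<epsilon> * zz\<^sup>2"
      using eps by (simp add: z'_def w_def W_def n_def zz_def field_simps)
    have Bb: "B * b t = 1" using pf(2) by (simp add: B_def)
    define C where "C = W' + (2 * \<gamma> * \<epsilon> * (p * (1 + t) powr (p - 1) * z t + z' * B)) * w"
    have Ceq: "C = - n * G + 4 * \<gamma> * \<epsilon> * w * B * n - 2 * \<gamma> * B * w\<^sup>2 - 2 * \<gamma> * B * w * \<epsilon> * zz\<^sup>2
         + 2 * \<gamma> * \<epsilon> * p * (1 + t) powr (p - 1) * zz * w"
    proof -
      have "2 * \<gamma> * w * B * (\<epsilon> * z') = 4 * \<gamma> * \<epsilon> * w * B * n - 2 * \<gamma> * B * w\<^sup>2 - 2 * \<gamma> * w * (B * b t) * zz - 2 * \<gamma> * B * w * \<epsilon> * zz\<^sup>2"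
        unfolding ez by (simp add: algebra_simps power2_eq_square)
      then show ?thesis unfolding Bb C_def W'_def n_def[symmetric] zz_def[symmetric] w_def[symmetric]
        by (simp add: algebra_simps)
    qed
    have w0: "0 \<le> w" using W0[OF t] by (simp add: w_def)
    have n0: "0 \<le> n" using nu_nonneg[OF t(1)] by (simp add: n_def)
    have B1: "1 \<le> B" using pf by (simp add: B_def)
    have wB: "(1 + t) * (w * B) \<le> M" using c(3) unfolding pf(1) w_def B_def by (simp add: mult.commute mult.left_commute)
    \<comment> \<open>The corrector creates a positive multiple of \<open>nu\<close>. The bootstrap
      bound (1+t) (1+t)^p W \<le> M makes it small against the damping term -nu G.\<close>
    have "4 * \<gamma> * \<epsilon> * w * B \<le> b t"
    proof -
      have "w * B \<le> M / (1 + t)" using wB t by (simp add: pos_le_divide_eq mult.commute)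
      then have "4 * \<gamma> * \<epsilon> * (w * B) \<le> 4 * \<gamma> * \<epsilon> * (M / (1 + t))"
        by (rule mult_left_mono) (use gam eps in simp)
      also have "\<dots> = (4 * \<gamma> * \<epsilon> * M) * (1 / (1 + t))" by simp
      also have "\<dots> \<le> 1 * (1 / (1 + t))" by (rule mult_right_mono[OF small_cases(2)]) (use t in simp)
      finally show ?thesis using pf(7) by simp
    qed
    also have "b t \<le> G" unfolding G_def by (rule damping_dominates[OF assms t])
    finally have "4 * \<gamma> * \<epsilon> * w * B * n \<le> G * n" using n0 by (rule mult_right_mono)
    then have c1: "- n * G + 4 * \<gamma> * \<epsilon> * w * B * n \<le> 0" by (simp add: mult.commute)
    have c2: "0 \<le> 2 * \<gamma> * B * w * \<epsilon> * zz\<^sup>2" using gam B1 w0 eps by simp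
    have c3: "2 * \<gamma> * \<epsilon> * p * (1 + t) powr (p - 1) * zz * w \<le> w / (1 + t)"
    proof -
      define \<kappa> where "\<kappa> = 2 * \<gamma> * \<epsilon> * p * (1 + t) powr (p - 1)"
      have "0 \<le> 2 * \<gamma> * \<epsilon>" "0 \<le> \<kappa>" using gam eps p by (simp_all add: \<kappa>_def)
      have "p * (1 + t) powr (p - 1) \<le> 1 * 1" by (rule mult_mono) (use p pf(6) in auto)
      then have "\<kappa> \<le> 2 * \<gamma> * \<epsilon> * 1"
        using mult_left_mono[OF _ \<open>0 \<le> 2 * \<gamma> * \<epsilon>\<close>, of "p * (1 + t) powr (p - 1)" 1] by (simp add: \<kappa>_def mult.assoc)
      have "\<kappa> * zz \<le> \<kappa> * \<bar>zz\<bar>" by (rule mult_left_mono) (use \<open>0 \<le> \<kappa>\<close> in auto)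
      also have "\<dots> \<le> 2 * \<gamma> * \<epsilon> * 1 * \<bar>zz\<bar>" by (rule mult_right_mono) (use \<open>\<kappa> \<le> 2 * \<gamma> * \<epsilon> * 1\<close> in auto)
      also have "2 * \<gamma> * \<epsilon> * 1 * \<bar>zz\<bar> \<le> 2 * \<gamma> * \<epsilon> * (M / (1 + t))"
        using mult_left_mono[OF c(4), of "2 * \<gamma> * \<epsilon>"] gam eps by (simp add: zz_def)
      also have "\<dots> = (2 * \<gamma> * \<epsilon> * M) * (1 / (1 + t))" by simp
      also have "\<dots> \<le> 1 * (1 / (1 + t))" by (rule mult_right_mono) (use small_cases(3) t in auto)
      finally have "\<kappa> * zz * w \<le> 1 * (1 / (1 + t)) * w"
        using w0 by (rule mult_right_mono)
      then show ?thesis by (simp add: \<kappa>_def)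
    qed
    have Cle: "C \<le> w / (1 + t) - 2 * \<gamma> * B * w\<^sup>2" unfolding Ceq using c1 c2 c3 by linarith
    have Deq: "D = exp (r t) * ((p + 1) * B * w + (1 + t) * B * C)"
      unfolding D_def C_def pf(1) w_def[symmetric] by (simp add: B_def[symmetric] algebra_simps)
    have "D \<le> 0" if "K < Y t"
    proof -
      \<comment> \<open>The linear terms amount to p + 2 \<le> 3: p + 1 from the weight and 1 from
        the remainder \<open>c3\<close>.\<close>
      have "3 < Y t" using that by (simp add: K_def)
      also have "Y t = exp (r t) * ((1 + t) * B * w)" by (simp add: Y_def pf(1) B_def w_def)
      also have "\<dots> \<le> 2 * ((1 + t) * B * w)" using e2(1)[OF t] t B1 w0 by (intro mult_right_mono) auto
      also have "\<dots> \<le> 2 * \<gamma> * ((1 + t) * B * w)" using gam t B1 w0 by (intro mult_right_mono) auto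
      finally have big: "3 \<le> 2 * \<gamma> * ((1 + t) * B * w)" by simp
      have "(p + 1) * B * w + (1 + t) * B * C \<le> (p + 1) * B * w + (1 + t) * B * (w / (1 + t) - 2 * \<gamma> * B * w\<^sup>2)"
        using Cle t B1 by (intro add_left_mono mult_left_mono) auto
      also have "\<dots> = B * w * (p + 2 - 2 * \<gamma> * ((1 + t) * B * w))"
        using t by (simp add: algebra_simps power2_eq_square) (simp add: field_simps)
      also have "\<dots> \<le> 0" using big p B1 w0 by (intro mult_nonneg_nonpos) auto
      finally show ?thesis unfolding Deq by (intro mult_nonneg_nonpos) auto
    qed
    then show ?thesis using Yd by blast
  qed
  then obtain D where D: "\<And>t. 0 \<le> t \<Longrightarrow> t \<le> T \<Longrightarrow> (Y has_real_derivative D t) (at t within {0..T})"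
    "\<And>t. 0 \<le> t \<Longrightarrow> t \<le> T \<Longrightarrow> K < Y t \<Longrightarrow> D t \<le> 0" by metis
  have "Y T \<le> K"
  proof (rule barrier_upper[OF T D(1)])
    show "Y 0 \<le> K" using e2(1)[of 0] T W0[of 0] mult_left_mono[of "exp (r 0)" 2 "W 0"] by (simp add: Y_def K_def)
  qed (use D(2) in auto)
  moreover have "W T * (1 + T) powr (p + 1) \<le> 2 * Y T"
  proof -
    have "(1 + T) powr (p + 1) * W T * 1 \<le> (1 + T) powr (p + 1) * W T * (2 * exp (r T))"
      using e2(2)[of T] T W0[of T] by (intro mult_left_mono) auto
    then show ?thesis by (simp add: Y_def algebra_simps)
  qed
  moreover have "2 * K \<le> 4 * W 0 + 6" using W0[of 0] T by (auto simp: K_def max_def)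
  ultimately show ?thesis using W_init by linarith
qed

text \<open>The equation drives u' towards -(1+t)^p y^\<gamma> Au, so q is compared with (1+t)^(2p)
  y^(2\<gamma>) a; \<open>mm\<close> and \<open>\<theta>\<close> are weights under which this value
  is bounded by \<open>K\<close>. Where the weighted q exceeds 4 K, the forcing uses at most half of
  the damping 2 b/\<epsilon>, and for small \<epsilon> the other half beats the derivatives of the
  weights.\<close>

lemma velocity_bound:
  fixes mm \<theta> K \<kappa> :: real
  assumes "controlled T" and \<theta>: "\<theta> \<le> 1" and mm: "0 \<le> mm" "\<epsilon> * (2 * mm * M + 1) \<le> 1"
    and aK: "\<And>t. 0 \<le> t \<Longrightarrow> t \<le> T \<Longrightarrow> y t powr (2 * \<gamma> - mm) * a t * (1 + t) powr (\<theta> + 2 * p) \<le> K"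
    and "4 * K \<le> \<kappa>" and "q 0 * y 0 powr (-mm) \<le> \<kappa>"
  shows "q T * y T powr (-mm) * (1 + T) powr \<theta> \<le> \<kappa>"
proof -
  have T: "0 \<le> T" using assms by (simp add: controlled_def)
  define f where "f t = q t * y t powr (-mm) * (1 + t) powr \<theta>" for t
  have "\<exists>D. (f has_real_derivative D) (at t within {0..T}) \<and> (\<kappa> < f t \<longrightarrow> D \<le> 0)" if t: "0 \<le> t" "t \<le> T" for t
  proof -
    note c = controlledD[OF assms(1) t]
    note pf = powr_facts[OF t(1)]
    define Y where "Y = y t powr (-mm)"
    define C where "C = y t powr \<gamma>"
    define R where "R = (1 + t) powr \<theta>"
    define D where "D = ((- (2 / \<epsilon>) * (b t * q t + C * h t)) * Y + (- mm * Y * (2 * z t)) * q t) * R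
       + (\<theta> * (1 + t) powr (\<theta> - 1)) * (q t * Y)"
    have fd: "(f has_real_derivative D) (at t within {0..T})"
      unfolding f_def[abs_def] D_def Y_def C_def R_def
      by (rule DERIV_mult[OF DERIV_mult[OF der_within[OF q_deriv[OF t(1)] T] der_within[OF y_powr_deriv[OF t(1) c(1)] T]]
            has_real_derivative_one_add_powr[OF t(1)]])
    have R1: "(1 + t) powr (\<theta> - 1) = R / (1 + t)" using t by (simp add: R_def powr_diff)
    have ft: "f t = q t * Y * R" by (simp add: f_def Y_def R_def)
    have pos: "0 \<le> Y" "0 \<le> C" "0 \<le> R" by (simp_all add: Y_def C_def R_def)
    have q0: "0 \<le> q t" using nonneg(2)[of t] t by simp
    have Deq: "D = f t * (- 2 * b t / \<epsilon> - 2 * mm * z t + \<theta> / (1 + t)) - (2 / \<epsilon>) * (C * h t * Y * R)"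
      unfolding D_def R1 ft by (simp add: algebra_simps add_divide_distrib diff_divide_distrib)
    have "D \<le> 0" if k: "\<kappa> < f t"
    proof -
      have f0: "0 \<le> f t" using q0 pos by (simp add: ft)
      \<comment> \<open>Cauchy-Schwarz for <Au, u'> splits the squared forcing into the weighted q
        and the quantity bounded by \<open>K\<close>.\<close>
      have "(C * h t * Y * R)\<^sup>2 = (h t)\<^sup>2 * (C\<^sup>2 * Y\<^sup>2 * R\<^sup>2)" by (simp add: power_mult_distrib)
      also have "\<dots> \<le> (q t * a t) * (C\<^sup>2 * Y\<^sup>2 * R\<^sup>2)" by (rule mult_right_mono[OF hq[OF t(1)]]) simp
      also have "\<dots> = f t * (y t powr (2 * \<gamma> - mm) * a t * (1 + t) powr (\<theta> + 2 * p)) * (b t)\<^sup>2"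
      proof -
        have 1: "y t powr (2 * \<gamma> - mm) = C\<^sup>2 * Y"
          using c(1) by (simp add: C_def Y_def power2_eq_square flip: powr_add)
        have 2: "(1 + t) powr (\<theta> + 2 * p) * (b t)\<^sup>2 = R"
          using t by (simp add: R_def power2_eq_square flip: powr_add)
        have "f t * (y t powr (2 * \<gamma> - mm) * a t * (1 + t) powr (\<theta> + 2 * p)) * (b t)\<^sup>2
          = f t * (y t powr (2 * \<gamma> - mm) * a t) * ((1 + t) powr (\<theta> + 2 * p) * (b t)\<^sup>2)"
          by (simp only: mult.assoc)
        also have "\<dots> = q t * a t * (C\<^sup>2 * Y\<^sup>2 * R\<^sup>2)" unfolding 1 2 ft by (simp add: power2_eq_square)
        finally show ?thesis by (rule sym)
      qed
      also have "\<dots> \<le> f t * (f t / 4) * (b t)\<^sup>2"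
      proof -
        have "y t powr (2 * \<gamma> - mm) * a t * (1 + t) powr (\<theta> + 2 * p) \<le> f t / 4"
          using aK[OF t] k assms(6) by linarith
        then show ?thesis using f0 by (intro mult_right_mono mult_left_mono) auto
      qed
      also have "\<dots> = (f t * b t / 2)\<^sup>2" by (simp add: power2_eq_square)
      finally have "\<bar>C * h t * Y * R\<bar> \<le> f t * b t / 2"
        using f0 by (simp add: power2_le_iff_abs_le)
      then have "- (C * h t * Y * R) \<le> f t * b t / 2" by linarith
      then have "(2 / \<epsilon>) * (- (C * h t * Y * R)) \<le> (2 / \<epsilon>) * (f t * b t / 2)"
        using eps by (intro mult_left_mono) auto
      then have "D \<le> f t * (- 2 * b t / \<epsilon> - 2 * mm * z t + \<theta> / (1 + t)) + f t * (b t / \<epsilon>)"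
        unfolding Deq by simp
      also have "\<dots> = f t * (- b t / \<epsilon> - 2 * mm * z t + \<theta> / (1 + t))" by (simp add: algebra_simps)
      also have "\<dots> \<le> 0"
      proof (rule mult_nonneg_nonpos[OF f0])
        have "- (2 * mm * z t) \<le> 2 * mm * (M * b t)"
        proof -
          have "- z t \<le> M * b t" using c(5) by linarith
          then have "2 * mm * (- z t) \<le> 2 * mm * (M * b t)" by (rule mult_left_mono) (use mm(1) in simp)
          then show ?thesis by (simp only: mult_minus_right)
        qed
        moreover have "\<theta> / (1 + t) \<le> b t"
        proof -
          have "\<theta> / (1 + t) \<le> 1 / (1 + t)" using \<theta> t by (intro divide_right_mono) auto
          then show ?thesis using pf(7) by linarith
        qed
        moreover have "(2 * mm * M + 1) * b t \<le> b t / \<epsilon>"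
        proof -
          have "2 * mm * M + 1 \<le> 1 / \<epsilon>" using mm(2) eps by (simp add: pos_le_divide_eq mult.commute)
          then have "(2 * mm * M + 1) * b t \<le> (1 / \<epsilon>) * b t" by (rule mult_right_mono) simp
          then show ?thesis by simp
        qed
        moreover have "(2 * mm * M + 1) * b t = 2 * mm * (M * b t) + b t" by (simp add: algebra_simps)
        ultimately have "- (2 * mm * z t) + \<theta> / (1 + t) \<le> b t / \<epsilon>" by linarith
        then show "- b t / \<epsilon> - 2 * mm * z t + \<theta> / (1 + t) \<le> 0" by simp
      qed
      finally show ?thesis .
    qed
    then show ?thesis using fd by blast
  qed
  then obtain D where D: "\<And>t. 0 \<le> t \<Longrightarrow> t \<le> T \<Longrightarrow> (f has_real_derivative D t) (at t within {0..T})"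
    "\<And>t. 0 \<le> t \<Longrightarrow> t \<le> T \<Longrightarrow> \<kappa> < f t \<Longrightarrow> D t \<le> 0" by metis
  have "f T \<le> \<kappa>"
    by (rule barrier_upper[OF T D(1)]) (use D(2) assms(7) in \<open>auto simp: f_def\<close>)
  then show ?thesis by (simp add: f_def)
qed

lemma q_init:
  assumes "0 \<le> r"
  shows "q 0 * y 0 powr (-r) \<le> Q0 / Ylo powr r"
proof -
  have "q 0 / y 0 powr r \<le> Q0 / Ylo powr r"
    by (rule frac_le) (use Q0 init_nonneg Ylo assms in \<open>auto intro!: powr_mono2\<close>)
  then show ?thesis by (simp add: powr_minus divide_inverse)
qed

lemma a_decay:
  assumes "controlled T"
  shows "y T powr (\<gamma> - 1) * a T * (1 + T) powr (p + 1) \<le> WB"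
proof -
  have T: "0 \<le> T" using assms by (simp add: controlled_def)
  have "y T powr (\<gamma> - 1) * a T * (1 + T) powr (p + 1) \<le> W T * (1 + T) powr (p + 1)"
    using W_ge[OF T] controlledD[OF assms T] by (intro mult_right_mono) auto
  then show ?thesis using W_decay[OF assms] by linarith
qed

lemma controlled_mono: "controlled T \<Longrightarrow> 0 \<le> t \<Longrightarrow> t \<le> T \<Longrightarrow> controlled t"
  by (auto simp: controlled_def)

lemma q_decay:
  assumes "controlled T"
  shows "q T * y T powr (-(\<gamma> + 1)) * (1 + T) powr (1 - p) \<le> QB"
proof (rule velocity_bound[OF assms, where K = WB])
  show "1 - p \<le> 1" "0 \<le> \<gamma> + 1" using p gam by auto
  show "\<epsilon> * (2 * (\<gamma> + 1) * M + 1) \<le> 1" by (fact small_cases)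
  have e: "2 * \<gamma> - (\<gamma> + 1) = \<gamma> - 1" "1 - p + 2 * p = p + 1" by auto
  show "y t powr (2 * \<gamma> - (\<gamma> + 1)) * a t * (1 + t) powr (1 - p + 2 * p) \<le> WB" if "0 \<le> t" "t \<le> T" for t
    unfolding e by (rule a_decay[OF controlled_mono[OF assms that]])
  show "4 * WB \<le> QB" using init_nonneg by (simp add: Q_bound_def)
  show "q 0 * y 0 powr (-(\<gamma> + 1)) \<le> QB"
    using q_init[of "\<gamma> + 1"] gam bounds_nonneg by (simp add: Q_bound_def)
qed

text \<open>The second choice of weights rests on a/y instead of the decay of W. It bounds u' by a
  power of y that does not deteriorate as y tends to 0 faster than its upper rate, and is the source
  of the sharp lower bound of y.\<close>

lemma q_parabolic:
  assumes "controlled T"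
  shows "q T * y T powr (-(2 * \<gamma> + 1)) * (1 + T) powr (- 2 * p) \<le> RB"
proof (rule velocity_bound[OF assms, where K = PB])
  show "- 2 * p \<le> 1" "0 \<le> 2 * \<gamma> + 1" using p gam by auto
  show "\<epsilon> * (2 * (2 * \<gamma> + 1) * M + 1) \<le> 1" by (fact small_cases)
  have e: "2 * \<gamma> - (2 * \<gamma> + 1) = -1" "- 2 * p + 2 * p = 0" by auto
  show "y t powr (2 * \<gamma> - (2 * \<gamma> + 1)) * a t * (1 + t) powr (- 2 * p + 2 * p) \<le> PB" if t: "0 \<le> t" "t \<le> T" for t
    unfolding e using P_decreasing[OF controlled_mono[OF assms t]] controlledD(1)[OF assms t] t
    by (simp add: powr_minus divide_inverse mult.commute)
  show "4 * PB \<le> RB" using init_nonneg by (simp add: R_bound_def)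
  show "q 0 * y 0 powr (-(2 * \<gamma> + 1)) \<le> RB"
    using q_init[of "2 * \<gamma> + 1"] gam bounds_nonneg by (simp add: R_bound_def)
qed

text \<open>By h^2 \<le> q a, the square of (1+t) z is at most the product of the two assumed
  quantities: the powers of y multiply to y^(-2) and those of 1+t to (1+t)^2.\<close>

lemma z_less:
  assumes t: "0 \<le> t" "0 < y t"
    and 1: "y t powr (\<gamma> - 1) * a t * (1 + t) powr (p + 1) \<le> WB"
    and 2: "q t * y t powr (-(\<gamma> + 1)) * (1 + t) powr (1 - p) \<le> QB"
  shows "\<bar>z t\<bar> * (1 + t) < M"
proof -
  have "(\<bar>z t\<bar> * (1 + t))\<^sup>2 = (h t)\<^sup>2 * ((1 + t)\<^sup>2 / (y t)\<^sup>2)"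
    by (simp add: z_def power_mult_distrib power_divide)
  also have "\<dots> \<le> q t * a t * ((1 + t)\<^sup>2 / (y t)\<^sup>2)" by (rule mult_right_mono[OF hq[OF t(1)]]) simp
  also have "\<dots> = (y t powr (\<gamma> - 1) * a t * (1 + t) powr (p + 1)) * (q t * y t powr (-(\<gamma> + 1)) * (1 + t) powr (1 - p))"
  proof -
    have "y t powr (\<gamma> - 1) * y t powr (-(\<gamma> + 1)) = y t powr (-2)" by (simp flip: powr_add)
    also have "\<dots> = 1 / (y t)\<^sup>2" using t by (simp add: powr_minus divide_inverse powr_numeral)
    finally have e1: "y t powr (\<gamma> - 1) * y t powr (-(\<gamma> + 1)) = 1 / (y t)\<^sup>2" .
    have "(1 + t) powr (p + 1) * (1 + t) powr (1 - p) = (1 + t) powr 2" by (simp flip: powr_add)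
    also have "\<dots> = (1 + t)\<^sup>2" using t by (simp add: powr_numeral)
    finally have e2: "(1 + t) powr (p + 1) * (1 + t) powr (1 - p) = (1 + t)\<^sup>2" .
    have "(y t powr (\<gamma> - 1) * a t * (1 + t) powr (p + 1)) * (q t * y t powr (-(\<gamma> + 1)) * (1 + t) powr (1 - p))
      = q t * a t * ((y t powr (\<gamma> - 1) * y t powr (-(\<gamma> + 1))) * ((1 + t) powr (p + 1) * (1 + t) powr (1 - p)))"
      by (simp only: mult.assoc mult.commute mult.left_commute)
    then show ?thesis unfolding e1 e2 by simp
  qed
  also have "\<dots> \<le> WB * QB"
    by (rule mult_mono[OF 1 2]) (use bounds_nonneg nonneg(2)[of t] t in auto)
  also have "\<dots> \<le> (WB + QB)\<^sup>2"
    using bounds_nonneg mult_nonneg_nonneg[of WB QB] zero_le_power2[of WB] zero_le_power2[of QB]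
    unfolding power2_sum by linarith
  finally have "\<bar>z t\<bar> * (1 + t) \<le> WB + QB" by (rule power2_le_imp_le) (use bounds_nonneg in simp)
  then show ?thesis using bounds_nonneg by (simp add: M_def z_bound_def)
qed

end

section \<open>Closing the bootstrap and its consequences\<close>

context strong_energy
begin

text \<open>The conditions are multiplied out by powers of y before forming the maximum, so that its
  continuity does not presuppose y > 0. \<open>z_less\<close> and \<open>W_decay\<close> improve two
  of them strictly; positivity follows from the bound of z.\<close>

lemma controlled_always:
  assumes "0 \<le> t"
  shows "controlled t"
proof -
  \<comment> \<open>Positivity is replaced by an explicit lower bound; the factor 1/2 makes it
    strict at every time.\<close>
  define f1 where "f1 t = y 0 / 2 * (1 + t) powr (-2 * M) - y t" for t
  define f2 where "f2 t = \<bar>h t\<bar> * (1 + t) - M * y t" for t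
  define f3 where "f3 t = (\<epsilon> * (y t * d t - (h t)\<^sup>2) + y t powr (\<gamma> + 1) * a t) * (1 + t) powr (p + 1) - M * (y t)\<^sup>2" for t
  define f where "f t = max (f1 t) (max (f2 t) (f3 t))" for t
  have y0: "0 < y 0" by (rule init_nonneg)
  have C: "continuous_on {0..} y" "continuous_on {0..} h" "continuous_on {0..} d" "continuous_on {0..} a"
    using y_deriv h' d' a' by (auto intro!: DERIV_continuous_on)
  have P: "continuous_on {0..} (\<lambda>t::real. (1 + t) powr r)" for r
    using has_real_derivative_one_add_powr by (auto intro!: DERIV_continuous_on)
  have Yp: "continuous_on {0..} (\<lambda>t. y t powr (\<gamma> + 1))"
    by (rule continuous_on_powr'[OF C(1) continuous_on_const]) (use nonneg(1) gam in auto)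
  have cont: "continuous_on {0..} f"
    unfolding f_def[abs_def] f1_def f2_def f3_def
    by (intro continuous_on_max continuous_on_add continuous_on_diff continuous_on_mult
        continuous_on_divide continuous_on_power continuous_on_rabs continuous_on_const
        continuous_on_id C P Yp) auto
  have iff: "f3 t < 0 \<longleftrightarrow> W t * (1 + t) powr (p + 1) < M" "f3 t \<le> 0 \<longleftrightarrow> W t * (1 + t) powr (p + 1) \<le> M"
    "f2 t < 0 \<longleftrightarrow> \<bar>z t\<bar> * (1 + t) < M" "f2 t \<le> 0 \<longleftrightarrow> \<bar>z t\<bar> * (1 + t) \<le> M"
    if t: "0 \<le> t" "0 < y t" for t
  proof -
    have "y t powr (\<gamma> + 1) * a t = (y t)\<^sup>2 * (y t powr \<gamma> * (a t / y t))"
      using t by (simp add: powr_add power2_eq_square)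
    moreover have "\<epsilon> * (y t * d t - (h t)\<^sup>2) = (y t)\<^sup>2 * (\<epsilon> * nu t)" using t by (simp add: nu_def)
    ultimately have f3: "f3 t = (y t)\<^sup>2 * (W t * (1 + t) powr (p + 1) - M)"
      unfolding f3_def W_def by (simp add: algebra_simps)
    have f2: "f2 t = y t * (\<bar>z t\<bar> * (1 + t) - M)"
      using t by (simp add: f2_def z_def field_simps)
    show "f3 t < 0 \<longleftrightarrow> W t * (1 + t) powr (p + 1) < M" "f3 t \<le> 0 \<longleftrightarrow> W t * (1 + t) powr (p + 1) \<le> M"
      unfolding f3 using t by (auto simp: mult_less_0_iff mult_le_0_iff)
    show "f2 t < 0 \<longleftrightarrow> \<bar>z t\<bar> * (1 + t) < M" "f2 t \<le> 0 \<longleftrightarrow> \<bar>z t\<bar> * (1 + t) \<le> M"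
      unfolding f2 using t by (auto simp: mult_less_0_iff mult_le_0_iff)
  qed
  have WM: "WB < M" using bounds_nonneg by (simp add: M_def z_bound_def)
  have "f s < 0" if s: "0 \<le> s" for s
  proof (rule continuity_method[OF cont _ _ s])
    have "0 \<le> W 0" using nu_nonneg[of 0] an[of 0] eps y0 by (simp add: W_def)
    then have "W 0 \<le> WB" using W_init by linarith
    have wa: "y 0 powr (\<gamma> - 1) * a 0 * (1 + 0) powr (p + 1) \<le> WB"
      using W_ge[of 0] y0 \<open>W 0 \<le> WB\<close> by simp
    have qa: "q 0 * y 0 powr (-(\<gamma> + 1)) * (1 + 0) powr (1 - p) \<le> QB"
      using q_init[of "\<gamma> + 1"] gam bounds_nonneg by (simp add: Q_bound_def)
    have "f1 0 < 0" using y0 by (simp add: f1_def)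
    moreover have "f2 0 < 0" using iff(3)[of 0] y0 z_less[OF _ y0 wa qa] by simp
    moreover have "f3 0 < 0" using iff(1)[of 0] y0 \<open>W 0 \<le> WB\<close> WM by simp
    ultimately show "f 0 < 0" by (simp add: f_def)
  next
    fix T :: real assume T: "0 \<le> T" and le: "\<And>t. 0 \<le> t \<Longrightarrow> t \<le> T \<Longrightarrow> f t \<le> 0"
    have pos: "0 < y t" if "0 \<le> t" "t \<le> T" for t
    proof -
      have "y 0 / 2 * (1 + t) powr (-2 * M) \<le> y t" using le[OF that] by (simp add: f_def f1_def)
      moreover have "0 < y 0 / 2 * (1 + t) powr (-2 * M)" using y0 that by simp
      ultimately show ?thesis by linarith
    qed
    have con: "controlled T"
      unfolding controlled_def
    proof (intro conjI allI impI T; elim conjE)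
      fix t assume t: "0 \<le> t" "t \<le> T"
      show "0 < y t" by (rule pos[OF t])
      show "\<bar>z t\<bar> * (1 + t) \<le> M" using le[OF t] iff(4)[OF t(1) pos[OF t]] by (simp add: f_def)
      show "W t * (1 + t) powr (p + 1) \<le> M" using le[OF t] iff(2)[OF t(1) pos[OF t]] by (simp add: f_def)
    qed
    have yT: "0 < y T" by (rule pos) (use T in auto)
    have "f2 T < 0" using iff(3)[OF T yT] z_less[OF T yT a_decay[OF con] q_decay[OF con]] by simp
    moreover have "f3 T < 0" using iff(1)[OF T yT] W_decay[OF con] WM by simp
    moreover have "f1 T < 0"
    proof -
      \<comment> \<open>Since y' = 2 z y and z \<ge> -M/(1+t), the product of y and (1+t)^(2M) is
        nondecreasing.\<close>
      have "- (y T * (1 + T) powr (2 * M)) \<le> - (y 0 * (1 + 0) powr (2 * M))"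
      proof (rule nonincreasing_within[OF T])
        fix t assume t: "0 \<le> t" "t \<le> T"
        show "((\<lambda>t. - (y t * (1 + t) powr (2 * M))) has_real_derivative
           - (2 * h t * (1 + t) powr (2 * M) + (2 * M * (1 + t) powr (2 * M - 1)) * y t)) (at t within {0..T})"
          by (rule DERIV_minus[OF DERIV_mult[OF der_within[OF y_deriv[OF t(1)] T] has_real_derivative_one_add_powr[OF t(1)]]])
        have "- (M / (1 + t)) \<le> z t" using controlledD(4)[OF con t] by linarith
        then have "0 \<le> (z t + M / (1 + t)) * (2 * y t * (1 + t) powr (2 * M))"
          using pos[OF t] by simp
        also have "\<dots> = 2 * h t * (1 + t) powr (2 * M) + (2 * M * (1 + t) powr (2 * M - 1)) * y t"
        proof -
          have 1: "(1 + t) powr (2 * M - 1) = (1 + t) powr (2 * M) / (1 + t)" using t by (simp add: powr_diff)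
          have "(h t / y t + M / (1 + t)) * (2 * y t * E) = 2 * h t * E + (2 * M * (E / (1 + t))) * y t" for E
            using pos[OF t] by (simp add: distrib_right)
          then show ?thesis unfolding 1 z_def .
        qed
        finally show "- (2 * h t * (1 + t) powr (2 * M) + (2 * M * (1 + t) powr (2 * M - 1)) * y t) \<le> 0"
          by (simp only: neg_le_0_iff_le)
      qed
      then have "y 0 \<le> y T * (1 + T) powr (2 * M)" by simp
      then have "y 0 * (1 + T) powr (-2 * M) \<le> y T * (1 + T) powr (2 * M) * (1 + T) powr (-2 * M)"
        by (rule mult_right_mono) simp
      also have "\<dots> = y T" using T by (simp add: mult.assoc flip: powr_add)
      finally have 1: "y 0 * (1 + T) powr (-2 * M) \<le> y T" .
      have "0 < y 0 * (1 + T) powr (-2 * M)" using y0 T by simp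
      then show ?thesis using 1 by (simp add: f1_def)
    qed
    ultimately show "f T < 0" by (simp add: f_def)
  qed
  then have fneg: "f1 s < 0" "f2 s < 0" "f3 s < 0" if "0 \<le> s" for s
    using that by (auto simp: f_def)
  have pos: "0 < y s" if "0 \<le> s" for s
  proof -
    have "0 < y 0 / 2 * (1 + s) powr (-2 * M)" using y0 that by simp
    then show ?thesis using fneg(1)[OF that] by (simp add: f1_def)
  qed
  show ?thesis
    unfolding controlled_def
  proof (intro conjI allI impI assms; elim conjE)
    fix s assume s: "0 \<le> s" "s \<le> t"
    show "0 < y s" by (rule pos[OF s(1)])
    show "\<bar>z s\<bar> * (1 + s) \<le> M" using fneg(2)[OF s(1)] iff(3)[OF s(1) pos[OF s(1)]] by simp
    show "W s * (1 + s) powr (p + 1) \<le> M" using fneg(3)[OF s(1)] iff(1)[OF s(1) pos[OF s(1)]] by simp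
  qed
qed

text \<open>The bound of \<open>d\<close>, read off from d/y = nu + z^2, is the only one that
  degenerates with \<epsilon>; it serves compactness at fixed \<epsilon>.\<close>

lemma strong_decay:
  assumes t: "0 \<le> t"
  shows "0 < y t" "\<bar>h t\<bar> * (1 + t) \<le> M * y t" "a t \<le> PB * y t"
    "y t powr (\<gamma> - 1) * a t * (1 + t) powr (p + 1) \<le> WB"
    "q t * (1 + t) powr (1 - p) \<le> QB * y t powr (\<gamma> + 1)"
    "y t powr (-\<gamma>) \<le> (Ylo powr (-\<gamma>) + 2 * \<gamma> * (RB + PB)) * (1 + t) powr (p + 1)"
    "\<epsilon> * d t \<le> (\<epsilon> * M\<^sup>2 + M) * y t"
proof -
  note con = controlled_always[OF t]
  show yt: "0 < y t" by (rule controlledD(1)[OF con]) (use t in auto)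
  have zM: "\<bar>z t\<bar> * (1 + t) \<le> M" by (rule controlledD(2)[OF con]) (use t in auto)
  then have "\<bar>z t\<bar> * (1 + t) * y t \<le> M * y t" using yt by (simp add: mult_right_mono)
  then show "\<bar>h t\<bar> * (1 + t) \<le> M * y t" using yt by (simp add: z_def)
  show "a t \<le> PB * y t" using P_decreasing[OF con] yt by (simp add: pos_divide_le_eq)
  show "y t powr (\<gamma> - 1) * a t * (1 + t) powr (p + 1) \<le> WB" by (rule a_decay[OF con])
  have "q t * y t powr (-(\<gamma> + 1)) * (1 + t) powr (1 - p) * y t powr (\<gamma> + 1) \<le> QB * y t powr (\<gamma> + 1)"
    by (rule mult_right_mono[OF q_decay[OF con]]) simp
  moreover have "q t * y t powr (-(\<gamma> + 1)) * (1 + t) powr (1 - p) * y t powr (\<gamma> + 1)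
      = q t * (1 + t) powr (1 - p) * (y t powr (-(\<gamma> + 1)) * y t powr (\<gamma> + 1))" by simp
  moreover have "y t powr (-(\<gamma> + 1)) * y t powr (\<gamma> + 1) = 1" using yt by (simp flip: powr_add)
  ultimately show "q t * (1 + t) powr (1 - p) \<le> QB * y t powr (\<gamma> + 1)" by (simp only: mult_1_right)
  \<comment> \<open>The bootstrap bound |z| \<le> M/(1+t) would give a lower rate depending on M.
    The parabolic bound gives -z \<le> C y^\<gamma> (1+t)^p, hence (y^(-\<gamma>))' \<le> 2 \<gamma>
    C (1+t)^p, and the power p + 1 results by integration.\<close>
  have zlow: "- z s \<le> (RB + PB) * (y s powr \<gamma> * (1 + s) powr p)" if s: "0 \<le> s" "s \<le> t" for s
  proof -
    note con = controlled_always[OF s(1)]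
    have ys: "0 < y s" by (rule controlledD(1)[OF con]) (use s in auto)
    have "(z s)\<^sup>2 = (h s)\<^sup>2 * (1 / (y s)\<^sup>2)" by (simp add: z_def power_divide)
    also have "\<dots> \<le> q s * a s * (1 / (y s)\<^sup>2)" by (rule mult_right_mono[OF hq[OF s(1)]]) simp
    also have "\<dots> = (q s * y s powr (-(2 * \<gamma> + 1)) * (1 + s) powr (- 2 * p)) * (a s / y s) * (y s powr \<gamma> * (1 + s) powr p)\<^sup>2"
    proof -
      have 1: "y s powr (-(2 * \<gamma> + 1)) * (y s powr \<gamma>)\<^sup>2 = 1 / y s"
        using ys by (simp add: power2_eq_square powr_minus_divide flip: powr_add)
      have 2: "(1 + s) powr (- 2 * p) * ((1 + s) powr p)\<^sup>2 = 1"
        using s by (simp add: power2_eq_square flip: powr_add)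
      have "(q s * y s powr (-(2 * \<gamma> + 1)) * (1 + s) powr (- 2 * p)) * (a s / y s) * (y s powr \<gamma> * (1 + s) powr p)\<^sup>2
        = q s * (a s / y s) * (y s powr (-(2 * \<gamma> + 1)) * (y s powr \<gamma>)\<^sup>2) * ((1 + s) powr (- 2 * p) * ((1 + s) powr p)\<^sup>2)"
        unfolding power_mult_distrib by (simp only: mult.assoc mult.commute mult.left_commute)
      then show ?thesis unfolding 1 2 by (simp add: power2_eq_square)
    qed
    also have "\<dots> \<le> RB * PB * (y s powr \<gamma> * (1 + s) powr p)\<^sup>2"
      by (intro mult_right_mono mult_mono q_parabolic[OF con] P_decreasing[OF con])
        (use bounds_nonneg an[OF s(1)] ys in auto)
    also have "\<dots> \<le> (RB + PB)\<^sup>2 * (y s powr \<gamma> * (1 + s) powr p)\<^sup>2"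
    proof (rule mult_right_mono)
      show "RB * PB \<le> (RB + PB)\<^sup>2"
        using bounds_nonneg mult_nonneg_nonneg[of RB PB] zero_le_power2[of RB] zero_le_power2[of PB]
        unfolding power2_sum by linarith
    qed simp
    finally have "(- z s)\<^sup>2 \<le> ((RB + PB) * (y s powr \<gamma> * (1 + s) powr p))\<^sup>2" by (simp add: power_mult_distrib)
    then show ?thesis by (rule power2_le_imp_le) (use bounds_nonneg in simp)
  qed
  define K where "K = 2 * \<gamma> * (RB + PB)"
  have K0: "0 \<le> K" using gam bounds_nonneg by (simp add: K_def)
  have "y t powr (-\<gamma>) - K * (1 + t) powr (p + 1) \<le> y 0 powr (-\<gamma>) - K * (1 + 0) powr (p + 1)"
  proof (rule nonincreasing_within[OF t])
    fix s assume s: "0 \<le> s" "s \<le> t"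
    have ys: "0 < y s" by (rule controlledD(1)[OF con s])
    show "((\<lambda>t. y t powr (-\<gamma>) - K * (1 + t) powr (p + 1)) has_real_derivative
        - \<gamma> * y s powr (-\<gamma>) * (2 * z s) - K * ((p + 1) * (1 + s) powr (p + 1 - 1))) (at s within {0..t})"
      by (rule DERIV_diff[OF der_within[OF y_powr_deriv[OF s(1) ys] t] DERIV_cmult[OF has_real_derivative_one_add_powr[OF s(1)]]])
    have "2 * \<gamma> * y s powr (-\<gamma>) * (- z s) \<le> 2 * \<gamma> * y s powr (-\<gamma>) * ((RB + PB) * (y s powr \<gamma> * (1 + s) powr p))"
      by (rule mult_left_mono[OF zlow[OF s]]) (use gam in simp)
    also have "\<dots> = K * (1 + s) powr p * (y s powr (-\<gamma>) * y s powr \<gamma>)" by (simp add: K_def)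
    also have "y s powr (-\<gamma>) * y s powr \<gamma> = 1" using ys by (simp flip: powr_add)
    finally have 1: "2 * \<gamma> * y s powr (-\<gamma>) * (- z s) \<le> K * (1 + s) powr p" by simp
    have "K * (1 + s) powr p * 1 \<le> K * (1 + s) powr p * (p + 1)"
      by (rule mult_left_mono) (use p K0 in auto)
    then show "- \<gamma> * y s powr (-\<gamma>) * (2 * z s) - K * ((p + 1) * (1 + s) powr (p + 1 - 1)) \<le> 0"
      using 1 by (simp add: algebra_simps)
  qed
  then have 1: "y t powr (-\<gamma>) \<le> y 0 powr (-\<gamma>) + K * (1 + t) powr (p + 1)" using K0 by simp
  have 2: "y 0 powr (-\<gamma>) \<le> Ylo powr (-\<gamma>)"
    using Ylo gam by (intro powr_mono2') auto
  have "Ylo powr (-\<gamma>) * 1 \<le> Ylo powr (-\<gamma>) * (1 + t) powr (p + 1)"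
    by (rule mult_left_mono) (use t p in \<open>auto intro: ge_one_powr_ge_zero\<close>)
  then have "y t powr (-\<gamma>) \<le> Ylo powr (-\<gamma>) * (1 + t) powr (p + 1) + K * (1 + t) powr (p + 1)"
    using 1 2 by linarith
  then show "y t powr (-\<gamma>) \<le> (Ylo powr (-\<gamma>) + 2 * \<gamma> * (RB + PB)) * (1 + t) powr (p + 1)"
    by (simp add: distrib_right K_def)
  have "W t * (1 + t) powr (p + 1) \<le> M" by (rule controlledD(3)[OF con]) (use t in auto)
  moreover have Wn: "\<epsilon> * nu t \<le> W t" using yt an[OF t] by (simp add: W_def)
  moreover have "\<epsilon> * nu t * 1 \<le> \<epsilon> * nu t * (1 + t) powr (p + 1)"
    by (rule mult_left_mono) (use t p nu_nonneg[OF t] eps in \<open>auto intro: ge_one_powr_ge_zero\<close>)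
  moreover have "\<epsilon> * nu t * (1 + t) powr (p + 1) \<le> W t * (1 + t) powr (p + 1)"
    by (rule mult_right_mono[OF Wn]) simp
  ultimately have nuM: "\<epsilon> * nu t \<le> M" by linarith
  have zM': "\<bar>z t\<bar> \<le> M"
  proof -
    have "\<bar>z t\<bar> * 1 \<le> \<bar>z t\<bar> * (1 + t)" by (rule mult_left_mono) (use t in auto)
    then show ?thesis using zM by linarith
  qed
  then have "(z t)\<^sup>2 \<le> M\<^sup>2" using bounds_nonneg by (simp flip: abs_le_square_iff)
  then have "\<epsilon> * (z t)\<^sup>2 \<le> \<epsilon> * M\<^sup>2" using eps by simp
  then have "(\<epsilon> * nu t + \<epsilon> * (z t)\<^sup>2) * y t \<le> (\<epsilon> * M\<^sup>2 + M) * y t"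
    using nuM yt by (intro mult_right_mono) auto
  moreover have "(\<epsilon> * nu t + \<epsilon> * (z t)\<^sup>2) * y t = \<epsilon> * d t"
    using yt by (simp add: nu_def z_def field_simps power2_eq_square)
  ultimately show "\<epsilon> * d t \<le> (\<epsilon> * M\<^sup>2 + M) * y t" by simp
qed

end

section \<open>Ordinary differential equations\<close>

lemma at_within_halfline: "0 \<le> t \<Longrightarrow> t < T \<Longrightarrow> at t within {0..T} = at t within {0..}" for t :: real
  by (rule at_within_nhd[of t "{..<T}"]) auto

lemma continuous_on_halfline:
  fixes f :: "real \<Rightarrow> 'b::topological_space"
  assumes "\<And>T. 0 \<le> T \<Longrightarrow> continuous_on {0..T} f"
  shows "continuous_on {0..} f"
  unfolding continuous_on_eq_continuous_within
proof
  fix t :: real assume "t \<in> {0..}"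
  then have t: "0 \<le> t" by simp
  have "continuous (at t within {0..t + 1}) f"
    using assms[of "t + 1"] t by (simp add: continuous_on_eq_continuous_within)
  then show "continuous (at t within {0..}) f" using at_within_halfline[of t "t + 1"] t by simp
qed

text \<open>In the supremum norm weighted by exp(-2 K t) the integral operator contracts by 1/2 on
  intervals of any length, so the iterates converge on the whole half line and no continuation
  argument arises.\<close>

lemma picard_global:
  fixes \<Phi> :: "real \<Rightarrow> 'b::banach \<Rightarrow> 'b"
  assumes K: "0 < K" and lip: "\<And>t x y. 0 \<le> t \<Longrightarrow> norm (\<Phi> t x - \<Phi> t y) \<le> K * norm (x - y)"
    and cont: "\<And>X. continuous_on {0..} X \<Longrightarrow> continuous_on {0..} (\<lambda>t. \<Phi> t (X t))"
  obtains X where "X 0 = x0" "\<And>t. 0 \<le> t \<Longrightarrow> (X has_vector_derivative \<Phi> t (X t)) (at t within {0..})"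
proof -
  define X where "X = rec_nat (\<lambda>t::real. x0) (\<lambda>n f t. x0 + integral {0..t} (\<lambda>s. \<Phi> s (f s)))"
  have X0: "X 0 t = x0" for t by (simp add: X_def)
  have XS: "X (Suc n) t = x0 + integral {0..t} (\<lambda>s. \<Phi> s (X n s))" for n t by (simp add: X_def)
  have cont': "continuous_on {0..T} (\<lambda>t. \<Phi> t (f t))" if "continuous_on {0..} f" for f and T :: real
    by (rule continuous_on_subset[OF cont[OF that]]) auto
  have contX: "continuous_on {0..} (X n)" for n
  proof (induction n)
    case 0
    show ?case by (simp add: X0[abs_def])
  next
    case (Suc n)
    show ?case
    proof (rule continuous_on_halfline)
      fix T :: real assume "0 \<le> T"
      have "(\<lambda>s. \<Phi> s (X n s)) integrable_on {0..T}"
        by (rule integrable_continuous_interval[OF cont'[OF Suc]])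
      then show "continuous_on {0..T} (X (Suc n))"
        unfolding XS[abs_def] by (intro continuous_intros indefinite_integral_continuous_1)
    qed
  qed
  have int: "(\<lambda>s. \<Phi> s (f s)) integrable_on {0..t}" if "continuous_on {0..} f" for f t
    by (rule integrable_continuous_interval[OF cont'[OF that]])
  have bound: "\<exists>C. \<forall>n. \<forall>t\<in>{0..T}. norm (X (Suc n) t - X n t) \<le> C * (1/2) ^ n * exp (2 * K * t)" for T :: real
  proof -
    have "continuous_on {0..T} (\<lambda>t. X 1 t - X 0 t)"
      by (intro continuous_intros continuous_on_subset[OF contX]) auto
    then have "bounded ((\<lambda>t. X 1 t - X 0 t) ` {0..T})"
      by (intro compact_imp_bounded compact_continuous_image) auto
    then obtain C where C: "0 < C" "\<And>t. t \<in> {0..T} \<Longrightarrow> norm (X 1 t - X 0 t) \<le> C"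
      unfolding bounded_pos by auto
    have "norm (X (Suc n) t - X n t) \<le> C * (1/2) ^ n * exp (2 * K * t)" if "t \<in> {0..T}" for n t
      using that
    proof (induction n arbitrary: t)
      case 0
      have "C * 1 \<le> C * exp (2 * K * t)" using C 0 K by (intro mult_left_mono) auto
      then show ?case using C(2)[OF 0] by simp
    next
      case (Suc n)
      let ?c = "C * (1/2) ^ n"
      have t: "0 \<le> t" using Suc by simp
      \<comment> \<open>The majorant integrates exactly to half of itself; this is the contraction
        factor.\<close>
      have I: "((\<lambda>s. K * (?c * exp (2 * K * s))) has_integral ?c / 2 * exp (2 * K * t) - ?c / 2 * exp (2 * K * 0)) {0..t}"
      proof (rule fundamental_theorem_of_calculus[OF t])
        fix s assume "s \<in> {0..t}"
        have "((\<lambda>s. ?c / 2 * exp (2 * K * s)) has_real_derivative K * (?c * exp (2 * K * s))) (at s within {0..t})"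
          by (auto intro!: derivative_eq_intros)
        then show "((\<lambda>s. ?c / 2 * exp (2 * K * s)) has_vector_derivative K * (?c * exp (2 * K * s))) (at s within {0..t})"
          by (simp add: has_real_derivative_iff_has_vector_derivative)
      qed
      have "X (Suc (Suc n)) t - X (Suc n) t = integral {0..t} (\<lambda>s. \<Phi> s (X (Suc n) s) - \<Phi> s (X n s))"
        unfolding XS[of "Suc n" t] XS[of n t] integral_diff[OF int[OF contX] int[OF contX]] by simp
      also have "norm \<dots> \<le> integral {0..t} (\<lambda>s. K * (?c * exp (2 * K * s)))"
      proof (rule integral_norm_bound_integral)
        show "(\<lambda>s. \<Phi> s (X (Suc n) s) - \<Phi> s (X n s)) integrable_on {0..t}"
          by (intro integrable_diff int contX)
        show "(\<lambda>s. K * (?c * exp (2 * K * s))) integrable_on {0..t}" using I by blast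
        fix s assume s: "s \<in> {0..t}"
        have "norm (\<Phi> s (X (Suc n) s) - \<Phi> s (X n s)) \<le> K * norm (X (Suc n) s - X n s)" using s by (intro lip) auto
        also have "\<dots> \<le> K * (?c * exp (2 * K * s))"
          by (rule mult_left_mono[OF Suc.IH]) (use s Suc.prems K in auto)
        finally show "norm (\<Phi> s (X (Suc n) s) - \<Phi> s (X n s)) \<le> K * (?c * exp (2 * K * s))" .
      qed
      also have "\<dots> = ?c / 2 * exp (2 * K * t) - ?c / 2" using integral_unique[OF I] by simp
      also have "\<dots> \<le> C * (1/2) ^ Suc n * exp (2 * K * t)" using C by simp
      finally show ?case .
    qed
    then show ?thesis by blast
  qed
  define Y where "Y t = x0 + (\<Sum>i. X (Suc i) t - X i t)" for t
  have unif: "uniform_limit {0..T} X Y sequentially" for T :: real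
  proof -
    obtain C where C: "\<And>n t. t \<in> {0..T} \<Longrightarrow> norm (X (Suc n) t - X n t) \<le> C * (1/2) ^ n * exp (2 * K * t)"
      using bound by blast
    have "uniform_limit {0..T} (\<lambda>n t. \<Sum>i<n. X (Suc i) t - X i t) (\<lambda>t. \<Sum>i. X (Suc i) t - X i t) sequentially"
    proof (rule Weierstrass_m_test)
      fix n t assume t: "t \<in> {0..T}"
      have "0 \<le> C * (1/2) ^ n * exp (2 * K * t)" using C[OF t, of n] norm_ge_zero order_trans by blast
      then have "0 \<le> C * (1/2) ^ n" by (simp add: zero_le_mult_iff)
      then have "C * (1/2) ^ n * exp (2 * K * t) \<le> C * (1/2) ^ n * exp (2 * K * T)"
        using t K by (intro mult_left_mono) auto
      then show "norm (X (Suc n) t - X n t) \<le> C * exp (2 * K * T) * (1/2) ^ n"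
        using C[OF t, of n] by (simp add: mult.commute mult.left_commute)
    qed (simp add: summable_mult summable_geometric)
    then have "uniform_limit {0..T} (\<lambda>n t. x0 + (\<Sum>i<n. X (Suc i) t - X i t)) Y sequentially"
      unfolding Y_def by (intro uniform_limit_add uniform_limit_const)
    moreover have "x0 + (\<Sum>i<n. X (Suc i) t - X i t) = X n t" for n t
      using sum_lessThan_telescope[of "\<lambda>i. X i t" n] X0 by simp
    ultimately show ?thesis by simp
  qed
  have contY: "continuous_on {0..} Y"
  proof (rule continuous_on_halfline)
    fix T :: real
    show "continuous_on {0..T} Y"
      by (rule uniform_limit_theorem[OF _ unif])
        (auto intro!: always_eventually continuous_on_subset[OF contX])
  qed
  have lim: "(\<lambda>n. X n t) \<longlonglongrightarrow> Y t" if "0 \<le> t" for t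
    using tendsto_uniform_limitI[OF unif[of t]] that by simp
  have eq: "Y t = x0 + integral {0..t} (\<lambda>s. \<Phi> s (Y s))" if t: "0 \<le> t" for t
  proof (rule LIMSEQ_unique[OF LIMSEQ_Suc[OF lim[OF t]]])
    show "(\<lambda>n. X (Suc n) t) \<longlonglongrightarrow> x0 + integral {0..t} (\<lambda>s. \<Phi> s (Y s))"
    proof (rule LIMSEQ_I)
      fix e :: real assume e: "0 < e"
      \<comment> \<open>The denominator has t + 1 rather than t so that t = 0 is included and the
        final inequality is strict.\<close>
      define e' where "e' = e / (K * (t + 1))"
      have e': "0 < e'" using e K t by (simp add: e'_def)
      have "\<forall>\<^sub>F n in sequentially. \<forall>s\<in>{0..t}. dist (X n s) (Y s) < e'" using unif e' by (rule uniform_limitD)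
      then obtain N where N: "\<And>n s. n \<ge> N \<Longrightarrow> s \<in> {0..t} \<Longrightarrow> dist (X n s) (Y s) < e'"
        unfolding eventually_sequentially by blast
      show "\<exists>N. \<forall>n\<ge>N. norm (X (Suc n) t - (x0 + integral {0..t} (\<lambda>s. \<Phi> s (Y s)))) < e"
      proof (intro exI allI impI)
        fix n assume n: "N \<le> n"
        have "X (Suc n) t - (x0 + integral {0..t} (\<lambda>s. \<Phi> s (Y s))) = integral {0..t} (\<lambda>s. \<Phi> s (X n s) - \<Phi> s (Y s))"
          unfolding XS by (simp add: integral_diff int contX contY)
        also have "norm \<dots> \<le> (K * e') * (t - 0)"
        proof (rule integral_bound[OF t])
          show "continuous_on {0..t} (\<lambda>s. \<Phi> s (X n s) - \<Phi> s (Y s))"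
            by (intro continuous_on_diff cont' contX contY)
          fix s assume s: "s \<in> {0..t}"
          have "norm (\<Phi> s (X n s) - \<Phi> s (Y s)) \<le> K * norm (X n s - Y s)" using s by (intro lip) auto
          also have "\<dots> \<le> K * e'" using N[OF n s] K by (intro mult_left_mono) (auto simp: dist_norm)
          finally show "norm (\<Phi> s (X n s) - \<Phi> s (Y s)) \<le> K * e'" .
        qed
        also have "\<dots> = e * (t / (t + 1))"
        proof -
          have "K * e' = e / (t + 1)" using K t by (simp add: e'_def)
          then show ?thesis by simp
        qed
        also have "\<dots> < e * 1" using e t by (intro mult_strict_left_mono) auto
        finally show "norm (X (Suc n) t - (x0 + integral {0..t} (\<lambda>s. \<Phi> s (Y s)))) < e" by simp
      qed
    qed
  qed
  show ?thesis
  proof (rule that[of Y])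
    show "Y 0 = x0" using eq[of 0] by simp
    fix t :: real assume t: "0 \<le> t"
    have "((\<lambda>t. integral {0..t} (\<lambda>s. \<Phi> s (Y s))) has_vector_derivative \<Phi> t (Y t)) (at t within {0..t + 1})"
      by (rule integral_has_vector_derivative[OF cont'[OF contY]]) (use t in auto)
    from has_vector_derivative_add[OF has_vector_derivative_const this, of x0]
    have "((\<lambda>t. x0 + integral {0..t} (\<lambda>s. \<Phi> s (Y s))) has_vector_derivative \<Phi> t (Y t)) (at t within {0..})"
      using at_within_halfline[of t "t + 1"] t by simp
    then show "(Y has_vector_derivative \<Phi> t (Y t)) (at t within {0..})"
      by (rule has_vector_derivative_transform[rotated 2]) (use t eq in auto)
  qed
qed

text \<open>The sort of \<open>'a\<close> below does not include \<^class>\<open>banach\<close>, which the integral in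
  \<open>picard_global\<close> needs; so the equation is solved in the dual, which is isometric to
  \<open>'a\<close> by the Riesz representation.\<close>

lemma blinfun_inner_right_bij:
  "bij (blinfun_inner_right :: 'a::{real_inner,complete_space} \<Rightarrow> _)"
proof (rule bijI)
  show "inj (blinfun_inner_right :: 'a \<Rightarrow> _)"
  proof (rule injI)
    fix x y :: 'a assume "blinfun_inner_right x = blinfun_inner_right y"
    then have "inner x (x - y) = inner y (x - y)" by (metis blinfun_inner_right.rep_eq)
    then have "inner (x - y) (x - y) = 0" by (simp add: inner_diff_left)
    then show "x = y" by simp
  qed
  show "surj (blinfun_inner_right :: 'a \<Rightarrow> _)"
  proof (rule surjI)
    fix f :: "'a \<Rightarrow>\<^sub>L real"
    obtain z where "\<And>x. blinfun_apply f x = inner x z"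
      by (rule riesz_representation[OF blinfun.bounded_linear_right[of f]], rule that)
    then have "blinfun_inner_right z = f"
      by (intro blinfun_eqI) (simp add: blinfun_inner_right.rep_eq inner_commute)
    then show "blinfun_inner_right (SOME z. blinfun_inner_right z = f) = f" by (rule someI)
  qed
qed

lemma norm_blinfun_inner_right: "norm (blinfun_inner_right x) = norm x"
proof (rule antisym)
  show "norm (blinfun_inner_right x) \<le> norm x"
    by (rule norm_blinfun_bound) (simp_all add: blinfun_inner_right.rep_eq Cauchy_Schwarz_ineq2)
  have "norm x * norm x = \<bar>blinfun_apply (blinfun_inner_right x) x\<bar>"
    by (simp add: blinfun_inner_right.rep_eq norm_eq_sqrt_inner)
  also have "\<dots> \<le> norm (blinfun_inner_right x) * norm x" using norm_blinfun[of "blinfun_inner_right x" x] by simp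
  finally show "norm x \<le> norm (blinfun_inner_right x)" by (cases "x = 0") auto
qed

lemma second_order_ode:
  fixes G :: "'a::{real_inner,complete_space} \<Rightarrow> 'a"
  assumes "0 \<le> K" and lip: "\<And>x y. norm (G x - G y) \<le> K * norm (x - y)"
    and \<beta>: "continuous_on {0..} \<beta>" "\<And>t. 0 \<le> t \<Longrightarrow> \<bar>\<beta> t\<bar> \<le> 1" and \<epsilon>: "0 < \<epsilon>"
  obtains u v where "u 0 = u0" "v 0 = u1"
    "\<And>t. 0 \<le> t \<Longrightarrow> (u has_vector_derivative v t) (at t within {0..})"
    "\<And>t. 0 \<le> t \<Longrightarrow> (v has_vector_derivative (- (1 / \<epsilon>)) *\<^sub>R (\<beta> t *\<^sub>R v t + G (u t))) (at t within {0..})"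
proof -
  let ?i = "blinfun_inner_right :: 'a \<Rightarrow> _"
  \<comment> \<open>r identifies a functional with the vector representing it; being an isometry, it
    transports the Lipschitz bound and derivatives unchanged.\<close>
  define r where "r = inv ?i"
  have ri: "r (?i x) = x" for x by (simp add: r_def inv_f_f[OF bij_is_inj[OF blinfun_inner_right_bij]])
  have ir: "?i (r f) = f" for f by (simp add: r_def surj_f_inv_f[OF bij_is_surj[OF blinfun_inner_right_bij]])
  have ibl: "bounded_linear ?i" by (rule bounded_linear_blinfun_inner_right)
  have idiff: "?i (x - y) = ?i x - ?i y" for x y by (rule linear_diff[OF bounded_linear.linear[OF ibl]])
  have nr: "norm (r f) = norm f" for f using norm_blinfun_inner_right[of "r f"] ir by simp
  have rbl: "bounded_linear r"
  proof (rule bounded_linear_intro[where K = 1])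
    show "r (f + g) = r f + r g" for f g
      by (metis ri ir linear_add[OF bounded_linear.linear[OF ibl]])
    show "r (c *\<^sub>R f) = c *\<^sub>R r f" for c f
      by (metis ri ir linear_scale[OF bounded_linear.linear[OF ibl]])
  qed (simp add: nr)
  have rdiff: "r (f - g) = r f - r g" for f g by (rule linear_diff[OF bounded_linear.linear[OF rbl]])
  define \<Psi> where "\<Psi> t x w = (- (1 / \<epsilon>)) *\<^sub>R (\<beta> t *\<^sub>R w + G x)" for t x w
  define \<Phi> where "\<Phi> t X = (snd X, ?i (\<Psi> t (r (fst X)) (r (snd X))))" for t X
  have lipPsi: "norm (\<Psi> t x w - \<Psi> t x' w') \<le> (1 / \<epsilon>) * (norm (w - w') + K * norm (x - x'))" if "0 \<le> t" for t x w x' w'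
  proof -
    have "\<Psi> t x w - \<Psi> t x' w' = (- (1 / \<epsilon>)) *\<^sub>R (\<beta> t *\<^sub>R (w - w') + (G x - G x'))"
      unfolding \<Psi>_def by (simp add: algebra_simps)
    then have "norm (\<Psi> t x w - \<Psi> t x' w') = (1 / \<epsilon>) * norm (\<beta> t *\<^sub>R (w - w') + (G x - G x'))"
      using \<epsilon> by simp
    also have "\<dots> \<le> (1 / \<epsilon>) * (norm (w - w') + K * norm (x - x'))"
    proof (rule mult_left_mono)
      have "norm (\<beta> t *\<^sub>R (w - w')) \<le> 1 * norm (w - w')"
        using \<beta>(2)[OF that] by (simp add: mult_left_le_one_le)
      then show "norm (\<beta> t *\<^sub>R (w - w') + (G x - G x')) \<le> norm (w - w') + K * norm (x - x')"
        using norm_triangle_ineq[of "\<beta> t *\<^sub>R (w - w')" "G x - G x'"] lip[of x x'] by simp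
    qed (use \<epsilon> in simp)
    finally show ?thesis .
  qed
  have "K-lipschitz_on UNIV G"
    by (rule lipschitz_onI) (use lip \<open>0 \<le> K\<close> in \<open>auto simp: dist_norm\<close>)
  then have contG: "continuous_on UNIV G" by (rule lipschitz_on_continuous_on)
  define K' where "K' = 1 + (1 / \<epsilon>) * (1 + K)"
  obtain X where X: "X 0 = (?i u0, ?i u1)"
    "\<And>t. 0 \<le> t \<Longrightarrow> (X has_vector_derivative \<Phi> t (X t)) (at t within {0..})"
  proof (rule picard_global[of K' \<Phi> "(?i u0, ?i u1)"])
    show "0 < K'" using \<epsilon> \<open>0 \<le> K\<close> by (simp add: K'_def add_pos_nonneg)
    fix t :: real and X Y :: "('a \<Rightarrow>\<^sub>L real) \<times> ('a \<Rightarrow>\<^sub>L real)" assume t: "0 \<le> t"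
    have nn: "norm (snd (X - Y)) \<le> norm (X - Y)" "norm (fst (X - Y)) \<le> norm (X - Y)"
      using norm_snd_le[of "snd (X - Y)" "fst (X - Y)"] norm_fst_le[of "fst (X - Y)" "snd (X - Y)"]
      by (simp_all only: prod.collapse)
    let ?d = "\<Psi> t (r (fst X)) (r (snd X)) - \<Psi> t (r (fst Y)) (r (snd Y))"
    have "\<Phi> t X - \<Phi> t Y = (snd (X - Y), ?i ?d)" by (simp add: \<Phi>_def idiff)
    then have "norm (\<Phi> t X - \<Phi> t Y) \<le> norm (snd (X - Y)) + norm ?d"
      using norm_Pair_le[of "snd (X - Y)" "?i ?d"] by (simp add: norm_blinfun_inner_right)
    also have "\<dots> \<le> norm (X - Y) + (1 / \<epsilon>) * (norm (X - Y) + K * norm (X - Y))"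
    proof (rule add_mono[OF nn(1)])
      have "norm ?d \<le> (1 / \<epsilon>) * (norm (r (snd X) - r (snd Y)) + K * norm (r (fst X) - r (fst Y)))"
        by (rule lipPsi[OF t])
      also have "\<dots> = (1 / \<epsilon>) * (norm (snd (X - Y)) + K * norm (fst (X - Y)))"
        unfolding rdiff[symmetric] nr by simp
      also have "\<dots> \<le> (1 / \<epsilon>) * (norm (X - Y) + K * norm (X - Y))"
        using \<epsilon> \<open>0 \<le> K\<close> by (intro mult_left_mono add_mono nn) auto
      finally show "norm ?d \<le> (1 / \<epsilon>) * (norm (X - Y) + K * norm (X - Y))" .
    qed
    also have "\<dots> = K' * norm (X - Y)" by (simp add: K'_def algebra_simps add_divide_distrib)
    finally show "norm (\<Phi> t X - \<Phi> t Y) \<le> K' * norm (X - Y)" .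
  next
    fix X :: "real \<Rightarrow> ('a \<Rightarrow>\<^sub>L real) \<times> ('a \<Rightarrow>\<^sub>L real)" assume cX: "continuous_on {0..} X"
    have 1: "continuous_on {0..} (\<lambda>t. r (fst (X t)))" "continuous_on {0..} (\<lambda>t. r (snd (X t)))"
      by (intro bounded_linear.continuous_on[OF rbl] continuous_on_fst continuous_on_snd cX)+
    have 2: "continuous_on {0..} (\<lambda>t. G (r (fst (X t))))"
      by (rule continuous_on_compose2[OF contG 1(1)]) simp
    show "continuous_on {0..} (\<lambda>t. \<Phi> t (X t))"
      unfolding \<Phi>_def \<Psi>_def
      by (intro continuous_on_Pair continuous_on_snd cX bounded_linear.continuous_on[OF ibl]
          continuous_on_scaleR continuous_on_const continuous_on_add \<beta>(1) 1 2)
  qed (rule that)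
  show ?thesis
  proof (rule that[of "\<lambda>t. r (fst (X t))" "\<lambda>t. r (snd (X t))"])
    show "r (fst (X 0)) = u0" "r (snd (X 0)) = u1" by (simp_all add: X(1) ri)
    fix t :: real assume t: "0 \<le> t"
    show "((\<lambda>t. r (fst (X t))) has_vector_derivative r (snd (X t))) (at t within {0..})"
      using bounded_linear.has_vector_derivative[OF rbl bounded_linear.has_vector_derivative[OF bounded_linear_fst X(2)[OF t]]]
      by (simp add: \<Phi>_def)
    show "((\<lambda>t. r (snd (X t))) has_vector_derivative
        (- (1 / \<epsilon>)) *\<^sub>R (\<beta> t *\<^sub>R r (snd (X t)) + G (r (fst (X t))))) (at t within {0..})"
      using bounded_linear.has_vector_derivative[OF rbl bounded_linear.has_vector_derivative[OF bounded_linear_snd X(2)[OF t]]]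
      by (simp add: \<Phi>_def ri \<Psi>_def)
  qed
qed

section \<open>The equation with a bounded operator\<close>

lemma has_real_derivative_inner:
  assumes "(f has_vector_derivative f') (at t within S)" "(g has_vector_derivative g') (at t within S)"
  shows "((\<lambda>t. inner (f t) (g t)) has_real_derivative inner f' (g t) + inner (f t) g') (at t within S)"
proof -
  have "((\<lambda>t. inner (f t) (g t)) has_vector_derivative inner (f t) g' + inner f' (g t)) (at t within S)"
    by (rule bounded_bilinear.has_vector_derivative[OF bounded_bilinear_inner assms])
  then show ?thesis by (simp add: has_real_derivative_iff_has_vector_derivative add.commute)
qed

locale bounded_form =
  fixes L :: "'a::{real_inner,complete_space} \<Rightarrow> 'a"
  assumes bl: "bounded_linear L" and sym: "inner (L x) y = inner x (L y)" and nn: "0 \<le> inner (L x) x"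
begin

text \<open>The set S is a parameter because, while the a priori bound is still being proved, the
  truncated equation coincides with this one on an interval {0..T} only.\<close>

definition flow :: "real \<Rightarrow> real \<Rightarrow> real \<Rightarrow> real set \<Rightarrow> (real \<Rightarrow> 'a) \<Rightarrow> (real \<Rightarrow> 'a) \<Rightarrow> bool" where
  "flow \<epsilon> p \<gamma> S u v \<longleftrightarrow> (\<forall>t\<in>S. (u has_vector_derivative v t) (at t within S) \<and>
     (v has_vector_derivative (- (1 / \<epsilon>)) *\<^sub>R ((1 + t) powr (-p) *\<^sub>R v t
        + inner (L (u t)) (u t) powr \<gamma> *\<^sub>R L (u t))) (at t within S))"

lemma flow_weak_energy:
  assumes fl: "flow \<epsilon> p \<gamma> S u v" and "0 < \<epsilon>" "\<epsilon> \<le> 1/8" "0 \<le> p" "p \<le> 1" "1 \<le> \<gamma>"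
    and "\<And>t. t \<in> S \<Longrightarrow> 0 \<le> t" "\<And>t. t \<in> S \<Longrightarrow> {0..t} \<subseteq> S"
  shows "weak_energy \<epsilon> p \<gamma> S (\<lambda>t. inner (L (u t)) (u t)) (\<lambda>t. inner (L (u t)) (v t))
     (\<lambda>t. inner (v t) (v t)) (\<lambda>t. inner (u t) (v t)) (\<lambda>t. inner (u t) (u t))"
proof (unfold_locales; (fact assms)?)
  fix t assume t: "t \<in> S"
  have u': "(u has_vector_derivative v t) (at t within S)" and
    v': "(v has_vector_derivative (- (1 / \<epsilon>)) *\<^sub>R ((1 + t) powr (-p) *\<^sub>R v t
        + inner (L (u t)) (u t) powr \<gamma> *\<^sub>R L (u t))) (at t within S)"
    using fl t by (auto simp: flow_def)
  have Lu': "((\<lambda>t. L (u t)) has_vector_derivative L (v t)) (at t within S)"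
    by (rule bounded_linear.has_vector_derivative[OF bl u'])
  show "((\<lambda>t. inner (L (u t)) (u t)) has_real_derivative 2 * inner (L (u t)) (v t)) (at t within S)"
    using has_real_derivative_inner[OF Lu' u'] sym[of "v t" "u t"] by (simp add: inner_commute)
  show "((\<lambda>t. inner (v t) (v t)) has_real_derivative - (2 / \<epsilon>) * ((1 + t) powr (-p) * inner (v t) (v t)
      + inner (L (u t)) (u t) powr \<gamma> * inner (L (u t)) (v t))) (at t within S)"
    using has_real_derivative_inner[OF v' v'] by (simp add: inner_add inner_commute algebra_simps add_divide_distrib)
  show "((\<lambda>t. inner (u t) (v t)) has_real_derivative inner (v t) (v t) - (1 / \<epsilon>) * ((1 + t) powr (-p) * inner (u t) (v t)
      + inner (L (u t)) (u t) powr \<gamma> * inner (L (u t)) (u t))) (at t within S)"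
    using has_real_derivative_inner[OF u' v'] by (simp add: inner_add inner_commute algebra_simps add_divide_distrib)
  show "((\<lambda>t. inner (u t) (u t)) has_real_derivative 2 * inner (u t) (v t)) (at t within S)"
    using has_real_derivative_inner[OF u' u'] by (simp add: inner_commute)
  show "(inner (u t) (v t))\<^sup>2 \<le> inner (u t) (u t) * inner (v t) (v t)" by (rule Cauchy_Schwarz_ineq)
qed (simp_all add: nn)

lemma flow_strong_energy:
  assumes fl: "flow \<epsilon> p \<gamma> {0..} u v" and par: "0 < \<epsilon>" "\<epsilon> \<le> 1/8" "0 \<le> p" "p \<le> 1" "1 \<le> \<gamma>"
    and init: "0 < Ylo" "Ylo \<le> inner (L (u 0)) (u 0)" "inner (L (u 0)) (u 0) \<le> Yhi"
      "inner (L (u 0)) (L (u 0)) \<le> A0" "inner (L (v 0)) (v 0) \<le> D0" "inner (v 0) (v 0) \<le> Q0"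
      "M = z_bound \<gamma> Ylo Yhi A0 D0 Q0" "\<epsilon> * (10 * \<gamma> * M + 10) \<le> 1"
  shows "strong_energy \<epsilon> p \<gamma> (\<lambda>t. inner (L (u t)) (u t)) (\<lambda>t. inner (L (u t)) (v t))
     (\<lambda>t. inner (v t) (v t)) (\<lambda>t. inner (u t) (v t)) (\<lambda>t. inner (u t) (u t))
     (\<lambda>t. inner (L (v t)) (v t)) (\<lambda>t. inner (L (u t)) (L (v t))) (\<lambda>t. inner (L (u t)) (L (u t)))
     Ylo Yhi A0 D0 Q0 M"
proof -
  interpret weak_energy \<epsilon> p \<gamma> "{0..}" "\<lambda>t. inner (L (u t)) (u t)" "\<lambda>t. inner (L (u t)) (v t)"
     "\<lambda>t. inner (v t) (v t)" "\<lambda>t. inner (u t) (v t)" "\<lambda>t. inner (u t) (u t)"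
    by (rule flow_weak_energy[OF fl par]) auto
  show ?thesis
  proof (unfold_locales; (fact init)?)
    fix t :: real assume t: "0 \<le> t"
    have u': "(u has_vector_derivative v t) (at t within {0..})" and
      v': "(v has_vector_derivative (- (1 / \<epsilon>)) *\<^sub>R ((1 + t) powr (-p) *\<^sub>R v t
        + inner (L (u t)) (u t) powr \<gamma> *\<^sub>R L (u t))) (at t within {0..})"
      using fl t by (auto simp: flow_def)
    note Lu' = bounded_linear.has_vector_derivative[OF bl u']
    note Lv' = bounded_linear.has_vector_derivative[OF bl v']
    have LL: "L ((- (1 / \<epsilon>)) *\<^sub>R (x *\<^sub>R v t + y *\<^sub>R L (u t))) = (- (1 / \<epsilon>)) *\<^sub>R (x *\<^sub>R L (v t) + y *\<^sub>R L (L (u t)))" for x y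
      by (simp only: linear_scale[OF bounded_linear.linear[OF bl]] linear_add[OF bounded_linear.linear[OF bl]])
    have k2: "inner (L (L (u t))) (v t) = inner (L (u t)) (L (v t))" by (rule sym)
    show "((\<lambda>t. inner (L (u t)) (v t)) has_real_derivative inner (L (v t)) (v t) - (1 / \<epsilon>) *
       ((1 + t) powr (-p) * inner (L (u t)) (v t) + inner (L (u t)) (u t) powr \<gamma> * inner (L (u t)) (L (u t)))) (at t within {0..})"
      using has_real_derivative_inner[OF Lu' v'] by (simp add: inner_add algebra_simps add_divide_distrib)
    show "((\<lambda>t. inner (L (v t)) (v t)) has_real_derivative - (2 / \<epsilon>) *
       ((1 + t) powr (-p) * inner (L (v t)) (v t) + inner (L (u t)) (u t) powr \<gamma> * inner (L (u t)) (L (v t)))) (at t within {0..})"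
      using has_real_derivative_inner[OF Lv' v'] unfolding LL
      by (simp add: inner_add k2 inner_commute[of "L (v t)" "L (u t)"] algebra_simps add_divide_distrib)
    show "((\<lambda>t. inner (L (u t)) (L (u t))) has_real_derivative 2 * inner (L (u t)) (L (v t))) (at t within {0..})"
      using has_real_derivative_inner[OF Lu' Lu'] by (simp add: inner_commute)
    show "(inner (L (u t)) (v t))\<^sup>2 \<le> inner (L (u t)) (u t) * inner (L (v t)) (v t)"
      by (rule form_cauchy_schwarz[OF bounded_linear.linear[OF bl] sym nn])
    show "(inner (L (u t)) (v t))\<^sup>2 \<le> inner (v t) (v t) * inner (L (u t)) (L (u t))"
      using Cauchy_Schwarz_ineq[of "L (u t)" "v t"] by (simp add: mult.commute)
  qed (simp_all add: nn)
qed

text \<open>The coefficient is Lipschitz on balls because \<gamma> \<ge> 1 and the quadratic form of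
  a bounded operator is; for negative R the ball is empty and the claim vacuous.\<close>

lemma lipschitz_on_ball:
  assumes "1 \<le> \<gamma>"
  shows "\<exists>K\<ge>0. \<forall>x y. norm x \<le> R \<longrightarrow> norm y \<le> R \<longrightarrow>
     norm (inner (L x) x powr \<gamma> *\<^sub>R L x - inner (L y) y powr \<gamma> *\<^sub>R L y) \<le> K * norm (x - y)"
proof (cases "0 \<le> R")
  case R: True
  obtain B where B: "0 < B" "\<And>x. norm (L x) \<le> norm x * B" using bounded_linear.pos_bounded[OF bl] by blast
  define Y where "Y = R * B * R"
  have Y0: "0 \<le> Y" using R B by (simp add: Y_def)
  define K where "K = Y powr \<gamma> * B + \<gamma> * Y powr (\<gamma> - 1) * (2 * (R * B)) * (R * B)"
  have yb: "inner (L x) x \<le> Y" if "norm x \<le> R" for x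
  proof -
    have "inner (L x) x \<le> norm (L x) * norm x" by (rule norm_cauchy_schwarz)
    also have "\<dots> \<le> (norm x * B) * norm x" using B(2) by (rule mult_right_mono) simp
    also have "\<dots> \<le> Y" unfolding Y_def using that B R by (intro mult_mono) auto
    finally show ?thesis .
  qed
  have ydiff: "\<bar>inner (L x) x - inner (L y) y\<bar> \<le> 2 * (R * B) * norm (x - y)" if "norm x \<le> R" "norm y \<le> R" for x y
  proof -
    have "inner (L x) x - inner (L y) y = inner (x - y) (L x + L y)"
      unfolding inner_diff_left inner_add_right
      using sym[of x y] inner_commute[of "L x" y] inner_commute[of "L x" x] inner_commute[of "L y" y] by linarith
    also have "\<bar>\<dots>\<bar> \<le> norm (x - y) * norm (L x + L y)" by (rule Cauchy_Schwarz_ineq2)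
    also have "\<dots> \<le> norm (x - y) * (2 * (R * B))"
    proof (rule mult_left_mono)
      have "norm x * B \<le> R * B" "norm y * B \<le> R * B" using that B by (auto intro: mult_right_mono)
      then show "norm (L x + L y) \<le> 2 * (R * B)"
        using norm_triangle_ineq[of "L x" "L y"] B(2)[of x] B(2)[of y] by linarith
    qed simp
    finally show ?thesis by (simp only: mult.commute[of "norm (x - y)"])
  qed
  have "norm (inner (L x) x powr \<gamma> *\<^sub>R L x - inner (L y) y powr \<gamma> *\<^sub>R L y) \<le> K * norm (x - y)"
    if xy: "norm x \<le> R" "norm y \<le> R" for x y
  proof -
    let ?a = "inner (L x) x powr \<gamma>" and ?b = "inner (L y) y powr \<gamma>"
    have "?a *\<^sub>R L x - ?b *\<^sub>R L y = ?a *\<^sub>R L (x - y) + (?a - ?b) *\<^sub>R L y"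
      using bounded_linear.linear[OF bl] by (simp add: linear_diff algebra_simps)
    then have "norm (?a *\<^sub>R L x - ?b *\<^sub>R L y) \<le> ?a * norm (L (x - y)) + \<bar>?a - ?b\<bar> * norm (L y)"
      using norm_triangle_ineq[of "?a *\<^sub>R L (x - y)" "(?a - ?b) *\<^sub>R L y"] by simp
    also have "?a * norm (L (x - y)) \<le> Y powr \<gamma> * (norm (x - y) * B)"
      using yb[OF xy(1)] nn[of x] assms by (intro mult_mono B powr_mono2) auto
    also have "\<bar>?a - ?b\<bar> * norm (L y) \<le> (\<gamma> * Y powr (\<gamma> - 1) * (2 * (R * B) * norm (x - y))) * (R * B)"
    proof (rule mult_mono)
      have "\<bar>?a - ?b\<bar> \<le> \<gamma> * Y powr (\<gamma> - 1) * \<bar>inner (L x) x - inner (L y) y\<bar>"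
        by (rule powr_diff_le[OF assms nn yb[OF xy(1)] nn yb[OF xy(2)]])
      also have "\<dots> \<le> \<gamma> * Y powr (\<gamma> - 1) * (2 * (R * B) * norm (x - y))"
        by (rule mult_left_mono[OF ydiff[OF xy]]) (use assms in simp)
      finally show "\<bar>?a - ?b\<bar> \<le> \<gamma> * Y powr (\<gamma> - 1) * (2 * (R * B) * norm (x - y))" .
      have "norm y * B \<le> R * B" using xy B by (intro mult_right_mono) auto
      then show "norm (L y) \<le> R * B" using B(2)[of y] by linarith
    qed (use assms R B in auto)
    finally show ?thesis by (simp add: K_def algebra_simps)
  qed
  moreover have "0 \<le> K" using assms R B by (simp add: K_def)
  ultimately show ?thesis by blast
next
  case False
  then have "\<not> norm x \<le> R" for x :: 'a using norm_ge_zero[of x] by linarith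
  then show ?thesis by (intro exI[of _ 0]) auto
qed

text \<open>The constant 2 is what the triangle inequality yields: moving a point onto the sphere
  costs at most the distance once more.\<close>

lemma radial_retraction_lipschitz:
  fixes x y :: 'a
  assumes "0 < R"
  defines "\<rho> \<equiv> \<lambda>x::'a. if norm x \<le> R then x else (R / norm x) *\<^sub>R x"
  shows "norm (\<rho> x) \<le> R" "norm (\<rho> x - \<rho> y) \<le> 2 * norm (x - y)"
proof -
  show "norm (\<rho> x) \<le> R" using assms(1) by (auto simp: \<rho>_def)
  have mixed: "norm (x - (R / norm y) *\<^sub>R y) \<le> 2 * norm (x - y)" if "norm x \<le> R" "R < norm y" for x y :: 'a
  proof -
    have y0: "norm y \<noteq> 0" using that assms(1) by auto
    have "y - (R / norm y) *\<^sub>R y = ((norm y - R) / norm y) *\<^sub>R y"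
      using y0 by (simp add: diff_divide_distrib scaleR_diff_left)
    then have "norm (y - (R / norm y) *\<^sub>R y) = norm y - R" using y0 that by simp
    also have "\<dots> \<le> norm (x - y)" using that norm_triangle_ineq2[of y x] by (simp add: norm_minus_commute)
    finally show ?thesis using norm_triangle_ineq[of "x - y" "y - (R / norm y) *\<^sub>R y"] by simp
  qed
  show "norm (\<rho> x - \<rho> y) \<le> 2 * norm (x - y)"
  proof -
    consider "norm x \<le> R" "norm y \<le> R" | "norm x \<le> R" "R < norm y" | "R < norm x" "norm y \<le> R" | "R < norm x" "R < norm y"
      by linarith
    then show ?thesis
    proof cases
      case 1 then show ?thesis by (simp add: \<rho>_def)
    next
      case 2 then show ?thesis using mixed[of x y] by (simp add: \<rho>_def)
    next
      case 3 then show ?thesis using mixed[of y x] by (simp add: \<rho>_def norm_minus_commute)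
    next
      case 4
      then have n: "0 < norm x" "0 < norm y" using assms(1) by linarith+
      have "(R / norm x) *\<^sub>R x - (R / norm y) *\<^sub>R y = (R / norm x) *\<^sub>R (x - y) + (R / norm x * ((norm y - norm x) / norm y)) *\<^sub>R y"
        using n by (simp add: algebra_simps diff_divide_distrib)
      then have "norm ((R / norm x) *\<^sub>R x - (R / norm y) *\<^sub>R y)
          \<le> R / norm x * norm (x - y) + R / norm x * (\<bar>norm y - norm x\<bar> / norm y) * norm y"
        using norm_triangle_ineq[of "(R / norm x) *\<^sub>R (x - y)" "(R / norm x * ((norm y - norm x) / norm y)) *\<^sub>R y"] assms(1)
        by (simp add: abs_mult)
      also have "\<dots> = R / norm x * (norm (x - y) + \<bar>norm y - norm x\<bar>)" using n by (simp add: distrib_left)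
      also have "\<dots> \<le> 1 * (norm (x - y) + norm (x - y))"
        by (rule mult_mono) (use 4 n norm_triangle_ineq3[of y x] in \<open>auto simp: norm_minus_commute\<close>)
      finally show ?thesis using 4 by (simp add: \<rho>_def)
    qed
  qed
qed

text \<open>The nonlinearity is made globally Lipschitz by composing it with the retraction onto a ball;
  the a priori bound of \<open>|u|\<close> shows that the solution never leaves that ball.\<close>

lemma flow_exists:
  assumes par: "0 < \<epsilon>" "\<epsilon> \<le> 1/8" "0 \<le> p" "p \<le> 1" "1 \<le> \<gamma>"
  obtains u v where "flow \<epsilon> p \<gamma> {0..} u v" "u 0 = u0" "v 0 = u1"
proof -
  \<comment> \<open>Eight times the bound of F 0, as in the estimate of |u|^2 by
    \<open>weak_decay\<close>. The radius satisfies R^2 = C + 1, so that estimate strictly improves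
    |u| \<le> R.\<close>
  define C where "C = 8 * (2 * inner u1 u1 + 2 * inner u0 u0 + inner (L u0) u0 powr (\<gamma> + 1))"
  have C0: "0 \<le> C" by (simp add: C_def)
  define R where "R = sqrt (C + 1)"
  have R: "0 < R" "R\<^sup>2 = C + 1" using C0 by (simp_all add: R_def)
  define \<rho> where "\<rho> x = (if norm x \<le> R then x else (R / norm x) *\<^sub>R x)" for x :: 'a
  have \<rho>: "norm (\<rho> x) \<le> R" "norm (\<rho> x - \<rho> y) \<le> 2 * norm (x - y)" for x y
    using radial_retraction_lipschitz[OF R(1)] by (simp_all add: \<rho>_def)
  define N where "N x = inner (L x) x powr \<gamma> *\<^sub>R L x" for x
  obtain K where K: "0 \<le> K" "\<And>x y. norm x \<le> R \<Longrightarrow> norm y \<le> R \<Longrightarrow> norm (N x - N y) \<le> K * norm (x - y)"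
    using lipschitz_on_ball[OF par(5), of R] unfolding N_def by blast
  have lipG: "norm (N (\<rho> x) - N (\<rho> y)) \<le> (2 * K) * norm (x - y)" for x y
  proof -
    have "norm (N (\<rho> x) - N (\<rho> y)) \<le> K * norm (\<rho> x - \<rho> y)" by (intro K \<rho>)
    also have "\<dots> \<le> K * (2 * norm (x - y))" by (intro mult_left_mono \<rho> K)
    finally show ?thesis by simp
  qed
  obtain u v where uv: "u 0 = u0" "v 0 = u1"
    "\<And>t. 0 \<le> t \<Longrightarrow> (u has_vector_derivative v t) (at t within {0..})"
    "\<And>t. 0 \<le> t \<Longrightarrow> (v has_vector_derivative (- (1 / \<epsilon>)) *\<^sub>R ((1 + t) powr (-p) *\<^sub>R v t + N (\<rho> (u t)))) (at t within {0..})"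
  proof (rule second_order_ode[of "2 * K" "\<lambda>x. N (\<rho> x)" "\<lambda>t. (1 + t) powr (-p)" \<epsilon> u0 u1])
    show "0 \<le> 2 * K" using K by simp
    show "norm (N (\<rho> x) - N (\<rho> y)) \<le> 2 * K * norm (x - y)" for x y by (rule lipG)
    show "continuous_on {0..} (\<lambda>t::real. (1 + t) powr (-p))"
      using has_real_derivative_one_add_powr by (auto intro!: DERIV_continuous_on)
    show "\<bar>(1 + t) powr (-p)\<bar> \<le> 1" if "0 \<le> t" for t
      using powr_mono[of "-p" 0 "1 + t"] that par by simp
    show "0 < \<epsilon>" by (fact par)
  qed (rule that)
  have contu: "continuous_on {0..} u"
    by (auto simp: continuous_on_eq_continuous_within intro: has_vector_derivative_continuous uv(3))
  have small: "inner (u t) (u t) - R\<^sup>2 < 0" if t: "0 \<le> t" for t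
  proof (rule continuity_method[OF _ _ _ t])
    show "continuous_on {0..} (\<lambda>t. inner (u t) (u t) - R\<^sup>2)" by (intro continuous_intros contu)
    have "inner u0 u0 \<le> C" by (simp add: C_def)
    then show "inner (u 0) (u 0) - R\<^sup>2 < 0" using R uv by simp
    fix T :: real assume T: "0 \<le> T" and le: "\<And>t. 0 \<le> t \<Longrightarrow> t \<le> T \<Longrightarrow> inner (u t) (u t) - R\<^sup>2 \<le> 0"
    have id: "\<rho> (u t) = u t" if "0 \<le> t" "t \<le> T" for t
    proof -
      have "(norm (u t))\<^sup>2 \<le> R\<^sup>2" using le[OF that] by (simp add: power2_norm_eq_inner)
      then have "norm (u t) \<le> R" by (rule power2_le_imp_le) (use R in simp)
      then show ?thesis by (simp add: \<rho>_def)
    qed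
    have "flow \<epsilon> p \<gamma> {0..T} u v" unfolding flow_def
    proof (intro ballI conjI)
      fix t assume "t \<in> {0..T}"
      then have t: "0 \<le> t" "t \<le> T" by auto
      show "(u has_vector_derivative v t) (at t within {0..T})"
        by (rule has_vector_derivative_within_subset[OF uv(3)[OF t(1)]]) auto
      show "(v has_vector_derivative (- (1 / \<epsilon>)) *\<^sub>R ((1 + t) powr (-p) *\<^sub>R v t
        + inner (L (u t)) (u t) powr \<gamma> *\<^sub>R L (u t))) (at t within {0..T})"
        using has_vector_derivative_within_subset[OF uv(4)[OF t(1)], of "{0..T}"] id[OF t] by (simp add: N_def)
    qed
    then interpret weak_energy \<epsilon> p \<gamma> "{0..T}" "\<lambda>t. inner (L (u t)) (u t)" "\<lambda>t. inner (L (u t)) (v t)"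
       "\<lambda>t. inner (v t) (v t)" "\<lambda>t. inner (u t) (v t)" "\<lambda>t. inner (u t) (u t)"
      by (rule flow_weak_energy[OF _ par]) auto
    have "inner (u T) (u T) \<le> 8 * F 0" using weak_decay(1)[of T] T by simp
    also have "\<dots> \<le> C" using F_0_le T uv by (simp add: C_def)
    finally show "inner (u T) (u T) - R\<^sup>2 < 0" using R by simp
  qed
  have id: "\<rho> (u t) = u t" if "0 \<le> t" for t
  proof -
    have "(norm (u t))\<^sup>2 \<le> R\<^sup>2" using small[OF that] by (simp add: power2_norm_eq_inner)
    then have "norm (u t) \<le> R" by (rule power2_le_imp_le) (use R in simp)
    then show ?thesis by (simp add: \<rho>_def)
  qed
  show ?thesis
  proof (rule that[of u v])
    show "flow \<epsilon> p \<gamma> {0..} u v" unfolding flow_def using uv(3,4) id by (auto simp: N_def)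
  qed (fact uv)+
qed

end

section \<open>Strong solutions\<close>

lemma vector_derivative_bound:
  fixes f :: "real \<Rightarrow> 'b::real_normed_vector"
  assumes "\<And>t. t \<in> {a..b} \<Longrightarrow> (f has_vector_derivative f' t) (at t within {a..b})"
    and "\<And>t. t \<in> {a..b} \<Longrightarrow> norm (f' t) \<le> K" and "s \<in> {a..b}" "t \<in> {a..b}"
  shows "norm (f s - f t) \<le> K * \<bar>s - t\<bar>"
proof -
  have "norm (f s - f t) \<le> K * norm (s - t)"
  proof (rule differentiable_bound[of "{a..b}" f "\<lambda>t h. h *\<^sub>R f' t" K s t])
    fix x assume x: "x \<in> {a..b}"
    show "(f has_derivative (\<lambda>h. h *\<^sub>R f' x)) (at x within {a..b})"
      using assms(1)[OF x] by (simp add: has_vector_derivative_def)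
    show "onorm (\<lambda>h. h *\<^sub>R f' x) \<le> K"
    proof (rule onorm_le)
      fix h :: real
      show "norm (h *\<^sub>R f' x) \<le> K * norm h" using mult_right_mono[OF assms(2)[OF x], of "\<bar>h\<bar>"] by (simp add: mult.commute)
    qed
  qed (use assms in auto)
  then show ?thesis by simp
qed

text \<open>For large N the differences f n - f N are Lipschitz with constant e/2 uniformly in n,
  which survives the pointwise limit; the difference quotient of the single function f N settles the
  rest.\<close>

lemma has_vector_derivative_uniform_limit:
  fixes f :: "nat \<Rightarrow> real \<Rightarrow> 'b::real_normed_vector"
  assumes der: "\<And>n t. t \<in> {a..b} \<Longrightarrow> (f n has_vector_derivative f' n t) (at t within {a..b})"
    and lim: "\<And>t. t \<in> {a..b} \<Longrightarrow> (\<lambda>n. f n t) \<longlonglongrightarrow> F t"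
    and unif: "uniform_limit {a..b} f' F' sequentially" and t: "t \<in> {a..b}"
  shows "(F has_vector_derivative F' t) (at t within {a..b})"
  unfolding has_vector_derivative_def has_derivative_within_alt
proof (intro conjI allI impI)
  show "bounded_linear (\<lambda>h. h *\<^sub>R F' t)" by (rule bounded_linear_scaleR_left)
  fix e :: real assume e: "0 < e"
  then have "\<forall>\<^sub>F n in sequentially. \<forall>s\<in>{a..b}. dist (f' n s) (F' s) < e / 4"
    by (intro uniform_limitD[OF unif]) simp
  then obtain N where N: "\<And>n s. n \<ge> N \<Longrightarrow> s \<in> {a..b} \<Longrightarrow> norm (f' n s - F' s) < e / 4"
    unfolding eventually_sequentially dist_norm by blast
  have tail: "norm ((F s - f N s) - (F t - f N t)) \<le> e / 2 * \<bar>s - t\<bar>" if s: "s \<in> {a..b}" for s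
  proof (rule LIMSEQ_le_const2)
    show "(\<lambda>n. norm ((f n s - f N s) - (f n t - f N t))) \<longlonglongrightarrow> norm ((F s - f N s) - (F t - f N t))"
      by (intro tendsto_intros lim s t)
    show "\<exists>M. \<forall>n\<ge>M. norm ((f n s - f N s) - (f n t - f N t)) \<le> e / 2 * \<bar>s - t\<bar>"
    proof (intro exI allI impI)
      fix n assume n: "N \<le> n"
      show "norm ((f n s - f N s) - (f n t - f N t)) \<le> e / 2 * \<bar>s - t\<bar>"
      proof (rule vector_derivative_bound[OF _ _ s t])
        fix r assume r: "r \<in> {a..b}"
        show "((\<lambda>t. f n t - f N t) has_vector_derivative f' n r - f' N r) (at r within {a..b})"
          by (intro has_vector_derivative_diff der r)
        have "norm (f' n r - f' N r) \<le> norm (f' n r - F' r) + norm (f' N r - F' r)"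
          using norm_triangle_ineq4[of "f' n r - F' r" "f' N r - F' r"] by simp
        then show "norm (f' n r - f' N r) \<le> e / 2" using N[OF n r] N[OF order_refl r] by linarith
      qed
    qed
  qed
  have "0 < e / 4" using e by simp
  moreover have "\<forall>e>0. \<exists>d>0. \<forall>y\<in>{a..b}. norm (y - t) < d \<longrightarrow> norm (f N y - f N t - (y - t) *\<^sub>R f' N t) \<le> e * norm (y - t)"
    using der[OF t, of N] unfolding has_vector_derivative_def has_derivative_within_alt by blast
  ultimately obtain d where d: "0 < d"
    "\<And>y. y \<in> {a..b} \<Longrightarrow> norm (y - t) < d \<Longrightarrow> norm (f N y - f N t - (y - t) *\<^sub>R f' N t) \<le> e / 4 * norm (y - t)"
    by blast
  show "\<exists>d>0. \<forall>y\<in>{a..b}. norm (y - t) < d \<longrightarrow> norm (F y - F t - (y - t) *\<^sub>R F' t) \<le> e * norm (y - t)"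
  proof (intro exI[of _ d] conjI ballI impI d(1))
    fix y assume y: "y \<in> {a..b}" "norm (y - t) < d"
    have eq: "F y - F t - (y - t) *\<^sub>R F' t = ((F y - f N y) - (F t - f N t))
      + ((f N y - f N t - (y - t) *\<^sub>R f' N t) + (y - t) *\<^sub>R (f' N t - F' t))" by (simp add: algebra_simps)
    have "norm ((y - t) *\<^sub>R (f' N t - F' t)) \<le> \<bar>y - t\<bar> * (e / 4)"
      using mult_left_mono[OF less_imp_le[OF N[OF order_refl t]], of "\<bar>y - t\<bar>"] by simp
    then show "norm (F y - F t - (y - t) *\<^sub>R F' t) \<le> e * norm (y - t)"
      unfolding eq
      using tail[OF y(1)] d(2)[OF y]
        norm_triangle_ineq[of "(F y - f N y) - (F t - f N t)" "(f N y - f N t - (y - t) *\<^sub>R f' N t) + (y - t) *\<^sub>R (f' N t - F' t)"]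
        norm_triangle_ineq[of "f N y - f N t - (y - t) *\<^sub>R f' N t" "(y - t) *\<^sub>R (f' N t - F' t)"]
      by (simp add: mult.commute)
  qed
qed

lemma gronwall:
  fixes e :: "real \<Rightarrow> real"
  assumes T: "0 \<le> T" and D: "\<And>t. 0 \<le> t \<Longrightarrow> t \<le> T \<Longrightarrow> (e has_real_derivative D t) (at t within {0..T})"
    "\<And>t. 0 \<le> t \<Longrightarrow> t \<le> T \<Longrightarrow> D t \<le> C * e t"
  shows "e T \<le> e 0 * exp (C * T)"
proof -
  have "e T * exp (- C * T) \<le> e 0 * exp (- C * 0)"
  proof (rule nonincreasing_within[OF T])
    fix t assume t: "0 \<le> t" "t \<le> T"
    have "((\<lambda>t. exp (- C * t)) has_real_derivative exp (- C * t) * (- C)) (at t within {0..T})"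
      by (auto intro!: derivative_eq_intros)
    from DERIV_mult[OF D(1)[OF t] this]
    show "((\<lambda>t. e t * exp (- C * t)) has_real_derivative D t * exp (- C * t) + exp (- C * t) * (- C) * e t) (at t within {0..T})" .
    have "(D t - C * e t) * exp (- C * t) \<le> 0" using D(2)[OF t] by (simp add: mult_le_0_iff)
    then show "D t * exp (- C * t) + exp (- C * t) * (- C) * e t \<le> 0" by (simp add: algebra_simps)
  qed
  then have "e T * exp (- C * T) * exp (C * T) \<le> e 0 * exp (C * T)" by (intro mult_right_mono) auto
  moreover have "e T * exp (- C * T) * exp (C * T) = e T" by (simp add: mult.assoc flip: exp_add)
  ultimately show ?thesis by (simp only:)
qed

lemma at_halfline_nontrivial: "0 \<le> t \<Longrightarrow> at t within {0..} \<noteq> bot" for t :: real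
proof -
  assume t: "0 \<le> t"
  have "t islimpt {t<..<t + 1}" by (simp add: islimpt_greaterThanLessThan1)
  then have "t islimpt {0..}" by (rule islimpt_subset) (use t in auto)
  then show ?thesis by (simp add: trivial_limit_within)
qed

lemma time_deriv_eq:
  assumes "0 \<le> t" "(u has_vector_derivative d) (at t within {0..})"
  shows "time_deriv u t = d"
  unfolding time_deriv_def by (rule vector_derivative_within[OF at_halfline_nontrivial[OF assms(1)] assms(2)])

lemma C_class_has_derivative:
  assumes "C_class (Suc k) u" "0 \<le> t"
  shows "(u has_vector_derivative time_deriv u t) (at t within {0..})"
  using assms unfolding time_deriv_def by (simp add: differentiable_on_def flip: vector_derivative_works)

section \<open>Strong solutions and their stability\<close>

locale sqrt_pair =
  fixes A B :: "'a::{real_inner,complete_space} partial_op"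
  assumes sA: "self_adjoint_op A" and nA: "nonneg_op A" and sB: "self_adjoint_op B" and BB: "B \<circ>\<^sub>m B = A"
begin

lemma linA: "linear_op A" and linB: "linear_op B"
  using sA sB by (auto simp: self_adjoint_op_def)

lemmas A_lin = linear_opD[OF linA] and B_lin = linear_opD[OF linB]

lemma dom_AB: "x \<in> dom A \<Longrightarrow> x \<in> dom B" "x \<in> dom A \<Longrightarrow> B \<cdot> x \<in> dom B" "x \<in> dom A \<Longrightarrow> B \<cdot> (B \<cdot> x) = A \<cdot> x"
  using dom_map_compD[OF BB] by blast+

lemma A_inner:
  assumes "x \<in> dom A" "y \<in> dom B"
  shows "inner (A \<cdot> x) y = inner (B \<cdot> x) (B \<cdot> y)"
  using self_adjoint_sym[OF sB dom_AB(2)[OF assms(1)] assms(2)] dom_AB(3)[OF assms(1)] by simp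

definition accel :: "real \<Rightarrow> real \<Rightarrow> real \<Rightarrow> (real \<Rightarrow> 'a) \<Rightarrow> (real \<Rightarrow> 'a) \<Rightarrow> real \<Rightarrow> 'a" where
  "accel \<epsilon> p \<gamma> u v t = (- (1 / \<epsilon>)) *\<^sub>R ((1 + t) powr (-p) *\<^sub>R v t + (norm (B \<cdot> u t))\<^sup>2 powr \<gamma> *\<^sub>R (A \<cdot> u t))"

text \<open>The form of \<open>kirchhoff_solution\<close> used in the estimates: the velocity is a
  function of its own and the equation is solved for u''. The two notions are matched by
  \<open>kirchhoff_imp_strong_sol\<close> and \<open>strong_sol_imp_kirchhoff\<close>.\<close>

definition strong_sol :: "real \<Rightarrow> real \<Rightarrow> real \<Rightarrow> (real \<Rightarrow> 'a) \<Rightarrow> (real \<Rightarrow> 'a) \<Rightarrow> bool" where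
  "strong_sol \<epsilon> p \<gamma> u v \<longleftrightarrow>
     (\<forall>t\<ge>0. u t \<in> dom A \<and> v t \<in> dom B \<and> (u has_vector_derivative v t) (at t within {0..}) \<and>
       ((\<lambda>t. B \<cdot> u t) has_vector_derivative B \<cdot> v t) (at t within {0..}) \<and>
       (v has_vector_derivative accel \<epsilon> p \<gamma> u v t) (at t within {0..})) \<and>
     continuous_on {0..} (\<lambda>t. A \<cdot> u t) \<and> continuous_on {0..} (\<lambda>t. B \<cdot> v t)"

lemma strong_solD:
  assumes "strong_sol \<epsilon> p \<gamma> u v" "0 \<le> t"
  shows "u t \<in> dom A" "u t \<in> dom B" "v t \<in> dom B" "(u has_vector_derivative v t) (at t within {0..})"
    "((\<lambda>t. B \<cdot> u t) has_vector_derivative B \<cdot> v t) (at t within {0..})"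
    "(v has_vector_derivative accel \<epsilon> p \<gamma> u v t) (at t within {0..})"
  using assms dom_AB by (auto simp: strong_sol_def)

lemma strong_sol_continuous:
  assumes "strong_sol \<epsilon> p \<gamma> u v"
  shows "continuous_on {0..} u" "continuous_on {0..} v" "continuous_on {0..} (\<lambda>t. B \<cdot> u t)"
    "continuous_on {0..} (\<lambda>t. A \<cdot> u t)" "continuous_on {0..} (\<lambda>t. B \<cdot> v t)"
  using strong_solD(4-6)[OF assms] assms
  by (auto simp: continuous_on_eq_continuous_within strong_sol_def intro: has_vector_derivative_continuous)

lemma norm_sq_powr: "(norm x)\<^sup>2 powr g = norm x powr (2 * g)"
  by (cases "x = 0") (simp_all add: powr_powr flip: powr_numeral)

text \<open>Writing <Au, u'> as <Bu, Bu'> gives the first order identities for every strong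
  solution, so their consequences hold without approximation.\<close>

lemma strong_sol_weak_energy:
  assumes ss: "strong_sol \<epsilon> p \<gamma> u v" and par: "0 < \<epsilon>" "\<epsilon> \<le> 1/8" "0 \<le> p" "p \<le> 1" "1 \<le> \<gamma>"
  shows "weak_energy \<epsilon> p \<gamma> {0..} (\<lambda>t. (norm (B \<cdot> u t))\<^sup>2) (\<lambda>t. inner (B \<cdot> u t) (B \<cdot> v t))
     (\<lambda>t. (norm (v t))\<^sup>2) (\<lambda>t. inner (u t) (v t)) (\<lambda>t. (norm (u t))\<^sup>2)"
proof (unfold_locales; (fact par)?)
  fix t :: real assume "t \<in> {0..}"
  then have t: "0 \<le> t" by simp
  note d = strong_solD[OF ss t]
  show "((\<lambda>t. (norm (B \<cdot> u t))\<^sup>2) has_real_derivative 2 * inner (B \<cdot> u t) (B \<cdot> v t)) (at t within {0..})"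
    using has_real_derivative_inner[OF d(5) d(5)] by (simp add: inner_commute power2_norm_eq_inner)
  have e1: "inner (v t) (A \<cdot> u t) = inner (B \<cdot> u t) (B \<cdot> v t)"
    using A_inner[OF d(1,3)] by (simp add: inner_commute)
  have e2: "inner (u t) (A \<cdot> u t) = (norm (B \<cdot> u t))\<^sup>2"
    using A_inner[OF d(1,2)] by (simp add: inner_commute power2_norm_eq_inner)
  show "((\<lambda>t. (norm (v t))\<^sup>2) has_real_derivative - (2 / \<epsilon>) * ((1 + t) powr (-p) * (norm (v t))\<^sup>2
      + (norm (B \<cdot> u t))\<^sup>2 powr \<gamma> * inner (B \<cdot> u t) (B \<cdot> v t))) (at t within {0..})"
    using has_real_derivative_inner[OF d(6) d(6)] unfolding accel_def
    by (simp add: inner_add inner_commute[of "A \<cdot> u t"] e1 algebra_simps add_divide_distrib flip: power2_norm_eq_inner)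
  show "((\<lambda>t. inner (u t) (v t)) has_real_derivative (norm (v t))\<^sup>2 - (1 / \<epsilon>) * ((1 + t) powr (-p) * inner (u t) (v t)
      + (norm (B \<cdot> u t))\<^sup>2 powr \<gamma> * (norm (B \<cdot> u t))\<^sup>2)) (at t within {0..})"
    using has_real_derivative_inner[OF d(4) d(6)] unfolding accel_def
    by (simp add: inner_add e2 algebra_simps add_divide_distrib flip: power2_norm_eq_inner)
  show "((\<lambda>t. (norm (u t))\<^sup>2) has_real_derivative 2 * inner (u t) (v t)) (at t within {0..})"
    using has_real_derivative_inner[OF d(4) d(4)] by (simp add: inner_commute power2_norm_eq_inner)
  show "(inner (u t) (v t))\<^sup>2 \<le> (norm (u t))\<^sup>2 * (norm (v t))\<^sup>2"
    using Cauchy_Schwarz_ineq[of "u t" "v t"] by (simp add: power2_norm_eq_inner)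
qed auto

text \<open>The Gronwall rate of \<open>stability\<close>; it depends on the two solutions only
  through the common bounds \<delta> and K, hence is uniform over the approximations.\<close>

definition growth :: "real \<Rightarrow> real \<Rightarrow> real \<Rightarrow> real \<Rightarrow> real" where
  "growth \<epsilon> \<gamma> \<delta> K = (let C2 = \<gamma> * (K\<^sup>2) powr (\<gamma> - 1) * (2 * K) in
     (C2 * K + C2 * K) / \<delta> powr \<gamma> + C2 * K / \<epsilon>)"

text \<open>The difference is measured with the coefficient of the first solution. Its lower bound
  \<delta> makes the energy coercive, and the bound of Bv controls its derivative; the difference of
  the coefficients multiplies Au' of the second solution. No loss of derivatives occurs because only
  first order norms of the difference appear.\<close>

lemma stability:
  assumes s1: "strong_sol \<epsilon> p \<gamma> u v" and s2: "strong_sol \<epsilon> p \<gamma> u' v'"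
    and par: "0 < \<epsilon>" "1 \<le> \<gamma>" and \<delta>: "0 < \<delta>" and T: "0 \<le> T"
    and bd: "\<And>t. 0 \<le> t \<Longrightarrow> t \<le> T \<Longrightarrow> \<delta> \<le> (norm (B \<cdot> u t))\<^sup>2 \<and> norm (B \<cdot> u t) \<le> K \<and> norm (B \<cdot> u' t) \<le> K
      \<and> norm (B \<cdot> v t) \<le> K \<and> norm (A \<cdot> u' t) \<le> K"
  defines "e \<equiv> \<lambda>t. \<epsilon> * (norm (v t - v' t))\<^sup>2 + (norm (B \<cdot> u t))\<^sup>2 powr \<gamma> * (norm (B \<cdot> u t - B \<cdot> u' t))\<^sup>2"
  shows "e T \<le> e 0 * exp (growth \<epsilon> \<gamma> \<delta> K * T)"
proof -
  define C2 where "C2 = \<gamma> * (K\<^sup>2) powr (\<gamma> - 1) * (2 * K)"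
  define C where "C = growth \<epsilon> \<gamma> \<delta> K"
  have C_eq: "C = (C2 * K + C2 * K) / \<delta> powr \<gamma> + C2 * K / \<epsilon>" by (simp add: C_def growth_def C2_def Let_def)
  have K0: "0 \<le> K" using bd[of 0] T norm_ge_zero[of "B \<cdot> u 0"] by linarith
  have C20: "0 \<le> C2" using par K0 by (simp add: C2_def)
  define w where "w t = v t - v' t" for t
  define x where "x t = B \<cdot> u t - B \<cdot> u' t" for t
  define y where "y t = (norm (B \<cdot> u t))\<^sup>2" for t
  define y' where "y' t = (norm (B \<cdot> u' t))\<^sup>2" for t
  have e: "e t = \<epsilon> * inner (w t) (w t) + y t powr \<gamma> * inner (x t) (x t)" for t
    by (simp add: e_def w_def x_def y_def power2_norm_eq_inner)
  have "\<exists>D. (e has_real_derivative D) (at t within {0..T}) \<and> D \<le> C * e t" if t: "0 \<le> t" "t \<le> T" for t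
  proof -
    note d1 = strong_solD[OF s1 t(1)] and d2 = strong_solD[OF s2 t(1)]
    note bt = bd[OF t]
    let ?b = "(1 + t) powr (-p)"
    define c where "c = y t powr \<gamma>"
    define c' where "c' = y' t powr \<gamma>"
    define q where "q = accel \<epsilon> p \<gamma> u v t - accel \<epsilon> p \<gamma> u' v' t"
    define r where "r = B \<cdot> v t - B \<cdot> v' t"
    have y0: "0 < y t" using bt \<delta> unfolding y_def by linarith
    have yd: "(y has_real_derivative 2 * inner (B \<cdot> u t) (B \<cdot> v t)) (at t within {0..})"
      unfolding y_def[abs_def]
      using has_real_derivative_inner[OF d1(5) d1(5)] by (simp add: inner_commute power2_norm_eq_inner)
    have cd: "((\<lambda>t. y t powr \<gamma>) has_real_derivative \<gamma> * y t powr (\<gamma> - 1) * (2 * inner (B \<cdot> u t) (B \<cdot> v t))) (at t within {0..})"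
      by (rule DERIV_chain2[OF has_real_derivative_powr[OF y0] yd])
    have wd: "(w has_vector_derivative q) (at t within {0..})"
      unfolding w_def[abs_def] q_def by (rule has_vector_derivative_diff[OF d1(6) d2(6)])
    have xd: "(x has_vector_derivative r) (at t within {0..})"
      unfolding x_def[abs_def] r_def by (rule has_vector_derivative_diff[OF d1(5) d2(5)])
    define D where "D = \<epsilon> * (inner q (w t) + inner (w t) q) + (\<gamma> * y t powr (\<gamma> - 1) * (2 * inner (B \<cdot> u t) (B \<cdot> v t)) * inner (x t) (x t)
       + (inner r (x t) + inner (x t) r) * c)"
    have eD: "(e has_real_derivative D) (at t within {0..T})"
    proof (rule DERIV_subset)
      show "(e has_real_derivative D) (at t within {0..})"
        unfolding e[abs_def] D_def c_def
        by (rule DERIV_add[OF DERIV_cmult[OF has_real_derivative_inner[OF wd wd]] DERIV_mult[OF cd has_real_derivative_inner[OF xd xd]]])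
    qed auto
    have zA: "u t - u' t \<in> dom A" using d1(1) d2(1) A_lin(1) by (simp add: subspace_diff)
    have wB: "w t \<in> dom B" unfolding w_def using d1(3) d2(3) B_lin(1) by (simp add: subspace_diff)
    have Aw: "inner (A \<cdot> u t - A \<cdot> u' t) (w t) = inner (x t) r"
      using A_inner[OF zA wB] by (simp add: x_def r_def w_def A_lin(4)[OF d1(1) d2(1)] B_lin(4)[OF d1(2) d2(2)] B_lin(4)[OF d1(3) d2(3)])
    \<comment> \<open>The difference of the nonlinear terms is split as c A(u - u') + (c - c') A u':
      the first part belongs to the energy, the second is Lipschitz in Bu - Bu'.\<close>
    have q: "\<epsilon> *\<^sub>R q = - (?b *\<^sub>R w t + c *\<^sub>R (A \<cdot> u t - A \<cdot> u' t) + (c - c') *\<^sub>R (A \<cdot> u' t))"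
      using par by (simp add: q_def accel_def w_def c_def c'_def y_def y'_def algebra_simps)
    have "\<epsilon> * inner q (w t) = inner (\<epsilon> *\<^sub>R q) (w t)" by simp
    also have "\<dots> = - (?b * inner (w t) (w t) + c * inner (x t) r + (c - c') * inner (A \<cdot> u' t) (w t))"
      unfolding q inner_minus_left inner_add_left inner_scaleR_left Aw ..
    finally have qw: "\<epsilon> * inner q (w t) = - (?b * inner (w t) (w t) + c * inner (x t) r + (c - c') * inner (A \<cdot> u' t) (w t))" .
    \<comment> \<open>The contributions c <x, r> of kinetic and potential part cancel, leaving
      damping, coefficient difference and the derivative of c.\<close>
    have D: "D = - 2 * ?b * inner (w t) (w t) + - 2 * (c - c') * inner (A \<cdot> u' t) (w t)
        + \<gamma> * y t powr (\<gamma> - 1) * (2 * inner (B \<cdot> u t) (B \<cdot> v t)) * inner (x t) (x t)"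
    proof -
      have "D = 2 * (\<epsilon> * inner q (w t)) + \<gamma> * y t powr (\<gamma> - 1) * (2 * inner (B \<cdot> u t) (B \<cdot> v t)) * inner (x t) (x t) + 2 * c * inner (x t) r"
        by (simp add: D_def inner_commute algebra_simps)
      then show ?thesis unfolding qw by (simp add: algebra_simps)
    qed
    have yK: "y t \<le> K\<^sup>2" "y' t \<le> K\<^sup>2" using bt by (auto simp: y_def y'_def intro!: power_mono)
    have "\<bar>c - c'\<bar> \<le> \<gamma> * (K\<^sup>2) powr (\<gamma> - 1) * \<bar>y t - y' t\<bar>"
      unfolding c_def c'_def by (rule powr_diff_le) (use par yK in \<open>auto simp: y_def y'_def\<close>)
    also have "\<bar>y t - y' t\<bar> \<le> 2 * K * norm (x t)"
    proof -
      have "y t - y' t = inner (x t) (B \<cdot> u t + B \<cdot> u' t)"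
        by (simp add: y_def y'_def x_def power2_norm_eq_inner inner_add inner_diff inner_commute)
      also have "\<bar>\<dots>\<bar> \<le> norm (x t) * norm (B \<cdot> u t + B \<cdot> u' t)" by (rule Cauchy_Schwarz_ineq2)
      also have "\<dots> \<le> norm (x t) * (2 * K)"
        by (rule mult_left_mono) (use bt norm_triangle_ineq[of "B \<cdot> u t" "B \<cdot> u' t"] in auto)
      finally show ?thesis by (simp only: mult.commute)
    qed
    finally have cc: "\<bar>c - c'\<bar> \<le> C2 * norm (x t)" using par by (simp add: C2_def mult.assoc mult_left_mono)
    have i1: "- 2 * (c - c') * inner (A \<cdot> u' t) (w t) \<le> C2 * K * (inner (x t) (x t) + inner (w t) (w t))"
    proof -
      have "- 2 * (c - c') * inner (A \<cdot> u' t) (w t) \<le> 2 * (\<bar>c - c'\<bar> * \<bar>inner (A \<cdot> u' t) (w t)\<bar>)"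
      proof -
        have "- ((c - c') * inner (A \<cdot> u' t) (w t)) \<le> \<bar>c - c'\<bar> * \<bar>inner (A \<cdot> u' t) (w t)\<bar>"
          unfolding abs_mult[symmetric] by (rule abs_ge_minus_self)
        moreover have "- 2 * (c - c') * inner (A \<cdot> u' t) (w t) = 2 * (- ((c - c') * inner (A \<cdot> u' t) (w t)))"
          by (simp add: algebra_simps)
        ultimately show ?thesis by linarith
      qed
      also have "\<dots> \<le> 2 * ((C2 * norm (x t)) * (K * norm (w t)))"
      proof -
        have "\<bar>inner (A \<cdot> u' t) (w t)\<bar> \<le> norm (A \<cdot> u' t) * norm (w t)" by (rule Cauchy_Schwarz_ineq2)
        also have "\<dots> \<le> K * norm (w t)" using bt by (intro mult_right_mono) auto
        finally show ?thesis using cc C20 by (intro mult_left_mono mult_mono) auto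
      qed
      also have "\<dots> = C2 * K * (2 * norm (x t) * norm (w t))" by simp
      also have "\<dots> \<le> C2 * K * ((norm (x t))\<^sup>2 + (norm (w t))\<^sup>2)"
        using C20 K0 by (intro mult_left_mono sum_squares_bound) auto
      finally show ?thesis by (simp add: power2_norm_eq_inner)
    qed
    have i2: "\<gamma> * y t powr (\<gamma> - 1) * (2 * inner (B \<cdot> u t) (B \<cdot> v t)) * inner (x t) (x t) \<le> C2 * K * inner (x t) (x t)"
    proof (rule mult_right_mono)
      have "inner (B \<cdot> u t) (B \<cdot> v t) \<le> norm (B \<cdot> u t) * norm (B \<cdot> v t)" by (rule norm_cauchy_schwarz)
      also have "\<dots> \<le> K * K" using bt K0 by (intro mult_mono) auto
      finally have 1: "2 * inner (B \<cdot> u t) (B \<cdot> v t) \<le> 2 * K * K" by simp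
      have "\<gamma> * y t powr (\<gamma> - 1) * (2 * inner (B \<cdot> u t) (B \<cdot> v t)) \<le> \<gamma> * y t powr (\<gamma> - 1) * (2 * K * K)"
        by (rule mult_left_mono[OF 1]) (use par in simp)
      also have "\<dots> \<le> \<gamma> * (K\<^sup>2) powr (\<gamma> - 1) * (2 * K * K)"
        using yK y0 par K0 by (intro mult_right_mono mult_left_mono powr_mono2) auto
      finally show "\<gamma> * y t powr (\<gamma> - 1) * (2 * inner (B \<cdot> u t) (B \<cdot> v t)) \<le> C2 * K"
        by (simp add: C2_def mult.assoc)
    qed simp
    have i3: "- 2 * ?b * inner (w t) (w t) \<le> 0" by simp
    have x_e: "inner (x t) (x t) \<le> e t / \<delta> powr \<gamma>"
    proof -
      have "\<delta> powr \<gamma> \<le> c" unfolding c_def using bt \<delta> par by (intro powr_mono2) (auto simp: y_def)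
      then have "\<delta> powr \<gamma> * inner (x t) (x t) \<le> c * inner (x t) (x t)" by (intro mult_right_mono) auto
      also have "\<dots> \<le> e t" using par by (simp add: e c_def)
      finally show ?thesis using \<delta> by (simp add: pos_le_divide_eq mult.commute)
    qed
    have w_e: "inner (w t) (w t) \<le> e t / \<epsilon>"
    proof -
      have "\<epsilon> * inner (w t) (w t) \<le> e t" by (simp add: e)
      then show ?thesis using par by (simp add: pos_le_divide_eq mult.commute)
    qed
    have "D \<le> (C2 * K + C2 * K) * inner (x t) (x t) + C2 * K * inner (w t) (w t)"
      using add_mono[OF add_mono[OF i3 i1] i2] unfolding D[symmetric] by (simp add: algebra_simps)
    also have "\<dots> \<le> (C2 * K + C2 * K) * (e t / \<delta> powr \<gamma>) + C2 * K * (e t / \<epsilon>)"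
      using C20 K0 x_e w_e by (intro add_mono mult_left_mono) auto
    also have "\<dots> = C * e t" by (simp add: C_eq algebra_simps add_divide_distrib)
    finally show ?thesis using eD by blast
  qed
  then obtain D where D: "\<And>t. 0 \<le> t \<Longrightarrow> t \<le> T \<Longrightarrow> (e has_real_derivative D t) (at t within {0..T})"
    "\<And>t. 0 \<le> t \<Longrightarrow> t \<le> T \<Longrightarrow> D t \<le> C * e t" by metis
  have "e T \<le> e 0 * exp (C * T)" by (rule gronwall[OF T D])
  then show ?thesis by (simp only: C_def)
qed

end

section \<open>Approximation by bounded operators\<close>

locale cutoffs = sqrt_pair A B for A B :: "'a::{real_inner,complete_space} partial_op" +
  fixes E :: "nat \<Rightarrow> 'a \<Rightarrow> 'a"
  assumes E_lin: "linear (E n)" and E_norm: "norm (E n x) \<le> norm x"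
    and E_sym: "inner (E n x) y = inner x (E n y)"
    and E_idem: "E n (E n x) = E n x" and E_dom: "E n x \<in> dom A"
    and E_A: "x \<in> dom A \<Longrightarrow> E n (A \<cdot> x) = A \<cdot> E n x"
    and E_B: "x \<in> dom B \<Longrightarrow> E n (B \<cdot> x) = B \<cdot> E n x"
    and AE_bl: "bounded_linear (\<lambda>x. A \<cdot> E n x)"
    and E_lim: "(\<lambda>n. E n x) \<longlonglongrightarrow> x"
begin

text \<open>On the range of \<open>E n\<close> the operators \<open>L n\<close> and
  \<open>S n\<close> are A and its root. Being bounded, they commute with derivatives and limits,
  which A and B do not.\<close>

definition L :: "nat \<Rightarrow> 'a \<Rightarrow> 'a" where "L n x = A \<cdot> E n x"
definition S :: "nat \<Rightarrow> 'a \<Rightarrow> 'a" where "S n x = B \<cdot> E n x"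

lemma E_bl: "bounded_linear (E n)"
  by (rule contraction_bounded_linear[OF E_lin E_norm])

lemma E_domB: "E n x \<in> dom B"
  by (rule dom_AB(1)[OF E_dom])

lemma L_bl: "bounded_linear (L n)"
  unfolding L_def[abs_def] by (rule AE_bl)

lemma S_bl: "bounded_linear (S n)"
proof -
  obtain K where K: "0 < K" "\<And>x. norm (L n x) \<le> norm x * K" using bounded_linear.pos_bounded[OF L_bl] by blast
  show ?thesis
  proof (rule bounded_linear_intro[where K = "sqrt K"])
    show "S n (x + y) = S n x + S n y" for x y
      by (simp add: S_def linear_add[OF E_lin] B_lin(2)[OF E_domB E_domB])
    show "S n (r *\<^sub>R x) = r *\<^sub>R S n x" for r x
      by (simp add: S_def linear_scale[OF E_lin] B_lin(3)[OF E_domB])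
    fix x
    have "(norm (S n x))\<^sup>2 = inner (L n x) (E n x)"
      unfolding L_def S_def A_inner[OF E_dom E_domB] by (simp add: power2_norm_eq_inner)
    also have "\<dots> \<le> norm (L n x) * norm (E n x)" by (rule norm_cauchy_schwarz)
    also have "\<dots> \<le> (norm x * K) * norm x" using K by (intro mult_mono K E_norm) auto
    also have "\<dots> = (norm x * sqrt K)\<^sup>2" using K by (simp add: power_mult_distrib power2_eq_square)
    finally show "norm (S n x) \<le> norm x * sqrt K" by (rule power2_le_imp_le) (use K in simp)
  qed
qed

lemmas L_linear = bounded_linear.linear[OF L_bl] and S_linear = bounded_linear.linear[OF S_bl]

lemma E_L: "E n (L n x) = L n x"
  unfolding L_def E_A[OF E_dom] E_idem ..

lemma form: "bounded_form (L n)"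
proof (rule bounded_form.intro)
  show "bounded_linear (L n)" by (rule L_bl)
  fix x y
  have "inner (L n x) y = inner (E n (L n x)) y" by (simp add: E_L)
  also have "\<dots> = inner (A \<cdot> E n x) (E n y)" by (simp add: E_sym L_def)
  also have "\<dots> = inner (E n x) (A \<cdot> E n y)" by (rule self_adjoint_sym[OF sA E_dom E_dom])
  also have "\<dots> = inner x (L n y)" unfolding E_sym using E_L[of n y] by (simp add: L_def)
  finally show "inner (L n x) y = inner x (L n y)" .
  have "inner (L n x) x = inner (E n (L n x)) x" by (simp add: E_L)
  also have "\<dots> = inner (A \<cdot> E n x) (E n x)" by (simp add: E_sym L_def)
  also have "\<dots> \<ge> 0" using nA E_dom by (auto simp: nonneg_op_def)
  finally show "0 \<le> inner (L n x) x" .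
qed

text \<open>Commutation of \<open>E n\<close> and \<open>E k\<close> is not among the assumptions;
  instead \<open>E n x\<close> is replaced by x on both sides, at the cost of twice the distance
  since \<open>E k\<close> is a contraction.\<close>

lemma bounded_diff: "norm (E n x - E k (E n x)) \<le> norm (x - E k x) + 2 * norm (E n x - x)"
proof -
  have eq: "E n x - E k (E n x) = (x - E k x) + ((E n x - x) - E k (E n x - x))"
    by (simp add: linear_diff[OF E_lin])
  have "norm (E n x - E k (E n x)) \<le> norm (x - E k x) + norm ((E n x - x) - E k (E n x - x))"
    by (subst eq) (rule norm_triangle_ineq)
  then show ?thesis
    using norm_triangle_ineq4[of "E n x - x" "E k (E n x - x)"] E_norm[of k "E n x - x"] by linarith
qed

end

text \<open>Because \<open>init_low\<close> keeps the initial |A^(1/2)u|^2 of every approximation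
  above half of its limit, one M and one smallness condition serve all n.\<close>

locale approximation = cutoffs A B E for A B :: "'a::{real_inner,complete_space} partial_op" and E +
  fixes \<epsilon> p \<gamma> :: real and u0 u1 :: 'a and U V :: "nat \<Rightarrow> real \<Rightarrow> 'a" and M :: real
  assumes par: "0 < \<epsilon>" "\<epsilon> \<le> 1/8" "0 \<le> p" "p \<le> 1" "1 \<le> \<gamma>"
    and u0: "u0 \<in> dom A" and u1: "u1 \<in> dom B" and Bu0: "B \<cdot> u0 \<noteq> 0"
    and M: "M = z_bound \<gamma> ((norm (B \<cdot> u0))\<^sup>2 / 2) ((norm (B \<cdot> u0))\<^sup>2) ((norm (A \<cdot> u0))\<^sup>2) ((norm (B \<cdot> u1))\<^sup>2) ((norm u1)\<^sup>2)"
    and small: "\<epsilon> * (10 * \<gamma> * M + 10) \<le> 1"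
    and init_low: "\<And>n. (norm (B \<cdot> u0))\<^sup>2 / 2 \<le> (norm (B \<cdot> E n u0))\<^sup>2"
    and flow: "\<And>n. bounded_form.flow (L n) \<epsilon> p \<gamma> {0..} (U n) (V n)"
    and init: "\<And>n. U n 0 = E n u0" "\<And>n. V n 0 = E n u1"
begin

lemma flowD:
  assumes "0 \<le> t"
  shows "(U n has_vector_derivative V n t) (at t within {0..})"
    "(V n has_vector_derivative (- (1 / \<epsilon>)) *\<^sub>R ((1 + t) powr (-p) *\<^sub>R V n t
        + inner (L n (U n t)) (U n t) powr \<gamma> *\<^sub>R L n (U n t))) (at t within {0..})"
  using flow[of n] assms unfolding bounded_form.flow_def[OF form] by auto

text \<open>The component 1 - E n of the velocity solves the damped linear equation \<epsilon> s' =
  -(1+t)^(-p) s with zero data, because \<open>L n\<close> takes values in the range of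
  \<open>E n\<close>.\<close>

lemma invariant:
  assumes t: "0 \<le> t"
  shows "E n (V n t) = V n t" "E n (U n t) = U n t"
proof -
  define s where "s t = V n t - E n (V n t)" for t
  define r where "r t = U n t - E n (U n t)" for t
  have s': "(s has_vector_derivative (- (1 / \<epsilon>)) *\<^sub>R ((1 + t) powr (-p) *\<^sub>R s t)) (at t within {0..})" if "0 \<le> t" for t
  proof -
    define D where "D = (- (1 / \<epsilon>)) *\<^sub>R ((1 + t) powr (-p) *\<^sub>R V n t + inner (L n (U n t)) (U n t) powr \<gamma> *\<^sub>R L n (U n t))"
    have "(s has_vector_derivative D - E n D) (at t within {0..})"
      unfolding s_def[abs_def] D_def
      by (rule has_vector_derivative_diff[OF flowD(2)[OF that] bounded_linear.has_vector_derivative[OF E_bl flowD(2)[OF that]]])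
    moreover have "D - E n D = (- (1 / \<epsilon>)) *\<^sub>R ((1 + t) powr (-p) *\<^sub>R s t)"
      by (simp add: D_def linear_add[OF E_lin] linear_scale[OF E_lin] linear_neg[OF E_lin] linear_diff[OF E_lin] E_L s_def algebra_simps)
    ultimately show ?thesis by simp
  qed
  have s0: "s t = 0" if t: "0 \<le> t" for t
  proof -
    have "inner (s t) (s t) \<le> inner (s 0) (s 0)"
    proof (rule nonincreasing_within[OF t])
      fix q assume q: "0 \<le> q" "q \<le> t"
      show "((\<lambda>t. inner (s t) (s t)) has_real_derivative - (2 / \<epsilon>) * ((1 + q) powr (-p) * inner (s q) (s q))) (at q within {0..t})"
        using DERIV_subset[OF has_real_derivative_inner[OF s'[OF q(1)] s'[OF q(1)]], of "{0..t}"]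
        by (simp add: mult.commute)
      show "- (2 / \<epsilon>) * ((1 + q) powr (-p) * inner (s q) (s q)) \<le> 0"
        using par by (intro mult_nonpos_nonneg) auto
    qed
    also have "\<dots> = 0" by (simp add: s_def init E_idem)
    finally have "inner (s t) (s t) = 0" using inner_ge_zero[of "s t"] by linarith
    then show ?thesis by simp
  qed
  show "E n (V n t) = V n t" using s0[OF t] by (simp add: s_def)
  have "norm (r t - r 0) \<le> 0 * \<bar>t - 0\<bar>"
  proof (rule vector_derivative_bound)
    fix q assume "q \<in> {0..t}"
    then have q: "0 \<le> q" by simp
    have "(r has_vector_derivative s q) (at q within {0..})"
      unfolding r_def[abs_def] s_def
      by (rule has_vector_derivative_diff[OF flowD(1)[OF q] bounded_linear.has_vector_derivative[OF E_bl flowD(1)[OF q]]])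
    then show "(r has_vector_derivative s q) (at q within {0..t})"
      by (rule has_vector_derivative_within_subset) auto
    show "norm (s q) \<le> 0" using s0[OF q] by simp
  qed (use t in auto)
  then have "r t = r 0" by simp
  then show "E n (U n t) = U n t" by (simp add: r_def init E_idem)
qed

lemma AU: "0 \<le> t \<Longrightarrow> L n (U n t) = A \<cdot> U n t" "0 \<le> t \<Longrightarrow> S n (U n t) = B \<cdot> U n t" "0 \<le> t \<Longrightarrow> S n (V n t) = B \<cdot> V n t"
  by (simp_all add: L_def S_def invariant)

lemma domU: "0 \<le> t \<Longrightarrow> U n t \<in> dom A" "0 \<le> t \<Longrightarrow> V n t \<in> dom A"
  using E_dom[of n "U n t"] E_dom[of n "V n t"] by (simp_all add: invariant)

lemma form_eq:
  assumes "0 \<le> t"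
  shows "inner (L n (U n t)) (U n t) = (norm (B \<cdot> U n t))\<^sup>2" "inner (L n (V n t)) (V n t) = (norm (B \<cdot> V n t))\<^sup>2"
proof -
  show "inner (L n (U n t)) (U n t) = (norm (B \<cdot> U n t))\<^sup>2"
    using A_inner[OF domU(1)[OF assms] dom_AB(1)[OF domU(1)[OF assms]], of n n] assms by (simp add: AU power2_norm_eq_inner)
  show "inner (L n (V n t)) (V n t) = (norm (B \<cdot> V n t))\<^sup>2"
    using A_inner[OF domU(2)[OF assms] dom_AB(1)[OF domU(2)[OF assms]], of n n] assms
    by (simp add: L_def invariant power2_norm_eq_inner)
qed

text \<open>As \<open>L n\<close> equals A along \<open>U n\<close>, the approximations are exact
  solutions of the original equation with projected data; \<open>stability\<close> can therefore
  compare two of them directly.\<close>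

lemma sol: "strong_sol \<epsilon> p \<gamma> (U n) (V n)"
proof -
  have tr: "(f has_vector_derivative D) (at t within {0..})"
    if "(g has_vector_derivative D) (at t within {0..})" "0 \<le> t" "\<And>s. 0 \<le> s \<Longrightarrow> g s = f s" for f g :: "real \<Rightarrow> 'a" and D t
    by (rule has_vector_derivative_transform[OF _ _ that(1)]) (use that in auto)
  have BU: "((\<lambda>t. B \<cdot> U n t) has_vector_derivative B \<cdot> V n t) (at t within {0..})" if "0 \<le> t" for t
    unfolding AU(3)[OF that, symmetric]
    by (rule tr[OF bounded_linear.has_vector_derivative[OF S_bl flowD(1)[OF that]] that]) (simp add: AU)
  have BV: "continuous_on {0..} (\<lambda>t. S n (V n t))"
    using bounded_linear.has_vector_derivative[OF S_bl flowD(2)]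
    by (auto simp: continuous_on_eq_continuous_within intro: has_vector_derivative_continuous)
  have CA: "continuous_on {0..} (\<lambda>t. L n (U n t))"
    using bounded_linear.has_vector_derivative[OF L_bl flowD(1)]
    by (auto simp: continuous_on_eq_continuous_within intro: has_vector_derivative_continuous)
  show ?thesis unfolding strong_sol_def
  proof (intro conjI allI impI)
    fix t :: real assume t: "0 \<le> t"
    show "U n t \<in> dom A" by (rule domU[OF t])
    show "V n t \<in> dom B" by (rule dom_AB(1)[OF domU(2)[OF t]])
    show "(U n has_vector_derivative V n t) (at t within {0..})" by (rule flowD[OF t])
    show "((\<lambda>t. B \<cdot> U n t) has_vector_derivative B \<cdot> V n t) (at t within {0..})" by (rule BU[OF t])
    show "(V n has_vector_derivative accel \<epsilon> p \<gamma> (U n) (V n) t) (at t within {0..})"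
      unfolding accel_def using flowD(2)[OF t, of n] unfolding form_eq(1)[OF t] unfolding AU(1)[OF t] .
  next
    show "continuous_on {0..} (\<lambda>t. A \<cdot> U n t)" using continuous_on_cong[THEN iffD1, OF refl _ CA] by (simp add: AU)
    show "continuous_on {0..} (\<lambda>t. B \<cdot> V n t)" using continuous_on_cong[THEN iffD1, OF refl _ BV] by (simp add: AU)
  qed
qed

abbreviation "Ylo \<equiv> (norm (B \<cdot> u0))\<^sup>2 / 2"
abbreviation "Yhi \<equiv> (norm (B \<cdot> u0))\<^sup>2"
abbreviation "Ahi \<equiv> (norm (A \<cdot> u0))\<^sup>2"
abbreviation "Dhi \<equiv> (norm (B \<cdot> u1))\<^sup>2"
abbreviation "Qhi \<equiv> (norm u1)\<^sup>2"

lemma Bu0_in: "u0 \<in> dom B" by (rule dom_AB(1)[OF u0])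

lemma energies: "strong_energy \<epsilon> p \<gamma> (\<lambda>t. inner (L n (U n t)) (U n t)) (\<lambda>t. inner (L n (U n t)) (V n t))
     (\<lambda>t. inner (V n t) (V n t)) (\<lambda>t. inner (U n t) (V n t)) (\<lambda>t. inner (U n t) (U n t))
     (\<lambda>t. inner (L n (V n t)) (V n t)) (\<lambda>t. inner (L n (U n t)) (L n (V n t))) (\<lambda>t. inner (L n (U n t)) (L n (U n t)))
     Ylo Yhi Ahi Dhi Qhi M"
proof (rule bounded_form.flow_strong_energy[OF form flow par])
  show "0 < Ylo" using Bu0 by simp
  show "Ylo \<le> inner (L n (U n 0)) (U n 0)" using init_low[of n] unfolding form_eq(1)[OF order_refl] unfolding init(1) .
  have "norm (B \<cdot> E n u0) \<le> norm (B \<cdot> u0)" using E_norm[of n "B \<cdot> u0"] by (simp add: E_B[OF Bu0_in])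
  then show "inner (L n (U n 0)) (U n 0) \<le> Yhi"
    unfolding form_eq(1)[OF order_refl] unfolding init(1) by (simp add: power_mono)
  have "norm (A \<cdot> E n u0) \<le> norm (A \<cdot> u0)" using E_norm[of n "A \<cdot> u0"] by (simp add: E_A[OF u0])
  then show "inner (L n (U n 0)) (L n (U n 0)) \<le> Ahi"
    unfolding AU(1)[OF order_refl] unfolding init(1) by (simp add: power_mono flip: power2_norm_eq_inner)
  have "norm (B \<cdot> E n u1) \<le> norm (B \<cdot> u1)" using E_norm[of n "B \<cdot> u1"] by (simp add: E_B[OF u1])
  then show "inner (L n (V n 0)) (V n 0) \<le> Dhi"
    unfolding form_eq(2)[OF order_refl] unfolding init(2) by (simp add: power_mono)
  show "inner (V n 0) (V n 0) \<le> Qhi" using E_norm[of n u1] by (simp add: init power_mono flip: power2_norm_eq_inner)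
qed (fact M small)+

abbreviation "PBc \<equiv> P_bound \<gamma> Ylo Ahi Dhi"
abbreviation "WBc \<equiv> W_bound \<gamma> Ylo Yhi Ahi Dhi"
abbreviation "QBc \<equiv> Q_bound \<gamma> Ylo Yhi Ahi Dhi Qhi"
abbreviation "RBc \<equiv> R_bound \<gamma> Ylo Ahi Dhi Qhi"
definition "low = Ylo powr (-\<gamma>) + 2 * \<gamma> * (RBc + PBc)"
definition "Fhi = 2 * Qhi + 2 * (norm u0)\<^sup>2 + Yhi powr (\<gamma> + 1)"

lemma estimates:
  assumes t: "0 \<le> t"
  shows "0 < (norm (B \<cdot> U n t))\<^sup>2" "(norm (A \<cdot> U n t))\<^sup>2 \<le> PBc * (norm (B \<cdot> U n t))\<^sup>2"
    "((norm (B \<cdot> U n t))\<^sup>2) powr (\<gamma> - 1) * (norm (A \<cdot> U n t))\<^sup>2 * (1 + t) powr (p + 1) \<le> WBc"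
    "(norm (V n t))\<^sup>2 * (1 + t) powr (1 - p) \<le> QBc * ((norm (B \<cdot> U n t))\<^sup>2) powr (\<gamma> + 1)"
    "((norm (B \<cdot> U n t))\<^sup>2) powr (-\<gamma>) \<le> low * (1 + t) powr (p + 1)"
    "\<epsilon> * (norm (B \<cdot> V n t))\<^sup>2 \<le> (\<epsilon> * M\<^sup>2 + M) * (norm (B \<cdot> U n t))\<^sup>2"
  using strong_energy.strong_decay[OF energies t, of n]
  unfolding form_eq[OF t] unfolding AU(1)[OF t] power2_norm_eq_inner[symmetric] low_def by blast+

lemma BU_bound:
  assumes t: "0 \<le> t"
  shows "(norm (B \<cdot> U n t))\<^sup>2 \<le> max 1 (4 * (\<gamma> + 1) * Fhi)"
proof -
  interpret weak_energy \<epsilon> p \<gamma> "{0..}" "\<lambda>t. (norm (B \<cdot> U n t))\<^sup>2" "\<lambda>t. inner (B \<cdot> U n t) (B \<cdot> V n t)"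
     "\<lambda>t. (norm (V n t))\<^sup>2" "\<lambda>t. inner (U n t) (V n t)" "\<lambda>t. (norm (U n t))\<^sup>2"
    by (rule strong_sol_weak_energy[OF sol par])
  define y where "y = (norm (B \<cdot> U n t))\<^sup>2"
  have y0: "0 < y" using estimates(1)[OF t] by (simp add: y_def)
  have "F 0 \<le> Fhi"
  proof -
    have 1: "norm (V n 0) \<le> norm u1" "norm (U n 0) \<le> norm u0" using E_norm by (simp_all add: init)
    have "norm (B \<cdot> U n 0) \<le> norm (B \<cdot> u0)" using E_norm[of n "B \<cdot> u0"] by (simp add: E_B[OF Bu0_in] init)
    then have "((norm (B \<cdot> U n 0))\<^sup>2) powr (\<gamma> + 1) \<le> Yhi powr (\<gamma> + 1)"
      using par by (intro powr_mono2 power_mono) auto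
    moreover have "(norm (V n 0))\<^sup>2 \<le> Qhi" "(norm (U n 0))\<^sup>2 \<le> (norm u0)\<^sup>2" using 1 by (auto intro: power_mono)
    moreover have "F 0 \<le> 2 * (norm (V n 0))\<^sup>2 + 2 * (norm (U n 0))\<^sup>2 + ((norm (B \<cdot> U n 0))\<^sup>2) powr (\<gamma> + 1)"
      using F_0_le by simp
    ultimately show ?thesis unfolding Fhi_def by linarith
  qed
  then have F: "4 * (\<gamma> + 1) * F 0 \<le> 4 * (\<gamma> + 1) * Fhi" using par by (intro mult_left_mono) auto
  have "1 * y powr (\<gamma> + 1) \<le> (1 + t) powr (p + 1) * y powr (\<gamma> + 1)"
    using t par by (intro mult_right_mono) (auto intro: ge_one_powr_ge_zero)
  then have 1: "y powr (\<gamma> + 1) \<le> 4 * (\<gamma> + 1) * Fhi" using weak_decay(2)[of t] t F unfolding y_def by simp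
  \<comment> \<open>Either y \<le> 1, or y \<le> y^(\<gamma>+1); this is the origin of the maximum
    with 1.\<close>
  show ?thesis
  proof (cases "y \<le> 1")
    case False
    then have "y powr 1 \<le> y powr (\<gamma> + 1)" using par by (intro powr_mono) auto
    then show ?thesis using 1 y0 by (simp add: y_def)
  qed (simp add: y_def)
qed

text \<open>What the convergence proof consumes at fixed \<epsilon> and T: uniformity in n and a
  positive lower bound, which makes the problem nondegenerate on {0..T}.\<close>

lemma local_bounds:
  obtains \<delta> K where "0 < \<delta>" "0 < K" "\<And>n t. 0 \<le> t \<Longrightarrow> t \<le> T \<Longrightarrow> \<delta> \<le> (norm (B \<cdot> U n t))\<^sup>2 \<and> norm (B \<cdot> U n t) \<le> K
      \<and> norm (B \<cdot> V n t) \<le> K \<and> norm (A \<cdot> U n t) \<le> K"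
proof (cases "0 \<le> T")
  case True
  define Y where "Y = max 1 (4 * (\<gamma> + 1) * Fhi)"
  have pos: "0 \<le> PBc" "0 \<le> RBc" "0 \<le> M"
    using strong_energy.bounds_nonneg[OF energies[of 0]] by auto
  have low0: "0 < low"
    using Bu0 par pos by (simp add: low_def add_pos_nonneg)
  define X where "X = low * (1 + T) powr (p + 1)"
  have X0: "0 < X" using low0 True by (simp add: X_def)
  \<comment> \<open>The inequality y^(-\<gamma>) \<le> X solved for y.\<close>
  define \<delta> where "\<delta> = X powr (- (1 / \<gamma>))"
  define K2 where "K2 = Y + PBc * Y + ((\<epsilon> * M\<^sup>2 + M) * Y) / \<epsilon>"
  have Y1: "1 \<le> Y" by (simp add: Y_def)
  have K2: "Y \<le> K2" "PBc * Y \<le> K2" "((\<epsilon> * M\<^sup>2 + M) * Y) / \<epsilon> \<le> K2" "0 < K2"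
  proof -
    have 1: "0 \<le> PBc * Y" "0 \<le> ((\<epsilon> * M\<^sup>2 + M) * Y) / \<epsilon>" using pos Y1 par by auto
    show "Y \<le> K2" "PBc * Y \<le> K2" "((\<epsilon> * M\<^sup>2 + M) * Y) / \<epsilon> \<le> K2" "0 < K2"
      using 1 Y1 unfolding K2_def by linarith+
  qed
  have "\<delta> \<le> (norm (B \<cdot> U n t))\<^sup>2 \<and> norm (B \<cdot> U n t) \<le> sqrt K2 \<and> norm (B \<cdot> V n t) \<le> sqrt K2 \<and> norm (A \<cdot> U n t) \<le> sqrt K2"
    if t: "0 \<le> t" "t \<le> T" for n t
  proof -
    define y where "y = (norm (B \<cdot> U n t))\<^sup>2"
    note est = estimates[OF t(1), of n, folded y_def]
    have yY: "y \<le> Y" using BU_bound[OF t(1)] by (simp add: y_def Y_def)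
    have "y powr (-\<gamma>) \<le> X"
    proof -
      have "low * (1 + t) powr (p + 1) \<le> X" unfolding X_def
        using low0 t par by (intro mult_left_mono powr_mono2) auto
      then show ?thesis using est(5) by linarith
    qed
    then have "X powr (- (1 / \<gamma>)) \<le> (y powr (-\<gamma>)) powr (- (1 / \<gamma>))"
      using par est(1) by (intro powr_mono2') auto
    also have "\<dots> = y" using par est(1) by (simp add: powr_powr)
    finally have 1: "\<delta> \<le> y" by (simp add: \<delta>_def)
    have "y \<le> K2" using yY K2 by linarith
    then have 2: "norm (B \<cdot> U n t) \<le> sqrt K2" unfolding y_def by (rule real_le_rsqrt)
    have "PBc * y \<le> PBc * Y" using yY pos by (intro mult_left_mono) auto
    then have "(norm (A \<cdot> U n t))\<^sup>2 \<le> K2" using est(2) K2 by linarith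
    then have 3: "norm (A \<cdot> U n t) \<le> sqrt K2" by (rule real_le_rsqrt)
    have "(\<epsilon> * M\<^sup>2 + M) * y \<le> (\<epsilon> * M\<^sup>2 + M) * Y" using yY pos par by (intro mult_left_mono) auto
    then have "\<epsilon> * (norm (B \<cdot> V n t))\<^sup>2 \<le> (\<epsilon> * M\<^sup>2 + M) * Y" using est(6) by linarith
    then have "(norm (B \<cdot> V n t))\<^sup>2 \<le> ((\<epsilon> * M\<^sup>2 + M) * Y) / \<epsilon>" using par by (simp add: pos_le_divide_eq mult.commute)
    then have "(norm (B \<cdot> V n t))\<^sup>2 \<le> K2" using K2 by linarith
    then have 4: "norm (B \<cdot> V n t) \<le> sqrt K2" by (rule real_le_rsqrt)
    show ?thesis using 1 2 3 4 by (simp add: y_def)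
  qed
  then show ?thesis using that[of \<delta> "sqrt K2"] X0 K2(4) by (auto simp: \<delta>_def)
next
  case False
  then show ?thesis by (intro that[of 1 1]) auto
qed

end

section \<open>Uniform convergence of the approximations\<close>

lemma uniformly_Cauchy_on_normI:
  fixes f :: "nat \<Rightarrow> 'c \<Rightarrow> 'b::real_normed_vector"
  assumes "\<And>e. 0 < e \<Longrightarrow> \<exists>N. \<forall>m\<ge>N. \<forall>n\<ge>N. \<forall>t\<in>X. norm (f m t - f n t) \<le> e"
  shows "uniformly_Cauchy_on X f"
proof (rule uniformly_Cauchy_onI)
  fix e :: real assume e: "0 < e"
  then obtain N where N: "\<forall>m\<ge>N. \<forall>n\<ge>N. \<forall>t\<in>X. norm (f m t - f n t) \<le> e / 2" using assms[of "e / 2"] by auto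
  show "\<exists>M. \<forall>x\<in>X. \<forall>m\<ge>M. \<forall>n\<ge>M. dist (f m x) (f n x) < e"
  proof (intro exI ballI allI impI)
    fix x m n assume "x \<in> X" "N \<le> m" "N \<le> n"
    then have "norm (f m x - f n x) \<le> e / 2" using N by blast
    then show "dist (f m x) (f n x) < e" using e by (simp add: dist_norm)
  qed
qed

lemma Cauchy_normD:
  fixes x :: "nat \<Rightarrow> 'b::real_normed_vector"
  assumes "x \<longlonglongrightarrow> l" "0 < e"
  shows "\<exists>N. \<forall>m\<ge>N. \<forall>n\<ge>N. norm (x m - x n) \<le> e"
proof -
  obtain N where "\<And>m n. m \<ge> N \<Longrightarrow> n \<ge> N \<Longrightarrow> dist (x m) (x n) < e"
    using LIMSEQ_imp_Cauchy[OF assms(1)] assms(2) by (meson metric_CauchyD)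
  then show ?thesis by (intro exI[of _ N]) (simp add: dist_norm less_imp_le)
qed

lemma uniform_limit_lim:
  fixes f :: "nat \<Rightarrow> 'c \<Rightarrow> 'b::complete_space"
  assumes "uniformly_Cauchy_on X f"
  shows "uniform_limit X f (\<lambda>t. lim (\<lambda>n. f n t)) sequentially"
  using assms by (simp add: uniformly_convergent_eq_Cauchy flip: uniformly_convergent_uniform_limit_iff)

context approximation
begin

lemma coeff_bound: "(norm (B \<cdot> U n 0))\<^sup>2 powr \<gamma> \<le> Yhi powr \<gamma>"
proof -
  have "norm (B \<cdot> U n 0) \<le> norm (B \<cdot> u0)" using E_norm[of n "B \<cdot> u0"] by (simp add: E_B[OF Bu0_in] init)
  then show ?thesis using par by (intro powr_mono2 power_mono) auto
qed

lemma first_order_Cauchy: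
  assumes T: "0 \<le> T" and e: "0 < e"
  shows "\<exists>N. \<forall>m\<ge>N. \<forall>n\<ge>N. \<forall>t\<in>{0..T}. norm (V m t - V n t) \<le> e \<and> norm (B \<cdot> U m t - B \<cdot> U n t) \<le> e"
proof -
  obtain \<delta> K where \<delta>K: "0 < \<delta>" "0 < K" "\<And>n t. 0 \<le> t \<Longrightarrow> t \<le> T \<Longrightarrow> \<delta> \<le> (norm (B \<cdot> U n t))\<^sup>2 \<and> norm (B \<cdot> U n t) \<le> K
      \<and> norm (B \<cdot> V n t) \<le> K \<and> norm (A \<cdot> U n t) \<le> K"
    by (rule local_bounds[of T], rule that)
  define G where "G = exp (\<bar>growth \<epsilon> \<gamma> \<delta> K\<bar> * T)"
  define \<mu> where "\<mu> = min \<epsilon> (\<delta> powr \<gamma>)"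
  have \<mu>: "0 < \<mu>" using par \<delta>K by (simp add: \<mu>_def)
  define W where "W = (1 + Yhi powr \<gamma>) * G"
  have W: "0 < W" by (simp add: W_def G_def add_pos_nonneg)
  \<comment> \<open>From the data to time t the squared norms grow by at most W/\<mu>, where \<mu>
    is the coercivity constant of the energy; this \<eta> makes the result e^2.\<close>
  define \<eta> where "\<eta> = e * sqrt (\<mu> / W)"
  have \<eta>: "0 < \<eta>" "\<eta>\<^sup>2 * W = \<mu> * e\<^sup>2" using e \<mu> W by (simp_all add: \<eta>_def power_mult_distrib)
  obtain N1 where N1: "\<And>m n. N1 \<le> m \<Longrightarrow> N1 \<le> n \<Longrightarrow> norm (E m u1 - E n u1) \<le> \<eta>"
    using Cauchy_normD[OF E_lim \<eta>(1)] by blast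
  obtain N2 where N2: "\<And>m n. N2 \<le> m \<Longrightarrow> N2 \<le> n \<Longrightarrow> norm (E m (B \<cdot> u0) - E n (B \<cdot> u0)) \<le> \<eta>"
    using Cauchy_normD[OF E_lim \<eta>(1)] by blast
  show ?thesis
  proof (intro exI[of _ "max N1 N2"] allI impI ballI)
    fix m n t assume mn: "max N1 N2 \<le> m" "max N1 N2 \<le> n" and "t \<in> {0..T}"
    then have t: "0 \<le> t" "t \<le> T" by auto
    have st: "\<epsilon> * (norm (V m t - V n t))\<^sup>2 + (norm (B \<cdot> U m t))\<^sup>2 powr \<gamma> * (norm (B \<cdot> U m t - B \<cdot> U n t))\<^sup>2
      \<le> (\<epsilon> * (norm (V m 0 - V n 0))\<^sup>2 + (norm (B \<cdot> U m 0))\<^sup>2 powr \<gamma> * (norm (B \<cdot> U m 0 - B \<cdot> U n 0))\<^sup>2) * exp (growth \<epsilon> \<gamma> \<delta> K * t)"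
      by (rule stability[OF sol sol par(1,5) \<delta>K(1) t(1)]) (use \<delta>K(3) t in auto)
    have "\<epsilon> * (norm (V m 0 - V n 0))\<^sup>2 \<le> 1 * \<eta>\<^sup>2"
      using N1[of m n] mn par by (intro mult_mono power_mono) (auto simp: init)
    moreover have "(norm (B \<cdot> U m 0))\<^sup>2 powr \<gamma> * (norm (B \<cdot> U m 0 - B \<cdot> U n 0))\<^sup>2 \<le> Yhi powr \<gamma> * \<eta>\<^sup>2"
      using N2[of m n] mn coeff_bound[of m] by (intro mult_mono power_mono) (auto simp: init E_B[OF Bu0_in])
    ultimately have i: "\<epsilon> * (norm (V m 0 - V n 0))\<^sup>2 + (norm (B \<cdot> U m 0))\<^sup>2 powr \<gamma> * (norm (B \<cdot> U m 0 - B \<cdot> U n 0))\<^sup>2 \<le> (1 + Yhi powr \<gamma>) * \<eta>\<^sup>2"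
      by (simp add: algebra_simps)
    have "growth \<epsilon> \<gamma> \<delta> K * t \<le> \<bar>growth \<epsilon> \<gamma> \<delta> K\<bar> * T" using t by (intro mult_mono) auto
    then have g: "exp (growth \<epsilon> \<gamma> \<delta> K * t) \<le> G" by (simp add: G_def)
    have "(\<epsilon> * (norm (V m 0 - V n 0))\<^sup>2 + (norm (B \<cdot> U m 0))\<^sup>2 powr \<gamma> * (norm (B \<cdot> U m 0 - B \<cdot> U n 0))\<^sup>2) * exp (growth \<epsilon> \<gamma> \<delta> K * t)
      \<le> (1 + Yhi powr \<gamma>) * \<eta>\<^sup>2 * G"
      by (rule mult_mono[OF i g]) (use par in auto)
    also have "\<dots> = \<eta>\<^sup>2 * W" by (simp add: W_def)
    also have "\<dots> = \<mu> * e\<^sup>2" by (rule \<eta>)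
    finally have le: "\<epsilon> * (norm (V m t - V n t))\<^sup>2 + (norm (B \<cdot> U m t))\<^sup>2 powr \<gamma> * (norm (B \<cdot> U m t - B \<cdot> U n t))\<^sup>2 \<le> \<mu> * e\<^sup>2"
      using st by linarith
    have c: "\<mu> \<le> (norm (B \<cdot> U m t))\<^sup>2 powr \<gamma>"
    proof -
      have "\<delta> powr \<gamma> \<le> (norm (B \<cdot> U m t))\<^sup>2 powr \<gamma>" using \<delta>K t par by (intro powr_mono2) auto
      then show ?thesis by (simp add: \<mu>_def)
    qed
    have 1: "\<mu> * (norm (V m t - V n t))\<^sup>2 \<le> \<epsilon> * (norm (V m t - V n t))\<^sup>2"
      by (rule mult_right_mono) (simp_all add: \<mu>_def)
    have 2: "\<mu> * (norm (B \<cdot> U m t - B \<cdot> U n t))\<^sup>2 \<le> (norm (B \<cdot> U m t))\<^sup>2 powr \<gamma> * (norm (B \<cdot> U m t - B \<cdot> U n t))\<^sup>2"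
      by (rule mult_right_mono[OF c]) simp
    have n: "0 \<le> \<mu> * (norm (V m t - V n t))\<^sup>2" "0 \<le> \<mu> * (norm (B \<cdot> U m t - B \<cdot> U n t))\<^sup>2" using \<mu> by auto
    have "\<mu> * (norm (V m t - V n t))\<^sup>2 \<le> \<mu> * e\<^sup>2" "\<mu> * (norm (B \<cdot> U m t - B \<cdot> U n t))\<^sup>2 \<le> \<mu> * e\<^sup>2"
      using le 1 2 n by linarith+
    then have "(norm (V m t - V n t))\<^sup>2 \<le> e\<^sup>2" "(norm (B \<cdot> U m t - B \<cdot> U n t))\<^sup>2 \<le> e\<^sup>2" using \<mu> by auto
    then show "norm (V m t - V n t) \<le> e \<and> norm (B \<cdot> U m t - B \<cdot> U n t) \<le> e"
      using e by (auto intro: power2_le_imp_le)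
  qed
qed

lemma first_order_uniformly_Cauchy:
  assumes "0 \<le> T"
  shows "uniformly_Cauchy_on {0..T} V" "uniformly_Cauchy_on {0..T} (\<lambda>n t. B \<cdot> U n t)"
proof -
  show "uniformly_Cauchy_on {0..T} V"
  proof (rule uniformly_Cauchy_on_normI)
    fix e :: real assume "0 < e"
    from first_order_Cauchy[OF assms this] obtain N where
      "\<forall>m\<ge>N. \<forall>n\<ge>N. \<forall>t\<in>{0..T}. norm (V m t - V n t) \<le> e \<and> norm (B \<cdot> U m t - B \<cdot> U n t) \<le> e" ..
    then show "\<exists>N. \<forall>m\<ge>N. \<forall>n\<ge>N. \<forall>t\<in>{0..T}. norm (V m t - V n t) \<le> e"
      by (intro exI[of _ N]) simp
  qed
  show "uniformly_Cauchy_on {0..T} (\<lambda>n t. B \<cdot> U n t)"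
  proof (rule uniformly_Cauchy_on_normI)
    fix e :: real assume "0 < e"
    from first_order_Cauchy[OF assms this] obtain N where
      "\<forall>m\<ge>N. \<forall>n\<ge>N. \<forall>t\<in>{0..T}. norm (V m t - V n t) \<le> e \<and> norm (B \<cdot> U m t - B \<cdot> U n t) \<le> e" ..
    then show "\<exists>N. \<forall>m\<ge>N. \<forall>n\<ge>N. \<forall>t\<in>{0..T}. norm (B \<cdot> U m t - B \<cdot> U n t) \<le> e"
      by (intro exI[of _ N]) simp
  qed
qed

lemma U_close:
  assumes T: "0 \<le> T" and e: "0 < e"
  shows "\<exists>N. \<forall>m\<ge>N. \<forall>n\<ge>N. \<forall>t\<in>{0..T}. norm (U m t - U n t) \<le> e"
proof -
  define \<eta> where "\<eta> = e / (1 + T)"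
  have \<eta>: "0 < \<eta>" using e T by (simp add: \<eta>_def)
  obtain N1 where N1: "\<And>m n. N1 \<le> m \<Longrightarrow> N1 \<le> n \<Longrightarrow> norm (E m u0 - E n u0) \<le> \<eta>"
    using Cauchy_normD[OF E_lim \<eta>] by blast
  obtain N2 where N2: "\<And>m n t. N2 \<le> m \<Longrightarrow> N2 \<le> n \<Longrightarrow> t \<in> {0..T} \<Longrightarrow> norm (V m t - V n t) \<le> \<eta>"
    using first_order_Cauchy[OF T \<eta>] by blast
  show ?thesis
  proof (intro exI[of _ "max N1 N2"] allI impI ballI)
    fix m n t assume mn: "max N1 N2 \<le> m" "max N1 N2 \<le> n" and t: "t \<in> {0..T}"
    have "norm ((U m t - U n t) - (U m 0 - U n 0)) \<le> \<eta> * \<bar>t - 0\<bar>"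
    proof (rule vector_derivative_bound[of 0 T])
      fix s assume s: "s \<in> {0..T}"
      show "((\<lambda>s. U m s - U n s) has_vector_derivative V m s - V n s) (at s within {0..T})"
        by (rule has_vector_derivative_within_subset[OF has_vector_derivative_diff[OF flowD(1) flowD(1)]]) (use s in auto)
      show "norm (V m s - V n s) \<le> \<eta>" using N2 mn s by simp
    qed (use t T in auto)
    also have "\<eta> * \<bar>t - 0\<bar> \<le> \<eta> * T" using \<eta> t by (intro mult_left_mono) auto
    finally have "norm ((U m t - U n t) - (U m 0 - U n 0)) \<le> \<eta> * T" .
    moreover have "norm (U m 0 - U n 0) \<le> \<eta>" using N1 mn by (simp add: init)
    moreover have "norm (U m t - U n t) \<le> norm ((U m t - U n t) - (U m 0 - U n 0)) + norm (U m 0 - U n 0)"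
      using norm_triangle_ineq[of "(U m t - U n t) - (U m 0 - U n 0)" "U m 0 - U n 0"] by simp
    ultimately have "norm (U m t - U n t) \<le> \<eta> * T + \<eta>" by linarith
    also have "\<dots> = \<eta> * (1 + T)" by (simp add: algebra_simps)
    also have "\<dots> = e" using T by (simp add: \<eta>_def)
    finally show "norm (U m t - U n t) \<le> e" .
  qed
qed

text \<open>Second order energy of \<open>(1 - E k) u\<close>: it solves the linear equation with the coefficient of
  \<open>u\<close>, so its energy is controlled, uniformly in \<open>n\<close>, by that of the tail of the data.\<close>

lemma tail_energy:
  assumes T: "0 \<le> T" and \<delta>K: "0 < \<delta>" "\<And>n t. 0 \<le> t \<Longrightarrow> t \<le> T \<Longrightarrow> \<delta> \<le> (norm (B \<cdot> U n t))\<^sup>2 \<and> norm (B \<cdot> U n t) \<le> K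
      \<and> norm (B \<cdot> V n t) \<le> K \<and> norm (A \<cdot> U n t) \<le> K"
  defines "C \<equiv> \<gamma> * (K\<^sup>2) powr (\<gamma> - 1) * (2 * K * K) / \<delta> powr \<gamma>"
    and "g \<equiv> \<lambda>n k t. \<epsilon> * (norm (S n (V n t) - S k (V n t)))\<^sup>2 + (norm (B \<cdot> U n t))\<^sup>2 powr \<gamma> * (norm (L n (U n t) - L k (U n t)))\<^sup>2"
  shows "g n k T \<le> g n k 0 * exp (C * T)"
proof -
  define x where "x t = L n (U n t) - L k (U n t)" for t
  define z where "z t = S n (V n t) - S k (V n t)" for t
  define y where "y t = (norm (B \<cdot> U n t))\<^sup>2" for t
  define e where "e = g n k"
  have e: "e t = \<epsilon> * inner (z t) (z t) + y t powr \<gamma> * inner (x t) (x t)" for t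
    by (simp add: e_def g_def x_def y_def z_def power2_norm_eq_inner)
  have K0: "0 \<le> K" using \<delta>K(2)[OF order_refl T, of 0] norm_ge_zero[of "B \<cdot> U 0 0"] by linarith
  have "\<exists>D. (e has_real_derivative D) (at t within {0..T}) \<and> D \<le> C * e t" if t: "0 \<le> t" "t \<le> T" for t
  proof -
    note bt = \<delta>K(2)[OF t, of n]
    let ?b = "(1 + t) powr (-p)"
    define c where "c = y t powr \<gamma>"
    have y0: "0 < y t" using bt \<delta>K(1) unfolding y_def by linarith
    note d = strong_solD[OF sol t(1), of n]
    have yd: "(y has_real_derivative 2 * inner (B \<cdot> U n t) (B \<cdot> V n t)) (at t within {0..})"
      unfolding y_def[abs_def]
      using has_real_derivative_inner[OF d(5) d(5)] by (simp add: inner_commute power2_norm_eq_inner)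
    have cd: "((\<lambda>t. y t powr \<gamma>) has_real_derivative \<gamma> * y t powr (\<gamma> - 1) * (2 * inner (B \<cdot> U n t) (B \<cdot> V n t))) (at t within {0..})"
      by (rule DERIV_chain2[OF has_real_derivative_powr[OF y0] yd])
    define a where "a = accel \<epsilon> p \<gamma> (U n) (V n) t"
    define x' where "x' = L n (V n t) - L k (V n t)"
    define z' where "z' = S n a - S k a"
    have xd: "(x has_vector_derivative x') (at t within {0..})"
      unfolding x_def[abs_def] x'_def
      by (intro has_vector_derivative_diff bounded_linear.has_vector_derivative[OF L_bl] d)
    have zd: "(z has_vector_derivative z') (at t within {0..})"
      unfolding z_def[abs_def] z'_def a_def
      by (intro has_vector_derivative_diff bounded_linear.has_vector_derivative[OF S_bl] d)
    define D where "D = \<epsilon> * (inner z' (z t) + inner (z t) z') + (\<gamma> * y t powr (\<gamma> - 1) * (2 * inner (B \<cdot> U n t) (B \<cdot> V n t)) * inner (x t) (x t)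
       + (inner x' (x t) + inner (x t) x') * c)"
    have eD: "(e has_real_derivative D) (at t within {0..T})"
    proof (rule DERIV_subset)
      show "(e has_real_derivative D) (at t within {0..})"
        unfolding e[abs_def] D_def c_def
        by (rule DERIV_add[OF DERIV_cmult[OF has_real_derivative_inner[OF zd zd]] DERIV_mult[OF cd has_real_derivative_inner[OF xd xd]]])
    qed auto
    \<comment> \<open>For the cancellation, B has to be applied to \<open>x t\<close>. Rewritten as
      \<rho>, a difference of values of \<open>E n\<close> and \<open>E k\<close>, that vector is
      seen to lie in the domain of \<open>B\<close>; likewise \<open>s\<close> in the domain of
      \<open>A\<close>.\<close>
    define s where "s = E n (V n t) - E k (V n t)"
    define \<rho> where "\<rho> = E n (A \<cdot> U n t) - E k (A \<cdot> U n t)"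
    have sA: "s \<in> dom A" "s \<in> dom B" and \<rho>B: "\<rho> \<in> dom B"
      unfolding s_def \<rho>_def by (intro subspace_diff A_lin(1) B_lin(1) E_dom E_domB)+
    have As: "A \<cdot> s = x'" by (simp add: s_def x'_def L_def A_lin(4)[OF E_dom E_dom])
    have Bs: "B \<cdot> s = z t" by (simp add: s_def z_def S_def B_lin(4)[OF E_domB E_domB])
    have B\<rho>: "B \<cdot> \<rho> = S n (A \<cdot> U n t) - S k (A \<cdot> U n t)" by (simp add: \<rho>_def S_def B_lin(4)[OF E_domB E_domB])
    have \<rho>: "\<rho> = x t" by (simp add: \<rho>_def x_def L_def E_A[OF d(1)])
    have zB: "inner (z t) (B \<cdot> \<rho>) = inner x' (x t)"
      using A_inner[OF sA(1) \<rho>B] by (simp add: As Bs \<rho>)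
    have Sa: "S i a = (- (1 / \<epsilon>)) *\<^sub>R (?b *\<^sub>R S i (V n t) + c *\<^sub>R S i (A \<cdot> U n t))" for i
      unfolding a_def accel_def c_def y_def by (simp only: linear_scale[OF S_linear] linear_add[OF S_linear])
    have "\<epsilon> *\<^sub>R z' = - (?b *\<^sub>R z t + c *\<^sub>R (B \<cdot> \<rho>))"
      unfolding z'_def Sa z_def B\<rho> using par by (simp add: algebra_simps)
    then have "\<epsilon> * inner z' (z t) = inner (- (?b *\<^sub>R z t + c *\<^sub>R (B \<cdot> \<rho>))) (z t)" by (metis inner_scaleR_left)
    also have "\<dots> = - (?b * inner (z t) (z t) + c * inner x' (x t))"
      unfolding inner_minus_left inner_add_left inner_scaleR_left using zB by (simp add: inner_commute)
    finally have zz: "\<epsilon> * inner z' (z t) = - (?b * inner (z t) (z t) + c * inner x' (x t))" .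
    have "D = 2 * (\<epsilon> * inner z' (z t)) + \<gamma> * y t powr (\<gamma> - 1) * (2 * inner (B \<cdot> U n t) (B \<cdot> V n t)) * inner (x t) (x t) + 2 * c * inner x' (x t)"
      by (simp add: D_def inner_commute algebra_simps)
    then have D: "D = - 2 * (?b * inner (z t) (z t)) + \<gamma> * y t powr (\<gamma> - 1) * (2 * inner (B \<cdot> U n t) (B \<cdot> V n t)) * inner (x t) (x t)"
      unfolding zz by (simp add: algebra_simps)
    have yK: "y t \<le> K\<^sup>2" using bt by (auto simp: y_def intro!: power_mono)
    define C1 where "C1 = \<gamma> * (K\<^sup>2) powr (\<gamma> - 1) * (2 * K * K)"
    have C10: "0 \<le> C1" using par K0 by (simp add: C1_def)
    have i2: "\<gamma> * y t powr (\<gamma> - 1) * (2 * inner (B \<cdot> U n t) (B \<cdot> V n t)) * inner (x t) (x t) \<le> C1 * inner (x t) (x t)"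
    proof (rule mult_right_mono)
      have "inner (B \<cdot> U n t) (B \<cdot> V n t) \<le> norm (B \<cdot> U n t) * norm (B \<cdot> V n t)" by (rule norm_cauchy_schwarz)
      also have "\<dots> \<le> K * K" using bt K0 by (intro mult_mono) auto
      finally have 1: "2 * inner (B \<cdot> U n t) (B \<cdot> V n t) \<le> 2 * K * K" by simp
      have "\<gamma> * y t powr (\<gamma> - 1) * (2 * inner (B \<cdot> U n t) (B \<cdot> V n t)) \<le> \<gamma> * y t powr (\<gamma> - 1) * (2 * K * K)"
        by (rule mult_left_mono[OF 1]) (use par in simp)
      also have "\<dots> \<le> C1" unfolding C1_def
        using yK y0 par K0 by (intro mult_right_mono mult_left_mono powr_mono2) auto
      finally show "\<gamma> * y t powr (\<gamma> - 1) * (2 * inner (B \<cdot> U n t) (B \<cdot> V n t)) \<le> C1" .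
    qed simp
    have x_e: "inner (x t) (x t) \<le> e t / \<delta> powr \<gamma>"
    proof -
      have "\<delta> powr \<gamma> \<le> c" unfolding c_def using bt \<delta>K(1) par by (intro powr_mono2) (auto simp: y_def)
      then have "\<delta> powr \<gamma> * inner (x t) (x t) \<le> c * inner (x t) (x t)" by (intro mult_right_mono) auto
      also have "\<dots> \<le> e t" using par by (simp add: e c_def)
      finally show ?thesis using \<delta>K(1) by (simp add: pos_le_divide_eq mult.commute)
    qed
    have "D \<le> C1 * inner (x t) (x t)" 
    proof -
      have "0 \<le> ?b * inner (z t) (z t)" by simp
      then show ?thesis using i2 unfolding D by linarith
    qed
    also have "\<dots> \<le> C1 * (e t / \<delta> powr \<gamma>)" by (rule mult_left_mono[OF x_e C10])
    also have "\<dots> = C * e t" by (simp add: C_def C1_def)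
    finally show ?thesis using eD by blast
  qed
  then obtain D where D: "\<And>t. 0 \<le> t \<Longrightarrow> t \<le> T \<Longrightarrow> (e has_real_derivative D t) (at t within {0..T})"
    "\<And>t. 0 \<le> t \<Longrightarrow> t \<le> T \<Longrightarrow> D t \<le> C * e t" by metis
  show ?thesis unfolding e_def[symmetric] by (rule gronwall[OF T D])
qed

lemma tail_small:
  assumes T: "0 \<le> T" and e: "0 < e"
  shows "\<exists>k N. \<forall>n\<ge>N. \<forall>t\<in>{0..T}. norm (L n (U n t) - L k (U n t)) \<le> e \<and> norm (S n (V n t) - S k (V n t)) \<le> e"
proof -
  obtain \<delta> K where \<delta>K: "0 < \<delta>" "0 < K" "\<And>n t. 0 \<le> t \<Longrightarrow> t \<le> T \<Longrightarrow> \<delta> \<le> (norm (B \<cdot> U n t))\<^sup>2 \<and> norm (B \<cdot> U n t) \<le> K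
      \<and> norm (B \<cdot> V n t) \<le> K \<and> norm (A \<cdot> U n t) \<le> K"
    by (rule local_bounds[of T], rule that)
  define C where "C = \<gamma> * (K\<^sup>2) powr (\<gamma> - 1) * (2 * K * K) / \<delta> powr \<gamma>"
  have C: "0 \<le> C" using par \<delta>K by (simp add: C_def)
  define \<mu> where "\<mu> = min \<epsilon> (\<delta> powr \<gamma>)"
  have \<mu>: "0 < \<mu>" using par \<delta>K by (simp add: \<mu>_def)
  define W where "W = (1 + Yhi powr \<gamma>) * exp (C * T)"
  have W: "0 < W" by (simp add: W_def add_pos_nonneg)
  define \<eta> where "\<eta> = e * sqrt (\<mu> / W)"
  have \<eta>: "0 < \<eta>" "\<eta>\<^sup>2 * W = \<mu> * e\<^sup>2" using e \<mu> W by (simp_all add: \<eta>_def power_mult_distrib)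
  \<comment> \<open>Thirds, because \<open>bounded_diff\<close> charges one tail at k and twice the
    projection error at n.\<close>
  have ev: "\<exists>N. \<forall>n\<ge>N. norm (E n x - x) < \<eta> / 3" for x
    using LIMSEQ_D[OF E_lim, of "\<eta> / 3" x] \<eta> by simp
  obtain N1 where N1: "\<And>n. N1 \<le> n \<Longrightarrow> norm (E n (A \<cdot> u0) - A \<cdot> u0) < \<eta> / 3" using ev by blast
  obtain N2 where N2: "\<And>n. N2 \<le> n \<Longrightarrow> norm (E n (B \<cdot> u1) - B \<cdot> u1) < \<eta> / 3" using ev by blast
  \<comment> \<open>The tail index depends on the data alone and then works for all n \<ge> k and
    all t in {0..T}.\<close>
  define k where "k = max N1 N2"
  have data: "norm (L n (U n 0) - L k (U n 0)) \<le> \<eta>" "norm (S n (V n 0) - S k (V n 0)) \<le> \<eta>" if n: "k \<le> n" for n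
  proof -
    have "L n (U n 0) - L k (U n 0) = E n (A \<cdot> u0) - E k (E n (A \<cdot> u0))"
      unfolding L_def init E_idem E_A[OF u0, symmetric] E_A[OF E_dom, symmetric] by simp
    then show "norm (L n (U n 0) - L k (U n 0)) \<le> \<eta>"
      using bounded_diff[of n "A \<cdot> u0" k] N1[of n] N1[of k] n by (simp add: k_def norm_minus_commute)
    have "S n (V n 0) - S k (V n 0) = E n (B \<cdot> u1) - E k (E n (B \<cdot> u1))"
      unfolding S_def init E_idem E_B[OF u1, symmetric] E_B[OF E_domB, symmetric] by simp
    then show "norm (S n (V n 0) - S k (V n 0)) \<le> \<eta>"
      using bounded_diff[of n "B \<cdot> u1" k] N2[of n] N2[of k] n by (simp add: k_def norm_minus_commute)
  qed
  show ?thesis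
  proof (intro exI[of _ k] allI impI ballI)
    fix n t assume n: "k \<le> n" and "t \<in> {0..T}"
    then have t: "0 \<le> t" "t \<le> T" by auto
    have st: "\<epsilon> * (norm (S n (V n t) - S k (V n t)))\<^sup>2 + (norm (B \<cdot> U n t))\<^sup>2 powr \<gamma> * (norm (L n (U n t) - L k (U n t)))\<^sup>2
      \<le> (\<epsilon> * (norm (S n (V n 0) - S k (V n 0)))\<^sup>2 + (norm (B \<cdot> U n 0))\<^sup>2 powr \<gamma> * (norm (L n (U n 0) - L k (U n 0)))\<^sup>2) * exp (C * t)"
      unfolding C_def by (rule tail_energy[OF t(1) \<delta>K(1)]) (use \<delta>K(3) t in auto)
    have "\<epsilon> * (norm (S n (V n 0) - S k (V n 0)))\<^sup>2 \<le> 1 * \<eta>\<^sup>2"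
      using data[OF n] par by (intro mult_mono power_mono) auto
    moreover have "(norm (B \<cdot> U n 0))\<^sup>2 powr \<gamma> * (norm (L n (U n 0) - L k (U n 0)))\<^sup>2 \<le> Yhi powr \<gamma> * \<eta>\<^sup>2"
      using data[OF n] coeff_bound[of n] by (intro mult_mono power_mono) auto
    ultimately have i: "\<epsilon> * (norm (S n (V n 0) - S k (V n 0)))\<^sup>2 + (norm (B \<cdot> U n 0))\<^sup>2 powr \<gamma> * (norm (L n (U n 0) - L k (U n 0)))\<^sup>2 \<le> (1 + Yhi powr \<gamma>) * \<eta>\<^sup>2"
      by (simp add: algebra_simps)
    have g: "exp (C * t) \<le> exp (C * T)" using t C by (simp add: mult_left_mono)
    have "(\<epsilon> * (norm (S n (V n 0) - S k (V n 0)))\<^sup>2 + (norm (B \<cdot> U n 0))\<^sup>2 powr \<gamma> * (norm (L n (U n 0) - L k (U n 0)))\<^sup>2) * exp (C * t)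
      \<le> (1 + Yhi powr \<gamma>) * \<eta>\<^sup>2 * exp (C * T)"
      by (rule mult_mono[OF i g]) (use par in auto)
    also have "\<dots> = \<eta>\<^sup>2 * W" by (simp add: W_def)
    also have "\<dots> = \<mu> * e\<^sup>2" by (rule \<eta>)
    finally have le: "\<epsilon> * (norm (S n (V n t) - S k (V n t)))\<^sup>2 + (norm (B \<cdot> U n t))\<^sup>2 powr \<gamma> * (norm (L n (U n t) - L k (U n t)))\<^sup>2 \<le> \<mu> * e\<^sup>2"
      using st by linarith
    have c: "\<mu> \<le> (norm (B \<cdot> U n t))\<^sup>2 powr \<gamma>"
    proof -
      have "\<delta> powr \<gamma> \<le> (norm (B \<cdot> U n t))\<^sup>2 powr \<gamma>" using \<delta>K t par by (intro powr_mono2) auto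
      then show ?thesis by (simp add: \<mu>_def)
    qed
    have 1: "\<mu> * (norm (S n (V n t) - S k (V n t)))\<^sup>2 \<le> \<epsilon> * (norm (S n (V n t) - S k (V n t)))\<^sup>2"
      by (rule mult_right_mono) (simp_all add: \<mu>_def)
    have 2: "\<mu> * (norm (L n (U n t) - L k (U n t)))\<^sup>2 \<le> (norm (B \<cdot> U n t))\<^sup>2 powr \<gamma> * (norm (L n (U n t) - L k (U n t)))\<^sup>2"
      by (rule mult_right_mono[OF c]) simp
    have n: "0 \<le> \<mu> * (norm (S n (V n t) - S k (V n t)))\<^sup>2" "0 \<le> \<mu> * (norm (L n (U n t) - L k (U n t)))\<^sup>2" using \<mu> by auto
    have "\<mu> * (norm (L n (U n t) - L k (U n t)))\<^sup>2 \<le> \<mu> * e\<^sup>2" "\<mu> * (norm (S n (V n t) - S k (V n t)))\<^sup>2 \<le> \<mu> * e\<^sup>2"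
      using le 1 2 n by linarith+
    then have "(norm (L n (U n t) - L k (U n t)))\<^sup>2 \<le> e\<^sup>2" "(norm (S n (V n t) - S k (V n t)))\<^sup>2 \<le> e\<^sup>2" using \<mu> by auto
    then show "norm (L n (U n t) - L k (U n t)) \<le> e \<and> norm (S n (V n t) - S k (V n t)) \<le> e"
      using e by (auto intro: power2_le_imp_le)
  qed
qed

text \<open>The tails are uniformly small, and on the range of \<open>E k\<close> the operators are bounded, so that
  first order convergence suffices there.\<close>

lemma second_order_Cauchy:
  assumes T: "0 \<le> T" and e: "0 < e"
  shows "\<exists>N. \<forall>m\<ge>N. \<forall>n\<ge>N. \<forall>t\<in>{0..T}. norm (A \<cdot> U m t - A \<cdot> U n t) \<le> e \<and> norm (B \<cdot> V m t - B \<cdot> V n t) \<le> e"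
proof -
  have e3: "0 < e / 3" using e by simp
  obtain k N0 where k: "\<forall>n\<ge>N0. \<forall>t\<in>{0..T}. norm (L n (U n t) - L k (U n t)) \<le> e / 3 \<and> norm (S n (V n t) - S k (V n t)) \<le> e / 3"
    using tail_small[OF T e3] by blast
  obtain K1 where K1: "0 < K1" "\<And>x. norm (L k x) \<le> norm x * K1" using bounded_linear.pos_bounded[OF L_bl] by blast
  obtain K2 where K2: "0 < K2" "\<And>x. norm (S k x) \<le> norm x * K2" using bounded_linear.pos_bounded[OF S_bl] by blast
  have "0 < e / 3 / K1" "0 < e / 3 / K2" using e K1 K2 by auto
  then obtain N1 N2 where N1: "\<forall>m\<ge>N1. \<forall>n\<ge>N1. \<forall>t\<in>{0..T}. norm (U m t - U n t) \<le> e / 3 / K1"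
    and N2: "\<forall>m\<ge>N2. \<forall>n\<ge>N2. \<forall>t\<in>{0..T}. norm (V m t - V n t) \<le> e / 3 / K2 \<and> norm (B \<cdot> U m t - B \<cdot> U n t) \<le> e / 3 / K2"
    using U_close[OF T] first_order_Cauchy[OF T] by meson
  show ?thesis
  proof (intro exI[of _ "max N0 (max N1 N2)"] allI impI ballI)
    fix m n t assume mn: "max N0 (max N1 N2) \<le> m" "max N0 (max N1 N2) \<le> n" and t: "t \<in> {0..T}"
    have t0: "0 \<le> t" using t by simp
    have tri: "norm (a - b) \<le> e" if "norm (a - a') \<le> e / 3" "norm (b - b') \<le> e / 3" "norm (a' - b') \<le> e / 3" for a b a' b' :: 'a
    proof -
      have "a - b = (a - a') - (b - b') + (a' - b')" by simp
      then have "norm (a - b) \<le> norm ((a - a') - (b - b')) + norm (a' - b')" by (metis norm_triangle_ineq)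
      then show ?thesis using norm_triangle_ineq4[of "a - a'" "b - b'"] that by linarith
    qed
    have "norm (L k (U m t) - L k (U n t)) \<le> norm (U m t - U n t) * K1"
      using K1(2)[of "U m t - U n t"] by (simp add: linear_diff[OF L_linear])
    also have "\<dots> \<le> (e / 3 / K1) * K1" using N1 mn t K1 by (intro mult_right_mono) auto
    also have "\<dots> = e / 3" using K1 by simp
    finally have 1: "norm (L k (U m t) - L k (U n t)) \<le> e / 3" .
    have "norm (S k (V m t) - S k (V n t)) \<le> norm (V m t - V n t) * K2"
      using K2(2)[of "V m t - V n t"] by (simp add: linear_diff[OF S_linear])
    also have "\<dots> \<le> (e / 3 / K2) * K2" using N2 mn t K2 by (intro mult_right_mono) auto
    also have "\<dots> = e / 3" using K2 by simp
    finally have 2: "norm (S k (V m t) - S k (V n t)) \<le> e / 3" .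
    have km: "norm (L m (U m t) - L k (U m t)) \<le> e / 3 \<and> norm (S m (V m t) - S k (V m t)) \<le> e / 3"
      and kn: "norm (L n (U n t) - L k (U n t)) \<le> e / 3 \<and> norm (S n (V n t) - S k (V n t)) \<le> e / 3"
      using k mn t by auto
    show "norm (A \<cdot> U m t - A \<cdot> U n t) \<le> e \<and> norm (B \<cdot> V m t - B \<cdot> V n t) \<le> e"
      using tri[OF km[THEN conjunct1] kn[THEN conjunct1] 1] tri[OF km[THEN conjunct2] kn[THEN conjunct2] 2]
      by (simp add: AU[OF t0])
  qed
qed

lemma uniformly_Cauchy:
  assumes "0 \<le> T"
  shows "uniformly_Cauchy_on {0..T} U" "uniformly_Cauchy_on {0..T} (\<lambda>n t. A \<cdot> U n t)"
    "uniformly_Cauchy_on {0..T} (\<lambda>n t. B \<cdot> V n t)"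
proof -
  show "uniformly_Cauchy_on {0..T} U" by (rule uniformly_Cauchy_on_normI[OF U_close[OF assms]])
  show "uniformly_Cauchy_on {0..T} (\<lambda>n t. A \<cdot> U n t)"
  proof (rule uniformly_Cauchy_on_normI)
    fix e :: real assume "0 < e"
    from second_order_Cauchy[OF assms this] obtain N where
      "\<forall>m\<ge>N. \<forall>n\<ge>N. \<forall>t\<in>{0..T}. norm (A \<cdot> U m t - A \<cdot> U n t) \<le> e \<and> norm (B \<cdot> V m t - B \<cdot> V n t) \<le> e" ..
    then show "\<exists>N. \<forall>m\<ge>N. \<forall>n\<ge>N. \<forall>t\<in>{0..T}. norm (A \<cdot> U m t - A \<cdot> U n t) \<le> e"
      by (intro exI[of _ N]) simp
  qed
  show "uniformly_Cauchy_on {0..T} (\<lambda>n t. B \<cdot> V n t)"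
  proof (rule uniformly_Cauchy_on_normI)
    fix e :: real assume "0 < e"
    from second_order_Cauchy[OF assms this] obtain N where
      "\<forall>m\<ge>N. \<forall>n\<ge>N. \<forall>t\<in>{0..T}. norm (A \<cdot> U m t - A \<cdot> U n t) \<le> e \<and> norm (B \<cdot> V m t - B \<cdot> V n t) \<le> e" ..
    then show "\<exists>N. \<forall>m\<ge>N. \<forall>n\<ge>N. \<forall>t\<in>{0..T}. norm (B \<cdot> V m t - B \<cdot> V n t) \<le> e"
      by (intro exI[of _ N]) simp
  qed
qed

definition "u t = lim (\<lambda>n. U n t)"
definition "v t = lim (\<lambda>n. V n t)"

lemma uniform_limits:
  assumes "0 \<le> T"
  shows "uniform_limit {0..T} U u sequentially" "uniform_limit {0..T} V v sequentially"
  unfolding u_def[abs_def] v_def[abs_def]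
  by (intro uniform_limit_lim uniformly_Cauchy first_order_uniformly_Cauchy assms)+

text \<open>Uniform Cauchy estimates give limits of Au, Bu and Bv along the approximations;
  closedness of the graphs identifies them with the operators at the limits.\<close>

lemma limits:
  assumes t: "0 \<le> t"
  shows "(\<lambda>n. U n t) \<longlonglongrightarrow> u t" "(\<lambda>n. V n t) \<longlonglongrightarrow> v t"
    "u t \<in> dom A" "v t \<in> dom B" "(\<lambda>n. A \<cdot> U n t) \<longlonglongrightarrow> A \<cdot> u t" "(\<lambda>n. B \<cdot> U n t) \<longlonglongrightarrow> B \<cdot> u t"
    "(\<lambda>n. B \<cdot> V n t) \<longlonglongrightarrow> B \<cdot> v t"
proof -
  have tt: "t \<in> {0..t}" using t by simp
  show 1: "(\<lambda>n. U n t) \<longlonglongrightarrow> u t" "(\<lambda>n. V n t) \<longlonglongrightarrow> v t"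
    using tendsto_uniform_limitI[OF uniform_limits(1)[OF t] tt] tendsto_uniform_limitI[OF uniform_limits(2)[OF t] tt] .
  have graph: "x \<in> dom D \<and> D \<cdot> x = y" if "self_adjoint_op D" "\<And>n. X n \<in> dom D" "X \<longlonglongrightarrow> x" "(\<lambda>n. D \<cdot> X n) \<longlonglongrightarrow> y"
    for D :: "'a partial_op" and X x y
  proof -
    have "(x, y) \<in> op_graph D"
    proof (rule closed_sequentially[OF closed_op_graph[OF that(1)]])
      show "(X n, D \<cdot> X n) \<in> op_graph D" for n using that(2)[of n] by (auto simp: op_graph_def)
      show "(\<lambda>n. (X n, D \<cdot> X n)) \<longlonglongrightarrow> (x, y)" by (intro tendsto_intros that)
    qed
    then show ?thesis by (auto simp: op_graph_def)
  qed
  have cA: "(\<lambda>n. A \<cdot> U n t) \<longlonglongrightarrow> lim (\<lambda>n. A \<cdot> U n t)"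
    by (rule tendsto_uniform_limitI[OF uniform_limit_lim[OF uniformly_Cauchy(2)[OF t]] tt])
  have cB: "(\<lambda>n. B \<cdot> U n t) \<longlonglongrightarrow> lim (\<lambda>n. B \<cdot> U n t)"
    by (rule tendsto_uniform_limitI[OF uniform_limit_lim[OF first_order_uniformly_Cauchy(2)[OF t]] tt])
  have cBV: "(\<lambda>n. B \<cdot> V n t) \<longlonglongrightarrow> lim (\<lambda>n. B \<cdot> V n t)"
    by (rule tendsto_uniform_limitI[OF uniform_limit_lim[OF uniformly_Cauchy(3)[OF t]] tt])
  note gA = graph[OF sA domU(1)[OF t] 1(1) cA]
    and gB = graph[OF sB dom_AB(1)[OF domU(1)[OF t]] 1(1) cB]
    and gBV = graph[OF sB dom_AB(1)[OF domU(2)[OF t]] 1(2) cBV]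
  show "u t \<in> dom A" "v t \<in> dom B" using gA gBV by auto
  show "(\<lambda>n. A \<cdot> U n t) \<longlonglongrightarrow> A \<cdot> u t" using cA gA by simp
  show "(\<lambda>n. B \<cdot> U n t) \<longlonglongrightarrow> B \<cdot> u t" using cB gB by simp
  show "(\<lambda>n. B \<cdot> V n t) \<longlonglongrightarrow> B \<cdot> v t" using cBV gBV by simp
qed

lemma uniform_limits_op:
  assumes T: "0 \<le> T"
  shows "uniform_limit {0..T} (\<lambda>n t. A \<cdot> U n t) (\<lambda>t. A \<cdot> u t) sequentially"
    "uniform_limit {0..T} (\<lambda>n t. B \<cdot> U n t) (\<lambda>t. B \<cdot> u t) sequentially"
    "uniform_limit {0..T} (\<lambda>n t. B \<cdot> V n t) (\<lambda>t. B \<cdot> v t) sequentially"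
proof -
  have *: "uniform_limit {0..T} f g sequentially"
    if "uniformly_Cauchy_on {0..T} f" "\<And>t. 0 \<le> t \<Longrightarrow> (\<lambda>n. f n t) \<longlonglongrightarrow> g t" for f :: "nat \<Rightarrow> real \<Rightarrow> 'a" and g
  proof -
    have "uniform_limit {0..T} f (\<lambda>t. lim (\<lambda>n. f n t)) sequentially \<longleftrightarrow> uniform_limit {0..T} f g sequentially"
      by (rule uniform_limit_cong') (simp_all add: limI that(2))
    then show ?thesis using uniform_limit_lim[OF that(1)] by simp
  qed
  show "uniform_limit {0..T} (\<lambda>n t. A \<cdot> U n t) (\<lambda>t. A \<cdot> u t) sequentially"
    by (rule *[OF uniformly_Cauchy(2)[OF T] limits(5)])
  show "uniform_limit {0..T} (\<lambda>n t. B \<cdot> U n t) (\<lambda>t. B \<cdot> u t) sequentially"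
    by (rule *[OF first_order_uniformly_Cauchy(2)[OF T] limits(6)])
  show "uniform_limit {0..T} (\<lambda>n t. B \<cdot> V n t) (\<lambda>t. B \<cdot> v t) sequentially"
    by (rule *[OF uniformly_Cauchy(3)[OF T] limits(7)])
qed

end

section \<open>The limit is a strong solution and inherits the estimates\<close>

context approximation
begin

lemma limit_continuous:
  "continuous_on {0..} (\<lambda>t. A \<cdot> u t)" "continuous_on {0..} (\<lambda>t. B \<cdot> u t)" "continuous_on {0..} (\<lambda>t. B \<cdot> v t)"
  "continuous_on {0..} v"
proof -
  have *: "continuous_on {0..} g"
    if "\<And>n. continuous_on {0..} (f n)" "\<And>T. 0 \<le> T \<Longrightarrow> uniform_limit {0..T} f g sequentially" for f :: "nat \<Rightarrow> real \<Rightarrow> 'a" and g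
  proof (rule continuous_on_halfline)
    fix T :: real assume T: "0 \<le> T"
    show "continuous_on {0..T} g"
      by (rule uniform_limit_theorem[OF _ that(2)[OF T]])
        (auto intro!: always_eventually continuous_on_subset[OF that(1)])
  qed
  note c = strong_sol_continuous[OF sol]
  show "continuous_on {0..} (\<lambda>t. A \<cdot> u t)" by (rule *[OF c(4) uniform_limits_op(1)])
  show "continuous_on {0..} (\<lambda>t. B \<cdot> u t)" by (rule *[OF c(3) uniform_limits_op(2)])
  show "continuous_on {0..} (\<lambda>t. B \<cdot> v t)" by (rule *[OF c(5) uniform_limits_op(3)])
  show "continuous_on {0..} v" by (rule *[OF c(2) uniform_limits(2)])
qed

lemma bounded_halfline:
  fixes f :: "real \<Rightarrow> 'b::real_normed_vector"
  shows "continuous_on {0..} f \<Longrightarrow> bounded (f ` {0..T})"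
  by (intro compact_imp_bounded compact_continuous_image) (auto intro: continuous_on_subset)

text \<open>Uniform convergence of u'' is read off from the equation: a power is Lipschitz on
  bounded sets, and bounded uniform limits may be multiplied.\<close>

lemma accel_uniform_limit:
  assumes T: "0 \<le> T"
  shows "uniform_limit {0..T} (\<lambda>n. accel \<epsilon> p \<gamma> (U n) (V n)) (accel \<epsilon> p \<gamma> u v) sequentially"
proof -
  obtain \<delta> K where \<delta>K: "0 < \<delta>" "0 < K" "\<And>n t. 0 \<le> t \<Longrightarrow> t \<le> T \<Longrightarrow> \<delta> \<le> (norm (B \<cdot> U n t))\<^sup>2 \<and> norm (B \<cdot> U n t) \<le> K
      \<and> norm (B \<cdot> V n t) \<le> K \<and> norm (A \<cdot> U n t) \<le> K"
    by (rule local_bounds[of T], rule that)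
  define C where "C = 2 * \<gamma> * K powr (2 * \<gamma> - 1)"
  have C: "0 < C" using par \<delta>K by (simp add: C_def)
  have uK: "norm (B \<cdot> u t) \<le> K" if "0 \<le> t" "t \<le> T" for t
    by (rule LIMSEQ_le_const2[OF tendsto_norm[OF limits(6)[OF that(1)]]]) (use \<delta>K(3) that in blast)
  have c: "uniform_limit {0..T} (\<lambda>n t. (norm (B \<cdot> U n t))\<^sup>2 powr \<gamma>) (\<lambda>t. (norm (B \<cdot> u t))\<^sup>2 powr \<gamma>) sequentially"
  proof (rule uniform_limitI)
    fix e :: real assume e: "0 < e"
    have "\<forall>\<^sub>F n in sequentially. \<forall>t\<in>{0..T}. dist (B \<cdot> U n t) (B \<cdot> u t) < e / C"
      by (rule uniform_limitD[OF uniform_limits_op(2)[OF T]]) (use e C in simp)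
    then show "\<forall>\<^sub>F n in sequentially. \<forall>t\<in>{0..T}. dist ((norm (B \<cdot> U n t))\<^sup>2 powr \<gamma>) ((norm (B \<cdot> u t))\<^sup>2 powr \<gamma>) < e"
    proof (rule eventually_mono, intro ballI)
      fix n t assume n: "\<forall>t\<in>{0..T}. dist (B \<cdot> U n t) (B \<cdot> u t) < e / C" and "t \<in> {0..T}"
      then have t: "0 \<le> t" "t \<le> T" by auto
      have "\<bar>norm (B \<cdot> U n t) powr (2 * \<gamma>) - norm (B \<cdot> u t) powr (2 * \<gamma>)\<bar>
          \<le> C * \<bar>norm (B \<cdot> U n t) - norm (B \<cdot> u t)\<bar>"
        unfolding C_def by (rule powr_diff_le) (use par \<delta>K(3)[OF t] uK[OF t] in auto)
      also have "\<dots> \<le> C * norm (B \<cdot> U n t - B \<cdot> u t)"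
        using C norm_triangle_ineq3 by (intro mult_left_mono) auto
      also have "\<dots> < C * (e / C)"
        using n t C by (intro mult_strict_left_mono) (auto simp: dist_norm)
      also have "\<dots> = e" using C by simp
      finally show "dist ((norm (B \<cdot> U n t))\<^sup>2 powr \<gamma>) ((norm (B \<cdot> u t))\<^sup>2 powr \<gamma>) < e"
        by (simp add: norm_sq_powr dist_real_def)
    qed
  qed
  have cc: "continuous_on {0..} (\<lambda>t. (norm (B \<cdot> u t))\<^sup>2 powr \<gamma>)"
    by (rule continuous_on_powr') (use par in \<open>auto intro!: continuous_intros limit_continuous\<close>)
  have cb: "continuous_on {0..} (\<lambda>t::real. (1 + t) powr (-p))"
    using has_real_derivative_one_add_powr by (auto intro!: DERIV_continuous_on)
  have 1: "uniform_limit {0..T} (\<lambda>n t. (norm (B \<cdot> U n t))\<^sup>2 powr \<gamma> *\<^sub>R (A \<cdot> U n t))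
      (\<lambda>t. (norm (B \<cdot> u t))\<^sup>2 powr \<gamma> *\<^sub>R (A \<cdot> u t)) sequentially"
    by (rule bounded_bilinear.bounded_uniform_limit[OF bounded_bilinear_scaleR c uniform_limits_op(1)[OF T]
          bounded_halfline[OF limit_continuous(1)] bounded_halfline[OF cc]])
  have 2: "uniform_limit {0..T} (\<lambda>n t. (1 + t) powr (-p) *\<^sub>R V n t) (\<lambda>t. (1 + t) powr (-p) *\<^sub>R v t) sequentially"
    by (rule bounded_bilinear.bounded_uniform_limit[OF bounded_bilinear_scaleR uniform_limit_const uniform_limits(2)[OF T]
          bounded_halfline[OF limit_continuous(4)] bounded_halfline[OF cb]])
  show ?thesis
    unfolding accel_def[abs_def]
    by (rule bounded_linear.uniform_limit[OF bounded_linear_scaleR_right uniform_limit_add[OF 2 1]])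
qed

lemma limit_sol: "strong_sol \<epsilon> p \<gamma> u v"
proof -
  have der: "(G has_vector_derivative G' t) (at t within {0..})"
    if "\<And>n t. 0 \<le> t \<Longrightarrow> (g n has_vector_derivative g' n t) (at t within {0..})"
      "\<And>t. 0 \<le> t \<Longrightarrow> (\<lambda>n. g n t) \<longlonglongrightarrow> G t"
      "\<And>T. 0 \<le> T \<Longrightarrow> uniform_limit {0..T} g' G' sequentially" "0 \<le> t"
    for g g' :: "nat \<Rightarrow> real \<Rightarrow> 'a" and G G' and t :: real
  proof -
    have "(G has_vector_derivative G' t) (at t within {0..t + 1})"
    proof (rule has_vector_derivative_uniform_limit[where f = g and f' = g'])
      fix n s assume s: "s \<in> {0..t + 1}"
      show "(g n has_vector_derivative g' n s) (at s within {0..t + 1})"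
        by (rule has_vector_derivative_within_subset[OF that(1)]) (use s in auto)
      show "(\<lambda>n. g n s) \<longlonglongrightarrow> G s" by (rule that(2)) (use s in simp)
    qed (use that(3,4) in auto)
    then show ?thesis using at_within_halfline[of t "t + 1"] that(4) by simp
  qed
  note d = strong_solD[OF sol]
  show ?thesis unfolding strong_sol_def
  proof (intro conjI allI impI limit_continuous)
    fix t :: real assume t: "0 \<le> t"
    show "u t \<in> dom A" "v t \<in> dom B" by (rule limits[OF t])+
    show "(u has_vector_derivative v t) (at t within {0..})"
      by (rule der[OF d(4) limits(1) uniform_limits(2) t])
    show "((\<lambda>t. B \<cdot> u t) has_vector_derivative B \<cdot> v t) (at t within {0..})"
      by (rule der[OF d(5) limits(6) uniform_limits_op(3) t])
    show "(v has_vector_derivative accel \<epsilon> p \<gamma> u v t) (at t within {0..})"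
      by (rule der[OF d(6) limits(2) accel_uniform_limit t])
  qed
qed

lemma limit_init: "u 0 = u0" "v 0 = u1"
  using LIMSEQ_unique[OF limits(1)[OF order_refl]] LIMSEQ_unique[OF limits(2)[OF order_refl]] E_lim
  by (simp_all add: init)

lemma low_pos: "0 < low"
proof -
  have "0 \<le> PBc" "0 \<le> RBc" using strong_energy.bounds_nonneg[OF energies[of 0]] by auto
  then show ?thesis using Bu0 par by (simp add: low_def add_pos_nonneg)
qed

text \<open>The bound of y^(-\<gamma>) is inverted for each n, before the limit: positivity of the
  limit is what lets real powers of y converge in \<open>limit_estimates\<close>.\<close>

lemma limit_low:
  assumes t: "0 \<le> t"
  shows "low powr (- (1 / \<gamma>)) / (1 + t) powr ((p + 1) / \<gamma>) \<le> (norm (B \<cdot> u t))\<^sup>2"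
proof (rule LIMSEQ_le_const)
  show "(\<lambda>n. (norm (B \<cdot> U n t))\<^sup>2) \<longlonglongrightarrow> (norm (B \<cdot> u t))\<^sup>2" by (intro tendsto_intros limits t)
  define X where "X = low * (1 + t) powr (p + 1)"
  have X0: "0 < X" using low_pos t by (simp add: X_def)
  have "X powr (- (1 / \<gamma>)) = low powr (- (1 / \<gamma>)) * (1 + t) powr ((p + 1) * (- (1 / \<gamma>)))"
    using low_pos t by (simp add: X_def powr_mult powr_powr)
  also have "\<dots> = low powr (- (1 / \<gamma>)) / (1 + t) powr ((p + 1) / \<gamma>)"
    by (simp add: powr_minus divide_inverse)
  finally have eq: "X powr (- (1 / \<gamma>)) = low powr (- (1 / \<gamma>)) / (1 + t) powr ((p + 1) / \<gamma>)" .
  have "low powr (- (1 / \<gamma>)) / (1 + t) powr ((p + 1) / \<gamma>) \<le> (norm (B \<cdot> U n t))\<^sup>2" for n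
  proof -
    define y where "y = (norm (B \<cdot> U n t))\<^sup>2"
    have y: "0 < y" "y powr (-\<gamma>) \<le> X" using estimates(1,5)[OF t, of n] by (simp_all add: y_def X_def)
    then have "X powr (- (1 / \<gamma>)) \<le> (y powr (-\<gamma>)) powr (- (1 / \<gamma>))"
      using par by (intro powr_mono2') auto
    also have "\<dots> = y" using par y by (simp add: powr_powr)
    finally show ?thesis by (simp add: y_def eq)
  qed
  then show "\<exists>N. \<forall>n\<ge>N. low powr (- (1 / \<gamma>)) / (1 + t) powr ((p + 1) / \<gamma>) \<le> (norm (B \<cdot> U n t))\<^sup>2" by blast
qed

lemma limit_pos: "0 \<le> t \<Longrightarrow> 0 < (norm (B \<cdot> u t))\<^sup>2"
proof -
  assume t: "0 \<le> t"
  have "0 < low powr (- (1 / \<gamma>)) / (1 + t) powr ((p + 1) / \<gamma>)" using low_pos t by simp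
  then show ?thesis using limit_low[OF t] by linarith
qed

lemma limit_estimates:
  assumes t: "0 \<le> t"
  shows "((norm (B \<cdot> u t))\<^sup>2) powr (\<gamma> - 1) * (norm (A \<cdot> u t))\<^sup>2 * (1 + t) powr (p + 1) \<le> WBc"
    "(norm (v t))\<^sup>2 * (1 + t) powr (1 - p) \<le> QBc * ((norm (B \<cdot> u t))\<^sup>2) powr (\<gamma> + 1)"
proof -
  have y: "(\<lambda>n. (norm (B \<cdot> U n t))\<^sup>2) \<longlonglongrightarrow> (norm (B \<cdot> u t))\<^sup>2" by (intro tendsto_intros limits t)
  have yp: "(\<lambda>n. ((norm (B \<cdot> U n t))\<^sup>2) powr r) \<longlonglongrightarrow> ((norm (B \<cdot> u t))\<^sup>2) powr r" for r
    by (rule tendsto_powr[OF y tendsto_const]) (use limit_pos[OF t] in simp)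
  show "((norm (B \<cdot> u t))\<^sup>2) powr (\<gamma> - 1) * (norm (A \<cdot> u t))\<^sup>2 * (1 + t) powr (p + 1) \<le> WBc"
  proof (rule LIMSEQ_le_const2)
    show "(\<lambda>n. ((norm (B \<cdot> U n t))\<^sup>2) powr (\<gamma> - 1) * (norm (A \<cdot> U n t))\<^sup>2 * (1 + t) powr (p + 1)) \<longlonglongrightarrow>
      ((norm (B \<cdot> u t))\<^sup>2) powr (\<gamma> - 1) * (norm (A \<cdot> u t))\<^sup>2 * (1 + t) powr (p + 1)"
      by (intro tendsto_mult yp tendsto_power tendsto_norm limits t tendsto_const)
  qed (use estimates(3)[OF t] in blast)
  show "(norm (v t))\<^sup>2 * (1 + t) powr (1 - p) \<le> QBc * ((norm (B \<cdot> u t))\<^sup>2) powr (\<gamma> + 1)"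
  proof (rule LIMSEQ_le)
    show "(\<lambda>n. (norm (V n t))\<^sup>2 * (1 + t) powr (1 - p)) \<longlonglongrightarrow> (norm (v t))\<^sup>2 * (1 + t) powr (1 - p)"
      by (intro tendsto_mult tendsto_power tendsto_norm limits t tendsto_const)
    show "(\<lambda>n. QBc * ((norm (B \<cdot> U n t))\<^sup>2) powr (\<gamma> + 1)) \<longlonglongrightarrow> QBc * ((norm (B \<cdot> u t))\<^sup>2) powr (\<gamma> + 1)"
      by (intro tendsto_mult yp tendsto_const)
  qed (use estimates(4)[OF t] in blast)
qed

end

section \<open>Uniqueness\<close>

context sqrt_pair
begin

text \<open>The weight in \<open>stability\<close> is the coefficient of the first solution alone,
  so its minimum over the compact interval serves as \<delta>; the competitor may be any strong
  solution.\<close>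

lemma uniqueness:
  assumes s1: "strong_sol \<epsilon> p \<gamma> u v" and s2: "strong_sol \<epsilon> p \<gamma> u' v'"
    and par: "0 < \<epsilon>" "1 \<le> \<gamma>" and pos: "\<And>t. 0 \<le> t \<Longrightarrow> 0 < (norm (B \<cdot> u t))\<^sup>2"
    and init: "u 0 = u' 0" "v 0 = v' 0" and t: "0 \<le> t"
  shows "u t = u' t" "v t = v' t"
proof -
  have bd: "\<exists>K\<ge>0. \<forall>t\<in>{0..T}. norm (f t) \<le> K" if "continuous_on {0..} f" for f :: "real \<Rightarrow> 'a" and T
  proof -
    have "bounded (f ` {0..T})"
      using that by (intro compact_imp_bounded compact_continuous_image) (auto intro: continuous_on_subset)
    then show ?thesis unfolding bounded_pos by (auto intro: less_imp_le)
  qed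
  note c1 = strong_sol_continuous[OF s1] and c2 = strong_sol_continuous[OF s2]
  have v_eq: "v T = v' T" if T: "0 \<le> T" for T
  proof -
    obtain K1 where K1: "0 \<le> K1" "\<forall>t\<in>{0..T}. norm (B \<cdot> u t) \<le> K1" using bd[OF c1(3)] by blast
    obtain K2 where K2: "0 \<le> K2" "\<forall>t\<in>{0..T}. norm (B \<cdot> u' t) \<le> K2" using bd[OF c2(3)] by blast
    obtain K3 where K3: "0 \<le> K3" "\<forall>t\<in>{0..T}. norm (B \<cdot> v t) \<le> K3" using bd[OF c1(5)] by blast
    obtain K4 where K4: "0 \<le> K4" "\<forall>t\<in>{0..T}. norm (A \<cdot> u' t) \<le> K4" using bd[OF c2(4)] by blast
    define K where "K = K1 + K2 + K3 + K4"
    have "\<exists>s\<in>{0..T}. \<forall>t\<in>{0..T}. (norm (B \<cdot> u s))\<^sup>2 \<le> (norm (B \<cdot> u t))\<^sup>2"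
      by (rule continuous_attains_inf) (use T in \<open>auto intro!: continuous_intros continuous_on_subset[OF c1(3)]\<close>)
    then obtain s where s: "s \<in> {0..T}" "\<forall>t\<in>{0..T}. (norm (B \<cdot> u s))\<^sup>2 \<le> (norm (B \<cdot> u t))\<^sup>2" by blast
    have "\<epsilon> * (norm (v T - v' T))\<^sup>2 + (norm (B \<cdot> u T))\<^sup>2 powr \<gamma> * (norm (B \<cdot> u T - B \<cdot> u' T))\<^sup>2
      \<le> (\<epsilon> * (norm (v 0 - v' 0))\<^sup>2 + (norm (B \<cdot> u 0))\<^sup>2 powr \<gamma> * (norm (B \<cdot> u 0 - B \<cdot> u' 0))\<^sup>2)
         * exp (growth \<epsilon> \<gamma> ((norm (B \<cdot> u s))\<^sup>2) K * T)"
    proof (rule stability[OF s1 s2 par _ T])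
      show "0 < (norm (B \<cdot> u s))\<^sup>2" by (rule pos) (use s in simp)
      fix t assume "0 \<le> t" "t \<le> T"
      then have t: "t \<in> {0..T}" by simp
      have "norm (B \<cdot> u t) \<le> K1" "norm (B \<cdot> u' t) \<le> K2" "norm (B \<cdot> v t) \<le> K3" "norm (A \<cdot> u' t) \<le> K4"
        using K1(2) K2(2) K3(2) K4(2) t by auto
      then show "(norm (B \<cdot> u s))\<^sup>2 \<le> (norm (B \<cdot> u t))\<^sup>2 \<and> norm (B \<cdot> u t) \<le> K \<and> norm (B \<cdot> u' t) \<le> K
          \<and> norm (B \<cdot> v t) \<le> K \<and> norm (A \<cdot> u' t) \<le> K"
        using s(2) t K1(1) K2(1) K3(1) K4(1) by (auto simp: K_def)
    qed
    also have "\<dots> = 0" by (simp add: init)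
    finally have "\<epsilon> * (norm (v T - v' T))\<^sup>2 + (norm (B \<cdot> u T))\<^sup>2 powr \<gamma> * (norm (B \<cdot> u T - B \<cdot> u' T))\<^sup>2 \<le> 0" .
    moreover have "0 \<le> (norm (B \<cdot> u T))\<^sup>2 powr \<gamma> * (norm (B \<cdot> u T - B \<cdot> u' T))\<^sup>2" by simp
    ultimately have "\<epsilon> * (norm (v T - v' T))\<^sup>2 \<le> 0" by linarith
    then show ?thesis using par by (simp add: mult_le_0_iff)
  qed
  show "v t = v' t" by (rule v_eq[OF t])
  have "norm ((u t - u' t) - (u 0 - u' 0)) \<le> 0 * \<bar>t - 0\<bar>"
  proof (rule vector_derivative_bound)
    fix q assume "q \<in> {0..t}"
    then have q: "0 \<le> q" by simp
    show "((\<lambda>t. u t - u' t) has_vector_derivative v q - v' q) (at q within {0..t})"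
      by (rule has_vector_derivative_within_subset[OF has_vector_derivative_diff[OF strong_solD(4)[OF s1 q] strong_solD(4)[OF s2 q]]]) auto
    show "norm (v q - v' q) \<le> 0" using v_eq[OF q] by simp
  qed (use t in auto)
  then show "u t = u' t" by (simp add: init)
qed

end

section \<open>Proof of the theorem\<close>

lemma C_class_Suc_continuous: "C_class (Suc 0) u \<Longrightarrow> continuous_on {0..} (time_deriv u)"
  by simp

lemma has_vector_derivative_cong_halfline:
  assumes "(g has_vector_derivative D) (at t within {0..})" "0 \<le> (t::real)" "\<And>s. 0 \<le> s \<Longrightarrow> f s = g s"
  shows "(f has_vector_derivative D) (at t within {0..})"
  by (rule has_vector_derivative_transform[OF _ _ assms(1)]) (use assms in auto)

section \<open>Equivalence of the two notions of solution\<close>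

context sqrt_pair
begin

text \<open>Differentiating <B x, w> = <x, B w> for fixed x in the domain and using maximality shows
  that w' is in the domain and that (B w)' = B w'.\<close>

lemma has_derivative_in_graph:
  assumes w: "\<And>t. 0 \<le> t \<Longrightarrow> w t \<in> dom B" and t: "0 \<le> t"
    and d: "((\<lambda>t. (w t, B \<cdot> w t)) has_vector_derivative D) (at t within {0..})"
  shows "B (fst D) = Some (snd D)"
proof (rule self_adjoint_maximal[OF sB])
  fix x assume x: "x \<in> dom B"
  have 1: "(w has_vector_derivative fst D) (at t within {0..})"
    using bounded_linear.has_vector_derivative[OF bounded_linear_fst d] by simp
  have 2: "((\<lambda>t. B \<cdot> w t) has_vector_derivative snd D) (at t within {0..})"
    using bounded_linear.has_vector_derivative[OF bounded_linear_snd d] by simp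
  have 3: "((\<lambda>t. inner (B \<cdot> x) (w t)) has_vector_derivative inner (B \<cdot> x) (fst D)) (at t within {0..})"
    by (rule bounded_linear.has_vector_derivative[OF bounded_linear_inner_right 1])
  have 4: "((\<lambda>t. inner x (B \<cdot> w t)) has_vector_derivative inner x (snd D)) (at t within {0..})"
    by (rule bounded_linear.has_vector_derivative[OF bounded_linear_inner_right 2])
  have "((\<lambda>t. inner (B \<cdot> x) (w t)) has_vector_derivative inner x (snd D)) (at t within {0..})"
    by (rule has_vector_derivative_cong_halfline[OF 4 t]) (rule self_adjoint_sym[OF sB x w])
  then show "inner (B \<cdot> x) (fst D) = inner x (snd D)"
    using 3 time_deriv_eq[OF t] by metis
qed

lemma accel_continuous:
  assumes "strong_sol \<epsilon> p \<gamma> u v" "1 \<le> \<gamma>"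
  shows "continuous_on {0..} (accel \<epsilon> p \<gamma> u v)"
proof -
  note c = strong_sol_continuous[OF assms(1)]
  have cc: "continuous_on {0..} (\<lambda>t. (norm (B \<cdot> u t))\<^sup>2 powr \<gamma>)"
    by (rule continuous_on_powr') (use assms(2) in \<open>auto intro!: continuous_intros c\<close>)
  have cb: "continuous_on {0..} (\<lambda>t::real. (1 + t) powr (-p))"
    using has_real_derivative_one_add_powr by (auto intro!: DERIV_continuous_on)
  show ?thesis unfolding accel_def[abs_def]
    by (intro continuous_on_scaleR continuous_on_add continuous_on_const cb cc c)
qed

end

text \<open>The derivative in the graph norm has first component w', and
  \<open>has_derivative_in_graph\<close> identifies the second as B w'; its continuity is then that
  of B w'.\<close>

lemma kirchhoff_imp_strong_sol:
  assumes pair: "sqrt_pair A (sqrt_op A)" and sol: "kirchhoff_solution A p \<gamma> u0 u1 \<epsilon> w" and \<epsilon>: "0 < \<epsilon>"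
  shows "sqrt_pair.strong_sol A (sqrt_op A) \<epsilon> p \<gamma> w (time_deriv w)"
proof -
  interpret sqrt_pair A "sqrt_op A" by (fact pair)
  let ?B = "sqrt_op A"
  have c2: "C_class (Suc (Suc 0)) w" and cB: "C_class_dom (Suc 0) ?B w" and cA: "C_class_dom 0 A w"
    and eq: "\<And>t. 0 \<le> t \<Longrightarrow> \<epsilon> *\<^sub>R time_deriv (time_deriv w) t + (1 + t) powr (-p) *\<^sub>R time_deriv w t
       + norm (?B \<cdot> w t) powr (2 * \<gamma>) *\<^sub>R (A \<cdot> w t) = 0"
    using sol by (simp_all add: kirchhoff_solution_def numeral_2_eq_2)
  have domA: "\<And>t. 0 \<le> t \<Longrightarrow> w t \<in> dom A" and contA: "continuous_on {0..} (\<lambda>t. (w t, A \<cdot> w t))"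
    using cA by (auto simp: C_class_dom_def)
  have domB: "\<And>t. 0 \<le> t \<Longrightarrow> w t \<in> dom ?B" and cB': "C_class (Suc 0) (\<lambda>t. (w t, ?B \<cdot> w t))"
    using cB by (auto simp: C_class_dom_def simp del: C_class.simps)
  have w': "(w has_vector_derivative time_deriv w t) (at t within {0..})" if "0 \<le> t" for t
    by (rule C_class_has_derivative[OF c2 that])
  have "C_class (Suc 0) (time_deriv w)" using c2 by simp
  then have w'': "(time_deriv w has_vector_derivative time_deriv (time_deriv w) t) (at t within {0..})" if "0 \<le> t" for t
    using that by (rule C_class_has_derivative)
  define D where "D = time_deriv (\<lambda>t. (w t, ?B \<cdot> w t))"
  have D: "((\<lambda>t. (w t, ?B \<cdot> w t)) has_vector_derivative D t) (at t within {0..})" if "0 \<le> t" for t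
    unfolding D_def by (rule C_class_has_derivative[OF cB' that])
  have contD: "continuous_on {0..} D" unfolding D_def by (rule C_class_Suc_continuous[OF cB'])
  have fstD: "fst (D t) = time_deriv w t" if t: "0 \<le> t" for t
    using time_deriv_eq[OF t bounded_linear.has_vector_derivative[OF bounded_linear_fst D[OF t]]] by simp
  have graph: "?B (time_deriv w t) = Some (snd (D t))" if t: "0 \<le> t" for t
    using has_derivative_in_graph[OF domB t D[OF t]] fstD[OF t] by simp
  have acc: "time_deriv (time_deriv w) t = accel \<epsilon> p \<gamma> w (time_deriv w) t" if t: "0 \<le> t" for t
  proof -
    have "\<epsilon> *\<^sub>R time_deriv (time_deriv w) t = - ((1 + t) powr (-p) *\<^sub>R time_deriv w t + norm (?B \<cdot> w t) powr (2 * \<gamma>) *\<^sub>R (A \<cdot> w t))"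
      using eq[OF t] by (simp add: add_eq_0_iff2 add.assoc)
    then have "(1 / \<epsilon>) *\<^sub>R (\<epsilon> *\<^sub>R time_deriv (time_deriv w) t)
      = (1 / \<epsilon>) *\<^sub>R (- ((1 + t) powr (-p) *\<^sub>R time_deriv w t + norm (?B \<cdot> w t) powr (2 * \<gamma>) *\<^sub>R (A \<cdot> w t)))"
      by (simp only:)
    also have "\<dots> = accel \<epsilon> p \<gamma> w (time_deriv w) t"
      by (simp only: accel_def norm_sq_powr scaleR_minus_left scaleR_minus_right)
    finally show ?thesis using \<epsilon> by simp
  qed
  show ?thesis unfolding strong_sol_def
  proof (intro conjI allI impI)
    fix t :: real assume t: "0 \<le> t"
    show "w t \<in> dom A" by (rule domA[OF t])
    show "time_deriv w t \<in> dom ?B" using graph[OF t] by auto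
    show "(w has_vector_derivative time_deriv w t) (at t within {0..})" by (rule w'[OF t])
    show "((\<lambda>t. ?B \<cdot> w t) has_vector_derivative ?B \<cdot> time_deriv w t) (at t within {0..})"
      using bounded_linear.has_vector_derivative[OF bounded_linear_snd D[OF t]] graph[OF t] by simp
    show "(time_deriv w has_vector_derivative accel \<epsilon> p \<gamma> w (time_deriv w) t) (at t within {0..})"
      using w''[OF t] acc[OF t] by simp
  next
    show "continuous_on {0..} (\<lambda>t. A \<cdot> w t)" using continuous_on_snd[OF contA] by simp
    have "continuous_on {0..} (\<lambda>t. snd (D t))" by (rule continuous_on_snd[OF contD])
    then show "continuous_on {0..} (\<lambda>t. ?B \<cdot> time_deriv w t)"
      by (rule continuous_on_eq) (simp add: graph)
  qed
qed

lemma strong_sol_imp_kirchhoff: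
  assumes pair: "sqrt_pair A (sqrt_op A)" and sol: "sqrt_pair.strong_sol A (sqrt_op A) \<epsilon> p \<gamma> w w'"
    and \<epsilon>: "0 < \<epsilon>" and \<gamma>: "1 \<le> \<gamma>" and init: "w 0 = u0" "w' 0 = u1"
  shows "kirchhoff_solution A p \<gamma> u0 u1 \<epsilon> w"
proof -
  interpret sqrt_pair A "sqrt_op A" by (fact pair)
  let ?B = "sqrt_op A"
  note d = strong_solD[OF sol] and c = strong_sol_continuous[OF sol]
  have td: "time_deriv w t = w' t" if "0 \<le> t" for t by (rule time_deriv_eq[OF that d(4)[OF that]])
  have d2: "(time_deriv w has_vector_derivative accel \<epsilon> p \<gamma> w w' t) (at t within {0..})" if "0 \<le> t" for t
    by (rule has_vector_derivative_cong_halfline[OF d(6)[OF that] that td])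
  have td2: "time_deriv (time_deriv w) t = accel \<epsilon> p \<gamma> w w' t" if "0 \<le> t" for t
    by (rule time_deriv_eq[OF that d2[OF that]])
  have dB: "((\<lambda>t. (w t, ?B \<cdot> w t)) has_vector_derivative (w' t, ?B \<cdot> w' t)) (at t within {0..})" if "0 \<le> t" for t
    by (rule has_vector_derivative_Pair[OF d(4)[OF that] d(5)[OF that]])
  have tdB: "time_deriv (\<lambda>t. (w t, ?B \<cdot> w t)) t = (w' t, ?B \<cdot> w' t)" if "0 \<le> t" for t
    by (rule time_deriv_eq[OF that dB[OF that]])
  have dif: "f differentiable_on {0..}" if "\<And>t. 0 \<le> t \<Longrightarrow> (f has_vector_derivative f' t) (at t within {0..})"
    for f :: "real \<Rightarrow> 'b::real_normed_vector" and f'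
    using that by (auto simp: differentiable_on_def intro: differentiableI_vector)
  have 1: "C_class 2 w"
  proof -
    have "continuous_on {0..} (time_deriv (time_deriv w))"
      by (rule continuous_on_eq[OF accel_continuous[OF sol \<gamma>]]) (simp add: td2)
    then show ?thesis using dif[OF d(4)] dif[OF d2] by (simp add: numeral_2_eq_2)
  qed
  have 2: "C_class_dom 1 ?B w"
  proof -
    have "continuous_on {0..} (\<lambda>t. (w' t, ?B \<cdot> w' t))" by (intro continuous_on_Pair c)
    then have "continuous_on {0..} (time_deriv (\<lambda>t. (w t, ?B \<cdot> w t)))"
      by (rule continuous_on_eq) (simp add: tdB)
    moreover have "(\<lambda>t. (w t, ?B \<cdot> w t)) differentiable_on {0..}" by (rule dif[OF dB])
    ultimately show ?thesis using d(2) unfolding C_class_dom_def One_nat_def C_class.simps by blast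
  qed
  have 3: "C_class_dom 0 A w"
  proof -
    have "continuous_on {0..} (\<lambda>t. (w t, A \<cdot> w t))" by (intro continuous_on_Pair c)
    then show ?thesis using d(1) unfolding C_class_dom_def C_class.simps by blast
  qed
  have 4: "\<epsilon> *\<^sub>R time_deriv (time_deriv w) t + (1 + t) powr (-p) *\<^sub>R time_deriv w t
      + norm (?B \<cdot> w t) powr (2 * \<gamma>) *\<^sub>R (A \<cdot> w t) = 0" if t: "0 \<le> t" for t
  proof -
    have "\<epsilon> *\<^sub>R accel \<epsilon> p \<gamma> w w' t = - ((1 + t) powr (-p) *\<^sub>R w' t + norm (?B \<cdot> w t) powr (2 * \<gamma>) *\<^sub>R (A \<cdot> w t))"
      using \<epsilon> by (simp add: accel_def norm_sq_powr)
    then show ?thesis by (simp add: td[OF t] td2[OF t])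
  qed
  show ?thesis unfolding kirchhoff_solution_def
    using 1 2 3 4 init td[of 0] by blast
qed

lemma cutoffs_exist:
  fixes A :: "'a::{real_inner,complete_space} partial_op"
  assumes A: "self_adjoint_op A" "nonneg_op A" and u0: "u0 \<in> dom A" and u1: "u1 \<in> dom (sqrt_op A)"
    and Bu0: "sqrt_op A \<cdot> u0 \<noteq> 0"
  obtains E where "cutoffs A (sqrt_op A) E"
    "\<And>n::nat. (norm (sqrt_op A \<cdot> u0))\<^sup>2 / 2 \<le> (norm (sqrt_op A \<cdot> E n u0))\<^sup>2"
proof -
  let ?B = "sqrt_op A"
  note B = sqrt_op_self_adjoint[OF A]
  have pair: "sqrt_pair A ?B" using A B by unfold_locales
  interpret sqrt_pair A ?B by (fact pair)
  obtain E :: "nat \<Rightarrow> 'a \<Rightarrow> 'a" where E: "\<And>n. linear (E n)" "\<And>n x. norm (E n x) \<le> norm x"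
    "\<And>n x y. inner (E n x) y = inner x (E n y)"
    "\<And>n x. E n (E n x) = E n x" "\<And>n x. E n x \<in> dom A"
    "\<And>n x. x \<in> dom A \<Longrightarrow> E n (A \<cdot> x) = A \<cdot> E n x" "\<And>n x. x \<in> dom ?B \<Longrightarrow> E n (?B \<cdot> x) = ?B \<cdot> E n x"
    "\<And>n. bounded_linear (\<lambda>x. A \<cdot> E n x)" "\<And>x. (\<lambda>n. E n x) \<longlonglongrightarrow> x"
    by (rule spectral_cutoff_sequence[OF A B(1,3)], rule that)
  have "(\<lambda>n. (norm (E n (?B \<cdot> u0)))\<^sup>2) \<longlonglongrightarrow> (norm (?B \<cdot> u0))\<^sup>2" by (intro tendsto_intros E(9))
  moreover have "(norm (?B \<cdot> u0))\<^sup>2 / 2 < (norm (?B \<cdot> u0))\<^sup>2" using Bu0 by simp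
  ultimately have "\<forall>\<^sub>F n in sequentially. (norm (?B \<cdot> u0))\<^sup>2 / 2 < (norm (E n (?B \<cdot> u0)))\<^sup>2"
    by (rule order_tendstoD(1))
  then obtain N where N: "\<And>n. N \<le> n \<Longrightarrow> (norm (?B \<cdot> u0))\<^sup>2 / 2 < (norm (E n (?B \<cdot> u0)))\<^sup>2"
    unfolding eventually_sequentially by blast
  \<comment> \<open>Dropping the first N projections makes the lower bound of |B E n u0|^2 hold for
    every index instead of eventually.\<close>
  show ?thesis
  proof (rule that[of "\<lambda>n. E (n + N)"])
    show "cutoffs A ?B (\<lambda>n. E (n + N))"
    proof (rule cutoffs.intro[OF pair cutoffs_axioms.intro])
      show "linear (E (n + N))" for n by (rule E(1))
      show "norm (E (n + N) x) \<le> norm x" for n x by (rule E(2))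
      show "inner (E (n + N) x) y = inner x (E (n + N) y)" for n x y by (rule E(3))
      show "E (n + N) (E (n + N) x) = E (n + N) x" for n x by (rule E(4))
      show "E (n + N) x \<in> dom A" for n x by (rule E(5))
      show "E (n + N) (A \<cdot> x) = A \<cdot> E (n + N) x" if "x \<in> dom A" for n x using that by (rule E(6))
      show "E (n + N) (?B \<cdot> x) = ?B \<cdot> E (n + N) x" if "x \<in> dom ?B" for n x using that by (rule E(7))
      show "bounded_linear (\<lambda>x. A \<cdot> E (n + N) x)" for n by (rule E(8))
      show "(\<lambda>n. E (n + N) x) \<longlonglongrightarrow> x" for x by (rule LIMSEQ_ignore_initial_segment[OF E(9)])
    qed
    show "(norm (?B \<cdot> u0))\<^sup>2 / 2 \<le> (norm (?B \<cdot> E (n + N) u0))\<^sup>2" for n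
      using N[of "n + N"] E(7)[OF dom_AB(1)[OF u0], of "n + N"] by simp
  qed
qed

text \<open>The constants are spelled out as functions of the data, rather than asserted to exist,
  because the theorem needs them to be the same for all \<epsilon>.\<close>

lemma strong_solution_exists:
  fixes A :: "'a::{real_inner,complete_space} partial_op"
  assumes A: "self_adjoint_op A" "nonneg_op A" and u0: "u0 \<in> dom A" and u1: "u1 \<in> dom (sqrt_op A)"
    and Bu0: "sqrt_op A \<cdot> u0 \<noteq> 0"
    and par: "0 < \<epsilon>" "\<epsilon> \<le> 1/8" "0 \<le> p" "p \<le> 1" "1 \<le> \<gamma>"
  defines "y0 \<equiv> (norm (sqrt_op A \<cdot> u0))\<^sup>2"
  defines "a0 \<equiv> (norm (A \<cdot> u0))\<^sup>2" and "d0 \<equiv> (norm (sqrt_op A \<cdot> u1))\<^sup>2" and "q0 \<equiv> (norm u1)\<^sup>2"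
  defines "lo \<equiv> (y0 / 2) powr (-\<gamma>) + 2 * \<gamma> * (R_bound \<gamma> (y0 / 2) a0 d0 q0 + P_bound \<gamma> (y0 / 2) a0 d0)"
  assumes small: "\<epsilon> * (10 * \<gamma> * z_bound \<gamma> (y0 / 2) y0 a0 d0 q0 + 10) \<le> 1"
  shows "\<exists>u v. sqrt_pair.strong_sol A (sqrt_op A) \<epsilon> p \<gamma> u v \<and> u 0 = u0 \<and> v 0 = u1 \<and> 0 < lo \<and>
     (\<forall>t\<ge>0. lo powr (- (1 / \<gamma>)) / (1 + t) powr ((p + 1) / \<gamma>) \<le> (norm (sqrt_op A \<cdot> u t))\<^sup>2 \<and>
       ((norm (sqrt_op A \<cdot> u t))\<^sup>2) powr (\<gamma> - 1) * (norm (A \<cdot> u t))\<^sup>2 * (1 + t) powr (p + 1) \<le> W_bound \<gamma> (y0 / 2) y0 a0 d0 \<and>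
       (norm (v t))\<^sup>2 * (1 + t) powr (1 - p) \<le> Q_bound \<gamma> (y0 / 2) y0 a0 d0 q0 * ((norm (sqrt_op A \<cdot> u t))\<^sup>2) powr (\<gamma> + 1))"
proof -
  obtain E where E: "cutoffs A (sqrt_op A) E"
    "\<And>n::nat. (norm (sqrt_op A \<cdot> u0))\<^sup>2 / 2 \<le> (norm (sqrt_op A \<cdot> E n u0))\<^sup>2"
    by (rule cutoffs_exist[OF A u0 u1 Bu0], rule that)
  interpret cutoffs A "sqrt_op A" E by (fact E(1))
  have "\<exists>u v. bounded_form.flow (L n) \<epsilon> p \<gamma> {0..} u v \<and> u 0 = E n u0 \<and> v 0 = E n u1" for n
    by (rule bounded_form.flow_exists[OF form par, of n "E n u0" "E n u1"]) blast
  then have "\<exists>U. \<forall>n. \<exists>v. bounded_form.flow (L n) \<epsilon> p \<gamma> {0..} (U n) v \<and> U n 0 = E n u0 \<and> v 0 = E n u1"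
    by (intro choice allI)
  then obtain U where "\<forall>n. \<exists>v. bounded_form.flow (L n) \<epsilon> p \<gamma> {0..} (U n) v \<and> U n 0 = E n u0 \<and> v 0 = E n u1" ..
  then have "\<exists>V. \<forall>n. bounded_form.flow (L n) \<epsilon> p \<gamma> {0..} (U n) (V n) \<and> U n 0 = E n u0 \<and> V n 0 = E n u1"
    by (rule choice)
  then obtain V where UV: "\<forall>n. bounded_form.flow (L n) \<epsilon> p \<gamma> {0..} (U n) (V n) \<and> U n 0 = E n u0 \<and> V n 0 = E n u1" ..
  interpret approximation A "sqrt_op A" E \<epsilon> p \<gamma> u0 u1 U V "z_bound \<gamma> (y0 / 2) y0 a0 d0 q0"
  proof (unfold_locales; (fact par u0 u1 Bu0 E(2) small)?)
    show "z_bound \<gamma> (y0 / 2) y0 a0 d0 q0 = z_bound \<gamma> ((norm (sqrt_op A \<cdot> u0))\<^sup>2 / 2) ((norm (sqrt_op A \<cdot> u0))\<^sup>2)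
       ((norm (A \<cdot> u0))\<^sup>2) ((norm (sqrt_op A \<cdot> u1))\<^sup>2) ((norm u1)\<^sup>2)"
      by (simp add: y0_def a0_def d0_def q0_def)
  qed (use UV in auto)
  have lo: "lo = low" by (simp add: lo_def low_def y0_def a0_def d0_def q0_def)
  show ?thesis
  proof (rule exI[of _ u], rule exI[of _ v], intro conjI allI impI)
    show "strong_sol \<epsilon> p \<gamma> u v" by (rule limit_sol)
    show "u 0 = u0" "v 0 = u1" by (fact limit_init)+
    show "0 < lo" unfolding lo by (rule low_pos)
    fix t :: real assume t: "0 \<le> t"
    show "lo powr (- (1 / \<gamma>)) / (1 + t) powr ((p + 1) / \<gamma>) \<le> (norm (sqrt_op A \<cdot> u t))\<^sup>2"
      unfolding lo by (rule limit_low[OF t])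
    show "((norm (sqrt_op A \<cdot> u t))\<^sup>2) powr (\<gamma> - 1) * (norm (A \<cdot> u t))\<^sup>2 * (1 + t) powr (p + 1) \<le> W_bound \<gamma> (y0 / 2) y0 a0 d0"
      using limit_estimates(1)[OF t] by (simp add: y0_def a0_def d0_def q0_def)
    show "(norm (v t))\<^sup>2 * (1 + t) powr (1 - p) \<le> Q_bound \<gamma> (y0 / 2) y0 a0 d0 q0 * ((norm (sqrt_op A \<cdot> u t))\<^sup>2) powr (\<gamma> + 1)"
      using limit_estimates(2)[OF t] by (simp add: y0_def a0_def d0_def q0_def)
  qed
qed

text \<open>An integral of a nonnegative function bounded by a finite number includes its
  convergence. Monotone convergence reduces it to the intervals {0..n}, where
  \<open>weak_decay\<close> applies.\<close>

lemma (in weak_energy) velocity_nn_integral: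
  assumes S: "S = {0..}"
  shows "(\<integral>\<^sup>+t\<in>{0..}. ennreal (q t * (1 + t)) \<partial>lborel) \<le> ennreal (2 * F 0)"
proof -
  have cq: "continuous_on {0..} (\<lambda>t. (1 + t) * q t)"
  proof -
    have "continuous_on {0..} q" using q' S by (auto intro!: DERIV_continuous_on)
    then show ?thesis by (intro continuous_intros)
  qed
  let ?f = "\<lambda>n t. ennreal (q t * (1 + t)) * indicator {0..real n} t"
  have "(\<integral>\<^sup>+t. ?f n t \<partial>lborel) \<le> ennreal (2 * F 0)" for n
  proof -
    have c: "continuous_on {0..real n} (\<lambda>t. (1 + t) * q t)" by (rule continuous_on_subset[OF cq]) auto
    have "((\<lambda>t. (1 + t) * q t) has_integral integral {0..real n} (\<lambda>t. (1 + t) * q t)) {0..real n}"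
      by (rule integrable_integral[OF integrable_continuous_interval[OF c]])
    then have "(\<integral>\<^sup>+t\<in>{0..real n}. ennreal ((1 + t) * q t) \<partial>lborel) = ennreal (integral {0..real n} (\<lambda>t. (1 + t) * q t))"
      by (rule nn_integral_has_integral_lebesgue'[rotated]) (use nonneg(2) S in auto)
    also have "\<dots> \<le> ennreal (2 * F 0)" by (rule ennreal_leI[OF weak_decay(3)]) (simp add: S)
    finally show ?thesis by (simp add: mult.commute)
  qed
  moreover have "(\<integral>\<^sup>+t\<in>{0..}. ennreal (q t * (1 + t)) \<partial>lborel) = (SUP n. \<integral>\<^sup>+t. ?f n t \<partial>lborel)"
  proof -
    have "(\<integral>\<^sup>+t. (SUP n. ?f n t) \<partial>lborel) = (SUP n. \<integral>\<^sup>+t. ?f n t \<partial>lborel)"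
    proof (rule nn_integral_monotone_convergence_SUP)
      show "incseq ?f"
        by (auto simp: incseq_def le_fun_def indicator_def)
      fix n
      have "continuous_on {0..real n} (\<lambda>t. q t * (1 + t))"
        using continuous_on_subset[OF cq, of "{0..real n}"] by (simp add: mult.commute)
      then have "(\<lambda>t. indicator {0..real n} t *\<^sub>R (q t * (1 + t))) \<in> borel_measurable borel"
        by (rule borel_measurable_continuous_on_indicator[rotated]) simp
      then have "(\<lambda>t. ennreal (indicator {0..real n} t *\<^sub>R (q t * (1 + t)))) \<in> borel_measurable lborel" by simp
      moreover have "(\<lambda>t. ennreal (indicator {0..real n} t *\<^sub>R (q t * (1 + t)))) = ?f n"
        by (auto simp: indicator_def)
      ultimately show "?f n \<in> borel_measurable lborel" by simp
    qed
    moreover have "(SUP n. ?f n t) = ennreal (q t * (1 + t)) * indicator {0..} t" for t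
    proof (rule antisym)
      show "(SUP n. ?f n t) \<le> ennreal (q t * (1 + t)) * indicator {0..} t"
        by (rule SUP_least) (auto simp: indicator_def)
      obtain n where "t \<le> real n" using real_arch_simple by blast
      then have "ennreal (q t * (1 + t)) * indicator {0..} t \<le> ?f n t" by (auto simp: indicator_def)
      then show "ennreal (q t * (1 + t)) * indicator {0..} t \<le> (SUP n. ?f n t)" by (rule SUP_upper2[OF UNIV_I])
    qed
    ultimately show ?thesis by simp
  qed
  ultimately show ?thesis by (simp add: SUP_least)
qed

theorem theorem2p1:
  fixes A :: "'a::{real_inner, complete_space} partial_op"
    and p \<gamma> :: real and u0 u1 :: 'a
  assumes "self_adjoint_op A" and "nonneg_op A"
    and "0 \<le> p" and "p \<le> 1" and "1 \<le> \<gamma>"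
    and "u0 \<in> dom A" and "u1 \<in> dom (sqrt_op A)"
    and "sqrt_op A \<cdot> u0 \<noteq> 0"
  shows "\<exists>\<epsilon>0>0.
     (\<forall>\<epsilon>\<in>{0<..<\<epsilon>0}. \<exists>u. kirchhoff_solution A p \<gamma> u0 u1 \<epsilon> u \<and>
        (\<forall>v. kirchhoff_solution A p \<gamma> u0 u1 \<epsilon> v \<longrightarrow> (\<forall>t\<ge>0. v t = u t))) \<and>
     (\<exists>C1>0. \<exists>C2>0. \<forall>\<epsilon>\<in>{0<..<\<epsilon>0}. \<forall>u. kirchhoff_solution A p \<gamma> u0 u1 \<epsilon> u \<longrightarrow>
        (\<forall>t\<ge>0. (norm (u t))\<^sup>2 \<le> C2) \<and>
        (\<forall>t\<ge>0. C1 / (1 + t) powr ((p + 1) / \<gamma>) \<le> (norm (sqrt_op A \<cdot> u t))\<^sup>2 \<and>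
                (norm (sqrt_op A \<cdot> u t))\<^sup>2 \<le> C2 / (1 + t) powr ((p + 1) / (\<gamma> + 1))) \<and>
        (\<forall>t\<ge>0. norm (sqrt_op A \<cdot> u t) powr (2 * (\<gamma> - 1)) * (norm (A \<cdot> u t))\<^sup>2
                  \<le> C2 / (1 + t) powr (p + 1)) \<and>
        (\<forall>t\<ge>0. (norm (time_deriv u t))\<^sup>2
                  \<le> C2 * norm (sqrt_op A \<cdot> u t) powr (2 * (\<gamma> + 1)) / (1 + t) powr (1 - p)) \<and>
        (\<integral>\<^sup>+t\<in>{0..}. ennreal ((norm (time_deriv u t))\<^sup>2 * (1 + t)) \<partial>lborel) \<le> ennreal C2)"
proof -
  note A = assms(1,2) and p = assms(3,4) and \<gamma> = assms(5) and u0 = assms(6) and u1 = assms(7) and Bu0 = assms(8)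
  let ?B = "sqrt_op A"
  note B = sqrt_op_self_adjoint[OF A]
  have pair: "sqrt_pair A ?B" using A B by unfold_locales
  interpret sqrt_pair A ?B by (fact pair)
  define y0 where "y0 = (norm (?B \<cdot> u0))\<^sup>2"
  define a0 where "a0 = (norm (A \<cdot> u0))\<^sup>2"
  define d0 where "d0 = (norm (?B \<cdot> u1))\<^sup>2"
  define q0 where "q0 = (norm u1)\<^sup>2"
  define lo where "lo = (y0 / 2) powr (-\<gamma>) + 2 * \<gamma> * (R_bound \<gamma> (y0 / 2) a0 d0 q0 + P_bound \<gamma> (y0 / 2) a0 d0)"
  define M where "M = z_bound \<gamma> (y0 / 2) y0 a0 d0 q0"
  define WB where "WB = W_bound \<gamma> (y0 / 2) y0 a0 d0"
  define QB where "QB = Q_bound \<gamma> (y0 / 2) y0 a0 d0 q0"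
  define FB where "FB = 2 * q0 + 2 * (norm u0)\<^sup>2 + y0 powr (\<gamma> + 1)"
  \<comment> \<open>The value 1/8 is the restriction of the first order estimates, the second entry
    is the smallness condition; the absolute value keeps the denominator positive whatever the sign
    of M.\<close>
  define \<epsilon>0 where "\<epsilon>0 = min (1/8) (1 / (10 * \<gamma> * \<bar>M\<bar> + 10))"
  have y0: "0 < y0" using Bu0 by (simp add: y0_def)
  have nn: "0 \<le> a0" "0 \<le> d0" "0 \<le> q0" by (simp_all add: a0_def d0_def q0_def)
  have WB: "0 < WB" using y0 nn by (simp add: WB_def W_bound_def add_nonneg_pos)
  have QB: "0 < QB" using y0 nn WB by (simp add: QB_def Q_bound_def WB_def add_nonneg_pos)
  have FB: "0 < FB" using y0 nn by (simp add: FB_def add_nonneg_pos)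
  have den: "0 < 10 * \<gamma> * \<bar>M\<bar> + 10" using \<gamma> by (simp add: add_nonneg_pos)
  have \<epsilon>0: "0 < \<epsilon>0" using den by (simp add: \<epsilon>0_def)
  have eps: "0 < \<epsilon>" "\<epsilon> \<le> 1/8" "\<epsilon> * (10 * \<gamma> * M + 10) \<le> 1" if "\<epsilon> \<in> {0<..<\<epsilon>0}" for \<epsilon>
  proof -
    show "0 < \<epsilon>" "\<epsilon> \<le> 1/8" using that by (auto simp: \<epsilon>0_def)
    have "10 * \<gamma> * M + 10 \<le> 10 * \<gamma> * \<bar>M\<bar> + 10" using \<gamma> by (simp add: mult_left_mono)
    then have "\<epsilon> * (10 * \<gamma> * M + 10) \<le> \<epsilon> * (10 * \<gamma> * \<bar>M\<bar> + 10)" using that by (intro mult_left_mono) auto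
    also have "\<dots> \<le> 1"
    proof -
      have "\<epsilon> \<le> 1 / (10 * \<gamma> * \<bar>M\<bar> + 10)" using that by (auto simp: \<epsilon>0_def)
      then show ?thesis using den by (simp add: pos_le_divide_eq)
    qed
    finally show "\<epsilon> * (10 * \<gamma> * M + 10) \<le> 1" .
  qed
  have ex: "\<exists>u v. strong_sol \<epsilon> p \<gamma> u v \<and> u 0 = u0 \<and> v 0 = u1 \<and> 0 < lo \<and>
     (\<forall>t\<ge>0. lo powr (- (1 / \<gamma>)) / (1 + t) powr ((p + 1) / \<gamma>) \<le> (norm (?B \<cdot> u t))\<^sup>2 \<and>
       ((norm (?B \<cdot> u t))\<^sup>2) powr (\<gamma> - 1) * (norm (A \<cdot> u t))\<^sup>2 * (1 + t) powr (p + 1) \<le> WB \<and>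
       (norm (v t))\<^sup>2 * (1 + t) powr (1 - p) \<le> QB * ((norm (?B \<cdot> u t))\<^sup>2) powr (\<gamma> + 1))"
    if "\<epsilon> \<in> {0<..<\<epsilon>0}" for \<epsilon>
    using strong_solution_exists[OF A u0 u1 Bu0 eps(1,2)[OF that] p \<gamma>] eps(3)[OF that]
    unfolding y0_def a0_def d0_def q0_def lo_def M_def WB_def QB_def by blast
  have uniq: "w t = u t \<and> time_deriv w t = v t"
    if "\<epsilon> \<in> {0<..<\<epsilon>0}" "strong_sol \<epsilon> p \<gamma> u v" "u 0 = u0" "v 0 = u1"
      "\<And>t. 0 \<le> t \<Longrightarrow> 0 < (norm (?B \<cdot> u t))\<^sup>2" "kirchhoff_solution A p \<gamma> u0 u1 \<epsilon> w" "0 \<le> t" for \<epsilon> u v w t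
  proof -
    have w: "strong_sol \<epsilon> p \<gamma> w (time_deriv w)"
      by (rule kirchhoff_imp_strong_sol[OF pair that(6) eps(1)[OF that(1)]])
    have i: "u 0 = w 0" "v 0 = time_deriv w 0" using that(3,4,6) by (simp_all add: kirchhoff_solution_def)
    show ?thesis using uniqueness[OF that(2) w eps(1)[OF that(1)] \<gamma> that(5) i that(7)] by simp
  qed
  have posI: "0 < (norm (?B \<cdot> u t))\<^sup>2"
    if "0 < lo" "lo powr (- (1 / \<gamma>)) / (1 + t) powr ((p + 1) / \<gamma>) \<le> (norm (?B \<cdot> u t))\<^sup>2" "0 \<le> t" for u t
  proof -
    have "0 < lo powr (- (1 / \<gamma>)) / (1 + t) powr ((p + 1) / \<gamma>)" using that by simp
    then show ?thesis using that(2) by linarith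
  qed
  \<comment> \<open>\<open>lo\<close> is independent of \<epsilon>, so its positivity may be taken
    from the existence result at one admissible value.\<close>
  have lo: "0 < lo" using ex[of "\<epsilon>0 / 2"] \<epsilon>0 by auto
  define Y where "Y = (4 * (\<gamma> + 1) * FB) powr (1 / (\<gamma> + 1))"
  \<comment> \<open>A sum of nonnegative constants, hence above each of those in the upper
    estimates; Y is the (\<gamma>+1)-th root of the constant in the decay of y^(\<gamma>+1).\<close>
  define C2 where "C2 = 8 * FB + Y + WB + QB"
  have C: "8 * FB \<le> C2" "2 * FB \<le> C2" "Y \<le> C2" "WB \<le> C2" "QB \<le> C2" "0 < C2"
    using FB WB QB powr_ge_zero[of "4 * (\<gamma> + 1) * FB" "1 / (\<gamma> + 1)"] unfolding C2_def Y_def by linarith+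
  show ?thesis
  proof (rule exI[of _ \<epsilon>0], intro conjI \<epsilon>0)
    show "\<forall>\<epsilon>\<in>{0<..<\<epsilon>0}. \<exists>u. kirchhoff_solution A p \<gamma> u0 u1 \<epsilon> u \<and>
        (\<forall>v. kirchhoff_solution A p \<gamma> u0 u1 \<epsilon> v \<longrightarrow> (\<forall>t\<ge>0. v t = u t))"
    proof
      fix \<epsilon> assume e: "\<epsilon> \<in> {0<..<\<epsilon>0}"
      obtain u v where uv: "strong_sol \<epsilon> p \<gamma> u v" "u 0 = u0" "v 0 = u1"
        "\<forall>t\<ge>0. lo powr (- (1 / \<gamma>)) / (1 + t) powr ((p + 1) / \<gamma>) \<le> (norm (?B \<cdot> u t))\<^sup>2"
        using ex[OF e] by blast
      have pos: "0 < (norm (?B \<cdot> u t))\<^sup>2" if "0 \<le> t" for t by (rule posI[OF lo _ that]) (use uv(4) that in blast)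
      show "\<exists>u. kirchhoff_solution A p \<gamma> u0 u1 \<epsilon> u \<and>
        (\<forall>v. kirchhoff_solution A p \<gamma> u0 u1 \<epsilon> v \<longrightarrow> (\<forall>t\<ge>0. v t = u t))"
      proof (intro exI[of _ u] conjI allI impI)
        show "kirchhoff_solution A p \<gamma> u0 u1 \<epsilon> u"
          by (rule strong_sol_imp_kirchhoff[OF pair uv(1) eps(1)[OF e] \<gamma> uv(2,3)])
        fix w t assume "kirchhoff_solution A p \<gamma> u0 u1 \<epsilon> w" "(0::real) \<le> t"
        then show "w t = u t" using uniq[OF e uv(1-3) pos] by blast
      qed
    qed
    show "\<exists>C1>0. \<exists>C2>0. \<forall>\<epsilon>\<in>{0<..<\<epsilon>0}. \<forall>u. kirchhoff_solution A p \<gamma> u0 u1 \<epsilon> u \<longrightarrow>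
        (\<forall>t\<ge>0. (norm (u t))\<^sup>2 \<le> C2) \<and>
        (\<forall>t\<ge>0. C1 / (1 + t) powr ((p + 1) / \<gamma>) \<le> (norm (sqrt_op A \<cdot> u t))\<^sup>2 \<and>
                (norm (sqrt_op A \<cdot> u t))\<^sup>2 \<le> C2 / (1 + t) powr ((p + 1) / (\<gamma> + 1))) \<and>
        (\<forall>t\<ge>0. norm (sqrt_op A \<cdot> u t) powr (2 * (\<gamma> - 1)) * (norm (A \<cdot> u t))\<^sup>2
                  \<le> C2 / (1 + t) powr (p + 1)) \<and>
        (\<forall>t\<ge>0. (norm (time_deriv u t))\<^sup>2
                  \<le> C2 * norm (sqrt_op A \<cdot> u t) powr (2 * (\<gamma> + 1)) / (1 + t) powr (1 - p)) \<and>
        (\<integral>\<^sup>+t\<in>{0..}. ennreal ((norm (time_deriv u t))\<^sup>2 * (1 + t)) \<partial>lborel) \<le> ennreal C2"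
    proof (rule exI[of _ "lo powr (- (1 / \<gamma>))"], intro conjI, goal_cases)
      case 1
      show ?case using lo by simp
    next
      case 2
      show ?case
      proof (rule exI[of _ C2], intro conjI C(6) ballI allI impI)
        fix \<epsilon> w assume e: "\<epsilon> \<in> {0<..<\<epsilon>0}" and w: "kirchhoff_solution A p \<gamma> u0 u1 \<epsilon> w"
        have ss: "strong_sol \<epsilon> p \<gamma> w (time_deriv w)"
          by (rule kirchhoff_imp_strong_sol[OF pair w eps(1)[OF e]])
        have w0: "w 0 = u0" "time_deriv w 0 = u1" using w by (simp_all add: kirchhoff_solution_def)
        interpret weak_energy \<epsilon> p \<gamma> "{0..}" "\<lambda>t. (norm (?B \<cdot> w t))\<^sup>2" "\<lambda>t. inner (?B \<cdot> w t) (?B \<cdot> time_deriv w t)"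
          "\<lambda>t. (norm (time_deriv w t))\<^sup>2" "\<lambda>t. inner (w t) (time_deriv w t)" "\<lambda>t. (norm (w t))\<^sup>2"
          by (rule strong_sol_weak_energy[OF ss eps(1,2)[OF e] p \<gamma>])
        have F0: "F 0 \<le> FB" using F_0_le by (simp add: FB_def y0_def q0_def w0)
        obtain u v where uv: "strong_sol \<epsilon> p \<gamma> u v" "u 0 = u0" "v 0 = u1"
          and lower: "\<forall>t\<ge>0. lo powr (- (1 / \<gamma>)) / (1 + t) powr ((p + 1) / \<gamma>) \<le> (norm (?B \<cdot> u t))\<^sup>2"
          and aest: "\<forall>t\<ge>0. ((norm (?B \<cdot> u t))\<^sup>2) powr (\<gamma> - 1) * (norm (A \<cdot> u t))\<^sup>2 * (1 + t) powr (p + 1) \<le> WB"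
          and vest: "\<forall>t\<ge>0. (norm (v t))\<^sup>2 * (1 + t) powr (1 - p) \<le> QB * ((norm (?B \<cdot> u t))\<^sup>2) powr (\<gamma> + 1)"
          using ex[OF e] by blast
        have pos: "0 < (norm (?B \<cdot> u t))\<^sup>2" if "0 \<le> t" for t by (rule posI[OF lo _ that]) (use lower that in blast)
        \<comment> \<open>Uniqueness carries the lower bound and the estimates of Au and u' from the
          constructed solution to w; the remaining estimates come from the energy of w
          itself.\<close>
        have eq: "w t = u t" "time_deriv w t = v t" if "0 \<le> t" for t
          using uniq[OF e uv pos w that] by auto
        show "(\<integral>\<^sup>+t\<in>{0..}. ennreal ((norm (time_deriv w t))\<^sup>2 * (1 + t)) \<partial>lborel) \<le> ennreal C2"
          by (rule order_trans[OF velocity_nn_integral[OF refl]]) (use F0 C(2) in \<open>auto intro: ennreal_leI\<close>)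
        fix t :: real assume t: "0 \<le> t"
        have R: "0 < (1 + t) powr r" for r using t by simp
        show "(norm (w t))\<^sup>2 \<le> C2" using weak_decay(1)[of t] t F0 C(1) by simp
        show "lo powr (- (1 / \<gamma>)) / (1 + t) powr ((p + 1) / \<gamma>) \<le> (norm (?B \<cdot> w t))\<^sup>2"
          using lower t by (simp add: eq)
        show "(norm (?B \<cdot> w t))\<^sup>2 \<le> C2 / (1 + t) powr ((p + 1) / (\<gamma> + 1))"
        proof -
          define y where "y = (norm (?B \<cdot> w t))\<^sup>2"
          have "4 * (\<gamma> + 1) * F 0 \<le> 4 * (\<gamma> + 1) * FB" using F0 \<gamma> by (intro mult_left_mono) auto
          then have "(1 + t) powr (p + 1) * y powr (\<gamma> + 1) \<le> 4 * (\<gamma> + 1) * FB"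
            using weak_decay(2)[of t] t unfolding y_def by simp
          then have "((1 + t) powr (p + 1) * y powr (\<gamma> + 1)) powr (1 / (\<gamma> + 1)) \<le> Y"
            unfolding Y_def using \<gamma> by (intro powr_mono2) auto
          moreover have "((1 + t) powr (p + 1) * y powr (\<gamma> + 1)) powr (1 / (\<gamma> + 1)) = (1 + t) powr ((p + 1) / (\<gamma> + 1)) * y"
            using \<gamma> t by (simp add: powr_mult powr_powr y_def)
          ultimately have "(1 + t) powr ((p + 1) / (\<gamma> + 1)) * y \<le> C2" using C(3) by linarith
          then show ?thesis using R by (simp add: y_def pos_le_divide_eq mult.commute)
        qed
        have "norm (?B \<cdot> w t) powr (2 * (\<gamma> - 1)) * (norm (A \<cdot> w t))\<^sup>2 * (1 + t) powr (p + 1) \<le> C2"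
          using aest t C(4) by (auto simp: eq norm_sq_powr intro: order_trans)
        then show "norm (?B \<cdot> w t) powr (2 * (\<gamma> - 1)) * (norm (A \<cdot> w t))\<^sup>2 \<le> C2 / (1 + t) powr (p + 1)"
          using R by (simp only: pos_le_divide_eq)
        have "QB * norm (?B \<cdot> w t) powr (2 * (\<gamma> + 1)) \<le> C2 * norm (?B \<cdot> w t) powr (2 * (\<gamma> + 1))"
          by (rule mult_right_mono[OF C(5)]) simp
        then have "(norm (time_deriv w t))\<^sup>2 * (1 + t) powr (1 - p) \<le> C2 * norm (?B \<cdot> w t) powr (2 * (\<gamma> + 1))"
          using vest t by (auto simp: eq norm_sq_powr intro: order_trans)
        then show "(norm (time_deriv w t))\<^sup>2 \<le> C2 * norm (?B \<cdot> w t) powr (2 * (\<gamma> + 1)) / (1 + t) powr (1 - p)"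
          using R by (simp only: pos_le_divide_eq)
      qed
    qed
  qed
qed

end
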